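(* Assume that $-\mathcal{L}_K+V$ is positive definite. Let $(u_p)_{2<p<2^*_s}$ be a family of least energy nodal solutions of $$-\mathcal{L}_K u+V(x)u=\lambda_2|u|^{p-2}u \ \text{ in } \Omega,\qquad u=0\ \text{ in } \mathbb{R}^N\setminus\Omega. \qquad (\ast)$$ Let $p_n\to2$ (with $p_n>2$) be such that $u_{p_n}\to u_*$ in $H$. Then $u_*\in E_2\setminus\{0\}$ and $u_*$ achieves the minimum of the reduced functional $$\mathcal{E}_*:E_2\to\mathbb{R}:\ u\mapsto\tfrac12\int_\Omega \bigl(u^2-u^2\ln u^2\bigr)\,dx$$ subject to the constraint $u\in\mathcal{N}_*$, where $\mathcal{N}_*=\{u\in E_2\setminus\{0\}:\mathcal{E}_*'(u)[u]=0\}$ is the reduced Nehari manifold. In particular, $u_*$ satisfies $$-\mathcal{L}_Ku_*+Vu_*=\lambda_2u_*\ \text{ in }\Omega,\qquad u_*=0\ \text{ in }\mathbb{R}^N\setminus\Omega,\qquad \int_\Omega u_*\ln|u_*|\,v\,dx=0\ \text{ for all }v\in E_2.$$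
   Context: Let $N\ge 2$, $s\in(0,1)$, $2^*_s=\frac{2N}{N-2s}$; $\Omega\subset\mathbb{R}^N$ is an open bounded domain with Lipschitz boundary and $V\in L^\infty(\Omega)$. The kernel $K:\mathbb{R}^N\setminus\{0\}\to(0,+\infty)$ satisfies $K(x)=K(-x)$, $\min\{|x|^2,1\}K(x)\in L^1(\mathbb{R}^N)$, and there is $\theta>0$ with $K(x)\ge\theta|x|^{-(N+2s)}$ for all $x\neq0$. Put $\mathcal{L}_Ku(x)=\int_{\mathbb{R}^N}(u(x+y)-2u(x)+u(x-y))K(y)\,dy$. $H$ is the Hilbert space of measurable $g:\mathbb{R}^N\to\mathbb{R}$ with $g=0$ a.e. outside $\Omega$, $g|_\Omega\in L^2(\Omega)$ and $(x,y)\mapsto (g(x)-g(y))\sqrt{K(x-y)}\in L^2(Q)$, where $Q=\mathbb{R}^{2N}\setminus((\mathbb{R}^N\setminus\Omega)\times(\mathbb{R}^N\setminus\Omega))$, with inner product $\langle u,v\rangle_H=\int_Q(u(x)-u(y))(v(x)-v(y))K(x-y)\,dx\,dy$ and norm $\|\cdot\|_H$. $|\cdot|_q$ is the $L^q$ norm. All equations are understood weakly: $-\mathcal{L}_Ku+Vu=f$ in $\Omega$, $u=0$ outside $\Omega$, means $u\in H$ and $\langle u,\phi\rangle_H+\int_\Omega Vu\phi=\int_\Omega f\phi$ for all $\phi\in H$. "$-\mathcal{L}_K+V$ is positive definite" means that $\|u\|_H^2+\int_\Omega Vu^2>0$ for all $u\in H\setminus\{0\}$. For $k\ge1$, $\lambda_k$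 is the $k$-th eigenvalue, counted without multiplicity ($\lambda_1<\lambda_2<\dots$), of $-\mathcal{L}_K+V$ with zero condition on $\mathbb{R}^N\setminus\Omega$, and $E_k\subset H$ is its eigenspace. The functional associated with $(\ast)$ is $\tilde{\mathcal{E}}_p(u)=\frac12\|u\|_H^2+\frac12\int_\Omega Vu^2-\frac{\lambda_2}{p}|u|_p^p$ on $H$. A least energy nodal solution of $(\ast)$ is a sign-changing solution ($u^+=\max\{u,0\}\ne0$ and $u^-=\min\{u,0\}\neq0$) of minimal $\tilde{\mathcal{E}}_p$ among all sign-changing solutions. Expressions such as $t\ln|t|$ are understood as $0$ when $t=0$. $\mathcal{E}_*'(u)[v]$ denotes the derivative at $u$ in the direction $v$. *)

theory Defs
  imports "HOL-Analysis.Analysis"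
begin

text \<open>
  Elements of the function spaces are represented by functions on the whole of
  \<^typ>\<open>real ^ 'n\<close>, so that \<open>N\<close> is \<open>CARD('n)\<close>; equality in these spaces is equality almost
  everywhere with respect to Lebesgue measure.
\<close>

definition ae_zero :: "(real ^ 'n \<Rightarrow> real) \<Rightarrow> bool" where
  "ae_zero u \<longleftrightarrow> (AE x in lebesgue. u x = 0)"

definition L2_on :: "'a::euclidean_space set \<Rightarrow> ('a \<Rightarrow> real) \<Rightarrow> bool" where
  "L2_on A f \<longleftrightarrow> set_borel_measurable lebesgue A f \<and> set_integrable lebesgue A (\<lambda>x. (f x)\<^sup>2)"

definition Linf_on :: "'a::euclidean_space set \<Rightarrow> ('a \<Rightarrow> real) \<Rightarrow> bool" where
  "Linf_on A f \<longleftrightarrow> set_borel_measurable lebesgue A f \<and>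
     (\<exists>C. AE x in lebesgue. x \<in> A \<longrightarrow> \<bar>f x\<bar> \<le> C)"

text \<open>
  Near each boundary point, the set is the part lying strictly above a Lipschitz graph, in
  suitable orthonormal coordinates. The unit vector \<open>e\<close> is the last coordinate direction; the
  remaining coordinates of \<open>y\<close> are given by its projection to the hyperplane orthogonal to \<open>e\<close>.
\<close>

definition lipschitz_boundary :: "(real ^ 'n) set \<Rightarrow> bool" where
  "lipschitz_boundary \<Omega> \<longleftrightarrow> (\<forall>x0 \<in> frontier \<Omega>. \<exists>r > 0. \<exists>e \<gamma> L. norm e = 1 \<and>
     L-lipschitz_on {y. y \<bullet> e = 0} \<gamma> \<and>
     \<Omega> \<inter> ball x0 r = {y \<in> ball x0 r. \<gamma> (y - (y \<bullet> e) *\<^sub>R e) < y \<bullet> e})"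

definition admissible_kernel :: "real \<Rightarrow> (real ^ 'n \<Rightarrow> real) \<Rightarrow> bool" where
  "admissible_kernel s K \<longleftrightarrow>
     (\<forall>x. x \<noteq> 0 \<longrightarrow> K x > 0) \<and>
     (\<forall>x. x \<noteq> 0 \<longrightarrow> K x = K (- x)) \<and>
     integrable lebesgue (\<lambda>x. min ((norm x)\<^sup>2) 1 * K x) \<and>
     (\<exists>\<theta> > 0. \<forall>x. x \<noteq> 0 \<longrightarrow> K x \<ge> \<theta> * norm x powr (- (real CARD('n) + 2 * s)))"

definition crit_exponent :: "'n::finite itself \<Rightarrow> real \<Rightarrow> real" where
  "crit_exponent _ s = 2 * real CARD('n) / (real CARD('n) - 2 * s)"

definition Q_set :: "(real ^ 'n) set \<Rightarrow> ((real ^ 'n) \<times> (real ^ 'n)) set" where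
  "Q_set \<Omega> = UNIV - (UNIV - \<Omega>) \<times> (UNIV - \<Omega>)"

definition H_space :: "(real ^ 'n) set \<Rightarrow> (real ^ 'n \<Rightarrow> real) \<Rightarrow> (real ^ 'n \<Rightarrow> real) set" where
  "H_space \<Omega> K = {g. g \<in> borel_measurable lebesgue \<and>
     (AE x in lebesgue. x \<notin> \<Omega> \<longrightarrow> g x = 0) \<and>
     L2_on \<Omega> g \<and>
     L2_on (Q_set \<Omega>) (\<lambda>(x, y). (g x - g y) * sqrt (K (x - y)))}"

definition inner_H ::
  "(real ^ 'n) set \<Rightarrow> (real ^ 'n \<Rightarrow> real) \<Rightarrow> (real ^ 'n \<Rightarrow> real) \<Rightarrow> (real ^ 'n \<Rightarrow> real) \<Rightarrow> real" where
  "inner_H \<Omega> K u v = set_lebesgue_integral lebesgue (Q_set \<Omega>)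
     (\<lambda>(x, y). (u x - u y) * (v x - v y) * K (x - y))"

definition norm_H :: "(real ^ 'n) set \<Rightarrow> (real ^ 'n \<Rightarrow> real) \<Rightarrow> (real ^ 'n \<Rightarrow> real) \<Rightarrow> real" where
  "norm_H \<Omega> K u = sqrt (inner_H \<Omega> K u u)"

definition positive_definite ::
  "(real ^ 'n) set \<Rightarrow> (real ^ 'n \<Rightarrow> real) \<Rightarrow> (real ^ 'n \<Rightarrow> real) \<Rightarrow> bool" where
  "positive_definite \<Omega> K V \<longleftrightarrow> (\<forall>u \<in> H_space \<Omega> K. \<not> ae_zero u \<longrightarrow>
     (norm_H \<Omega> K u)\<^sup>2 + (LINT x:\<Omega>|lebesgue. V x * (u x)\<^sup>2) > 0)"

text \<open>
  Weak solutions of \<open>- L\<^sub>K u + V u = f\<close> in \<open>\<Omega>\<close>, \<open>u = 0\<close> outside \<open>\<Omega>\<close>. For the right-hand sides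
  used below (powers of \<open>u\<close> of subcritical growth) the integrands are integrable, since the
  fractional Sobolev embedding puts \<open>H\<close> into \<open>L\<^sup>q\<close> for every \<open>q\<close> up to the critical exponent.
\<close>

definition weak_solution ::
  "(real ^ 'n) set \<Rightarrow> (real ^ 'n \<Rightarrow> real) \<Rightarrow> (real ^ 'n \<Rightarrow> real) \<Rightarrow>
   (real ^ 'n \<Rightarrow> real) \<Rightarrow> (real ^ 'n \<Rightarrow> real) \<Rightarrow> bool" where
  "weak_solution \<Omega> K V f u \<longleftrightarrow> u \<in> H_space \<Omega> K \<and>
     (\<forall>\<phi> \<in> H_space \<Omega> K. inner_H \<Omega> K u \<phi> + (LINT x:\<Omega>|lebesgue. V x * u x * \<phi> x)
        = (LINT x:\<Omega>|lebesgue. f x * \<phi> x))"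

definition eigenvalue ::
  "(real ^ 'n) set \<Rightarrow> (real ^ 'n \<Rightarrow> real) \<Rightarrow> (real ^ 'n \<Rightarrow> real) \<Rightarrow> real \<Rightarrow> bool" where
  "eigenvalue \<Omega> K V \<mu> \<longleftrightarrow> (\<exists>u. \<not> ae_zero u \<and> weak_solution \<Omega> K V (\<lambda>x. \<mu> * u x) u)"

text \<open>
  The \<open>k\<close>-th eigenvalue, for \<open>k \<ge> 1\<close>, counted without multiplicity: exactly \<open>k - 1\<close> distinct
  eigenvalues lie strictly below it.
\<close>

definition eig ::
  "(real ^ 'n) set \<Rightarrow> (real ^ 'n \<Rightarrow> real) \<Rightarrow> (real ^ 'n \<Rightarrow> real) \<Rightarrow> nat \<Rightarrow> real" where
  "eig \<Omega> K V k = (THE \<mu>. eigenvalue \<Omega> K V \<mu> \<and>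
     finite {\<nu>. eigenvalue \<Omega> K V \<nu> \<and> \<nu> < \<mu>} \<and>
     Suc (card {\<nu>. eigenvalue \<Omega> K V \<nu> \<and> \<nu> < \<mu>}) = k)"

definition eigenspace ::
  "(real ^ 'n) set \<Rightarrow> (real ^ 'n \<Rightarrow> real) \<Rightarrow> (real ^ 'n \<Rightarrow> real) \<Rightarrow> nat \<Rightarrow> (real ^ 'n \<Rightarrow> real) set" where
  "eigenspace \<Omega> K V k = {u. weak_solution \<Omega> K V (\<lambda>x. eig \<Omega> K V k * u x) u}"

definition energy ::
  "(real ^ 'n) set \<Rightarrow> (real ^ 'n \<Rightarrow> real) \<Rightarrow> (real ^ 'n \<Rightarrow> real) \<Rightarrow> real \<Rightarrow> (real ^ 'n \<Rightarrow> real) \<Rightarrow> real" where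
  "energy \<Omega> K V p u = (norm_H \<Omega> K u)\<^sup>2 / 2 + (LINT x:\<Omega>|lebesgue. V x * (u x)\<^sup>2) / 2
     - eig \<Omega> K V 2 / p * (LINT x:\<Omega>|lebesgue. \<bar>u x\<bar> powr p)"

definition sign_changing :: "(real ^ 'n \<Rightarrow> real) \<Rightarrow> bool" where
  "sign_changing u \<longleftrightarrow> \<not> ae_zero (\<lambda>x. max (u x) 0) \<and> \<not> ae_zero (\<lambda>x. min (u x) 0)"

definition nodal_solution ::
  "(real ^ 'n) set \<Rightarrow> (real ^ 'n \<Rightarrow> real) \<Rightarrow> (real ^ 'n \<Rightarrow> real) \<Rightarrow> real \<Rightarrow> (real ^ 'n \<Rightarrow> real) \<Rightarrow> bool" where
  "nodal_solution \<Omega> K V p u \<longleftrightarrow>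
     weak_solution \<Omega> K V (\<lambda>x. eig \<Omega> K V 2 * \<bar>u x\<bar> powr (p - 2) * u x) u \<and> sign_changing u"

definition least_energy_nodal_solution ::
  "(real ^ 'n) set \<Rightarrow> (real ^ 'n \<Rightarrow> real) \<Rightarrow> (real ^ 'n \<Rightarrow> real) \<Rightarrow> real \<Rightarrow> (real ^ 'n \<Rightarrow> real) \<Rightarrow> bool" where
  "least_energy_nodal_solution \<Omega> K V p u \<longleftrightarrow> nodal_solution \<Omega> K V p u \<and>
     (\<forall>w. nodal_solution \<Omega> K V p w \<longrightarrow> energy \<Omega> K V p u \<le> energy \<Omega> K V p w)"

definition reduced_energy :: "(real ^ 'n) set \<Rightarrow> (real ^ 'n \<Rightarrow> real) \<Rightarrow> real" where
  "reduced_energy \<Omega> u = (LINT x:\<Omega>|lebesgue. (u x)\<^sup>2 - (u x)\<^sup>2 * ln ((u x)\<^sup>2)) / 2"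

definition has_directional_derivative ::
  "((real ^ 'n \<Rightarrow> real) \<Rightarrow> real) \<Rightarrow> (real ^ 'n \<Rightarrow> real) \<Rightarrow> (real ^ 'n \<Rightarrow> real) \<Rightarrow> real \<Rightarrow> bool" where
  "has_directional_derivative F u v D \<longleftrightarrow>
     ((\<lambda>t. F (\<lambda>x. u x + t * v x)) has_real_derivative D) (at 0)"

definition reduced_Nehari ::
  "(real ^ 'n) set \<Rightarrow> (real ^ 'n \<Rightarrow> real) \<Rightarrow> (real ^ 'n \<Rightarrow> real) \<Rightarrow> (real ^ 'n \<Rightarrow> real) set" where
  "reduced_Nehari \<Omega> K V = {u \<in> eigenspace \<Omega> K V 2. \<not> ae_zero u \<and>
     has_directional_derivative (reduced_energy \<Omega>) u u 0}"

end

theory Submission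
  imports Defs "HOL-Complex_Analysis.Great_Picard"
begin

text \<open>
  Write \<open>\<lambda>\<^sub>2\<close> for the second eigenvalue, \<open>u\<^sup>+ = max u 0\<close> and \<open>u\<^sup>- = min u 0 \<le> 0\<close>, and
  \<open>p = 2 + \<epsilon>\<close>. The power \<open>\<bar>u\<bar>\<^sup>\<epsilon> u\<close> equals \<open>u + \<epsilon> u (\<bar>u\<bar>\<^sup>\<epsilon> - 1) / \<epsilon>\<close>, and the difference quotient
  tends to \<open>u ln \<bar>u\<bar>\<close>. At order zero the equations converge to the eigenvalue equation
  (\<open>limit_in_eigenspace\<close>). Tested with a second eigenfunction \<open>\<phi>\<close> the order zero terms cancel for
  every \<open>p\<close>, so the first order term vanishes in the limit: \<open>\<integral> u\<^sub>* ln \<bar>u\<^sub>*\<bar> \<phi> = 0\<close>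
  (\<open>limit_orthogonality\<close>). The choice \<open>\<phi> = u\<^sub>*\<close> is the constraint of the reduced Nehari manifold,
  on which the reduced functional is half of the squared \<open>L\<^sup>2\<close> norm. Two points need more.

  The limit is not zero (\<open>limit_nonzero\<close>). A convex combination \<open>z\<close> of \<open>u\<^sup>+\<close> and \<open>u\<^sup>-\<close> is orthogonal
  to the first eigenfunction. Its Rayleigh quotient is at least \<open>\<lambda>\<^sub>2\<close>, while the equation bounds its
  form by \<open>\<lambda>\<^sub>2 \<integral> \<bar>u\<bar>\<^sup>\<epsilon> z\<^sup>2\<close>. Convexity in the exponent gives a bound of the form by
  \<open>\<lambda>\<^sub>2 \<integral> \<bar>u\<bar>\<^sup>d z\<^sup>2\<close> with a fixed \<open>d > 0\<close>, which is impossible when \<open>u\<close> is small in \<open>L\<^sup>2\<close>.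

  The limit has minimal norm (\<open>limit_minimizes_norm\<close>). The energy of a least energy nodal solution
  is at most the minimum over the nodal Nehari set, because a minimizer exists and solves the
  equation (\<open>nodal_solution_exists\<close>). The kernel makes the form of \<open>\<sigma> y\<^sup>+ + \<tau> y\<^sup>-\<close> contain
  \<open>- c (\<sigma> - \<tau>)\<^sup>2\<close> with \<open>c > 0\<close> for every second eigenfunction \<open>y\<close>. If \<open>y\<close> is in the reduced Nehari manifold, this forces
  the point of the nodal Nehari set on the cone of \<open>y\<close> to have \<open>\<sigma> - \<tau> \<rightarrow> 0\<close>, since all other terms of
  its energy are of order \<open>\<epsilon>\<close>. After division by \<open>\<epsilon>\<close> the comparison of energies becomes
  \<open>\<integral> u\<^sub>*\<^sup>2 \<le> \<integral> y\<^sup>2\<close>.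

  The analytic basis is proved from the lower bound of the kernel. Comparing \<open>f\<close> on the set
  \<open>{\<bar>f\<bar> > 2t}\<close> with its values on \<open>{\<bar>f\<bar> \<le> t}\<close> in a ball of at least twice the measure of \<open>{\<bar>f\<bar> > t}\<close>
  yields the Poincare inequality and integrability of some power \<open>2 + \<kappa>\<close>
  (\<open>gagliardo_superlevel_bound\<close>); comparing \<open>f\<close> with its means on a fine grid yields compactness
  (\<open>Rellich\<close>). The second eigenvalue is identified with the minimum of the Rayleigh quotient on the
  complement of the first eigenfunction (\<open>second_eigenvalue\<close>). Minimizers exist by this
  compactness and by Fatou's lemma along almost everywhere convergent sequences.
\<close>

section \<open>Square-integrable functions and extraction of subsequences\<close>

definition sq_int :: "'a measure \<Rightarrow> ('a \<Rightarrow> real) \<Rightarrow> bool" where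
  "sq_int M f \<longleftrightarrow> f \<in> borel_measurable M \<and> integrable M (\<lambda>x. (f x)\<^sup>2)"

lemma sq_intD:
  assumes "sq_int M f"
  shows "f \<in> borel_measurable M" "integrable M (\<lambda>x. (f x)\<^sup>2)"
  using assms by (auto simp: sq_int_def)

lemma sq_int_mult_integrable:
  assumes "sq_int M f" "sq_int M g"
  shows "integrable M (\<lambda>x. f x * g x)"
proof (rule Bochner_Integration.integrable_bound)
  show "integrable M (\<lambda>x. (f x)\<^sup>2 + (g x)\<^sup>2)" using assms by (auto simp: sq_int_def)
  show "(\<lambda>x. f x * g x) \<in> borel_measurable M" using assms by (auto simp: sq_int_def)
  show "AE x in M. norm (f x * g x) \<le> norm ((f x)\<^sup>2 + (g x)\<^sup>2)"
  proof (rule AE_I2)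
    fix x
    have "2 * (\<bar>f x\<bar> * \<bar>g x\<bar>) \<le> (f x)\<^sup>2 + (g x)\<^sup>2"
      using sum_squares_bound[of "\<bar>f x\<bar>" "\<bar>g x\<bar>"] by simp
    moreover have "0 \<le> \<bar>f x\<bar> * \<bar>g x\<bar>" by simp
    ultimately have "\<bar>f x\<bar> * \<bar>g x\<bar> \<le> (f x)\<^sup>2 + (g x)\<^sup>2" by linarith
    then show "norm (f x * g x) \<le> norm ((f x)\<^sup>2 + (g x)\<^sup>2)"
      by (simp add: abs_mult)
  qed
qed

lemma sq_int_scale: "sq_int M f \<Longrightarrow> sq_int M (\<lambda>x. c * f x)"
  by (auto simp: sq_int_def power_mult_distrib)

lemma sq_int_add:
  assumes "sq_int M f" "sq_int M g"
  shows "sq_int M (\<lambda>x. f x + g x)"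
proof -
  have "integrable M (\<lambda>x. (f x)\<^sup>2 + (g x)\<^sup>2 + 2 * (f x * g x))"
    using assms sq_int_mult_integrable[OF assms] by (auto simp: sq_int_def)
  then show ?thesis using assms
    by (auto simp: sq_int_def power2_sum mult.assoc)
qed

lemma sq_int_diff:
  assumes "sq_int M f" "sq_int M g"
  shows "sq_int M (\<lambda>x. f x - g x)"
  using sq_int_add[OF assms(1) sq_int_scale[OF assms(2), of "-1"]] by simp

lemma sq_int_bound:
  assumes "sq_int M g" "f \<in> borel_measurable M" "AE x in M. \<bar>f x\<bar> \<le> \<bar>g x\<bar>"
  shows "sq_int M f"
proof -
  have "integrable M (\<lambda>x. (f x)\<^sup>2)"
  proof (rule Bochner_Integration.integrable_bound[OF sq_intD(2)[OF assms(1)]])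
    show "AE x in M. norm ((f x)\<^sup>2) \<le> norm ((g x)\<^sup>2)"
      using assms(3) by eventually_elim (simp add: abs_le_square_iff)
  qed (use assms(2) in simp)
  then show ?thesis using assms by (simp add: sq_int_def)
qed

lemma sq_int_abs: "sq_int M f \<Longrightarrow> sq_int M (\<lambda>x. \<bar>f x\<bar>)"
  by (auto simp: sq_int_def)

lemma Cauchy_Schwarz_sq_int:
  assumes f: "sq_int M f" and g: "sq_int M g"
  shows "\<bar>\<integral>x. f x * g x \<partial>M\<bar> \<le> sqrt (\<integral>x. (f x)\<^sup>2 \<partial>M) * sqrt (\<integral>x. (g x)\<^sup>2 \<partial>M)"
proof -
  define a b c where "a = (\<integral>x. (f x)\<^sup>2 \<partial>M)" and "b = (\<integral>x. f x * g x \<partial>M)" and "c = (\<integral>x. (g x)\<^sup>2 \<partial>M)"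
  have a: "0 \<le> a" and c: "0 \<le> c" by (auto simp: a_def c_def)
  have q: "0 \<le> a + 2 * t * b + t\<^sup>2 * c" for t
  proof -
    have "0 \<le> (\<integral>x. (f x + t * g x)\<^sup>2 \<partial>M)" by simp
    also have "\<dots> = (\<integral>x. (f x)\<^sup>2 + 2 * t * (f x * g x) + t\<^sup>2 * (g x)\<^sup>2 \<partial>M)"
      by (rule Bochner_Integration.integral_cong) (auto simp: power2_eq_square algebra_simps)
    also have "\<dots> = a + 2 * t * b + t\<^sup>2 * c"
      using sq_intD[OF f] sq_intD[OF g] sq_int_mult_integrable[OF f g]
      by (simp add: a_def b_def c_def)
    finally show ?thesis .
  qed
  have "b\<^sup>2 \<le> a * c"
  proof (cases "c = 0")
    case True
    have "b = 0"
    proof (rule ccontr)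
      assume "b \<noteq> 0"
      then show False using q[of "-(a + 1) / (2 * b)"] True a by (simp add: field_simps)
    qed
    then show ?thesis using True by simp
  next
    case False
    then have "c > 0" using c by simp
    then show ?thesis using q[of "- b / c"]
      by (simp add: power2_eq_square field_simps)
  qed
  then have "sqrt (b\<^sup>2) \<le> sqrt (a * c)" by (rule real_sqrt_le_mono)
  then show ?thesis by (simp add: real_sqrt_mult a_def b_def c_def)
qed

lemma strict_mono_choice:
  fixes P :: "nat \<Rightarrow> nat \<Rightarrow> bool"
  assumes "\<And>k. eventually (P k) sequentially"
  obtains r :: "nat \<Rightarrow> nat" where "strict_mono r" "\<And>k. P k (r k)"
proof -
  have "\<exists>n0. \<forall>n \<ge> n0. P k n" for k using assms[of k] by (simp add: eventually_sequentially)
  then obtain N where N: "\<And>k n. n \<ge> N k \<Longrightarrow> P k n" by metis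
  define r where "r = rec_nat (N 0) (\<lambda>k m. max (Suc m) (N (Suc k)))"
  have r0: "r 0 = N 0" and rS: "r (Suc k) = max (Suc (r k)) (N (Suc k))" for k
    by (auto simp: r_def)
  have "strict_mono r" by (rule strict_monoI_Suc) (simp add: rS)
  moreover have "P k (r k)" for k by (rule N) (cases k; simp add: r0 rS)
  ultimately show ?thesis by (rule that)
qed

text \<open>
  Convergence to zero in \<open>L\<^sup>1\<close> gives, after passing to a rapidly convergent subsequence, not only
  convergence almost everywhere but also a single integrable majorant, namely the sum of the
  subsequence. Dominated convergence then handles all later limits.
\<close>

lemma L1_dominated_subsequence:
  fixes g :: "nat \<Rightarrow> 'a \<Rightarrow> real"
  assumes int: "\<And>n. integrable M (g n)" and nn: "\<And>n x. 0 \<le> g n x"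
    and lim: "(\<lambda>n. \<integral>x. g n x \<partial>M) \<longlonglongrightarrow> 0"
  obtains r G where "strict_mono r" "integrable M G" "\<And>x. 0 \<le> G x"
    "AE x in M. (\<forall>k. g (r k) x \<le> G x) \<and> (\<lambda>k. g (r k) x) \<longlonglongrightarrow> 0"
proof -
  have "eventually (\<lambda>n. (\<integral>x. g n x \<partial>M) < (1/2)^k) sequentially" for k
    using lim by (rule order_tendstoD) simp
  then obtain r where r: "strict_mono r" "\<And>k. (\<integral>x. g (r k) x \<partial>M) < (1/2)^k"
    using strict_mono_choice[of "\<lambda>k n. (\<integral>x. g n x \<partial>M) < (1/2)^k"] by blast
  have meas[measurable]: "g n \<in> borel_measurable M" for n using int by auto
  have "(\<integral>\<^sup>+x. (\<Sum>k. ennreal (g (r k) x)) \<partial>M) = (\<Sum>k. \<integral>\<^sup>+x. ennreal (g (r k) x) \<partial>M)"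
    by (rule nn_integral_suminf) simp
  also have "\<dots> = (\<Sum>k. ennreal (\<integral>x. g (r k) x \<partial>M))"
    using int nn by (simp add: nn_integral_eq_integral)
  also have "\<dots> \<le> (\<Sum>k. ennreal ((1/2)^k))"
    using r(2) by (intro suminf_le) (auto intro: ennreal_leI less_imp_le)
  also have "\<dots> < \<infinity>"
    by (subst suminf_ennreal2) (auto intro: summable_geometric)
  finally have "AE x in M. (\<Sum>k. ennreal (g (r k) x)) \<noteq> \<infinity>"
    by (intro nn_integral_PInf_AE) auto
  then have sm: "AE x in M. summable (\<lambda>k. g (r k) x)"
  proof eventually_elim
    case (elim x)
    then show ?case using nn by (intro summable_suminf_not_top) (auto simp: top_unique)
  qed
  define G where "G x = \<bar>\<Sum>k. g (r k) x\<bar>" for x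
  have "integrable M (\<lambda>x. \<Sum>k. g (r k) x)"
  proof (rule integrable_suminf)
    show "AE x in M. summable (\<lambda>k. norm (g (r k) x))" using sm nn by simp
    show "summable (\<lambda>k. \<integral>x. norm (g (r k) x) \<partial>M)"
    proof (rule summable_comparison_test')
      show "summable (\<lambda>k. (1/2::real)^k)" by (rule summable_geometric) simp
      show "norm (\<integral>x. norm (g (r k) x) \<partial>M) \<le> (1/2)^k" if "0 \<le> k" for k
        using r(2)[of k] nn by simp
    qed
  qed (use int in auto)
  then have "integrable M G" unfolding G_def by (rule integrable_abs)
  moreover have "AE x in M. (\<forall>k. g (r k) x \<le> G x) \<and> (\<lambda>k. g (r k) x) \<longlonglongrightarrow> 0"
    using sm
  proof eventually_elim
    case (elim x)
    have "g (r k) x \<le> (\<Sum>k. g (r k) x)" for k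
      using sum_le_suminf[OF elim, of "{k}"] nn by simp
    then show ?case using summable_LIMSEQ_zero[OF elim] unfolding G_def
      by (meson abs_ge_self order_trans)
  qed
  ultimately show ?thesis using r(1) by (intro that[of r G]) (auto simp: G_def)
qed

text \<open>
  On a finite measure space an \<open>L\<^sup>2\<close> Cauchy sequence has a subsequence whose increments are
  summable in \<open>L\<^sup>1\<close>, hence almost everywhere.
\<close>

lemma L2_Cauchy_AE_convergent_subsequence:
  fixes f :: "nat \<Rightarrow> 'a \<Rightarrow> real"
  assumes fin: "finite_measure M" and f: "\<And>n. sq_int M (f n)"
    and C: "\<And>e. e > 0 \<Longrightarrow> \<exists>N. \<forall>m\<ge>N. \<forall>n\<ge>N. (\<integral>x. (f m x - f n x)\<^sup>2 \<partial>M) < e"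
  obtains r where "strict_mono r" "AE x in M. convergent (\<lambda>k. f (r k) x)"
proof -
  interpret finite_measure M by (rule fin)
  have "eventually (\<lambda>n. \<forall>m\<ge>n. (\<integral>x. (f m x - f n x)\<^sup>2 \<partial>M) < (1/4)^k) sequentially" for k
  proof -
    obtain N where "\<forall>m\<ge>N. \<forall>n\<ge>N. (\<integral>x. (f m x - f n x)\<^sup>2 \<partial>M) < (1/4)^k" using C[of "(1/4)^k"] by auto
    then show ?thesis by (auto simp: eventually_sequentially intro!: exI[of _ N])
  qed
  then obtain r where r: "strict_mono r" "\<And>k. \<forall>m\<ge>r k. (\<integral>x. (f m x - f (r k) x)\<^sup>2 \<partial>M) < (1/4)^k"
    using strict_mono_choice[of "\<lambda>k n. \<forall>m\<ge>n. (\<integral>x. (f m x - f n x)\<^sup>2 \<partial>M) < (1/4)^k"] by blast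
  define d where "d k x = f (r (Suc k)) x - f (r k) x" for k x
  have dsq: "sq_int M (d k)" for k unfolding d_def by (rule sq_int_diff[OF f f])
  have d1: "(\<integral>x. (d k x)\<^sup>2 \<partial>M) < (1/4)^k" for k
    using r(2)[of k] strict_monoD[OF r(1), of k "Suc k"] unfolding d_def by simp
  have dint: "integrable M (d k)" for k
  proof -
    have "sq_int M (\<lambda>x. 1::real)" by (simp add: sq_int_def)
    from sq_int_mult_integrable[OF dsq this] show ?thesis by simp
  qed
  have young: "\<bar>t\<bar> \<le> 2^k * t\<^sup>2 + (1/2)^k" for t :: real and k
  proof -
    have "0 \<le> 2^k * (\<bar>t\<bar> - (1/2)^k)\<^sup>2" by simp
    also have "\<dots> = 2^k * t\<^sup>2 - 2 * \<bar>t\<bar> * (2^k*(1/2)^k) + (2^k*(1/2)^k) * (1/2)^k"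
      unfolding power2_diff power2_eq_square by (simp add: algebra_simps)
    also have "(2::real)^k*(1/2)^k = 1" by (simp flip: power_mult_distrib)
    finally have "2 * \<bar>t\<bar> \<le> 2^k * t\<^sup>2 + (1/2)^k" by simp
    then show ?thesis by simp
  qed
  have d2: "(\<integral>x. \<bar>d k x\<bar> \<partial>M) \<le> (1 + measure M (space M)) * (1/2)^k" for k
  proof -
    have "(\<integral>x. \<bar>d k x\<bar> \<partial>M) \<le> (\<integral>x. 2^k * (d k x)\<^sup>2 + (1/2)^k \<partial>M)"
      using dint dsq young by (intro integral_mono) (auto simp: sq_int_def)
    also have "\<dots> = 2^k * (\<integral>x. (d k x)\<^sup>2 \<partial>M) + (1/2)^k * measure M (space M)"
      using dsq by (simp add: sq_int_def)
    also have "\<dots> \<le> 2^k * (1/4)^k + (1/2)^k * measure M (space M)"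
      using d1[of k] by (intro add_right_mono mult_left_mono) auto
    also have "(2::real)^k * (1/4)^k = (1/2)^k" by (simp flip: power_mult_distrib)
    finally show ?thesis by (simp add: algebra_simps)
  qed
  have [measurable]: "d k \<in> borel_measurable M" for k using dint by auto
  have "(\<integral>\<^sup>+x. (\<Sum>k. ennreal \<bar>d k x\<bar>) \<partial>M) = (\<Sum>k. \<integral>\<^sup>+x. ennreal \<bar>d k x\<bar> \<partial>M)"
    by (rule nn_integral_suminf) simp
  also have "\<dots> = (\<Sum>k. ennreal (\<integral>x. \<bar>d k x\<bar> \<partial>M))"
    using dint by (simp add: nn_integral_eq_integral)
  also have "\<dots> \<le> (\<Sum>k. ennreal ((1 + measure M (space M)) * (1/2)^k))"
    using d2 by (intro suminf_le) (auto intro: ennreal_leI)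
  also have "\<dots> < \<infinity>"
    by (subst suminf_ennreal2) (auto intro!: summable_mult summable_geometric)
  finally have "AE x in M. (\<Sum>k. ennreal \<bar>d k x\<bar>) \<noteq> \<infinity>"
    by (intro nn_integral_PInf_AE) auto
  then have "AE x in M. convergent (\<lambda>k. f (r k) x)"
  proof eventually_elim
    case (elim x)
    then have "summable (\<lambda>k. \<bar>d k x\<bar>)"
      by (intro summable_suminf_not_top) (auto simp: top_unique)
    then have "summable (\<lambda>k. d k x)" by (rule summable_rabs_cancel)
    then have "convergent (\<lambda>n. \<Sum>k<n. d k x)" by (simp add: summable_iff_convergent)
    moreover have "(\<Sum>k<n. d k x) = f (r n) x - f (r 0) x" for n
      unfolding d_def by (rule sum_lessThan_telescope)
    ultimately have "convergent (\<lambda>n. (f (r n) x - f (r 0) x) + f (r 0) x)"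
      by (intro convergent_add convergent_const) simp
    then show ?case by simp
  qed
  with r(1) show ?thesis by (rule that)
qed

text \<open>
  Lebesgue measure on the product type is not the product of the completed measures, so null sets and
  measurability are transported through Borel sets.
\<close>

lemma AE_lebesgue_fst_snd:
  fixes P :: "'a::euclidean_space \<Rightarrow> bool"
  assumes "AE x in lebesgue. P x"
  shows "AE z in (lebesgue :: ('a \<times> 'a) measure). P (fst z) \<and> P (snd z)"
proof -
  have "AE x in lborel. P x" using assms by (simp add: AE_completion_iff)
  then obtain N where N: "{x. \<not> P x} \<subseteq> N" "N \<in> null_sets lborel"
    by (auto elim!: AE_E simp: null_sets_def)
  have "N \<times> UNIV \<in> null_sets (lborel \<Otimes>\<^sub>M (lborel :: 'a measure))"
    "UNIV \<times> N \<in> null_sets ((lborel :: 'a measure) \<Otimes>\<^sub>M lborel)"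
    using N(2) by (auto simp: null_sets_def lborel.emeasure_pair_measure_Times)
  then have "(N \<times> UNIV) \<union> (UNIV \<times> N) \<in> null_sets (lborel :: ('a \<times> 'a) measure)"
    unfolding lborel_prod by (rule null_sets.Un)
  then have "AE z in (lborel :: ('a \<times> 'a) measure). P (fst z) \<and> P (snd z)"
    by (rule AE_I') (use N(1) in auto)
  then show ?thesis by (simp add: AE_completion_iff)
qed

lemma lebesgue_measurable_fst_snd:
  fixes u :: "'a::euclidean_space \<Rightarrow> real"
  assumes "u \<in> borel_measurable lebesgue"
  shows "(\<lambda>z. u (fst z)) \<in> borel_measurable (lebesgue :: ('a \<times> 'a) measure)"
    and "(\<lambda>z. u (snd z)) \<in> borel_measurable (lebesgue :: ('a \<times> 'a) measure)"
proof -
  obtain g where g: "g \<in> borel_measurable lborel" "AE x in lborel. u x = g x"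
    using completion_ex_borel_measurable_real[OF assms] by auto
  have g': "g \<in> borel_measurable borel" using g by simp
  have ae: "AE z in (lebesgue :: ('a \<times> 'a) measure). g (fst z) = u (fst z) \<and> g (snd z) = u (snd z)"
    by (rule AE_lebesgue_fst_snd) (use g(2) in \<open>auto simp: AE_completion_iff\<close>)
  have 1: "(\<lambda>z. g (fst z)) \<in> borel_measurable (lebesgue :: ('a \<times> 'a) measure)"
    using measurable_compose[OF borel_measurable_continuous_onI[OF continuous_on_fst[OF continuous_on_id]] g']
    by (intro measurable_completion) simp
  have 2: "(\<lambda>z. g (snd z)) \<in> borel_measurable (lebesgue :: ('a \<times> 'a) measure)"
    using measurable_compose[OF borel_measurable_continuous_onI[OF continuous_on_snd[OF continuous_on_id]] g']
    by (intro measurable_completion) simp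
  show "(\<lambda>z. u (fst z)) \<in> borel_measurable (lebesgue :: ('a \<times> 'a) measure)"
    by (rule borel_measurable_AE[OF 1]) (use ae in auto)
  show "(\<lambda>z. u (snd z)) \<in> borel_measurable (lebesgue :: ('a \<times> 'a) measure)"
    by (rule borel_measurable_AE[OF 2]) (use ae in auto)
qed

section \<open>The function space and its bilinear form\<close>

abbreviation pos_part :: "('a \<Rightarrow> real) \<Rightarrow> 'a \<Rightarrow> real" where
  "pos_part u \<equiv> (\<lambda>x. max (u x) 0)"

abbreviation neg_part :: "('a \<Rightarrow> real) \<Rightarrow> 'a \<Rightarrow> real" where
  "neg_part u \<equiv> (\<lambda>x. min (u x) 0)"

lemma L2_on_iff_sq_int:
  assumes "A \<in> sets lebesgue"
  shows "L2_on A f \<longleftrightarrow> sq_int (lebesgue_on A) f"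
proof -
  have A: "A \<inter> space lebesgue \<in> sets lebesgue" using assms by simp
  show ?thesis
    unfolding L2_on_def sq_int_def set_borel_measurable_def set_integrable_def
      borel_measurable_restrict_space_iff[OF A] integrable_restrict_space[OF A] by simp
qed

lemma AE_lebesgue_on_iff:
  assumes "A \<in> sets lebesgue"
  shows "(AE x in lebesgue_on A. P x) \<longleftrightarrow> (AE x in lebesgue. x \<in> A \<longrightarrow> P x)"
  using assms by (intro AE_restrict_space_iff) simp

locale nonlocal_problem =
  fixes \<Omega> :: "(real ^ 'n) set" and K V :: "real ^ 'n \<Rightarrow> real" and s :: real
  assumes dim: "CARD('n) \<ge> 2" and s0: "0 < s" and s1: "s < 1"
    and open_Omega: "open \<Omega>" and Omega_ne: "\<Omega> \<noteq> {}" and bounded_Omega: "bounded \<Omega>"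
    and V_Linf: "Linf_on \<Omega> V" and kernel: "admissible_kernel s K"
begin

abbreviation M where "M \<equiv> lebesgue_on \<Omega>"
abbreviation P where "P \<equiv> lebesgue_on (Q_set \<Omega>)"
abbreviation H where "H \<equiv> H_space \<Omega> K"
abbreviation inner where "inner \<equiv> inner_H \<Omega> K"

text \<open>The weighted difference turns the Gagliardo-type inner product into an \<open>L\<^sup>2\<close> inner product.\<close>

definition D :: "(real ^ 'n \<Rightarrow> real) \<Rightarrow> (real ^ 'n) \<times> (real ^ 'n) \<Rightarrow> real" where
  "D u z = (u (fst z) - u (snd z)) * sqrt (K (fst z - snd z))"

text \<open>
  The bilinear form of the operator with potential, to which both the eigenvalue problem and the
  nonlinear equation refer.
\<close>

definition form :: "(real ^ 'n \<Rightarrow> real) \<Rightarrow> (real ^ 'n \<Rightarrow> real) \<Rightarrow> real" where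
  "form u v = inner u v + (\<integral>x. V x * u x * v x \<partial>M)"

lemma Omega_sets[simp]: "\<Omega> \<in> sets lebesgue"
  by (intro sets_completionI_sets) (simp add: borel_open open_Omega)

lemma open_Q: "open (Q_set \<Omega>)"
proof -
  have "closed ((UNIV - \<Omega>) \<times> (UNIV - \<Omega>))"
    using open_Omega by (intro closed_Times) (auto intro: closed_Diff)
  then show ?thesis unfolding Q_set_def by (intro open_Diff) auto
qed

lemma Q_sets[simp]: "Q_set \<Omega> \<in> sets lebesgue"
  by (intro sets_completionI_sets) (simp add: borel_open open_Q)

lemma finite_M: "finite_measure M"
  by (rule finite_measure_lebesgue_on[OF lmeasurable_open[OF bounded_Omega open_Omega]])

lemma set_integral_Omega: "(LINT x:\<Omega>|lebesgue. f x) = (\<integral>x. f x \<partial>M)" for f :: "real ^ 'n \<Rightarrow> real"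
  unfolding set_lebesgue_integral_def by (subst integral_restrict_space) auto

lemma set_integral_Q: "(LINT x:Q_set \<Omega>|lebesgue. f x) = (\<integral>x. f x \<partial>P)" for f :: "(real ^ 'n) \<times> (real ^ 'n) \<Rightarrow> real"
  unfolding set_lebesgue_integral_def by (subst integral_restrict_space) auto

lemma K_pos: "x \<noteq> 0 \<Longrightarrow> K x > 0"
  using kernel unfolding admissible_kernel_def by blast

lemma mem_H:
  "u \<in> H \<longleftrightarrow> u \<in> borel_measurable lebesgue \<and> (AE x in lebesgue. x \<notin> \<Omega> \<longrightarrow> u x = 0) \<and>
     sq_int M u \<and> sq_int P (D u)"
proof -
  have "(\<lambda>(x, y). (u x - u y) * sqrt (K (x - y))) = D u"
    by (auto simp: D_def fun_eq_iff)
  then show ?thesis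
    by (simp only: H_space_def mem_Collect_eq L2_on_iff_sq_int[OF Omega_sets] L2_on_iff_sq_int[OF Q_sets])
qed

lemma H_D:
  assumes "u \<in> H"
  shows "u \<in> borel_measurable lebesgue" "AE x in lebesgue. x \<notin> \<Omega> \<longrightarrow> u x = 0"
     "sq_int M u" "sq_int P (D u)" "u \<in> borel_measurable M" "integrable M (\<lambda>x. (u x)\<^sup>2)"
     "D u \<in> borel_measurable P"
  using assms by (auto simp: mem_H sq_int_def)

lemma D_mult: "D u z * D v z = (u (fst z) - u (snd z)) * (v (fst z) - v (snd z)) * K (fst z - snd z)"
proof (cases "fst z = snd z")
  case False
  then have "sqrt (K (fst z - snd z)) * sqrt (K (fst z - snd z)) = K (fst z - snd z)"
    using K_pos[of "fst z - snd z"] by simp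
  moreover have "D u z * D v z = (u (fst z) - u (snd z)) * (v (fst z) - v (snd z))
      * (sqrt (K (fst z - snd z)) * sqrt (K (fst z - snd z)))"
    by (simp only: D_def mult_ac)
  ultimately show ?thesis by simp
qed (simp add: D_def)

lemma inner_eq: "inner u v = (\<integral>z. D u z * D v z \<partial>P)"
  unfolding inner_H_def set_integral_Q D_mult case_prod_beta ..

lemma D_lin: "D (\<lambda>x. a * u x + b * v x) z = a * D u z + b * D v z"
  by (simp add: D_def algebra_simps)

lemma H_lin:
  assumes "u \<in> H" "v \<in> H"
  shows "(\<lambda>x. a * u x + b * v x) \<in> H"
proof -
  have "AE x in lebesgue. x \<notin> \<Omega> \<longrightarrow> a * u x + b * v x = 0"
    using H_D(2)[OF assms(1)] H_D(2)[OF assms(2)] by eventually_elim simp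
  moreover have "D (\<lambda>x. a * u x + b * v x) = (\<lambda>z. a * D u z + b * D v z)"
    by (simp add: D_lin fun_eq_iff)
  ultimately show ?thesis
    using H_D[OF assms(1)] H_D[OF assms(2)]
    by (auto simp: mem_H intro!: sq_int_add sq_int_scale)
qed

lemma H_scale: "u \<in> H \<Longrightarrow> (\<lambda>x. a * u x) \<in> H"
  using H_lin[of u u a 0] by simp

lemma H_add: "u \<in> H \<Longrightarrow> v \<in> H \<Longrightarrow> (\<lambda>x. u x + v x) \<in> H"
  using H_lin[of u v 1 1] by simp

lemma H_diff: "u \<in> H \<Longrightarrow> v \<in> H \<Longrightarrow> (\<lambda>x. u x - v x) \<in> H"
  using H_lin[of u v 1 "-1"] by simp

text \<open>
  \<open>D (f \<circ> u)\<close> is \<open>D u\<close> times the difference quotient of \<open>f\<close> at the two values of \<open>u\<close>, and thus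
  inherits measurability and integrability from \<open>D u\<close>.
\<close>

lemma H_contraction:
  assumes u: "u \<in> H" and f0: "f 0 = 0" and lip: "\<And>a b. \<bar>f a - f b\<bar> \<le> \<bar>a - b\<bar>"
  shows "(\<lambda>x. f (u x)) \<in> H" and "\<bar>D (\<lambda>x. f (u x)) z\<bar> \<le> \<bar>D u z\<bar>"
proof -
  have "1-lipschitz_on UNIV f" by (rule lipschitz_onI) (use lip in \<open>auto simp: dist_real_def\<close>)
  then have cf: "continuous_on UNIV f" by (rule lipschitz_on_continuous_on)
  then have [measurable]: "f \<in> borel_measurable borel" by (rule borel_measurable_continuous_onI)
  show D_le: "\<bar>D (\<lambda>x. f (u x)) z\<bar> \<le> \<bar>D u z\<bar>" for z
    unfolding D_def abs_mult by (intro mult_right_mono lip) simp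
  have fu: "\<bar>f (u x)\<bar> \<le> \<bar>u x\<bar>" for x using lip[of "u x" 0] f0 by simp
  have D_eq: "D (\<lambda>x. f (u x)) = (\<lambda>z. D u z * ((f (u (fst z)) - f (u (snd z))) / (u (fst z) - u (snd z))))"
    by (auto simp: D_def fun_eq_iff)
  have [measurable]: "(\<lambda>z. u (fst z)) \<in> borel_measurable P" "(\<lambda>z. u (snd z)) \<in> borel_measurable P"
    using lebesgue_measurable_fst_snd[OF H_D(1)[OF u]] by (auto intro: measurable_restrict_space1)
  have [measurable]: "D u \<in> borel_measurable P" using H_D(4)[OF u] by (simp add: sq_int_def)
  have "D (\<lambda>x. f (u x)) \<in> borel_measurable P" unfolding D_eq by measurable
  then have 1: "sq_int P (D (\<lambda>x. f (u x)))"
    using D_le by (intro sq_int_bound[OF H_D(4)[OF u]]) auto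
  have [measurable]: "u \<in> borel_measurable lebesgue" "u \<in> borel_measurable M" using H_D[OF u] by auto
  have 2: "sq_int M (\<lambda>x. f (u x))" using fu by (intro sq_int_bound[OF H_D(3)[OF u]]) auto
  have 3: "AE x in lebesgue. x \<notin> \<Omega> \<longrightarrow> f (u x) = 0"
    using H_D(2)[OF u] by eventually_elim (simp add: f0)
  show "(\<lambda>x. f (u x)) \<in> H" using 1 2 3 by (auto simp: mem_H)
qed

lemma H_pos_part: "u \<in> H \<Longrightarrow> pos_part u \<in> H"
  by (rule H_contraction(1)[where f="\<lambda>t. max t 0"]) auto

lemma H_neg_part: "u \<in> H \<Longrightarrow> neg_part u \<in> H"
  by (rule H_contraction(1)[where f="\<lambda>t. min t 0"]) auto

lemma D_pos_part_le: "u \<in> H \<Longrightarrow> \<bar>D (pos_part u) z\<bar> \<le> \<bar>D u z\<bar>"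
  by (rule H_contraction(2)[where f="\<lambda>t. max t 0"]) auto

lemma D_neg_part_le: "u \<in> H \<Longrightarrow> \<bar>D (neg_part u) z\<bar> \<le> \<bar>D u z\<bar>"
  by (rule H_contraction(2)[where f="\<lambda>t. min t 0"]) auto

lemma ae_zero_iff_M:
  assumes "u \<in> H"
  shows "ae_zero u \<longleftrightarrow> (AE x in M. u x = 0)"
proof -
  have "(AE x in lebesgue. u x = 0) \<longleftrightarrow> (AE x in lebesgue. x \<in> \<Omega> \<longrightarrow> u x = 0)"
  proof
    assume "AE x in lebesgue. x \<in> \<Omega> \<longrightarrow> u x = 0"
    with H_D(2)[OF assms] show "AE x in lebesgue. u x = 0" by eventually_elim blast
  next
    assume "AE x in lebesgue. u x = 0"
    then show "AE x in lebesgue. x \<in> \<Omega> \<longrightarrow> u x = 0" by eventually_elim simp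
  qed
  then show ?thesis by (simp add: ae_zero_def AE_lebesgue_on_iff)
qed

lemma ae_zero_iff_norm:
  assumes "u \<in> H"
  shows "ae_zero u \<longleftrightarrow> (\<integral>x. (u x)\<^sup>2 \<partial>M) = 0"
  using H_D(6)[OF assms] by (subst integral_nonneg_eq_0_iff_AE) (auto simp: ae_zero_iff_M[OF assms])

lemma norm_pos:
  assumes "u \<in> H" "\<not> ae_zero u"
  shows "(\<integral>x. (u x)\<^sup>2 \<partial>M) > 0"
proof -
  have "(\<integral>x. (u x)\<^sup>2 \<partial>M) \<ge> 0" by simp
  then show ?thesis using ae_zero_iff_norm[OF assms(1)] assms(2) by linarith
qed

lemma D_int: "u \<in> H \<Longrightarrow> v \<in> H \<Longrightarrow> integrable P (\<lambda>z. D u z * D v z)"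
  using H_D(4) by (intro sq_int_mult_integrable) auto

lemma inner_sym: "inner u v = inner v u"
  by (simp add: inner_eq mult.commute)

lemma inner_lin_left:
  assumes "u \<in> H" "v \<in> H" "w \<in> H"
  shows "inner (\<lambda>x. a * u x + b * v x) w = a * inner u w + b * inner v w"
proof -
  have "inner (\<lambda>x. a * u x + b * v x) w = (\<integral>z. a * (D u z * D w z) + b * (D v z * D w z) \<partial>P)"
    unfolding inner_eq D_lin by (simp add: algebra_simps)
  also have "\<dots> = a * inner u w + b * inner v w"
    unfolding inner_eq using D_int assms by simp
  finally show ?thesis .
qed

lemma inner_nonneg: "inner u u \<ge> 0"
  by (simp add: inner_eq)

lemma norm_H_sq: "(norm_H \<Omega> K u)\<^sup>2 = inner u u"
  using inner_nonneg by (simp add: norm_H_def)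

lemma inner_Cauchy_Schwarz:
  assumes "u \<in> H" "v \<in> H"
  shows "\<bar>inner u v\<bar> \<le> sqrt (inner u u) * sqrt (inner v v)"
  using Cauchy_Schwarz_sq_int[OF H_D(4)[OF assms(1)] H_D(4)[OF assms(2)]]
  by (simp add: inner_eq power2_eq_square)

lemma V_bound: obtains CV where "CV \<ge> 0" "AE x in M. \<bar>V x\<bar> \<le> CV"
proof -
  obtain C where "AE x in lebesgue. x \<in> \<Omega> \<longrightarrow> \<bar>V x\<bar> \<le> C" using V_Linf by (auto simp: Linf_on_def)
  then have "AE x in M. \<bar>V x\<bar> \<le> C" by (simp add: AE_lebesgue_on_iff)
  then have "AE x in M. \<bar>V x\<bar> \<le> max C 0" by eventually_elim simp
  then show ?thesis by (intro that[of "max C 0"]) auto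
qed

lemma V_meas[measurable]: "V \<in> borel_measurable M"
proof -
  have "\<Omega> \<inter> space lebesgue \<in> sets lebesgue" by simp
  from borel_measurable_restrict_space_iff[OF this, of V] show ?thesis
    using V_Linf by (simp add: Linf_on_def set_borel_measurable_def)
qed

lemma V_integrable:
  assumes u: "sq_int M u" and v: "sq_int M v"
  shows "integrable M (\<lambda>x. V x * u x * v x)"
proof -
  obtain CV where CV: "CV \<ge> 0" "AE x in M. \<bar>V x\<bar> \<le> CV" by (rule V_bound)
  show ?thesis
  proof (rule Bochner_Integration.integrable_bound)
    show "integrable M (\<lambda>x. CV * (u x * v x))" using sq_int_mult_integrable[OF u v] by simp
    show "(\<lambda>x. V x * u x * v x) \<in> borel_measurable M" using u v by (auto simp: sq_int_def)
    show "AE x in M. norm (V x * u x * v x) \<le> norm (CV * (u x * v x))"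
      using CV(2) by eventually_elim (use CV(1) in \<open>simp add: abs_mult mult.assoc mult_right_mono\<close>)
  qed
qed

lemma form_sym: "form u v = form v u"
  by (simp add: form_def inner_sym[of u v] mult.commute mult.left_commute)

lemma form_lin_left:
  assumes "u \<in> H" "v \<in> H" "w \<in> H"
  shows "form (\<lambda>x. a * u x + b * v x) w = a * form u w + b * form v w"
proof -
  have "(\<integral>x. V x * (a * u x + b * v x) * w x \<partial>M) = (\<integral>x. a * (V x * u x * w x) + b * (V x * v x * w x) \<partial>M)"
    by (rule Bochner_Integration.integral_cong) (auto simp: algebra_simps)
  also have "\<dots> = a * (\<integral>x. V x * u x * w x \<partial>M) + b * (\<integral>x. V x * v x * w x \<partial>M)"
    using V_integrable H_D(3) assms by simp
  finally show ?thesis unfolding form_def inner_lin_left[OF assms] by (simp add: algebra_simps)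
qed

lemma form_lin_right:
  assumes "u \<in> H" "v \<in> H" "w \<in> H"
  shows "form w (\<lambda>x. a * u x + b * v x) = a * form w u + b * form w v"
  using form_lin_left[OF assms] by (simp add: form_sym[of w])

lemma form_scale_left: "u \<in> H \<Longrightarrow> w \<in> H \<Longrightarrow> form (\<lambda>x. a * u x) w = a * form u w"
  using form_lin_left[of u u w a 0] by simp

lemma form_scale: "u \<in> H \<Longrightarrow> form (\<lambda>x. a * u x) (\<lambda>x. a * u x) = a\<^sup>2 * form u u"
  using form_scale_left[of u u a] form_scale_left[of u "\<lambda>x. a * u x" a] H_scale[of u a]
  by (simp add: form_sym[of u "\<lambda>x. a * u x"] power2_eq_square)

lemma form_quadratic:
  assumes "u \<in> H" "v \<in> H"
  shows "form (\<lambda>x. a * u x + b * v x) (\<lambda>x. a * u x + b * v x)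
     = a\<^sup>2 * form u u + 2 * a * b * form u v + b\<^sup>2 * form v v"
  using form_lin_left[OF assms H_lin[OF assms]] form_lin_right[OF assms assms(1)] form_lin_right[OF assms assms(2)]
  by (simp add: form_sym[of v u] power2_eq_square algebra_simps)

lemma weak_solution_iff:
  "weak_solution \<Omega> K V f u \<longleftrightarrow> u \<in> H \<and> (\<forall>\<phi>\<in>H. form u \<phi> = (\<integral>x. f x * \<phi> x \<partial>M))"
  unfolding weak_solution_def form_def set_integral_Omega ..

lemma energy_eq:
  "energy \<Omega> K V p u = form u u / 2 - eig \<Omega> K V 2 / p * (\<integral>x. \<bar>u x\<bar> powr p \<partial>M)"
  unfolding energy_def form_def set_integral_Omega norm_H_sq
  by (simp add: power2_eq_square mult.assoc add_divide_distrib)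

lemma positive_definite_iff:
  "positive_definite \<Omega> K V \<longleftrightarrow> (\<forall>u\<in>H. \<not> ae_zero u \<longrightarrow> form u u > 0)"
  unfolding positive_definite_def form_def set_integral_Omega norm_H_sq
  by (simp add: power2_eq_square mult.assoc)

text \<open>
  Lower semicontinuity: along a sequence converging almost everywhere, Fatou's lemma on the
  doubled domain controls the Gagliardo seminorm of the limit.
\<close>

lemma H_closed_under_bounded_AE_limits:
  fixes v :: "nat \<Rightarrow> real ^ 'n \<Rightarrow> real"
  assumes vn: "\<And>n. v n \<in> H" and bd: "\<And>n. inner (v n) (v n) \<le> C"
    and u: "u \<in> borel_measurable lebesgue" "AE x in lebesgue. x \<notin> \<Omega> \<longrightarrow> u x = 0" "sq_int M u"
    and lim: "AE x in M. (\<lambda>n. v n x) \<longlonglongrightarrow> u x"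
  shows "u \<in> H" and "inner u u \<le> C"
proof -
  have "AE x in lebesgue. \<forall>n. x \<notin> \<Omega> \<longrightarrow> v n x = 0"
    by (subst AE_all_countable) (use H_D(2)[OF vn] in blast)
  moreover have "AE x in lebesgue. x \<in> \<Omega> \<longrightarrow> (\<lambda>n. v n x) \<longlonglongrightarrow> u x"
    using lim by (simp add: AE_lebesgue_on_iff)
  ultimately have ae: "AE x in lebesgue. (\<lambda>n. v n x) \<longlonglongrightarrow> u x"
    using u(2) by eventually_elim (case_tac "x \<in> \<Omega>", auto)
  have "AE z in lebesgue. (\<lambda>n. v n (fst z)) \<longlonglongrightarrow> u (fst z) \<and> (\<lambda>n. v n (snd z)) \<longlonglongrightarrow> u (snd z)"
    by (rule AE_lebesgue_fst_snd[OF ae])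
  then have Dlim: "AE z in lebesgue. (\<lambda>n. D (v n) z) \<longlonglongrightarrow> D u z"
    by eventually_elim (auto simp: D_def intro!: tendsto_intros)
  define Q where "Q = Q_set \<Omega>"
  have Qm: "Q \<inter> space lebesgue \<in> sets lebesgue" by (simp add: Q_def)
  have DvP[measurable]: "D (v n) \<in> borel_measurable P" for n using H_D(4)[OF vn] by (simp add: sq_int_def)
  have Dv: "(\<lambda>z. indicator Q z *\<^sub>R D (v n) z) \<in> borel_measurable lebesgue" for n
    using borel_measurable_restrict_space_iff[OF Qm] DvP[of n] unfolding Q_def by blast
  \<comment> \<open>The limit is measurable because almost everywhere limits are, Lebesgue measure being complete.\<close>
  have "(\<lambda>z. lim (\<lambda>n. indicator Q z *\<^sub>R D (v n) z)) \<in> borel_measurable lebesgue"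
    by (intro borel_measurable_lim_metric Dv)
  moreover have "AE z in lebesgue. lim (\<lambda>n. indicator Q z *\<^sub>R D (v n) z) = indicator Q z *\<^sub>R D u z"
    using Dlim by eventually_elim (auto intro!: limI tendsto_intros)
  ultimately have "(\<lambda>z. indicator Q z *\<^sub>R D u z) \<in> borel_measurable lebesgue"
    by (rule borel_measurable_AE)
  then have DuP[measurable]: "D u \<in> borel_measurable P"
    using borel_measurable_restrict_space_iff[OF Qm] unfolding Q_def by blast
  have DlimP: "AE z in P. (\<lambda>n. D (v n) z) \<longlonglongrightarrow> D u z"
    unfolding AE_lebesgue_on_iff[OF Q_sets] using Dlim by eventually_elim simp
  have C0: "0 \<le> C" using inner_nonneg[of "v 0"] bd[of 0] by linarith
  have "(\<integral>\<^sup>+z. ennreal ((D u z)\<^sup>2) \<partial>P) = (\<integral>\<^sup>+z. liminf (\<lambda>n. ennreal ((D (v n) z)\<^sup>2)) \<partial>P)"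
  proof (rule nn_integral_cong_AE)
    show "AE z in P. ennreal ((D u z)\<^sup>2) = liminf (\<lambda>n. ennreal ((D (v n) z)\<^sup>2))"
      using DlimP
    proof eventually_elim
      case (elim z)
      have "(\<lambda>n. ennreal ((D (v n) z)\<^sup>2)) \<longlonglongrightarrow> ennreal ((D u z)\<^sup>2)"
        by (intro tendsto_ennrealI tendsto_intros elim)
      from lim_imp_Liminf[OF sequentially_bot this] show ?case by (rule sym)
    qed
  qed
  also have "\<dots> \<le> liminf (\<lambda>n. \<integral>\<^sup>+z. ennreal ((D (v n) z)\<^sup>2) \<partial>P)"
    by (rule nn_integral_liminf) simp
  also have "\<dots> \<le> liminf (\<lambda>n. ennreal C)"
  proof (intro Liminf_mono always_eventually allI)
    fix n
    have "(\<integral>\<^sup>+z. ennreal ((D (v n) z)\<^sup>2) \<partial>P) = ennreal (inner (v n) (v n))"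
      using H_D(4)[OF vn] by (subst nn_integral_eq_integral) (auto simp: sq_int_def inner_eq power2_eq_square)
    then show "(\<integral>\<^sup>+z. ennreal ((D (v n) z)\<^sup>2) \<partial>P) \<le> ennreal C" using bd by (simp add: ennreal_leI)
  qed
  also have "\<dots> = ennreal C" by (simp add: Liminf_const)
  finally have le: "(\<integral>\<^sup>+z. ennreal ((D u z)\<^sup>2) \<partial>P) \<le> ennreal C" .
  have int: "integrable P (\<lambda>z. (D u z)\<^sup>2)"
    using le by (intro integrableI_bounded) (auto simp: top_unique less_top[symmetric])
  then show "u \<in> H" using u by (auto simp: mem_H sq_int_def)
  have "ennreal (inner u u) = (\<integral>\<^sup>+z. ennreal ((D u z)\<^sup>2) \<partial>P)"
    using int by (subst nn_integral_eq_integral) (auto simp: inner_eq power2_eq_square)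
  with le have "ennreal (inner u u) \<le> ennreal C" by simp
  then show "inner u u \<le> C" using C0 by (simp only: ennreal_le_iff)
qed

lemma form_dominated_convergence:
  fixes u v :: "nat \<Rightarrow> real ^ 'n \<Rightarrow> real"
  assumes H: "\<And>n. u n \<in> H" "\<And>n. v n \<in> H" "u' \<in> H" "v' \<in> H"
    and lim: "\<And>x. (\<lambda>n. u n x) \<longlonglongrightarrow> u' x" "\<And>x. (\<lambda>n. v n x) \<longlonglongrightarrow> v' x"
    and g: "sq_int M g" "\<And>n x. \<bar>u n x\<bar> \<le> g x" "\<And>n x. \<bar>v n x\<bar> \<le> g x"
    and G: "sq_int P G" "\<And>n z. \<bar>D (u n) z\<bar> \<le> G z" "\<And>n z. \<bar>D (v n) z\<bar> \<le> G z"
  shows "(\<lambda>n. form (u n) (v n)) \<longlonglongrightarrow> form u' v'"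
proof -
  have 1: "(\<lambda>n. inner (u n) (v n)) \<longlonglongrightarrow> inner u' v'"
    unfolding inner_eq
  proof (rule integral_dominated_convergence)
    show "integrable P (\<lambda>z. G z * G z)" by (rule sq_int_mult_integrable[OF G(1) G(1)])
    show "AE z in P. (\<lambda>n. D (u n) z * D (v n) z) \<longlonglongrightarrow> D u' z * D v' z"
      unfolding D_def by (intro AE_I2 tendsto_intros lim)
    show "AE z in P. norm (D (u n) z * D (v n) z) \<le> G z * G z" for n
    proof (rule AE_I2)
      fix z
      show "norm (D (u n) z * D (v n) z) \<le> G z * G z"
        unfolding real_norm_def abs_mult by (intro mult_mono G) (use G(2)[of n z] in auto)
    qed
  qed (intro borel_measurable_times H_D(7) H)+
  obtain CV where CV: "CV \<ge> 0" "AE x in M. \<bar>V x\<bar> \<le> CV" by (rule V_bound)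
  have 2: "(\<lambda>n. \<integral>x. V x * u n x * v n x \<partial>M) \<longlonglongrightarrow> (\<integral>x. V x * u' x * v' x \<partial>M)"
  proof (rule integral_dominated_convergence)
    show "integrable M (\<lambda>x. CV * (g x * g x))" using sq_int_mult_integrable[OF g(1) g(1)] by simp
    show "AE x in M. (\<lambda>n. V x * u n x * v n x) \<longlonglongrightarrow> V x * u' x * v' x"
      by (intro AE_I2 tendsto_intros lim)
    show "AE x in M. norm (V x * u n x * v n x) \<le> CV * (g x * g x)" for n
      using CV(2)
    proof eventually_elim
      fix x assume "\<bar>V x\<bar> \<le> CV"
      then show "norm (V x * u n x * v n x) \<le> CV * (g x * g x)"
        unfolding real_norm_def abs_mult mult.assoc
        by (intro mult_mono g) (use g(2)[of n x] CV(1) in auto)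
    qed
  qed (use H_D(5) H in auto)
  show ?thesis unfolding form_def by (intro tendsto_add 1 2)
qed

text \<open>
  Two nonnegative functions with disjoint supports interact negatively through the kernel. Since
  the kernel is everywhere positive, the interaction vanishes only if one of them does. This
  takes the part of a strong maximum principle in all that follows.
\<close>

lemma inner_disjoint_nonneg:
  assumes u: "u \<in> H" and v: "v \<in> H"
    and nn: "AE x in lebesgue. 0 \<le> u x" "AE x in lebesgue. 0 \<le> v x"
    and dis: "AE x in lebesgue. u x * v x = 0"
  shows "inner u v \<le> 0" and "inner u v = 0 \<Longrightarrow> ae_zero u \<or> ae_zero v"
proof -
  have "AE x in lebesgue. 0 \<le> u x \<and> 0 \<le> v x \<and> u x * v x = 0 \<and> (x \<notin> \<Omega> \<longrightarrow> u x = 0 \<and> v x = 0)"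
    using nn dis H_D(2)[OF u] H_D(2)[OF v] by eventually_elim auto
  from AE_lebesgue_fst_snd[OF this]
  have ae: "AE z in lebesgue. 0 \<le> u (fst z) * v (snd z) \<and> 0 \<le> u (snd z) * v (fst z) \<and>
      - (D u z * D v z) = (u (fst z) * v (snd z) + u (snd z) * v (fst z)) * K (fst z - snd z)
      \<and> (z \<notin> Q_set \<Omega> \<longrightarrow> u (fst z) = 0) \<and> u (fst z) * v (fst z) = 0"
  proof eventually_elim
    case (elim z)
    have "(u (fst z) - u (snd z)) * (v (fst z) - v (snd z))
        = u (fst z) * v (fst z) + u (snd z) * v (snd z) - (u (fst z) * v (snd z) + u (snd z) * v (fst z))"
      by (simp add: algebra_simps)
    also have "\<dots> = - (u (fst z) * v (snd z) + u (snd z) * v (fst z))"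
      using elim by linarith
    finally have "- (D u z * D v z) = (u (fst z) * v (snd z) + u (snd z) * v (fst z)) * K (fst z - snd z)"
      by (simp only: D_mult mult_minus_left minus_minus)
    moreover have "z \<notin> Q_set \<Omega> \<longrightarrow> fst z \<notin> \<Omega>" by (auto simp: Q_set_def)
    ultimately show ?case using elim by (blast intro: mult_nonneg_nonneg)
  qed
  have ae2: "AE z in P. 0 \<le> - (D u z * D v z)"
    unfolding AE_lebesgue_on_iff[OF Q_sets] using ae
  proof eventually_elim
    case (elim z)
    show ?case
    proof (cases "fst z = snd z")
      case False
      then have k: "0 \<le> K (fst z - snd z)" using K_pos[of "fst z - snd z"] by simp
      have "0 \<le> u (fst z) * v (snd z) + u (snd z) * v (fst z)" using elim by linarith
      from mult_nonneg_nonneg[OF this k] show ?thesis using elim by argo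
    qed (simp add: D_def)
  qed
  have "0 \<le> (\<integral>z. - (D u z * D v z) \<partial>P)" by (rule integral_nonneg_AE[OF ae2])
  then show "inner u v \<le> 0" by (simp add: inner_eq)
  assume "inner u v = 0"
  then have "(\<integral>z. - (D u z * D v z) \<partial>P) = 0" by (simp add: inner_eq)
  then have "AE z in P. - (D u z * D v z) = 0"
    using D_int[OF u v] ae2 by (subst (asm) integral_nonneg_eq_0_iff_AE) auto
  then have "AE z in lebesgue. z \<in> Q_set \<Omega> \<longrightarrow> D u z * D v z = 0"
    by (simp add: AE_lebesgue_on_iff)
  with ae have "AE z in lebesgue. u (fst z) * v (snd z) = 0"
  proof eventually_elim
    case (elim z)
    show ?case
    proof (cases "fst z = snd z")
      case False
      then have k: "K (fst z - snd z) > 0" using K_pos by simp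
      show ?thesis
      proof (cases "z \<in> Q_set \<Omega>")
        case True
        then have "(u (fst z) * v (snd z) + u (snd z) * v (fst z)) * K (fst z - snd z) = 0"
          using elim by argo
        then have "u (fst z) * v (snd z) + u (snd z) * v (fst z) = 0" using k by simp
        then show ?thesis using elim by linarith
      next
        case False
        then have "u (fst z) = 0" using elim by blast
        then show ?thesis by simp
      qed
    next
      case True
      moreover have "u (fst z) * v (fst z) = 0" using elim by blast
      ultimately show ?thesis by simp
    qed
  qed
  then have "AE z in (lborel \<Otimes>\<^sub>M lborel). u (fst z) * v (snd z) = 0"
    unfolding AE_completion_iff lborel_prod .
  then have "AE x in lborel. AE y in lborel. u (fst (x, y)) * v (snd (x, y)) = 0"
    by (rule lborel_pair.AE_pair)
  then have *: "AE x in lborel. AE y in lborel. u x * v y = 0" by simp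
  show "ae_zero u \<or> ae_zero v"
  proof (rule disjCI)
    assume nv: "\<not> ae_zero v"
    from * have "AE x in lborel. u x = 0"
    proof eventually_elim
      case (elim x)
      show ?case
      proof (rule ccontr)
        assume "u x \<noteq> 0"
        with elim have "AE y in lborel. v y = 0" by simp
        with nv show False by (simp add: ae_zero_def AE_completion_iff)
      qed
    qed
    then show "ae_zero u" by (simp add: ae_zero_def AE_completion_iff)
  qed
qed

end

section \<open>Fractional Poincare and Sobolev inequalities\<close>

definition gagliardo :: "real \<Rightarrow> ('a::euclidean_space \<Rightarrow> real) \<Rightarrow> ennreal" where
  "gagliardo b f = (\<integral>\<^sup>+x. \<integral>\<^sup>+y. ennreal ((f x - f y)\<^sup>2 * norm (x - y) powr (- b)) \<partial>lborel \<partial>lborel)"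

text \<open>
  Let \<open>m\<close> bound the measure of \<open>{\<bar>f\<bar> > t}\<close>. A point where \<open>\<bar>f\<bar> > 2t\<close> sees, in the ball of measure
  \<open>2 m\<close> around it, at least the measure \<open>m\<close> of points where \<open>\<bar>f\<bar> \<le> t\<close>, and the values of \<open>f\<close> at
  these differ from its own by at least half of it.
  This one estimate yields both the Poincare inequality (level \<open>t = 0\<close>) and a gain of
  integrability (large \<open>t\<close>).
\<close>

lemma gagliardo_superlevel_bound:
  fixes f :: "'a::euclidean_space \<Rightarrow> real"
  assumes f[measurable]: "f \<in> borel_measurable borel" and t: "0 \<le> t" and m: "0 < m" and b: "0 < b" and r: "0 < r"
    and ball: "\<And>x::'a. emeasure lborel (ball x r) = ennreal (2 * m)"
    and A: "emeasure lborel {x. t < \<bar>f x\<bar>} \<le> ennreal m"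
  shows "ennreal (m * r powr (- b) / 4) * (\<integral>\<^sup>+x. ennreal ((f x)\<^sup>2) * indicator {x. 2 * t < \<bar>f x\<bar>} x \<partial>lborel)
    \<le> gagliardo b f"
proof -
  define A where "A = {x. t < \<bar>f x\<bar>}"
  have [measurable]: "A \<in> sets borel" unfolding A_def by measurable
  have pt: "ennreal (m * r powr (- b) / 4) * (ennreal ((f x)\<^sup>2) * indicator {x. 2 * t < \<bar>f x\<bar>} x)
     \<le> (\<integral>\<^sup>+y. ennreal ((f x - f y)\<^sup>2 * norm (x - y) powr (- b)) \<partial>lborel)" for x
  proof (cases "2 * t < \<bar>f x\<bar>")
    case True
    have "emeasure lborel (ball x r) \<le> emeasure lborel (ball x r - A) + emeasure lborel A"
    proof -
      have "emeasure lborel (ball x r) \<le> emeasure lborel ((ball x r - A) \<union> A)" by (rule emeasure_mono) auto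
      also have "\<dots> \<le> emeasure lborel (ball x r - A) + emeasure lborel A" by (rule emeasure_subadditive) auto
      finally show ?thesis .
    qed
    also have "\<dots> \<le> emeasure lborel (ball x r - A) + ennreal m" using A by (simp add: A_def)
    finally have "ennreal m + ennreal m \<le> emeasure lborel (ball x r - A) + ennreal m"
      using ball[of x] m by (simp add: ennreal_plus[symmetric] del: ennreal_plus)
    then have ms: "ennreal m \<le> emeasure lborel (ball x r - A)" by (simp add: add.commute)
    have "ennreal (m * r powr (- b) / 4) * (ennreal ((f x)\<^sup>2) * indicator {x. 2 * t < \<bar>f x\<bar>} x)
       = ennreal ((f x)\<^sup>2 / 4 * r powr (- b)) * ennreal m"
      using True m by (simp flip: ennreal_mult add: mult_ac)
    also have "\<dots> \<le> ennreal ((f x)\<^sup>2 / 4 * r powr (- b)) * emeasure lborel (ball x r - A)"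
      by (rule mult_left_mono[OF ms]) simp
    also have "\<dots> = (\<integral>\<^sup>+y. ennreal ((f x)\<^sup>2 / 4 * r powr (- b)) * indicator (ball x r - A) y \<partial>lborel)"
      by (simp add: nn_integral_cmult_indicator)
    also have "\<dots> \<le> (\<integral>\<^sup>+y. ennreal ((f x - f y)\<^sup>2 * norm (x - y) powr (- b)) \<partial>lborel)"
    proof (rule nn_integral_mono)
      fix y
      show "ennreal ((f x)\<^sup>2 / 4 * r powr (- b)) * indicator (ball x r - A) y
         \<le> ennreal ((f x - f y)\<^sup>2 * norm (x - y) powr (- b))"
      proof (cases "y \<in> ball x r - A")
        case y: True
        then have fy: "\<bar>f y\<bar> \<le> t" and d: "norm (x - y) < r" by (auto simp: A_def dist_norm)
        have xy: "x \<noteq> y" using fy True t by auto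
        have "\<bar>f x\<bar> / 2 \<le> \<bar>f x - f y\<bar>" using fy True t by linarith
        then have "(\<bar>f x\<bar> / 2)\<^sup>2 \<le> \<bar>f x - f y\<bar>\<^sup>2" by (intro power_mono) auto
        then have "(f x)\<^sup>2 / 4 \<le> (f x - f y)\<^sup>2" by (simp add: power_divide)
        moreover have "r powr (- b) \<le> norm (x - y) powr (- b)"
          using xy d b by (intro powr_mono2') auto
        ultimately have "(f x)\<^sup>2 / 4 * r powr (- b) \<le> (f x - f y)\<^sup>2 * norm (x - y) powr (- b)"
          by (intro mult_mono) auto
        then show ?thesis using y by (simp add: ennreal_leI)
      qed simp
    qed
    finally show ?thesis .
  qed simp
  have "ennreal (m * r powr (- b) / 4) * (\<integral>\<^sup>+x. ennreal ((f x)\<^sup>2) * indicator {x. 2 * t < \<bar>f x\<bar>} x \<partial>lborel)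
     = (\<integral>\<^sup>+x. ennreal (m * r powr (- b) / 4) * (ennreal ((f x)\<^sup>2) * indicator {x. 2 * t < \<bar>f x\<bar>} x) \<partial>lborel)"
    by (rule nn_integral_cmult[symmetric]) measurable
  also have "\<dots> \<le> gagliardo b f" unfolding gagliardo_def by (rule nn_integral_mono) (rule pt)
  finally show ?thesis .
qed

lemma emeasure_ball_eq:
  fixes x :: "'a::euclidean_space"
  assumes "0 < m"
  defines "w \<equiv> measure lborel (ball (0::'a) 1)"
  shows "emeasure lborel (ball x ((2 * m / w) powr (1 / DIM('a)))) = ennreal (2 * m)"
proof -
  have w: "w > 0" unfolding w_def by (rule content_ball_pos) simp
  have "emeasure lborel (ball x ((2 * m / w) powr (1 / DIM('a))))
      = ennreal (measure lborel (ball x ((2 * m / w) powr (1 / DIM('a)))))"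
    by (intro emeasure_eq_ennreal_measure less_imp_neq emeasure_lborel_ball_finite[unfolded infinity_ennreal_def])
  also have "measure lborel (ball x ((2 * m / w) powr (1 / DIM('a)))) = ((2 * m / w) powr (1 / DIM('a))) ^ DIM('a) * w"
    unfolding w_def by (rule content_ball_conv_unit_ball) simp
  also have "((2 * m / w) powr (1 / DIM('a))) ^ DIM('a) = 2 * m / w"
    using w assms(1) by (simp add: powr_realpow[symmetric] powr_powr)
  finally show ?thesis using w by simp
qed

text \<open>
  The radius is the one for which the ball has measure \<open>2 m\<close>.
\<close>

lemma gagliardo_superlevel_decay:
  fixes f :: "'a::euclidean_space \<Rightarrow> real"
  assumes f: "f \<in> borel_measurable borel" and t: "0 \<le> t" and m: "0 < m" and b: "0 < b"
    and A: "emeasure lborel {x. t < \<bar>f x\<bar>} \<le> ennreal m"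
  defines "w \<equiv> measure lborel (ball (0::'a) 1)"
  shows "(\<integral>\<^sup>+x. ennreal ((f x)\<^sup>2) * indicator {x. 2 * t < \<bar>f x\<bar>} x \<partial>lborel)
    \<le> ennreal (4 * (2 / w) powr (b / DIM('a)) * m powr (b / DIM('a) - 1)) * gagliardo b f"
proof -
  have w: "w > 0" unfolding w_def by (rule content_ball_pos) simp
  define r where "r = (2 * m / w) powr (1 / DIM('a))"
  have r: "r > 0" using w m by (simp add: r_def)
  define I where "I = (\<integral>\<^sup>+x. ennreal ((f x)\<^sup>2) * indicator {x. 2 * t < \<bar>f x\<bar>} x \<partial>lborel)"
  have le: "ennreal (m * r powr (- b) / 4) * I \<le> gagliardo b f"
    unfolding I_def
    by (rule gagliardo_superlevel_bound[OF f t m b r _ A])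
       (use emeasure_ball_eq[OF m] in \<open>simp add: r_def w_def\<close>)
  have c: "4 * (2 / w) powr (b / DIM('a)) * m powr (b / DIM('a) - 1) = 4 * r powr b / m"
    using w m by (simp add: r_def powr_powr powr_diff powr_mult powr_divide)
  have "I = ennreal (4 * r powr b / m) * (ennreal (m * r powr (- b) / 4) * I)"
    using m r by (simp add: mult.assoc[symmetric] ennreal_mult[symmetric] powr_minus divide_simps)
  also have "\<dots> \<le> ennreal (4 * r powr b / m) * gagliardo b f" by (rule mult_left_mono[OF le]) simp
  finally show ?thesis unfolding c I_def .
qed

text \<open>
  By Chebyshev's inequality the set \<open>{\<bar>f\<bar> > t}\<close> has measure at most \<open>C0 / t\<^sup>2\<close>, so the mass of
  \<open>f\<^sup>2\<close> above level \<open>t\<close> decays like \<open>t\<close> to the power \<open>- 2 k\<close>. Summing over dyadic levels leaves a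
  geometric series for the exponent \<open>2 + k\<close>.
\<close>

lemma gagliardo_higher_integrability:
  fixes C0 s :: real
  assumes C0: "0 < C0" and s: "0 < s"
  defines "N \<equiv> real DIM('a::euclidean_space)"
  defines "k \<equiv> 2 * s / N"
  obtains C where "0 \<le> C" "\<And>f :: 'a \<Rightarrow> real. f \<in> borel_measurable borel \<Longrightarrow> gagliardo (N + 2 * s) f \<le> 1 \<Longrightarrow>
      (\<integral>\<^sup>+x. ennreal ((f x)\<^sup>2) \<partial>lborel) \<le> ennreal C0 \<Longrightarrow>
      (\<integral>\<^sup>+x. ennreal (\<bar>f x\<bar> powr (2 + k)) \<partial>lborel) \<le> ennreal C"
proof -
  have N: "N > 0" by (simp add: N_def)
  have k: "k > 0" using s N by (simp add: k_def)
  define w where "w = measure lborel (ball (0::'a) 1)"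
  have w: "w > 0" unfolding w_def by (rule content_ball_pos) simp
  define B where "B = 4 * (2 / w) powr (1 + k) * C0 powr k"
  have B: "B \<ge> 0" by (simp add: B_def)
  define q where "q = (1/2) powr k"
  have q: "0 < q" "q < 1" using k powr_less_mono2[of k "1/2" 1] by (auto simp: q_def)
  define E where "E j = 2 powr k * 4 powr k * B * q ^ j" for j :: nat
  have E: "E j \<ge> 0" for j using B q by (simp add: E_def)
  have sE: "summable E" unfolding E_def using q by (intro summable_mult summable_geometric) simp
  define C where "C = C0 + (\<Sum>j. E j)"
  have "0 \<le> C" using C0 suminf_nonneg[OF sE E] by (simp add: C_def)
  moreover have "(\<integral>\<^sup>+x. ennreal (\<bar>f x\<bar> powr (2 + k)) \<partial>lborel) \<le> ennreal C"
    if f[measurable]: "f \<in> borel_measurable borel" and G: "gagliardo (N + 2 * s) f \<le> 1"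
      and L: "(\<integral>\<^sup>+x. ennreal ((f x)\<^sup>2) \<partial>lborel) \<le> ennreal C0" for f :: "'a \<Rightarrow> real"
  proof -
    have decay: "(\<integral>\<^sup>+x. ennreal ((f x)\<^sup>2) * indicator {x. 2 * t < \<bar>f x\<bar>} x \<partial>lborel) \<le> ennreal (B * t powr (- 2 * k))"
      if t: "0 < t" for t
    proof -
      have "ennreal (t\<^sup>2) * emeasure lborel {x. t < \<bar>f x\<bar>} = (\<integral>\<^sup>+x. ennreal (t\<^sup>2) * indicator {x. t < \<bar>f x\<bar>} x \<partial>lborel)"
        by (simp add: nn_integral_cmult_indicator)
      also have "\<dots> \<le> (\<integral>\<^sup>+x. ennreal ((f x)\<^sup>2) \<partial>lborel)"
      proof (rule nn_integral_mono)
        fix x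
        show "ennreal (t\<^sup>2) * indicator {x. t < \<bar>f x\<bar>} x \<le> ennreal ((f x)\<^sup>2)"
        proof (cases "t < \<bar>f x\<bar>")
          case True
          then have "t\<^sup>2 \<le> \<bar>f x\<bar>\<^sup>2" using t by (intro power_mono) auto
          then show ?thesis using True by (simp add: ennreal_leI)
        qed simp
      qed
      also have "\<dots> \<le> ennreal C0" by (rule L)
      finally have *: "ennreal (t\<^sup>2) * emeasure lborel {x. t < \<bar>f x\<bar>} \<le> ennreal C0" .
      have "emeasure lborel {x. t < \<bar>f x\<bar>} = ennreal (1 / t\<^sup>2) * (ennreal (t\<^sup>2) * emeasure lborel {x. t < \<bar>f x\<bar>})"
        using t by (simp add: mult.assoc[symmetric] ennreal_mult[symmetric])
      also have "\<dots> \<le> ennreal (1 / t\<^sup>2) * ennreal C0" by (rule mult_left_mono[OF *]) simp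
      also have "\<dots> = ennreal (C0 / t\<^sup>2)" using C0 by (simp flip: ennreal_mult)
      finally have A: "emeasure lborel {x. t < \<bar>f x\<bar>} \<le> ennreal (C0 / t\<^sup>2)" .
      have "(\<integral>\<^sup>+x. ennreal ((f x)\<^sup>2) * indicator {x. 2 * t < \<bar>f x\<bar>} x \<partial>lborel)
         \<le> ennreal (4 * (2 / w) powr ((N + 2 * s) / N) * (C0 / t\<^sup>2) powr ((N + 2 * s) / N - 1)) * gagliardo (N + 2 * s) f"
        unfolding N_def w_def
        by (rule gagliardo_superlevel_decay[OF f _ _ _ A]) (use t C0 s in \<open>auto intro: add_pos_pos\<close>)
      also have "\<dots> \<le> ennreal (4 * (2 / w) powr ((N + 2 * s) / N) * (C0 / t\<^sup>2) powr ((N + 2 * s) / N - 1)) * 1"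
        by (rule mult_left_mono[OF G]) simp
      also have "(N + 2 * s) / N = 1 + k" using N by (simp add: k_def field_simps)
      also have "(C0 / t\<^sup>2) powr (1 + k - 1) = C0 powr k * t powr (- 2 * k)"
      proof -
        have "(t\<^sup>2) powr k = t powr (2 * k)" using powr_powr[of t 2 k] t by simp
        then show ?thesis using t C0 by (simp add: powr_divide powr_minus divide_simps)
      qed
      finally show ?thesis by (simp add: B_def mult.assoc)
    qed
    have pt: "ennreal (\<bar>f x\<bar> powr (2 + k)) \<le> ennreal ((f x)\<^sup>2) +
        (\<Sum>j. ennreal ((2 * 2^j) powr k) * (ennreal ((f x)\<^sup>2) * indicator {x. 2 * (2^j / 2) < \<bar>f x\<bar>} x))" for x
    proof (cases "\<bar>f x\<bar> \<le> 1")
      case True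
      then have "\<bar>f x\<bar> powr (2 + k) \<le> \<bar>f x\<bar> powr 2" using k by (intro powr_mono') auto
      also have "\<dots> = (f x)\<^sup>2" by simp
      finally show ?thesis by (intro add_increasing2) (auto simp: ennreal_leI)
    next
      case False
      define y where "y = \<bar>f x\<bar>"
      have y1: "y > 1" using False by (simp add: y_def)
      obtain n0 where n0: "y < 2^n0" using real_arch_pow[of 2 y] by auto
      define n where "n = (LEAST n. y \<le> 2 * 2^n)"
      have n: "y \<le> 2 * 2^n" unfolding n_def
      proof (rule LeastI[of _ n0])
        have "(0::real) < 2^n0" by simp
        then show "y \<le> 2 * 2^n0" using n0 by linarith
      qed
      have n': "2^n < y"
      proof (cases n)
        case 0 then show ?thesis using y1 by simp
      next
        case (Suc i)
        then have "\<not> y \<le> 2 * 2^i" using not_less_Least[of i "\<lambda>n. y \<le> 2 * 2^n"] by (simp add: n_def)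
        then show ?thesis using Suc by simp
      qed
      have "\<bar>f x\<bar> powr (2 + k) = y powr k * (f x)\<^sup>2" using y1 by (simp add: y_def powr_add)
      also have "\<dots> \<le> (2 * 2^n) powr k * (f x)\<^sup>2" using n k y1 by (intro mult_right_mono powr_mono2) auto
      finally have "ennreal (\<bar>f x\<bar> powr (2 + k)) \<le> ennreal ((2 * 2^n) powr k) * (ennreal ((f x)\<^sup>2) * indicator {x. 2 * (2^n / 2) < \<bar>f x\<bar>} x)"
        using n' by (simp add: y_def ennreal_leI flip: ennreal_mult)
      also have "\<dots> \<le> (\<Sum>j. ennreal ((2 * 2^j) powr k) * (ennreal ((f x)\<^sup>2) * indicator {x. 2 * (2^j / 2) < \<bar>f x\<bar>} x))"
        using sum_le_suminf[of "\<lambda>j. ennreal ((2 * 2^j) powr k) * (ennreal ((f x)\<^sup>2) * indicator {x. 2 * (2^j / 2) < \<bar>f x\<bar>} x)" "{n}"]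
        by simp
      finally show ?thesis by (intro add_increasing) auto
    qed
    have term_le: "ennreal ((2 * 2^j) powr k) * (\<integral>\<^sup>+x. (ennreal ((f x)\<^sup>2) * indicator {x. 2 * (2^j / 2) < \<bar>f x\<bar>} x) \<partial>lborel) \<le> ennreal (E j)" for j :: nat
    proof -
      have "ennreal ((2 * 2^j) powr k) * (\<integral>\<^sup>+x. (ennreal ((f x)\<^sup>2) * indicator {x. 2 * (2^j / 2) < \<bar>f x\<bar>} x) \<partial>lborel)
         \<le> ennreal ((2 * 2^j) powr k) * ennreal (B * (2^j / 2) powr (- 2 * k))"
        by (intro mult_left_mono decay) auto
      also have "\<dots> = ennreal ((2 * 2^j) powr k * (B * (2^j / 2) powr (- 2 * k)))"
        using B by (simp flip: ennreal_mult)
      also have "(2 * 2^j) powr k * (B * (2^j / 2) powr (- 2 * k)) = E j"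
      proof -
        have j: "(2::real)^j = 2 powr real j" by (simp add: powr_realpow)
        have "q ^ j = 2 powr (- (real j * k))"
        proof -
          have "q = 2 powr (- k)" by (simp add: q_def powr_divide powr_minus divide_simps)
          then have "q ^ j = (2 powr (- k)) powr real j" by (simp add: powr_realpow)
          then show ?thesis by (simp only: powr_powr mult_minus_left mult.commute[of k])
        qed
        moreover have "(2 * 2^j) powr k = 2 powr k * 2 powr (real j * k)"
          by (simp add: j powr_mult powr_powr)
        moreover have "(2^j / 2) powr (- 2 * k) = 2 powr (- 2 * (real j * k)) * 4 powr k"
        proof -
          have 4: "(4::real) powr k = 2 powr (2 * k)" using powr_powr[of 2 2 k] by simp
          have "(2::real)^j / 2 = 2 powr (real j - 1)" by (simp add: j powr_diff)
          then show ?thesis by (simp add: powr_powr 4 flip: powr_add) (simp add: algebra_simps)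
        qed
        moreover have "2 powr (real j * k) * 2 powr (- 2 * (real j * k)) = 2 powr (- (real j * k))"
          unfolding powr_add[symmetric] by (rule arg_cong[where f="\<lambda>x. 2 powr x"]) simp
        ultimately show ?thesis by (simp add: E_def mult_ac)
      qed
      finally show ?thesis .
    qed
    have "(\<integral>\<^sup>+x. ennreal (\<bar>f x\<bar> powr (2 + k)) \<partial>lborel) \<le> (\<integral>\<^sup>+x. ennreal ((f x)\<^sup>2) +
        (\<Sum>j. ennreal ((2 * 2^j) powr k) * (ennreal ((f x)\<^sup>2) * indicator {x. 2 * (2^j / 2) < \<bar>f x\<bar>} x)) \<partial>lborel)"
      by (rule nn_integral_mono) (rule pt)
    also have "\<dots> = (\<integral>\<^sup>+x. ennreal ((f x)\<^sup>2) \<partial>lborel) +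
        (\<Sum>j. ennreal ((2 * 2^j) powr k) * (\<integral>\<^sup>+x. (ennreal ((f x)\<^sup>2) * indicator {x. 2 * (2^j / 2) < \<bar>f x\<bar>} x) \<partial>lborel))"
      by (subst nn_integral_add) (auto simp: nn_integral_suminf nn_integral_cmult)
    also have "\<dots> \<le> ennreal C0 + (\<Sum>j. ennreal (E j))"
      by (intro add_mono L suminf_le term_le) auto
    also have "\<dots> = ennreal C" using C0 suminf_nonneg[OF sE E]
      by (simp add: C_def suminf_ennreal2[OF E sE])
    finally show ?thesis .
  qed
  ultimately show ?thesis by (rule that)
qed

section \<open>Compactness of the embedding into the square-integrable functions\<close>

text \<open>
  On a set of small diameter the variance of \<open>f\<close> is a double integral of \<open>(f x - f y)\<^sup>2\<close>, which
  the Gagliardo weight dominates with a small constant. What remains is the mean of \<open>f\<close>.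
\<close>

lemma variance_le_gagliardo_cell:
  fixes f :: "'a::euclidean_space \<Rightarrow> real"
  assumes f[measurable]: "f \<in> borel_measurable borel" and f2: "integrable lborel (\<lambda>x. (f x)\<^sup>2)"
    and C[measurable]: "C \<in> sets borel" and m: "emeasure lborel C = ennreal m" "0 \<le> m"
    and b: "0 < b" and d: "\<And>x y. x \<in> C \<Longrightarrow> y \<in> C \<Longrightarrow> norm (x - y) \<le> d"
  shows "ennreal (2 * m * (\<integral>x. indicator C x * (f x)\<^sup>2 \<partial>lborel))
    \<le> ennreal (d powr b) * (\<integral>\<^sup>+x. \<integral>\<^sup>+y. indicator C x * indicator C y * ennreal ((f x - f y)\<^sup>2 * norm (x - y) powr (- b)) \<partial>lborel \<partial>lborel)
       + ennreal (2 * (\<integral>x. indicator C x * f x \<partial>lborel)\<^sup>2)"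
proof -
  define I J where "I = (\<integral>x. indicator C x * f x \<partial>lborel)" and "J = (\<integral>x. indicator C x * (f x)\<^sup>2 \<partial>lborel)"
  have iC: "integrable lborel (\<lambda>x. indicator C x :: real)" using m by (simp add: integrable_indicator_iff)
  have mC: "(\<integral>x. (indicator C x :: real) \<partial>lborel) = m" using m by (simp add: measure_def)
  have "(\<lambda>x. (indicator C x)\<^sup>2) = (indicator C :: _ \<Rightarrow> real)" by (auto simp: indicator_def fun_eq_iff)
  then have sC: "sq_int lborel (\<lambda>x. indicator C x :: real)" using iC by (simp add: sq_int_def)
  have sf: "sq_int lborel f" using f2 by (simp add: sq_int_def)
  have if': "integrable lborel (\<lambda>x. indicator C x * f x)" by (rule sq_int_mult_integrable[OF sC sf])
  have if2: "integrable lborel (\<lambda>x. indicator C x * (f x)\<^sup>2)"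
    using integrable_mult_indicator[OF _ f2, of C] by simp
  have inner: "(\<integral>\<^sup>+y. indicator C y * ennreal ((f x - f y)\<^sup>2) \<partial>lborel) = ennreal (m * (f x)\<^sup>2 - 2 * f x * I + J)" for x
  proof -
    have "(\<integral>\<^sup>+y. indicator C y * ennreal ((f x - f y)\<^sup>2) \<partial>lborel)
      = (\<integral>\<^sup>+y. ennreal ((f x)\<^sup>2 * indicator C y - 2 * f x * (indicator C y * f y) + indicator C y * (f y)\<^sup>2) \<partial>lborel)"
      by (rule nn_integral_cong) (auto simp: indicator_def power2_diff intro!: arg_cong[where f=ennreal])
    also have "\<dots> = ennreal (\<integral>y. (f x)\<^sup>2 * indicator C y - 2 * f x * (indicator C y * f y) + indicator C y * (f y)\<^sup>2 \<partial>lborel)"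
    proof (rule nn_integral_eq_integral)
      have "0 \<le> (f x)\<^sup>2 * indicator C y - 2 * f x * (indicator C y * f y) + indicator C y * (f y)\<^sup>2" for y
        using zero_le_power2[of "f x - f y"] by (auto simp: indicator_def power2_diff)
      then show "AE y in lborel. 0 \<le> (f x)\<^sup>2 * indicator C y - 2 * f x * (indicator C y * f y) + indicator C y * (f y)\<^sup>2"
        by simp
    qed (use iC if' if2 in auto)
    also have "(\<integral>y. (f x)\<^sup>2 * indicator C y - 2 * f x * (indicator C y * f y) + indicator C y * (f y)\<^sup>2 \<partial>lborel)
       = m * (f x)\<^sup>2 - 2 * f x * I + J"
      using iC if' if2 mC by (simp add: I_def J_def)
    finally show ?thesis .
  qed
  have nn: "0 \<le> m * (f x)\<^sup>2 - 2 * f x * I + J" for x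
  proof -
    have "0 \<le> (\<integral>y. (f x)\<^sup>2 * indicator C y - 2 * f x * (indicator C y * f y) + indicator C y * (f y)\<^sup>2 \<partial>lborel)"
    proof (rule Bochner_Integration.integral_nonneg)
      fix y show "0 \<le> (f x)\<^sup>2 * indicator C y - 2 * f x * (indicator C y * f y) + indicator C y * (f y)\<^sup>2"
        using zero_le_power2[of "f x - f y"] by (auto simp: indicator_def power2_diff)
    qed
    also have "\<dots> = m * (f x)\<^sup>2 - 2 * f x * I + J"
      using iC if' if2 mC by (simp add: I_def J_def)
    finally show ?thesis .
  qed
  have outer: "(\<integral>\<^sup>+x. indicator C x * ennreal (m * (f x)\<^sup>2 - 2 * f x * I + J) \<partial>lborel) = ennreal (2 * m * J - 2 * I\<^sup>2)"
  proof -
    have "(\<integral>\<^sup>+x. indicator C x * ennreal (m * (f x)\<^sup>2 - 2 * f x * I + J) \<partial>lborel)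
      = (\<integral>\<^sup>+x. ennreal (m * (indicator C x * (f x)\<^sup>2) - 2 * I * (indicator C x * f x) + J * indicator C x) \<partial>lborel)"
      by (rule nn_integral_cong) (auto simp: indicator_def mult_ac)
    also have "\<dots> = ennreal (\<integral>x. m * (indicator C x * (f x)\<^sup>2) - 2 * I * (indicator C x * f x) + J * indicator C x \<partial>lborel)"
    proof (rule nn_integral_eq_integral)
      have "0 \<le> m * (indicator C x * (f x)\<^sup>2) - 2 * I * (indicator C x * f x) + J * indicator C x" for x
        using nn[of x] by (auto simp: indicator_def mult_ac)
      then show "AE x in lborel. 0 \<le> m * (indicator C x * (f x)\<^sup>2) - 2 * I * (indicator C x * f x) + J * indicator C x"
        by simp
    qed (use iC if' if2 in auto)
    also have "(\<integral>x. m * (indicator C x * (f x)\<^sup>2) - 2 * I * (indicator C x * f x) + J * indicator C x \<partial>lborel)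
      = m * J - 2 * I * I + J * m"
      using iC if' if2 mC by (simp add: I_def J_def)
    finally show ?thesis by (simp add: power2_eq_square algebra_simps)
  qed
  have "ennreal (2 * m * J - 2 * I\<^sup>2) = (\<integral>\<^sup>+x. indicator C x * (\<integral>\<^sup>+y. indicator C y * ennreal ((f x - f y)\<^sup>2) \<partial>lborel) \<partial>lborel)"
    unfolding inner outer ..
  also have "\<dots> = (\<integral>\<^sup>+x. \<integral>\<^sup>+y. indicator C x * indicator C y * ennreal ((f x - f y)\<^sup>2) \<partial>lborel \<partial>lborel)"
    by (simp add: nn_integral_cmult mult.assoc)
  also have "\<dots> \<le> (\<integral>\<^sup>+x. \<integral>\<^sup>+y. ennreal (d powr b) * (indicator C x * indicator C y * ennreal ((f x - f y)\<^sup>2 * norm (x - y) powr (- b))) \<partial>lborel \<partial>lborel)"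
  proof (intro nn_integral_mono)
    fix x y
    show "indicator C x * indicator C y * ennreal ((f x - f y)\<^sup>2)
      \<le> ennreal (d powr b) * (indicator C x * indicator C y * ennreal ((f x - f y)\<^sup>2 * norm (x - y) powr (- b)))"
    proof (cases "x \<in> C \<and> y \<in> C \<and> x \<noteq> y")
      case True
      then have n: "0 < norm (x - y)" "norm (x - y) \<le> d" using d by auto
      then have "norm (x - y) powr b \<le> d powr b" using b by (intro powr_mono2) auto
      then have "1 \<le> d powr b * norm (x - y) powr (- b)" using n by (simp add: powr_minus field_simps)
      from mult_left_mono[OF this, of "(f x - f y)\<^sup>2"]
      have "(f x - f y)\<^sup>2 \<le> d powr b * ((f x - f y)\<^sup>2 * norm (x - y) powr (- b))" by (simp add: mult_ac)
      then show ?thesis using True by (simp add: ennreal_leI flip: ennreal_mult)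
    qed auto
  qed
  also have "\<dots> = ennreal (d powr b) * (\<integral>\<^sup>+x. \<integral>\<^sup>+y. indicator C x * indicator C y * ennreal ((f x - f y)\<^sup>2 * norm (x - y) powr (- b)) \<partial>lborel \<partial>lborel)"
    by (simp add: nn_integral_cmult)
  finally have *: "ennreal (2 * m * J - 2 * I\<^sup>2) \<le> \<dots>" .
  have "ennreal (2 * m * J) = ennreal ((2 * m * J - 2 * I\<^sup>2) + 2 * I\<^sup>2)" by simp
  also have "\<dots> \<le> ennreal (2 * m * J - 2 * I\<^sup>2) + ennreal (2 * I\<^sup>2)"
    by (cases "2 * m * J - 2 * I\<^sup>2 \<ge> 0") (auto simp: ennreal_neg intro: ennreal_leI simp flip: ennreal_plus)
  also have "\<dots> \<le> ennreal (d powr b) * (\<integral>\<^sup>+x. \<integral>\<^sup>+y. indicator C x * indicator C y * ennreal ((f x - f y)\<^sup>2 * norm (x - y) powr (- b)) \<partial>lborel \<partial>lborel) + ennreal (2 * I\<^sup>2)"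
    by (intro add_right_mono *)
  finally show ?thesis unfolding I_def J_def .
qed

text \<open>
  The cells of the cubic grid of side \<open>h\<close> are the fibres of this map.
\<close>

definition grid_index :: "real \<Rightarrow> real ^ 'n \<Rightarrow> int ^ 'n" where
  "grid_index h x = (\<chi> i. \<lfloor>x $ i / h\<rfloor>)"

lemma finite_grid_index:
  fixes S :: "(real ^ 'n) set"
  assumes "bounded S" "h > 0"
  shows "finite (grid_index h ` S)"
proof -
  obtain R where R: "\<And>x. x \<in> S \<Longrightarrow> norm x \<le> R" using assms(1) by (auto simp: bounded_iff)
  have "grid_index h ` S \<subseteq> (\<lambda>g. \<chi> i. g i) ` (UNIV \<rightarrow>\<^sub>E {- \<lceil>R / h\<rceil>..\<lceil>R / h\<rceil>})"
  proof
    fix j assume "j \<in> grid_index h ` S"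
    then obtain x where x: "x \<in> S" "j = grid_index h x" by auto
    have "j $ i \<in> {- \<lceil>R / h\<rceil>..\<lceil>R / h\<rceil>}" for i
    proof -
      have "\<bar>x $ i\<bar> \<le> R" using component_le_norm_cart[of x i] R[OF x(1)] by linarith
      then have "- (R / h) \<le> x $ i / h" "x $ i / h \<le> R / h" using assms(2) by (auto simp: field_simps)
      then have "\<lfloor>- (R / h)\<rfloor> \<le> \<lfloor>x $ i / h\<rfloor>" "\<lfloor>x $ i / h\<rfloor> \<le> \<lceil>R / h\<rceil>"
        by (auto intro: floor_mono) (linarith)
      then show ?thesis using x(2) by (simp add: grid_index_def floor_minus)
    qed
    then show "j \<in> (\<lambda>g. \<chi> i. g i) ` (UNIV \<rightarrow>\<^sub>E {- \<lceil>R / h\<rceil>..\<lceil>R / h\<rceil>})"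
      by (intro image_eqI[of _ _ "\<lambda>i. j $ i"]) auto
  qed
  then show ?thesis by (rule finite_subset) (intro finite_imageI finite_PiE, auto)
qed

lemma grid_cell:
  fixes j :: "int ^ 'n"
  assumes h: "h > 0"
  defines "C \<equiv> {x :: real ^ 'n. grid_index h x = j}"
  shows "C \<in> sets borel" "h ^ CARD('n) \<le> measure lborel C"
    "emeasure lborel C = ennreal (measure lborel C)"
    "\<And>x y. x \<in> C \<Longrightarrow> y \<in> C \<Longrightarrow> norm (x - y) \<le> real CARD('n) * h"
proof -
  have C: "x \<in> C \<longleftrightarrow> (\<forall>i. h * real_of_int (j $ i) \<le> x $ i \<and> x $ i < h * (real_of_int (j $ i) + 1))" for x
    using h by (auto simp: C_def grid_index_def vec_eq_iff floor_eq_iff field_simps)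
  have Ceq: "C = {x. \<forall>i. h * real_of_int (j $ i) \<le> x $ i \<and> x $ i < h * (real_of_int (j $ i) + 1)}"
    using C by auto
  have "C = (\<Inter>i. {x. h * real_of_int (j $ i) \<le> x $ i} \<inter> {x. x $ i < h * (real_of_int (j $ i) + 1)})"
    using Ceq by auto
  also have "\<dots> \<in> sets borel"
    by (intro sets.countable_INT'' sets.Int borel_closed borel_open closed_halfspace_component_ge_cart open_halfspace_component_lt_cart)
       auto
  finally show Cm: "C \<in> sets borel" .
  define lo hi :: "real ^ 'n" where "lo = (\<chi> i. h * real_of_int (j $ i))" and "hi = (\<chi> i. h * (real_of_int (j $ i) + 1))"
  have sub: "box lo hi \<subseteq> C" "C \<subseteq> cbox lo hi"
    by (auto simp: C lo_def hi_def mem_box_cart less_imp_le)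
  have fin: "emeasure lborel C < \<infinity>"
    using emeasure_mono[OF sub(2), of lborel] emeasure_lborel_cbox_finite[of lo hi] by (simp add: order_le_less_trans)
  then show e: "emeasure lborel C = ennreal (measure lborel C)"
    by (intro emeasure_eq_ennreal_measure) auto
  have "h ^ CARD('n) = measure lborel (cbox lo hi)"
    using h by (subst content_cbox_cart) (auto simp: lo_def hi_def interval_eq_empty_cart algebra_simps not_less)
  also have "\<dots> = measure lborel (box lo hi)" by (simp add: measure_lborel_box_eq measure_lborel_cbox_eq)
  also have "\<dots> \<le> measure lborel C"
    using fin Cm by (intro measure_mono_fmeasurable sub) (auto intro: fmeasurableI)
  finally show "h ^ CARD('n) \<le> measure lborel C" .
  fix x y assume "x \<in> C" "y \<in> C"
  then have "\<bar>(x - y) $ i\<bar> \<le> h" for i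
  proof -
    have e: "h * (real_of_int (j $ i) + 1) = h * real_of_int (j $ i) + h" by (simp add: distrib_left)
    have "h * real_of_int (j $ i) \<le> x $ i \<and> x $ i < h * real_of_int (j $ i) + h"
      "h * real_of_int (j $ i) \<le> y $ i \<and> y $ i < h * real_of_int (j $ i) + h"
      using \<open>x \<in> C\<close> \<open>y \<in> C\<close> C[of x] C[of y] unfolding e[symmetric] by blast+
    then show ?thesis unfolding vector_minus_component by linarith
  qed
  then have "(\<Sum>i\<in>UNIV. \<bar>(x - y) $ i\<bar>) \<le> (\<Sum>i\<in>(UNIV::'n set). h)" by (intro sum_mono)
  then show "norm (x - y) \<le> real CARD('n) * h" using norm_le_l1_cart[of "x - y"] by simp
qed

text \<open>
  Up to a small multiple of the seminorm, the \<open>L\<^sup>2\<close> norm is controlled by finitely many averages.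
  This is the quantitative form of compactness of the embedding.
\<close>

lemma L2_le_gagliardo_plus_averages:
  fixes S :: "(real ^ 'n) set" and s :: real
  assumes S: "bounded S" and s: "0 < s" and \<eta>: "0 < \<eta>"
  obtains \<C> c where "finite \<C>" "\<C> \<subseteq> sets borel" "0 \<le> c"
    "\<And>f. f \<in> borel_measurable borel \<Longrightarrow> (\<And>x. x \<notin> S \<Longrightarrow> f x = 0) \<Longrightarrow> integrable lborel (\<lambda>x. (f x)\<^sup>2) \<Longrightarrow>
      ennreal (\<integral>x. (f x)\<^sup>2 \<partial>lborel) \<le> ennreal \<eta> * gagliardo (real CARD('n) + 2 * s) f
        + ennreal (c * (\<Sum>C\<in>\<C>. (\<integral>x. indicator C x * f x \<partial>lborel)\<^sup>2))"
proof -
  define N where "N = real CARD('n)"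
  have N: "N > 0" by (simp add: N_def)
  define b where "b = N + 2 * s"
  have b: "b > 0" using N s by (simp add: b_def)
  \<comment> \<open>The side for which the constant of the variance estimate on a cell is exactly \<open>\<eta>\<close>.\<close>
  define h where "h = (2 * \<eta> / N powr b) powr (1 / (2 * s))"
  have h: "h > 0" using \<eta> N by (simp add: h_def)
  have hs: "(N * h) powr b = 2 * \<eta> * h ^ CARD('n)"
  proof -
    have "h powr (2 * s) = 2 * \<eta> / N powr b" using s \<eta> N by (simp add: h_def powr_powr)
    then have "h powr b = h powr N * (2 * \<eta> / N powr b)" by (simp add: b_def powr_add)
    then show ?thesis using h N by (simp add: powr_mult N_def powr_realpow)
  qed
  define cell where "cell j = {x :: real ^ 'n. grid_index h x = j}" for j
  define \<J> where "\<J> = grid_index h ` S"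
  have fin: "finite \<J>" unfolding \<J>_def by (rule finite_grid_index[OF S h])
  note gc = grid_cell[where 'n='n, OF h, folded cell_def N_def]
  have [measurable]: "cell j \<in> sets borel" for j by (rule gc(1))
  have inj: "inj_on cell \<J>"
  proof (rule inj_onI)
    fix i j assume "i \<in> \<J>" "j \<in> \<J>" "cell i = cell j"
    then show "i = j" by (auto simp: \<J>_def cell_def)
  qed
  define c where "c = 1 / h ^ CARD('n)"
  have key: "ennreal (\<integral>x. (f x)\<^sup>2 \<partial>lborel) \<le> ennreal \<eta> * gagliardo b f
        + ennreal (c * (\<Sum>C\<in>cell ` \<J>. (\<integral>x. indicator C x * f x \<partial>lborel)\<^sup>2))"
    if f[measurable]: "f \<in> borel_measurable borel" and f0: "\<And>x. x \<notin> S \<Longrightarrow> f x = 0"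
      and f2: "integrable lborel (\<lambda>x. (f x)\<^sup>2)" for f
  proof -
    define I J G where "I j = (\<integral>x. indicator (cell j) x * f x \<partial>lborel)"
      and "J j = (\<integral>x. indicator (cell j) x * (f x)\<^sup>2 \<partial>lborel)"
      and "G j = (\<integral>\<^sup>+x. \<integral>\<^sup>+y. indicator (cell j) x * indicator (cell j) y * ennreal ((f x - f y)\<^sup>2 * norm (x - y) powr (- b)) \<partial>lborel \<partial>lborel)" for j
    have J0: "J j \<ge> 0" for j unfolding J_def by (rule Bochner_Integration.integral_nonneg) simp
    have Jint: "integrable lborel (\<lambda>x. indicator (cell j) x * (f x)\<^sup>2)" for j
      using integrable_mult_indicator[OF _ f2, of "cell j"] by simp
    have Jsum: "(\<integral>x. (f x)\<^sup>2 \<partial>lborel) = (\<Sum>j\<in>\<J>. J j)"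
    proof -
      have "(f x)\<^sup>2 = (\<Sum>j\<in>\<J>. indicator (cell j) x * (f x)\<^sup>2)" for x
      proof (cases "x \<in> S")
        case True
        have "(\<Sum>j\<in>\<J>. indicator (cell j) x * (f x)\<^sup>2) = (\<Sum>j\<in>\<J>. if j = grid_index h x then (f x)\<^sup>2 else 0)"
          by (rule sum.cong) (auto simp: cell_def)
        also have "\<dots> = (f x)\<^sup>2" using fin True by (subst sum.delta) (auto simp: \<J>_def)
        finally show ?thesis by simp
      qed (simp add: f0)
      then have "(\<integral>x. (f x)\<^sup>2 \<partial>lborel) = (\<integral>x. (\<Sum>j\<in>\<J>. indicator (cell j) x * (f x)\<^sup>2) \<partial>lborel)" by presburger
      also have "\<dots> = (\<Sum>j\<in>\<J>. J j)" unfolding J_def using Jint by (intro Bochner_Integration.integral_sum)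
      finally show ?thesis .
    qed
    have Gsum: "(\<Sum>j\<in>\<J>. G j) \<le> gagliardo b f"
    proof -
      have "(\<Sum>j\<in>\<J>. G j) = (\<integral>\<^sup>+x. \<integral>\<^sup>+y. (\<Sum>j\<in>\<J>. indicator (cell j) x * indicator (cell j) y * ennreal ((f x - f y)\<^sup>2 * norm (x - y) powr (- b))) \<partial>lborel \<partial>lborel)"
        unfolding G_def by (simp add: nn_integral_sum)
      also have "\<dots> \<le> gagliardo b f"
        unfolding gagliardo_def
      proof (intro nn_integral_mono)
        fix x y
        let ?e = "ennreal ((f x - f y)\<^sup>2 * norm (x - y) powr (- b))"
        have "(\<Sum>j\<in>\<J>. indicator (cell j) x * indicator (cell j) y * ?e)
           = (\<Sum>j\<in>\<J>. if j = grid_index h x then indicator (cell j) y * ?e else 0)"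
          by (rule sum.cong) (auto simp: cell_def)
        also have "\<dots> \<le> ?e" using fin by (subst sum.delta) (auto simp: indicator_def)
        finally show "(\<Sum>j\<in>\<J>. indicator (cell j) x * indicator (cell j) y * ?e) \<le> ?e" .
      qed
      finally show ?thesis .
    qed
    have cellle: "ennreal (J j) \<le> ennreal \<eta> * G j + ennreal (c * (I j)\<^sup>2)" for j
    proof -
      define m where "m = measure lborel (cell j)"
      define hN where "hN = h ^ CARD('n)"
      have hN: "hN > 0" using h by (simp add: hN_def)
      have m: "hN \<le> m" unfolding m_def hN_def by (rule gc(2))
      have v: "ennreal (2 * m * J j) \<le> ennreal ((N * h) powr b) * G j + ennreal (2 * (I j)\<^sup>2)"
        unfolding I_def J_def G_def m_def
        by (rule variance_le_gagliardo_cell[OF f f2 gc(1) gc(3) _ b gc(4)]) auto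
      have "ennreal (J j) = ennreal (1 / (2 * hN)) * ennreal (2 * hN * J j)"
        using J0 hN by (simp flip: ennreal_mult)
      also have "\<dots> \<le> ennreal (1 / (2 * hN)) * ennreal (2 * m * J j)"
        using J0 m by (intro mult_left_mono ennreal_leI mult_right_mono) auto
      also have "\<dots> \<le> ennreal (1 / (2 * hN)) * (ennreal (2 * \<eta> * hN) * G j + ennreal (2 * (I j)\<^sup>2))"
        using v unfolding hs hN_def by (intro mult_left_mono) auto
      also have "\<dots> = ennreal \<eta> * G j + ennreal (c * (I j)\<^sup>2)"
        using hN \<eta> by (simp add: distrib_left mult.assoc[symmetric] c_def hN_def[symmetric] flip: ennreal_mult)
      finally show ?thesis .
    qed
    have "ennreal (\<integral>x. (f x)\<^sup>2 \<partial>lborel) = (\<Sum>j\<in>\<J>. ennreal (J j))"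
      unfolding Jsum using J0 by (simp add: sum_ennreal)
    also have "\<dots> \<le> (\<Sum>j\<in>\<J>. ennreal \<eta> * G j + ennreal (c * (I j)\<^sup>2))" by (rule sum_mono) (rule cellle)
    also have "\<dots> = ennreal \<eta> * (\<Sum>j\<in>\<J>. G j) + ennreal (c * (\<Sum>j\<in>\<J>. (I j)\<^sup>2))"
      using h by (simp add: sum.distrib sum_distrib_left sum_ennreal c_def)
    also have "\<dots> \<le> ennreal \<eta> * gagliardo b f + ennreal (c * (\<Sum>j\<in>\<J>. (I j)\<^sup>2))"
      by (intro add_right_mono mult_left_mono Gsum) simp
    also have "(\<Sum>j\<in>\<J>. (I j)\<^sup>2) = (\<Sum>C\<in>cell ` \<J>. (\<integral>x. indicator C x * f x \<partial>lborel)\<^sup>2)"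
      unfolding I_def using inj by (simp add: sum.reindex)
    finally show ?thesis .
  qed
  show ?thesis
    by (rule that[of "cell ` \<J>" c]) (use fin key h gc(1) in \<open>auto simp: b_def N_def c_def\<close>)
qed

section \<open>Poincare, Sobolev and Rellich theorems on the function space\<close>

lemma L2_limit_of_Cauchy_AE_convergent:
  fixes f :: "nat \<Rightarrow> 'a \<Rightarrow> real"
  assumes f: "\<And>n. sq_int M (f n)" and w[measurable]: "w \<in> borel_measurable M"
    and C: "\<And>e. e > 0 \<Longrightarrow> \<exists>N. \<forall>m\<ge>N. \<forall>n\<ge>N. (\<integral>x. (f m x - f n x)\<^sup>2 \<partial>M) < e"
    and lim: "AE x in M. (\<lambda>n. f n x) \<longlonglongrightarrow> w x"
  shows "sq_int M w" and "(\<lambda>n. \<integral>x. (f n x - w x)\<^sup>2 \<partial>M) \<longlonglongrightarrow> 0"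
proof -
  have [measurable]: "f n \<in> borel_measurable M" for n using f by (simp add: sq_int_def)
  have F: "(\<integral>\<^sup>+x. ennreal ((f m x - w x)\<^sup>2) \<partial>M) \<le> ennreal e"
    if N: "\<forall>m\<ge>N. \<forall>n\<ge>N. (\<integral>x. (f m x - f n x)\<^sup>2 \<partial>M) < e" "m \<ge> N" for e m N
  proof -
    have "(\<integral>\<^sup>+x. ennreal ((f m x - w x)\<^sup>2) \<partial>M) = (\<integral>\<^sup>+x. liminf (\<lambda>n. ennreal ((f m x - f n x)\<^sup>2)) \<partial>M)"
    proof (rule nn_integral_cong_AE)
      show "AE x in M. ennreal ((f m x - w x)\<^sup>2) = liminf (\<lambda>n. ennreal ((f m x - f n x)\<^sup>2))"
        using lim
      proof eventually_elim
        case (elim x)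
        have "(\<lambda>n. ennreal ((f m x - f n x)\<^sup>2)) \<longlonglongrightarrow> ennreal ((f m x - w x)\<^sup>2)"
          by (intro tendsto_ennrealI tendsto_intros elim)
        from lim_imp_Liminf[OF sequentially_bot this] show ?case by (rule sym)
      qed
    qed
    also have "\<dots> \<le> liminf (\<lambda>n. \<integral>\<^sup>+x. ennreal ((f m x - f n x)\<^sup>2) \<partial>M)"
      by (rule nn_integral_liminf) simp
    also have "\<dots> \<le> liminf (\<lambda>n. ennreal e)"
    proof (rule Liminf_mono)
      show "eventually (\<lambda>n. (\<integral>\<^sup>+x. ennreal ((f m x - f n x)\<^sup>2) \<partial>M) \<le> ennreal e) sequentially"
        using eventually_ge_at_top[of N]
      proof eventually_elim
        case (elim n)
        have "(\<integral>\<^sup>+x. ennreal ((f m x - f n x)\<^sup>2) \<partial>M) = ennreal (\<integral>x. (f m x - f n x)\<^sup>2 \<partial>M)"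
          using sq_int_diff[OF f f] by (intro nn_integral_eq_integral) (auto simp: sq_int_def)
        then show ?case using N elim by (simp add: ennreal_leI less_imp_le)
      qed
    qed
    also have "\<dots> = ennreal e" by (simp add: Liminf_const)
    finally show ?thesis .
  qed
  have d: "sq_int M (\<lambda>x. f m x - w x) \<and> (\<integral>x. (f m x - w x)\<^sup>2 \<partial>M) \<le> e"
    if N: "\<forall>m\<ge>N. \<forall>n\<ge>N. (\<integral>x. (f m x - f n x)\<^sup>2 \<partial>M) < e" "m \<ge> N" and e: "e > 0" for e m N
  proof -
    have le: "(\<integral>\<^sup>+x. ennreal ((f m x - w x)\<^sup>2) \<partial>M) \<le> ennreal e" by (rule F[OF N])
    then have i: "integrable M (\<lambda>x. (f m x - w x)\<^sup>2)"
      by (intro integrableI_bounded) (auto simp: top_unique less_top[symmetric])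
    then have "ennreal (\<integral>x. (f m x - w x)\<^sup>2 \<partial>M) \<le> ennreal e"
      using le by (subst (asm) nn_integral_eq_integral) auto
    then show ?thesis using i e by (simp add: sq_int_def)
  qed
  obtain N where N: "\<forall>m\<ge>N. \<forall>n\<ge>N. (\<integral>x. (f m x - f n x)\<^sup>2 \<partial>M) < 1" using C[of 1] by auto
  have "sq_int M (\<lambda>x. f N x - w x)" using d[OF N order_refl] by auto
  from sq_int_diff[OF f[of N] this] show "sq_int M w" by simp
  show "(\<lambda>n. \<integral>x. (f n x - w x)\<^sup>2 \<partial>M) \<longlonglongrightarrow> 0"
  proof (rule LIMSEQ_I)
    fix e :: real assume e: "e > 0"
    then obtain N where N: "\<forall>m\<ge>N. \<forall>n\<ge>N. (\<integral>x. (f m x - f n x)\<^sup>2 \<partial>M) < e / 2" using C[of "e / 2"] by auto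
    have "norm ((\<integral>x. (f m x - w x)\<^sup>2 \<partial>M) - 0) < e" if "m \<ge> N" for m
      using d[OF N that] e by simp
    then show "\<exists>N. \<forall>m\<ge>N. norm ((\<integral>x. (f m x - w x)\<^sup>2 \<partial>M) - 0) < e" by blast
  qed
qed

text \<open>The set argument only transports the dimension.\<close>

definition integrability_gain :: "(real ^ 'n) set \<Rightarrow> real \<Rightarrow> real" where
  "integrability_gain A s = 2 * s / real CARD('n)"

context nonlocal_problem begin

abbreviation kap :: real where "kap \<equiv> integrability_gain \<Omega> s"

lemma kap_pos: "0 < kap" using s0 dim by (simp add: integrability_gain_def)

text \<open>
  The Gagliardo estimates concern iterated integrals of Borel functions; elements of the space are
  moved there through representatives that vanish exactly outside \<open>\<Omega>\<close>.
\<close>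

lemma Borel_representative:
  assumes u: "u \<in> H"
  obtains f where "f \<in> borel_measurable borel" "\<And>x. x \<notin> \<Omega> \<Longrightarrow> f x = 0" "AE x in lebesgue. f x = u x"
proof -
  obtain g where g: "g \<in> borel_measurable lborel" "AE x in lborel. u x = g x"
    using completion_ex_borel_measurable_real[OF H_D(1)[OF u]] by auto
  show ?thesis
  proof (rule that)
    have [measurable]: "\<Omega> \<in> sets borel" "g \<in> borel_measurable borel" using open_Omega g by auto
    show "(\<lambda>x. indicator \<Omega> x * g x) \<in> borel_measurable borel" by measurable
    have "AE x in lebesgue. u x = g x" using g(2) by (simp add: AE_completion_iff)
    with H_D(2)[OF u] show "AE x in lebesgue. indicator \<Omega> x * g x = u x"
      by eventually_elim (auto simp: indicator_def)
  qed auto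
qed

lemma gagliardo_le_inner:
  obtains c where "0 < c" "\<And>u f. u \<in> H \<Longrightarrow> f \<in> borel_measurable borel \<Longrightarrow> (\<And>x. x \<notin> \<Omega> \<Longrightarrow> f x = 0) \<Longrightarrow>
     (AE x in lebesgue. f x = u x) \<Longrightarrow> gagliardo (real CARD('n) + 2 * s) f \<le> ennreal (c * inner u u)"
proof -
  obtain \<theta> where th: "\<theta> > 0" "\<And>x. x \<noteq> 0 \<Longrightarrow> K x \<ge> \<theta> * norm x powr (- (real CARD('n) + 2 * s))"
    using kernel unfolding admissible_kernel_def by blast
  define b where "b = real CARD('n) + 2 * s"
  have "gagliardo b f \<le> ennreal (1 / \<theta> * inner u u)"
    if u: "u \<in> H" and f[measurable]: "f \<in> borel_measurable borel" and f0: "\<And>x. x \<notin> \<Omega> \<Longrightarrow> f x = 0"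
      and ae: "AE x in lebesgue. f x = u x" for u f
  proof -
    have [measurable]: "(\<lambda>z. ennreal ((f (fst z) - f (snd z))\<^sup>2 * norm (fst z - snd z) powr (- b))) \<in> borel_measurable (lborel \<Otimes>\<^sub>M lborel)"
      by measurable
    have "gagliardo b f = (\<integral>\<^sup>+z. ennreal ((f (fst z) - f (snd z))\<^sup>2 * norm (fst z - snd z) powr (- b)) \<partial>(lborel \<Otimes>\<^sub>M lborel))"
      unfolding gagliardo_def by (subst lborel.nn_integral_fst[symmetric]) auto
    also have "\<dots> = (\<integral>\<^sup>+z. ennreal ((f (fst z) - f (snd z))\<^sup>2 * norm (fst z - snd z) powr (- b)) \<partial>lebesgue)"
      unfolding nn_integral_completion lborel_prod ..
    also have "\<dots> \<le> (\<integral>\<^sup>+z. ennreal (1 / \<theta> * (D u z)\<^sup>2) * indicator (Q_set \<Omega>) z \<partial>lebesgue)"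
    proof (rule nn_integral_mono_AE)
      show "AE z in lebesgue. ennreal ((f (fst z) - f (snd z))\<^sup>2 * norm (fst z - snd z) powr (- b))
         \<le> ennreal (1 / \<theta> * (D u z)\<^sup>2) * indicator (Q_set \<Omega>) z"
        using AE_lebesgue_fst_snd[OF ae]
      proof eventually_elim
        case (elim z)
        show ?case
        proof (cases "z \<in> Q_set \<Omega> \<and> fst z \<noteq> snd z")
          case True
          then have "\<theta> * norm (fst z - snd z) powr (- b) \<le> K (fst z - snd z)"
            using th(2)[of "fst z - snd z"] by (simp add: b_def)
          then have "norm (fst z - snd z) powr (- b) \<le> 1 / \<theta> * K (fst z - snd z)"
            using th(1) by (simp add: field_simps)
          then have "(f (fst z) - f (snd z))\<^sup>2 * norm (fst z - snd z) powr (- b)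
             \<le> (f (fst z) - f (snd z))\<^sup>2 * (1 / \<theta> * K (fst z - snd z))"
            by (rule mult_left_mono) simp
          also have "\<dots> = 1 / \<theta> * (D u z)\<^sup>2"
            using elim by (simp add: power2_eq_square[of "D u z"] D_mult power2_eq_square)
          finally show ?thesis using True by (simp add: ennreal_leI)
        next
          case False
          then have "f (fst z) - f (snd z) = 0"
            using f0 by (cases "fst z = snd z") (auto simp: Q_set_def mem_Times_iff)
          then show ?thesis by simp
        qed
      qed
    qed
    also have "\<dots> = (\<integral>\<^sup>+z. ennreal (1 / \<theta> * (D u z)\<^sup>2) \<partial>P)"
      by (simp add: nn_integral_restrict_space)
    also have "\<dots> = ennreal (\<integral>z. 1 / \<theta> * (D u z)\<^sup>2 \<partial>P)"
      using H_D(4)[OF u] th(1) by (intro nn_integral_eq_integral) (auto simp: sq_int_def)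
    also have "\<dots> = ennreal (1 / \<theta> * inner u u)"
      by (simp add: inner_eq power2_eq_square)
    finally show ?thesis .
  qed
  then show ?thesis using th(1) by (intro that[of "1 / \<theta>"]) (auto simp: b_def)
qed

lemma nn_integral_Borel_representative:
  assumes "AE x in lebesgue. f x = u x" "\<And>x. x \<notin> \<Omega> \<Longrightarrow> f x = 0" "g 0 = (0::ennreal)"
  shows "(\<integral>\<^sup>+x. g (f x) \<partial>lborel) = (\<integral>\<^sup>+x. g (u x) \<partial>M)"
proof -
  have "(\<integral>\<^sup>+x. g (f x) \<partial>lborel) = (\<integral>\<^sup>+x. g (f x) \<partial>lebesgue)" by (simp add: nn_integral_completion)
  also have "\<dots> = (\<integral>\<^sup>+x. g (u x) * indicator \<Omega> x \<partial>lebesgue)"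
    by (rule nn_integral_cong_AE) (use assms in \<open>auto elim!: eventually_mono simp: indicator_def\<close>)
  also have "\<dots> = (\<integral>\<^sup>+x. g (u x) \<partial>M)" by (simp add: nn_integral_restrict_space)
  finally show ?thesis .
qed

text \<open>
  This is the estimate of the superlevel sets at level zero: the set where \<open>u\<close> does not vanish has
  finite measure.
\<close>

lemma Poincare:
  obtains C where "0 < C" "\<And>u. u \<in> H \<Longrightarrow> (\<integral>x. (u x)\<^sup>2 \<partial>M) \<le> C * inner u u"
proof -
  obtain c where c: "0 < c" "\<And>u f. u \<in> H \<Longrightarrow> f \<in> borel_measurable borel \<Longrightarrow> (\<And>x. x \<notin> \<Omega> \<Longrightarrow> f x = 0) \<Longrightarrow>
     (AE x in lebesgue. f x = u x) \<Longrightarrow> gagliardo (real CARD('n) + 2 * s) f \<le> ennreal (c * inner u u)"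
    by (rule gagliardo_le_inner) blast
  define m where "m = measure lborel \<Omega> + 1"
  have fin: "emeasure lborel \<Omega> < \<infinity>" using emeasure_bounded_finite[OF bounded_Omega] by simp
  have m0: "m > 0" by (simp add: m_def add_nonneg_pos)
  have m: "emeasure lborel \<Omega> \<le> ennreal m"
    using fin by (subst emeasure_eq_ennreal_measure) (auto simp: m_def intro: ennreal_leI)
  define w where "w = measure lborel (ball (0::real ^ 'n) 1)"
  have w: "w > 0" unfolding w_def by (rule content_ball_pos) simp
  define b where "b = real CARD('n) + 2 * s"
  have b: "b > 0" using s0 by (simp add: b_def)
  define A where "A = 4 * (2 / w) powr (b / DIM(real ^ 'n)) * m powr (b / DIM(real ^ 'n) - 1)"
  have A: "A > 0" using w m0 by (simp add: A_def)
  have "(\<integral>x. (u x)\<^sup>2 \<partial>M) \<le> (A * c) * inner u u" if u: "u \<in> H" for u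
  proof -
    obtain f where f: "f \<in> borel_measurable borel" "\<And>x. x \<notin> \<Omega> \<Longrightarrow> f x = 0" "AE x in lebesgue. f x = u x"
      using Borel_representative[OF u] by blast
    have "{x. 0 < \<bar>f x\<bar>} \<subseteq> \<Omega>" using f(2) by auto
    then have "emeasure lborel {x. 0 < \<bar>f x\<bar>} \<le> emeasure lborel \<Omega>"
      using open_Omega by (intro emeasure_mono) auto
    then have e: "emeasure lborel {x. 0 < \<bar>f x\<bar>} \<le> ennreal m" using m by (rule order_trans)
    have "ennreal (\<integral>x. (u x)\<^sup>2 \<partial>M) = (\<integral>\<^sup>+x. ennreal ((u x)\<^sup>2) \<partial>M)"
      using H_D(6)[OF u] by (intro nn_integral_eq_integral[symmetric]) auto
    also have "\<dots> = (\<integral>\<^sup>+x. ennreal ((f x)\<^sup>2) \<partial>lborel)"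
      using nn_integral_Borel_representative[OF f(3) f(2), of "\<lambda>t. ennreal (t\<^sup>2)"] by simp
    also have "\<dots> = (\<integral>\<^sup>+x. ennreal ((f x)\<^sup>2) * indicator {x. 2 * 0 < \<bar>f x\<bar>} x \<partial>lborel)"
      by (rule nn_integral_cong) (auto simp: indicator_def)
    also have "\<dots> \<le> ennreal A * gagliardo b f"
      unfolding A_def w_def by (rule gagliardo_superlevel_decay[OF f(1) _ m0 b e]) simp
    also have "\<dots> \<le> ennreal A * ennreal (c * inner u u)"
      unfolding b_def by (intro mult_left_mono c(2)[OF u f]) simp_all
    also have "\<dots> = ennreal (A * c * inner u u)"
      using A c(1) inner_nonneg by (simp add: mult.assoc flip: ennreal_mult)
    finally show ?thesis using A c(1) inner_nonneg by (subst (asm) ennreal_le_iff) auto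
  qed
  then show ?thesis using A c(1) by (intro that[of "A * c"]) auto
qed

lemma ae_zero_iff_inner:
  assumes "u \<in> H" "inner u u = 0"
  shows "ae_zero u"
proof -
  obtain C where C: "0 < C" "\<And>u. u \<in> H \<Longrightarrow> (\<integral>x. (u x)\<^sup>2 \<partial>M) \<le> C * inner u u" by (rule Poincare) blast
  have "(\<integral>x. (u x)\<^sup>2 \<partial>M) \<le> 0" using C(2)[OF assms(1)] assms(2) by simp
  moreover have "0 \<le> (\<integral>x. (u x)\<^sup>2 \<partial>M)" by simp
  ultimately have "(\<integral>x. (u x)\<^sup>2 \<partial>M) = 0" by linarith
  then show ?thesis using ae_zero_iff_norm[OF assms(1)] by simp
qed

lemma inner_scale: "inner (\<lambda>x. a * u x) (\<lambda>x. a * u x) = a\<^sup>2 * inner u u" if "u \<in> H"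
  using inner_lin_left[OF that that H_scale[OF that, of a], of a 0] inner_lin_left[OF that that that, of a 0]
  by (simp add: inner_sym[of u "\<lambda>x. a * u x"] power2_eq_square)

text \<open>
  The integrability bound for functions of seminorm at most \<open>1\<close> extends by homogeneity. The exponents \<open>p\<close> tend to
  \<open>2\<close>, so any gain over the exponent \<open>2\<close> serves.
\<close>

lemma fractional_Sobolev:
  obtains C where "0 \<le> C" "\<And>u. u \<in> H \<Longrightarrow> integrable M (\<lambda>x. \<bar>u x\<bar> powr (2 + kap)) \<and>
     (\<integral>x. \<bar>u x\<bar> powr (2 + kap) \<partial>M) \<le> C * inner u u powr ((2 + kap) / 2)"
proof -
  obtain c where c: "0 < c" "\<And>u f. u \<in> H \<Longrightarrow> f \<in> borel_measurable borel \<Longrightarrow> (\<And>x. x \<notin> \<Omega> \<Longrightarrow> f x = 0) \<Longrightarrow>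
     (AE x in lebesgue. f x = u x) \<Longrightarrow> gagliardo (real CARD('n) + 2 * s) f \<le> ennreal (c * inner u u)"
    by (rule gagliardo_le_inner) blast
  obtain C0 where C0: "0 < C0" "\<And>u. u \<in> H \<Longrightarrow> (\<integral>x. (u x)\<^sup>2 \<partial>M) \<le> C0 * inner u u" by (rule Poincare) blast
  have C0c: "0 < C0 / c" using C0 c by simp
  obtain C1 where C1: "0 \<le> C1" "\<And>f :: real ^ 'n \<Rightarrow> real. f \<in> borel_measurable borel \<Longrightarrow> gagliardo (real CARD('n) + 2 * s) f \<le> 1 \<Longrightarrow>
      (\<integral>\<^sup>+x. ennreal ((f x)\<^sup>2) \<partial>lborel) \<le> ennreal (C0 / c) \<Longrightarrow>
      (\<integral>\<^sup>+x. ennreal (\<bar>f x\<bar> powr (2 + kap)) \<partial>lborel) \<le> ennreal C1"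
    using gagliardo_higher_integrability[where 'a = "real ^ 'n", OF C0c s0] by (auto simp: integrability_gain_def)
  have unit: "integrable M (\<lambda>x. \<bar>v x\<bar> powr (2 + kap)) \<and> (\<integral>x. \<bar>v x\<bar> powr (2 + kap) \<partial>M) \<le> C1"
    if v: "v \<in> H" and n: "inner v v \<le> 1 / c" for v
  proof -
    obtain f where f: "f \<in> borel_measurable borel" "\<And>x. x \<notin> \<Omega> \<Longrightarrow> f x = 0" "AE x in lebesgue. f x = v x"
      using Borel_representative[OF v] by blast
    have "gagliardo (real CARD('n) + 2 * s) f \<le> ennreal (c * inner v v)" by (rule c(2)[OF v f])
    also have "\<dots> \<le> ennreal 1" using n c(1) by (intro ennreal_leI) (simp add: field_simps)
    finally have g: "gagliardo (real CARD('n) + 2 * s) f \<le> 1" by simp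
    have "(\<integral>\<^sup>+x. ennreal ((f x)\<^sup>2) \<partial>lborel) = (\<integral>\<^sup>+x. ennreal ((v x)\<^sup>2) \<partial>M)"
      using nn_integral_Borel_representative[OF f(3) f(2), of "\<lambda>t. ennreal (t\<^sup>2)"] by simp
    also have "\<dots> = ennreal (\<integral>x. (v x)\<^sup>2 \<partial>M)"
      using H_D(6)[OF v] by (intro nn_integral_eq_integral) auto
    also have "\<dots> \<le> ennreal (C0 / c)"
    proof (rule ennreal_leI)
      have "C0 * inner v v \<le> C0 * (1 / c)" using n C0(1) by (intro mult_left_mono) auto
      then show "(\<integral>x. (v x)\<^sup>2 \<partial>M) \<le> C0 / c" using C0(2)[OF v] by simp
    qed
    finally have l: "(\<integral>\<^sup>+x. ennreal ((f x)\<^sup>2) \<partial>lborel) \<le> ennreal (C0 / c)" .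
    have "(\<integral>\<^sup>+x. ennreal (\<bar>v x\<bar> powr (2 + kap)) \<partial>M) = (\<integral>\<^sup>+x. ennreal (\<bar>f x\<bar> powr (2 + kap)) \<partial>lborel)"
      using nn_integral_Borel_representative[OF f(3) f(2), of "\<lambda>t. ennreal (\<bar>t\<bar> powr (2 + kap))"] by simp
    also have "\<dots> \<le> ennreal C1" by (rule C1(2)[OF f(1) g l])
    finally have le: "(\<integral>\<^sup>+x. ennreal (\<bar>v x\<bar> powr (2 + kap)) \<partial>M) \<le> ennreal C1" .
    have [measurable]: "v \<in> borel_measurable M" by (rule H_D(5)[OF v])
    have i: "integrable M (\<lambda>x. \<bar>v x\<bar> powr (2 + kap))"
      using le by (intro integrableI_bounded) (auto simp: top_unique less_top[symmetric])
    have "ennreal (\<integral>x. \<bar>v x\<bar> powr (2 + kap) \<partial>M) \<le> ennreal C1"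
      using le i by (subst (asm) nn_integral_eq_integral) auto
    then show ?thesis using i C1(1) by simp
  qed
  define C where "C = c powr ((2 + kap) / 2) * C1"
  have "integrable M (\<lambda>x. \<bar>u x\<bar> powr (2 + kap)) \<and>
     (\<integral>x. \<bar>u x\<bar> powr (2 + kap) \<partial>M) \<le> C * inner u u powr ((2 + kap) / 2)" if u: "u \<in> H" for u
  proof (cases "inner u u = 0")
    case True
    have "AE x in M. \<bar>u x\<bar> powr (2 + kap) = 0"
      using ae_zero_iff_inner[OF u True] unfolding ae_zero_iff_M[OF u] by eventually_elim simp
    moreover have [measurable]: "u \<in> borel_measurable M" by (rule H_D(5)[OF u])
    ultimately have "integrable M (\<lambda>x. \<bar>u x\<bar> powr (2 + kap)) \<longleftrightarrow> integrable M (\<lambda>x. 0::real)"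
      "(\<integral>x. \<bar>u x\<bar> powr (2 + kap) \<partial>M) = (\<integral>x. 0 \<partial>M)"
      by (intro integrable_cong_AE integral_cong_AE; simp)+
    then show ?thesis using True by simp
  next
    case False
    then have I: "inner u u > 0" using inner_nonneg[of u] by simp
    define a where "a = sqrt (c * inner u u)"
    have a: "a > 0" using I c by (simp add: a_def)
    have a2: "a powr (2 + kap) = c powr ((2 + kap) / 2) * inner u u powr ((2 + kap) / 2)"
      using I c(1) by (simp add: a_def powr_mult powr_half_sqrt[symmetric] powr_powr)
    have "inner (\<lambda>x. (1 / a) * u x) (\<lambda>x. (1 / a) * u x) = 1 / c"
      unfolding inner_scale[OF u] using I c(1) by (simp add: a_def power_divide)
    with unit[OF H_scale[OF u, of "1 / a"]]
    have *: "integrable M (\<lambda>x. \<bar>(1 / a) * u x\<bar> powr (2 + kap))" "(\<integral>x. \<bar>(1 / a) * u x\<bar> powr (2 + kap) \<partial>M) \<le> C1"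
      by auto
    have eq: "\<bar>u x\<bar> powr (2 + kap) = a powr (2 + kap) * \<bar>(1 / a) * u x\<bar> powr (2 + kap)" for x
      using a by (simp add: abs_mult powr_mult[symmetric])
    have "integrable M (\<lambda>x. \<bar>u x\<bar> powr (2 + kap))"
      unfolding eq using *(1) by (rule integrable_mult_right)
    moreover have "(\<integral>x. \<bar>u x\<bar> powr (2 + kap) \<partial>M) \<le> a powr (2 + kap) * C1"
      unfolding eq integral_mult_right_zero using *(2) by (rule mult_left_mono) simp
    ultimately show ?thesis unfolding a2 C_def by (simp add: mult_ac)
  qed
  moreover have "0 \<le> C" using C1(1) by (simp add: C_def)
  ultimately show ?thesis using that by blast
qed

lemma inner_diff_le:
  assumes "u \<in> H" "v \<in> H" "inner u u \<le> R" "inner v v \<le> R"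
  shows "inner (\<lambda>x. u x - v x) (\<lambda>x. u x - v x) \<le> 4 * R"
proof -
  have "inner (\<lambda>x. u x - v x) (\<lambda>x. u x - v x) + inner (\<lambda>x. u x + v x) (\<lambda>x. u x + v x) = 2 * inner u u + 2 * inner v v"
    using inner_lin_left[OF assms(1,2) H_diff[OF assms(1,2)], of 1 "-1"]
      inner_lin_left[OF assms(1,2) H_add[OF assms(1,2)], of 1 1]
      inner_lin_left[OF assms(1,2) assms(1), of 1 "-1"] inner_lin_left[OF assms(1,2) assms(2), of 1 "-1"]
      inner_lin_left[OF assms(1,2) assms(1), of 1 1] inner_lin_left[OF assms(1,2) assms(2), of 1 1]
    by (simp add: inner_sym[of u "\<lambda>x. u x - v x"] inner_sym[of v "\<lambda>x. u x - v x"]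
        inner_sym[of u "\<lambda>x. u x + v x"] inner_sym[of v "\<lambda>x. u x + v x"])
  then show ?thesis using inner_nonneg[of "\<lambda>x. u x + v x"] assms(3,4) by linarith
qed

text \<open>
  Along a subsequence all the countably many averages over the cells of all grids converge. The
  averages control the \<open>L\<^sup>2\<close> distances up to an arbitrarily small multiple of the bounded seminorms, so
  the subsequence is Cauchy.
\<close>

theorem Rellich:
  fixes u :: "nat \<Rightarrow> real ^ 'n \<Rightarrow> real"
  assumes u: "\<And>n. u n \<in> H" and R: "\<And>n. inner (u n) (u n) \<le> R"
  obtains r w where "strict_mono r" "w \<in> H" "inner w w \<le> R"
    "AE x in M. (\<lambda>n. u (r n) x) \<longlonglongrightarrow> w x" "(\<lambda>n. \<integral>x. (u (r n) x - w x)\<^sup>2 \<partial>M) \<longlonglongrightarrow> 0"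
proof -
  obtain c where c: "0 < c" "\<And>u f. u \<in> H \<Longrightarrow> f \<in> borel_measurable borel \<Longrightarrow> (\<And>x. x \<notin> \<Omega> \<Longrightarrow> f x = 0) \<Longrightarrow>
     (AE x in lebesgue. f x = u x) \<Longrightarrow> gagliardo (real CARD('n) + 2 * s) f \<le> ennreal (c * inner u u)"
    by (rule gagliardo_le_inner) blast
  obtain C0 where C0: "0 < C0" "\<And>u. u \<in> H \<Longrightarrow> (\<integral>x. (u x)\<^sup>2 \<partial>M) \<le> C0 * inner u u" by (rule Poincare) blast
  have R0: "0 \<le> R" using R[of 0] inner_nonneg[of "u 0"] by linarith
  have "\<exists>f. f \<in> borel_measurable borel \<and> (\<forall>x. x \<notin> \<Omega> \<longrightarrow> f x = 0) \<and> (AE x in lebesgue. f x = u n x)" for n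
    using Borel_representative[OF u[of n]] by metis
  then obtain f where f[measurable]: "\<And>n. f n \<in> borel_measurable borel" and f0: "\<And>n x. x \<notin> \<Omega> \<Longrightarrow> f n x = 0"
    and fu: "\<And>n. AE x in lebesgue. f n x = u n x" by metis
  have bridge: "integrable lborel (\<lambda>x. (g x)\<^sup>2) \<and> (\<integral>x. (g x)\<^sup>2 \<partial>lborel) = (\<integral>x. (v x)\<^sup>2 \<partial>M)"
    if v: "v \<in> H" and g[measurable]: "g \<in> borel_measurable borel" and g0: "\<And>x. x \<notin> \<Omega> \<Longrightarrow> g x = 0" and gv: "AE x in lebesgue. g x = v x" for g v
  proof -
    have eq: "(\<integral>\<^sup>+x. ennreal ((g x)\<^sup>2) \<partial>lborel) = ennreal (\<integral>x. (v x)\<^sup>2 \<partial>M)"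
      using nn_integral_Borel_representative[OF gv g0, of "\<lambda>t. ennreal (t\<^sup>2)"] H_D(6)[OF v]
      by (simp add: nn_integral_eq_integral)
    then have i: "integrable lborel (\<lambda>x. (g x)\<^sup>2)" by (intro integrableI_bounded) auto
    moreover have "(\<integral>x. (g x)\<^sup>2 \<partial>lborel) = (\<integral>x. (v x)\<^sup>2 \<partial>M)"
      using eq i by (subst (asm) nn_integral_eq_integral) (auto simp: integral_nonneg)
    ultimately show ?thesis ..
  qed
  define good where "good k \<C> c \<longleftrightarrow> finite \<C> \<and> \<C> \<subseteq> sets borel \<and> 0 \<le> c \<and>
    (\<forall>f. f \<in> borel_measurable borel \<longrightarrow> (\<forall>x. x \<notin> \<Omega> \<longrightarrow> f x = 0) \<longrightarrow> integrable lborel (\<lambda>x. (f x)\<^sup>2) \<longrightarrow>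
      ennreal (\<integral>x. (f x)\<^sup>2 \<partial>lborel) \<le> ennreal (1 / real (Suc k)) * gagliardo (real CARD('n) + 2 * s) f
        + ennreal (c * (\<Sum>C\<in>\<C>. (\<integral>x. indicator C x * f x \<partial>lborel)\<^sup>2)))" for k \<C> c
  have "\<exists>\<C> c. good k \<C> c" for k
    unfolding good_def
    by (rule L2_le_gagliardo_plus_averages[OF bounded_Omega s0, of "1 / real (Suc k)"]) (simp, blast)
  then obtain \<C> cc where good: "\<And>k. good k (\<C> k) (cc k)" by metis
  have CC: "\<And>k. finite (\<C> k)" "\<And>k. \<C> k \<subseteq> sets borel" "\<And>k. 0 \<le> cc k"
    using good unfolding good_def by blast+
  have av: "ennreal (\<integral>x. (f x)\<^sup>2 \<partial>lborel) \<le> ennreal (1 / real (Suc k)) * gagliardo (real CARD('n) + 2 * s) f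
        + ennreal (cc k * (\<Sum>C\<in>\<C> k. (\<integral>x. indicator C x * f x \<partial>lborel)\<^sup>2))"
    if "f \<in> borel_measurable borel" "\<And>x. x \<notin> \<Omega> \<Longrightarrow> f x = 0" "integrable lborel (\<lambda>x. (f x)\<^sup>2)" for k f
    using good[of k] that unfolding good_def by blast
  define L where "L n C = (\<integral>x. indicator C x * f n x \<partial>lborel)" for n C
  have fin: "emeasure lborel \<Omega> < \<infinity>" using emeasure_bounded_finite[OF bounded_Omega] by simp
  have [measurable]: "\<Omega> \<in> sets borel" using open_Omega by simp
  have intf: "integrable lborel (f n)" and Lb: "C \<in> sets borel \<Longrightarrow> integrable lborel (\<lambda>x. indicator C x * f n x) \<and> \<bar>L n C\<bar> \<le> measure lborel \<Omega> + C0 * R" for n C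
  proof -
    have b: "integrable lborel (\<lambda>x. (f n x)\<^sup>2)" "(\<integral>x. (f n x)\<^sup>2 \<partial>lborel) = (\<integral>x. (u n x)\<^sup>2 \<partial>M)"
      using bridge[OF u f f0 fu] by auto
    have i2: "integrable lborel (\<lambda>x. indicator \<Omega> x + (f n x)\<^sup>2)"
      using b(1) fin by (auto simp: integrable_indicator_iff)
    have pt: "\<bar>f n x\<bar> \<le> indicator \<Omega> x + (f n x)\<^sup>2" for x
    proof (cases "x \<in> \<Omega>")
      case True
      have "0 \<le> (\<bar>f n x\<bar> - 1)\<^sup>2 + (\<bar>f n x\<bar>)\<^sup>2 + 1" by simp
      then have "2 * \<bar>f n x\<bar> \<le> 2 * (1 + (f n x)\<^sup>2)" by (simp add: power2_diff)
      then show ?thesis using True by simp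
    qed (simp add: f0)
    show i1: "integrable lborel (f n)"
    proof (rule Bochner_Integration.integrable_bound[OF i2])
      show "AE x in lborel. norm (f n x) \<le> norm (indicator \<Omega> x + (f n x)\<^sup>2)"
      proof (rule AE_I2)
        fix x
        have "\<bar>f n x\<bar> \<le> \<bar>indicator \<Omega> x + (f n x)\<^sup>2\<bar>" using pt[of x] abs_ge_self order_trans by blast
        then show "norm (f n x) \<le> norm (indicator \<Omega> x + (f n x)\<^sup>2)" by simp
      qed
    qed simp
    assume C[measurable]: "C \<in> sets borel"
    have i: "integrable lborel (\<lambda>x. indicator C x * f n x)"
      using integrable_mult_indicator[OF _ i1, of C] by simp
    have "\<bar>L n C\<bar> \<le> (\<integral>x. \<bar>indicator C x * f n x\<bar> \<partial>lborel)" unfolding L_def by (rule integral_abs_bound)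
    also have "\<dots> \<le> (\<integral>x. indicator \<Omega> x + (f n x)\<^sup>2 \<partial>lborel)"
    proof (rule integral_mono[OF integrable_abs[OF i] i2])
      fix x show "\<bar>indicator C x * f n x\<bar> \<le> indicator \<Omega> x + (f n x)\<^sup>2"
        using pt[of x] by (auto simp: indicator_def split: if_splits)
    qed
    also have "\<dots> = measure lborel \<Omega> + (\<integral>x. (u n x)\<^sup>2 \<partial>M)"
      using b fin by (simp add: integrable_indicator_iff)
    also have "\<dots> \<le> measure lborel \<Omega> + C0 * R"
    proof -
      have "C0 * inner (u n) (u n) \<le> C0 * R" using R C0(1) by (intro mult_left_mono) auto
      then show ?thesis using C0(2)[OF u[of n]] by simp
    qed
    finally show "integrable lborel (\<lambda>x. indicator C x * f n x) \<and> \<bar>L n C\<bar> \<le> measure lborel \<Omega> + C0 * R"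
      using i by blast
  qed
  have cnt: "countable (\<Union>k. \<C> k)" using CC(1) by (auto intro: countable_finite)
  obtain r where r: "strict_mono r" "\<And>C. C \<in> (\<Union>k. \<C> k) \<Longrightarrow> \<exists>l. (\<lambda>n. L (r n) C) \<longlonglongrightarrow> l"
  proof (rule function_convergent_subsequence[OF cnt, of L "measure lborel \<Omega> + C0 * R"])
    fix n C assume "C \<in> (\<Union>k. \<C> k)"
    then have "C \<in> sets borel" using CC(2) by blast
    then show "norm (L n C) \<le> measure lborel \<Omega> + C0 * R" using Lb by simp
  qed blast
  then obtain l where l: "\<And>C. C \<in> (\<Union>k. \<C> k) \<Longrightarrow> (\<lambda>n. L (r n) C) \<longlonglongrightarrow> l C" by metis
  have Cauchy: "\<exists>N. \<forall>m\<ge>N. \<forall>n\<ge>N. (\<integral>x. (u (r m) x - u (r n) x)\<^sup>2 \<partial>M) < e" if e: "e > 0" for e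
  proof -
    obtain k where "8 * c * R / e < real k" using reals_Archimedean2 by blast
    then have k: "8 * c * R / e < real (Suc k)" by simp
    have k': "1 / real (Suc k) * (c * (4 * R)) < e / 2"
    proof -
      define K where "K = real (Suc k)"
      have "0 < K" by (simp add: K_def)
      moreover have "8 * c * R / e < K" using k by (simp add: K_def)
      ultimately show ?thesis using e unfolding K_def[symmetric] by (simp add: field_simps)
    qed
    define X where "X n = (\<Sum>C\<in>\<C> k. (L (r n) C - l C)\<^sup>2)" for n
    have "X \<longlonglongrightarrow> (\<Sum>C\<in>\<C> k. (l C - l C)\<^sup>2)"
      unfolding X_def by (intro tendsto_sum tendsto_power tendsto_diff l tendsto_const) auto
    then have "X \<longlonglongrightarrow> 0" by simp
    moreover have "0 < e / (8 * (cc k + 1))" using e CC(3)[of k] by simp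
    ultimately have "eventually (\<lambda>n. X n < e / (8 * (cc k + 1))) sequentially" by (rule order_tendstoD)
    then obtain N where N: "\<And>n. n \<ge> N \<Longrightarrow> X n < e / (8 * (cc k + 1))" by (auto simp: eventually_sequentially)
    have "(\<integral>x. (u (r m) x - u (r n) x)\<^sup>2 \<partial>M) < e" if mn: "m \<ge> N" "n \<ge> N" for m n
    proof -
      define g where "g x = f (r m) x - f (r n) x" for x
      define v where "v x = u (r m) x - u (r n) x" for x
      have v: "v \<in> H" unfolding v_def by (rule H_diff[OF u u])
      have g: "g \<in> borel_measurable borel" "\<And>x. x \<notin> \<Omega> \<Longrightarrow> g x = 0" unfolding g_def by (auto simp: f0)
      have gv: "AE x in lebesgue. g x = v x"
        using fu[of "r m"] fu[of "r n"] unfolding g_def v_def by eventually_elim simp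
      note b = bridge[OF v g gv]
      have "gagliardo (real CARD('n) + 2 * s) g \<le> ennreal (c * inner v v)" by (rule c(2)[OF v g gv])
      also have "\<dots> \<le> ennreal (c * (4 * R))"
        unfolding v_def using c(1) by (intro ennreal_leI mult_left_mono inner_diff_le u R) auto
      finally have G: "gagliardo (real CARD('n) + 2 * s) g \<le> ennreal (c * (4 * R))" .
      have S: "(\<Sum>C\<in>\<C> k. (\<integral>x. indicator C x * g x \<partial>lborel)\<^sup>2) \<le> 2 * X m + 2 * X n"
      proof -
        have "(\<integral>x. indicator C x * g x \<partial>lborel)\<^sup>2 \<le> 2 * (L (r m) C - l C)\<^sup>2 + 2 * (L (r n) C - l C)\<^sup>2" if "C \<in> \<C> k" for C
        proof -
          have "C \<in> sets borel" using that CC(2) by blast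
          then have "(\<integral>x. indicator C x * g x \<partial>lborel) = L (r m) C - L (r n) C"
            unfolding L_def g_def using Lb by (simp add: right_diff_distrib)
          moreover have "(p - q)\<^sup>2 \<le> 2 * (p - z)\<^sup>2 + 2 * (q - z)\<^sup>2" for p q z :: real
          proof -
            have "0 \<le> ((p - z) + (q - z))\<^sup>2" by simp
            then show ?thesis by (simp add: power2_eq_square algebra_simps)
          qed
          ultimately show ?thesis by simp
        qed
        then have "(\<Sum>C\<in>\<C> k. (\<integral>x. indicator C x * g x \<partial>lborel)\<^sup>2) \<le> (\<Sum>C\<in>\<C> k. 2 * (L (r m) C - l C)\<^sup>2 + 2 * (L (r n) C - l C)\<^sup>2)"
          by (rule sum_mono)
        then show ?thesis by (simp add: X_def sum.distrib sum_distrib_left)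
      qed
      have cS: "cc k * (\<Sum>C\<in>\<C> k. (\<integral>x. indicator C x * g x \<partial>lborel)\<^sup>2) \<le> e / 2"
      proof -
        have "cc k * (\<Sum>C\<in>\<C> k. (\<integral>x. indicator C x * g x \<partial>lborel)\<^sup>2) \<le> (cc k + 1) * (4 * (e / (8 * (cc k + 1))))"
        proof (rule mult_mono)
          show "(\<Sum>C\<in>\<C> k. (\<integral>x. indicator C x * g x \<partial>lborel)\<^sup>2) \<le> 4 * (e / (8 * (cc k + 1)))"
            using S N[OF mn(1)] N[OF mn(2)] by linarith
        qed (use CC(3)[of k] in \<open>simp_all add: sum_nonneg\<close>)
        also have "\<dots> = e / 2" using CC(3)[of k] by (simp add: field_simps)
        finally show ?thesis .
      qed
      have "ennreal (\<integral>x. (v x)\<^sup>2 \<partial>M) = ennreal (\<integral>x. (g x)\<^sup>2 \<partial>lborel)" using b by simp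
      also have "\<dots> \<le> ennreal (1 / real (Suc k)) * gagliardo (real CARD('n) + 2 * s) g
          + ennreal (cc k * (\<Sum>C\<in>\<C> k. (\<integral>x. indicator C x * g x \<partial>lborel)\<^sup>2))"
        by (rule av[OF g]) (use b in auto)
      also have "\<dots> \<le> ennreal (1 / real (Suc k)) * ennreal (c * (4 * R)) + ennreal (e / 2)"
        by (intro add_mono mult_left_mono G ennreal_leI cS) simp
      also have "\<dots> = ennreal (1 / real (Suc k) * (c * (4 * R)) + e / 2)"
      proof -
        have nn: "0 \<le> 1 / real (Suc k)" "0 \<le> c * (4 * R)" "0 \<le> e / 2" using c(1) R0 e by simp_all
        show ?thesis by (simp only: ennreal_plus[OF mult_nonneg_nonneg[OF nn(1,2)] nn(3)] ennreal_mult[OF nn(1,2)])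
      qed
      finally have "(\<integral>x. (v x)\<^sup>2 \<partial>M) \<le> 1 / real (Suc k) * (c * (4 * R)) + e / 2"
        using c(1) R0 e by (subst (asm) ennreal_le_iff) auto
      then show ?thesis using k' unfolding v_def by linarith
    qed
    then show ?thesis by blast
  qed
  obtain r' where r': "strict_mono r'" "AE x in M. convergent (\<lambda>k. u (r (r' k)) x)"
  proof (rule L2_Cauchy_AE_convergent_subsequence[of M "\<lambda>n. u (r n)"])
    show "finite_measure M" by (rule finite_M)
    show "sq_int M (u (r n))" for n by (rule H_D(3)[OF u])
    show "\<exists>N. \<forall>m\<ge>N. \<forall>n\<ge>N. (\<integral>x. (u (r m) x - u (r n) x)\<^sup>2 \<partial>M) < e" if "e > 0" for e
      by (rule Cauchy[OF that])
  qed
  define w where "w x = (if x \<in> \<Omega> then lim (\<lambda>k. u (r (r' k)) x) else 0)" for x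
  have wm: "w \<in> borel_measurable lebesgue"
  proof -
    have "(\<lambda>x. lim (\<lambda>k. u (r (r' k)) x)) \<in> borel_measurable lebesgue"
      by (rule borel_measurable_lim_metric) (rule H_D(1)[OF u])
    then have "(\<lambda>x. indicator \<Omega> x * lim (\<lambda>k. u (r (r' k)) x)) \<in> borel_measurable lebesgue"
      by (intro borel_measurable_times borel_measurable_indicator) auto
    moreover have "w = (\<lambda>x. indicator \<Omega> x * lim (\<lambda>k. u (r (r' k)) x))"
      by (auto simp: w_def indicator_def)
    ultimately show ?thesis by simp
  qed
  have wM: "w \<in> borel_measurable M" by (rule measurable_restrict_space1[OF wm])
  have wl: "AE x in M. (\<lambda>k. u (r (r' k)) x) \<longlonglongrightarrow> w x"
  proof -
    have "AE x in M. x \<in> \<Omega>" by (simp add: AE_lebesgue_on_iff)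
    with r'(2) show ?thesis by eventually_elim (simp add: w_def convergent_LIMSEQ_iff)
  qed
  have C': "\<exists>N. \<forall>m\<ge>N. \<forall>n\<ge>N. (\<integral>x. (u (r (r' m)) x - u (r (r' n)) x)\<^sup>2 \<partial>M) < e" if e: "e > 0" for e
  proof -
    obtain N where "\<forall>m\<ge>N. \<forall>n\<ge>N. (\<integral>x. (u (r m) x - u (r n) x)\<^sup>2 \<partial>M) < e" using Cauchy[OF e] by blast
    moreover have "r' m \<ge> N" if "m \<ge> N" for m N using seq_suble[OF r'(1), of m] that by linarith
    ultimately show ?thesis by blast
  qed
  note lims = L2_limit_of_Cauchy_AE_convergent[of M "\<lambda>k. u (r (r' k))", OF H_D(3)[OF u] wM C' wl]
  show ?thesis
  proof (rule that[of "r \<circ> r'" w])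
    show "strict_mono (r \<circ> r')" using r(1) r'(1) by (rule strict_mono_o)
    have w0: "AE x in lebesgue. x \<notin> \<Omega> \<longrightarrow> w x = 0" by (simp add: w_def)
    note closed = H_closed_under_bounded_AE_limits[of "\<lambda>k. u (r (r' k))", OF u R wm w0 lims(1) wl]
    show "w \<in> H" by (rule closed(1))
    show "inner w w \<le> R" by (rule closed(2))
    show "AE x in M. (\<lambda>n. u ((r \<circ> r') n) x) \<longlonglongrightarrow> w x" unfolding o_def by (rule wl)
    show "(\<lambda>n. \<integral>x. (u ((r \<circ> r') n) x - w x)\<^sup>2 \<partial>M) \<longlonglongrightarrow> 0" unfolding o_def by (rule lims(2))
  qed
qed

end

section \<open>The two lowest eigenvalues\<close>

lemma nonneg_quadratic_linear_term_zero:
  fixes b c :: real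
  assumes "\<And>t. 0 \<le> 2 * t * b + t\<^sup>2 * c"
  shows "b = 0"
proof (rule ccontr)
  assume b: "b \<noteq> 0"
  define k where "k = \<bar>c\<bar> + 1"
  have k: "k > 0" "c \<le> k" by (auto simp: k_def)
  have "0 \<le> 2 * (- b / k) * b + (- b / k)\<^sup>2 * c" by (rule assms)
  also have "\<dots> \<le> 2 * (- b / k) * b + (- b / k)\<^sup>2 * k" using k by (intro add_left_mono mult_left_mono) auto
  also have "\<dots> = - (b\<^sup>2 / k)" using k by (simp add: power2_eq_square field_simps)
  finally show False using b k by (simp add: divide_le_0_iff)
qed

lemma L2_weighted_bilinear_tendsto:
  fixes u v :: "nat \<Rightarrow> 'a \<Rightarrow> real"
  assumes u: "\<And>n. sq_int M (u n)" "sq_int M w" "(\<lambda>n. \<integral>x. (u n x - w x)\<^sup>2 \<partial>M) \<longlonglongrightarrow> 0"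
    and v: "\<And>n. sq_int M (v n)" "sq_int M z" "(\<lambda>n. \<integral>x. (v n x - z x)\<^sup>2 \<partial>M) \<longlonglongrightarrow> 0"
    and b[measurable]: "b \<in> borel_measurable M" and C: "AE x in M. \<bar>b x\<bar> \<le> C"
  shows "(\<lambda>n. \<integral>x. b x * u n x * v n x \<partial>M) \<longlonglongrightarrow> (\<integral>x. b x * w x * z x \<partial>M)"
proof -
  have bs: "sq_int M (\<lambda>x. b x * f x)" "(\<integral>x. (b x * f x)\<^sup>2 \<partial>M) \<le> C\<^sup>2 * (\<integral>x. (f x)\<^sup>2 \<partial>M)"
    if f: "sq_int M f" for f
  proof -
    have [measurable]: "f \<in> borel_measurable M" using f by (simp add: sq_int_def)
    have ae: "AE x in M. \<bar>b x * f x\<bar> \<le> \<bar>C * f x\<bar>"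
      using C by eventually_elim (auto simp: abs_mult intro!: mult_right_mono)
    show s: "sq_int M (\<lambda>x. b x * f x)" by (rule sq_int_bound[OF sq_int_scale[OF f] _ ae]) measurable
    have "(\<integral>x. (b x * f x)\<^sup>2 \<partial>M) \<le> (\<integral>x. (C * f x)\<^sup>2 \<partial>M)"
    proof (rule integral_mono_AE)
      show "integrable M (\<lambda>x. (b x * f x)\<^sup>2)" "integrable M (\<lambda>x. (C * f x)\<^sup>2)"
        using s sq_int_scale[OF f] by (auto simp: sq_int_def)
      show "AE x in M. (b x * f x)\<^sup>2 \<le> (C * f x)\<^sup>2"
        using ae by eventually_elim (simp add: abs_le_square_iff)
    qed
    then show "(\<integral>x. (b x * f x)\<^sup>2 \<partial>M) \<le> C\<^sup>2 * (\<integral>x. (f x)\<^sup>2 \<partial>M)" by (simp add: power_mult_distrib)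
  qed
  define X Y where "X n = sqrt (\<integral>x. (u n x - w x)\<^sup>2 \<partial>M)" and "Y n = sqrt (\<integral>x. (v n x - z x)\<^sup>2 \<partial>M)" for n
  have X0: "X \<longlonglongrightarrow> 0" unfolding X_def using tendsto_real_sqrt[OF u(3)] by simp
  have Y0: "Y \<longlonglongrightarrow> 0" unfolding Y_def using tendsto_real_sqrt[OF v(3)] by simp
  define W Z where "W = sqrt (\<integral>x. (b x * w x)\<^sup>2 \<partial>M)" and "Z = sqrt (\<integral>x. (z x)\<^sup>2 \<partial>M)"
  have bound: "\<bar>(\<integral>x. b x * u n x * v n x \<partial>M) - (\<integral>x. b x * w x * z x \<partial>M)\<bar> \<le> \<bar>C\<bar> * X n * Y n + \<bar>C\<bar> * X n * Z + W * Y n" for n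
  proof -
    define p q where "p x = u n x - w x" and "q x = v n x - z x" for x
    have p: "sq_int M p" and q: "sq_int M q" unfolding p_def q_def by (intro sq_int_diff u v)+
    have "(\<integral>x. b x * u n x * v n x \<partial>M) = (\<integral>x. (b x * p x) * q x + (b x * p x) * z x + (b x * w x) * q x + (b x * w x) * z x \<partial>M)"
      by (rule Bochner_Integration.integral_cong) (auto simp: p_def q_def algebra_simps)
    also have "\<dots> = (\<integral>x. (b x * p x) * q x \<partial>M) + (\<integral>x. (b x * p x) * z x \<partial>M) + (\<integral>x. (b x * w x) * q x \<partial>M) + (\<integral>x. (b x * w x) * z x \<partial>M)"
      using sq_int_mult_integrable[OF bs(1)[OF p] q] sq_int_mult_integrable[OF bs(1)[OF p] v(2)]
        sq_int_mult_integrable[OF bs(1)[OF u(2)] q] sq_int_mult_integrable[OF bs(1)[OF u(2)] v(2)] by simp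
    finally have "\<bar>(\<integral>x. b x * u n x * v n x \<partial>M) - (\<integral>x. b x * w x * z x \<partial>M)\<bar>
      \<le> \<bar>\<integral>x. (b x * p x) * q x \<partial>M\<bar> + \<bar>\<integral>x. (b x * p x) * z x \<partial>M\<bar> + \<bar>\<integral>x. (b x * w x) * q x \<partial>M\<bar>" by linarith
    also have "\<dots> \<le> sqrt (\<integral>x. (b x * p x)\<^sup>2 \<partial>M) * Y n + sqrt (\<integral>x. (b x * p x)\<^sup>2 \<partial>M) * Z + W * Y n"
      using Cauchy_Schwarz_sq_int[OF bs(1)[OF p] q] Cauchy_Schwarz_sq_int[OF bs(1)[OF p] v(2)] Cauchy_Schwarz_sq_int[OF bs(1)[OF u(2)] q]
      unfolding Y_def Z_def W_def q_def by linarith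
    also have "\<dots> \<le> (\<bar>C\<bar> * X n) * Y n + (\<bar>C\<bar> * X n) * Z + W * Y n"
    proof -
      have "sqrt (\<integral>x. (b x * p x)\<^sup>2 \<partial>M) \<le> sqrt (C\<^sup>2 * (\<integral>x. (p x)\<^sup>2 \<partial>M))"
        by (rule real_sqrt_le_mono[OF bs(2)[OF p]])
      also have "\<dots> = \<bar>C\<bar> * X n" by (simp add: real_sqrt_mult X_def p_def)
      finally have "sqrt (\<integral>x. (b x * p x)\<^sup>2 \<partial>M) \<le> \<bar>C\<bar> * X n" .
      then show ?thesis by (intro add_mono mult_right_mono) (auto simp: Y_def Z_def)
    qed
    finally show ?thesis .
  qed
  have "(\<lambda>n. \<bar>C\<bar> * X n * Y n + \<bar>C\<bar> * X n * Z + W * Y n) \<longlonglongrightarrow> \<bar>C\<bar> * 0 * 0 + \<bar>C\<bar> * 0 * Z + W * 0"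
    by (intro tendsto_intros X0 Y0)
  then have lim0: "(\<lambda>n. \<bar>C\<bar> * X n * Y n + \<bar>C\<bar> * X n * Z + W * Y n) \<longlonglongrightarrow> 0" by simp
  have "(\<lambda>n. (\<integral>x. b x * u n x * v n x \<partial>M) - (\<integral>x. b x * w x * z x \<partial>M)) \<longlonglongrightarrow> 0"
  proof (rule tendsto_rabs_zero_cancel, rule tendsto_sandwich[OF _ _ tendsto_const lim0])
    show "\<forall>\<^sub>F n in sequentially. 0 \<le> \<bar>(\<integral>x. b x * u n x * v n x \<partial>M) - (\<integral>x. b x * w x * z x \<partial>M)\<bar>" by simp
    show "\<forall>\<^sub>F n in sequentially. \<bar>(\<integral>x. b x * u n x * v n x \<partial>M) - (\<integral>x. b x * w x * z x \<partial>M)\<bar> \<le> \<bar>C\<bar> * X n * Y n + \<bar>C\<bar> * X n * Z + W * Y n"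
      using bound by (intro always_eventually allI)
  qed
  then show ?thesis by (simp add: Lim_null[symmetric])
qed

context nonlocal_problem begin

definition ip :: "(real ^ 'n \<Rightarrow> real) \<Rightarrow> (real ^ 'n \<Rightarrow> real) \<Rightarrow> real" where
  "ip u v = (\<integral>x. u x * v x \<partial>M)"

lemma ip_sym: "ip u v = ip v u" by (simp add: ip_def mult.commute)

lemma ip_self: "ip u u = (\<integral>x. (u x)\<^sup>2 \<partial>M)" by (simp add: ip_def power2_eq_square)

lemma ip_nonneg: "0 \<le> ip u u" by (simp add: ip_self)

lemma ip_lin_left:
  assumes "sq_int M u" "sq_int M v" "sq_int M w"
  shows "ip (\<lambda>x. a * u x + b * v x) w = a * ip u w + b * ip v w"
proof -
  have "ip (\<lambda>x. a * u x + b * v x) w = (\<integral>x. a * (u x * w x) + b * (v x * w x) \<partial>M)"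
    unfolding ip_def by (simp add: algebra_simps)
  also have "\<dots> = a * ip u w + b * ip v w"
    unfolding ip_def using sq_int_mult_integrable[OF assms(1,3)] sq_int_mult_integrable[OF assms(2,3)] by simp
  finally show ?thesis .
qed

lemma ip_scale: "ip (\<lambda>x. a * u x) (\<lambda>x. a * u x) = a\<^sup>2 * ip u u"
  by (simp add: ip_self power_mult_distrib)

lemma ip_quadratic:
  assumes "sq_int M u" "sq_int M v"
  shows "ip (\<lambda>x. a * u x + b * v x) (\<lambda>x. a * u x + b * v x) = a\<^sup>2 * ip u u + 2 * a * b * ip u v + b\<^sup>2 * ip v v"
proof -
  have h: "sq_int M (\<lambda>x. a * u x + b * v x)" using assms by (intro sq_int_add sq_int_scale)
  show ?thesis
    using ip_lin_left[OF assms h, of a b] ip_lin_left[OF assms assms(1), of a b] ip_lin_left[OF assms assms(2), of a b]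
    by (simp add: ip_sym[of u "\<lambda>x. a * u x + b * v x"] ip_sym[of v "\<lambda>x. a * u x + b * v x"] ip_sym[of v u]
        power2_eq_square algebra_simps)
qed

lemma ae_zero_iff_ip: "u \<in> H \<Longrightarrow> ae_zero u \<longleftrightarrow> ip u u = 0"
  by (simp add: ae_zero_iff_norm ip_self)

lemma form_ae_zero:
  assumes u: "u \<in> H" "ae_zero u" and v: "v \<in> H"
  shows "form u v = 0" and "ip u v = 0"
proof -
  have z: "AE x in lebesgue. u x = 0" using u(2) by (simp add: ae_zero_def)
  have "AE z in lebesgue. D u z = 0"
    using AE_lebesgue_fst_snd[OF z] by eventually_elim (simp add: D_def)
  then have "AE z in P. D u z * D v z = 0"
    unfolding AE_lebesgue_on_iff[OF Q_sets] by eventually_elim simp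
  then have 1: "inner u v = 0" unfolding inner_eq by (rule integral_eq_zero_AE)
  have zM: "AE x in M. u x = 0" using u(2) ae_zero_iff_M[OF u(1)] by blast
  then have "AE x in M. V x * u x * v x = 0" by eventually_elim simp
  then have "(\<integral>x. V x * u x * v x \<partial>M) = 0" by (rule integral_eq_zero_AE)
  with 1 show "form u v = 0" by (simp add: form_def)
  from zM have "AE x in M. u x * v x = 0" by eventually_elim simp
  then show "ip u v = 0" unfolding ip_def by (rule integral_eq_zero_AE)
qed

lemma inner_le_form_plus_L2:
  obtains C where "0 \<le> C" "\<And>u. u \<in> H \<Longrightarrow> inner u u \<le> form u u + C * ip u u"
proof -
  obtain CV where CV: "CV \<ge> 0" "AE x in M. \<bar>V x\<bar> \<le> CV" by (rule V_bound)
  have "inner u u \<le> form u u + CV * ip u u" if u: "u \<in> H" for u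
  proof -
    have "- (\<integral>x. V x * u x * u x \<partial>M) \<le> \<bar>\<integral>x. V x * u x * u x \<partial>M\<bar>" by simp
    also have "\<dots> \<le> (\<integral>x. \<bar>V x * u x * u x\<bar> \<partial>M)" by (rule integral_abs_bound)
    also have "\<dots> \<le> (\<integral>x. CV * (u x * u x) \<partial>M)"
    proof (rule integral_mono_AE)
      show "integrable M (\<lambda>x. \<bar>V x * u x * u x\<bar>)"
        by (intro integrable_abs V_integrable H_D(3) u)
      show "integrable M (\<lambda>x. CV * (u x * u x))"
        using sq_int_mult_integrable[OF H_D(3)[OF u] H_D(3)[OF u]] by simp
      show "AE x in M. \<bar>V x * u x * u x\<bar> \<le> CV * (u x * u x)"
        using CV(2) by eventually_elim (auto simp: abs_mult mult.assoc intro!: mult_right_mono)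
    qed
    also have "\<dots> = CV * ip u u" by (simp add: ip_def)
    finally show ?thesis by (simp add: form_def)
  qed
  with CV(1) show ?thesis by (rule that)
qed

lemma form_lower_semicontinuous:
  fixes v :: "nat \<Rightarrow> real ^ 'n \<Rightarrow> real"
  assumes v: "\<And>n. v n \<in> H" and w: "w \<in> H" and lim: "AE x in M. (\<lambda>n. v n x) \<longlonglongrightarrow> w x"
    and l2: "(\<lambda>n. \<integral>x. (v n x - w x)\<^sup>2 \<partial>M) \<longlonglongrightarrow> 0"
    and le: "\<And>n. form (v n) (v n) \<le> l n" and l: "l \<longlonglongrightarrow> L"
  shows "form w w \<le> L"
proof -
  obtain CV where CV: "CV \<ge> 0" "AE x in M. \<bar>V x\<bar> \<le> CV" by (rule V_bound)
  define X where "X n = l n - (\<integral>x. V x * v n x * v n x \<partial>M)" for n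
  have "X \<longlonglongrightarrow> L - (\<integral>x. V x * w x * w x \<partial>M)"
    unfolding X_def
    by (intro tendsto_diff l L2_weighted_bilinear_tendsto[OF H_D(3)[OF v] H_D(3)[OF w] l2 H_D(3)[OF v] H_D(3)[OF w] l2 V_meas CV(2)])
  have "inner w w \<le> L - (\<integral>x. V x * w x * w x \<partial>M)"
  proof (rule field_le_epsilon)
    fix e :: real assume "e > 0"
    then have "eventually (\<lambda>n. X n < L - (\<integral>x. V x * w x * w x \<partial>M) + e) sequentially"
      using \<open>X \<longlonglongrightarrow> _\<close> by (intro order_tendstoD) auto
    then obtain N where N: "\<And>n. n \<ge> N \<Longrightarrow> X n < L - (\<integral>x. V x * w x * w x \<partial>M) + e"
      by (auto simp: eventually_sequentially)
    have bd: "inner (v (n + N)) (v (n + N)) \<le> L - (\<integral>x. V x * w x * w x \<partial>M) + e" for n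
      using N[of "n + N"] le[of "n + N"] unfolding X_def form_def by simp
    have lim': "AE x in M. (\<lambda>n. v (n + N) x) \<longlonglongrightarrow> w x"
      using lim by eventually_elim (rule LIMSEQ_ignore_initial_segment)
    show "inner w w \<le> L - (\<integral>x. V x * w x * w x \<partial>M) + e"
      by (rule H_closed_under_bounded_AE_limits(2)[of "\<lambda>n. v (n + N)", OF v bd H_D(1)[OF w] H_D(2)[OF w] H_D(3)[OF w] lim'])
  qed
  then show ?thesis by (simp add: form_def)
qed

text \<open>
  The positive and negative parts interact only through the kernel, with a sign: \<open>u\<^sup>-\<close> is
  nonpositive here, so the cross term is nonnegative.
\<close>

lemma form_pos_neg:
  assumes u: "u \<in> H"
  shows "form (pos_part u) (neg_part u) \<ge> 0"
    and "form (pos_part u) (neg_part u) = 0 \<Longrightarrow> ae_zero (pos_part u) \<or> ae_zero (neg_part u)"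
proof -
  define p q where "p = pos_part u" and "q x = - 1 * neg_part u x" for x
  have p: "p \<in> H" using H_pos_part[OF u] by (simp add: p_def)
  have q: "q \<in> H" using H_scale[OF H_neg_part[OF u], of "-1"] by (simp add: q_def[abs_def])
  have d: "p x * neg_part u x = 0" for x by (auto simp: p_def max_def min_def)
  have nn: "AE x in lebesgue. 0 \<le> p x" "AE x in lebesgue. 0 \<le> q x" "AE x in lebesgue. p x * q x = 0"
    using d by (auto simp: p_def q_def)
  have "(\<lambda>x. V x * pos_part u x * neg_part u x) = (\<lambda>x. 0)" by (auto simp: fun_eq_iff max_def min_def)
  then have f: "form (pos_part u) (neg_part u) = inner p (neg_part u)"
    unfolding form_def by (simp add: p_def)
  have "inner q p = - inner (neg_part u) p"
    using inner_lin_left[OF H_neg_part[OF u] H_neg_part[OF u] p, of "-1" 0] by (simp add: q_def[abs_def])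
  then have i: "inner p q = - inner p (neg_part u)" by (simp add: inner_sym[of p])
  note dis = inner_disjoint_nonneg[OF p q nn]
  show "form (pos_part u) (neg_part u) \<ge> 0" using dis(1) f i by simp
  assume "form (pos_part u) (neg_part u) = 0"
  then have "ae_zero p \<or> ae_zero q" using dis(2) f i by simp
  then show "ae_zero (pos_part u) \<or> ae_zero (neg_part u)"
    by (simp add: p_def q_def[abs_def] ae_zero_def)
qed

lemma ip_pos_neg: "ip (pos_part u) (neg_part u) = 0"
proof -
  have "(\<lambda>x. pos_part u x * neg_part u x) = (\<lambda>x. 0)" by (auto simp: fun_eq_iff max_def min_def)
  then show ?thesis unfolding ip_def by simp
qed

lemma weak_eigenfunction_iff:
  "weak_solution \<Omega> K V (\<lambda>x. \<mu> * u x) u \<longleftrightarrow> u \<in> H \<and> (\<forall>\<phi>\<in>H. form u \<phi> = \<mu> * ip u \<phi>)"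
  unfolding weak_solution_iff ip_def by (simp add: mult.assoc)

end

locale positive_problem = nonlocal_problem \<Omega> K V s for \<Omega> :: "(real ^ 'n) set" and K V :: "real ^ 'n \<Rightarrow> real" and s :: real +
  assumes pd: "positive_definite \<Omega> K V" and nontrivial: "\<exists>u\<in>H. sign_changing u"
begin

lemma form_pos: "u \<in> H \<Longrightarrow> \<not> ae_zero u \<Longrightarrow> form u u > 0"
  using pd by (simp add: positive_definite_iff)

lemma form_nonneg: "u \<in> H \<Longrightarrow> form u u \<ge> 0"
  using form_pos[of u] form_ae_zero(1)[of u u] by (cases "ae_zero u") auto

text \<open>
  The direct method. The case \<open>g = 0\<close> gives the first eigenfunction, and \<open>g\<close> equal to the first
  eigenfunction gives the second one.
\<close>

lemma Rayleigh_minimizer_exists: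
  assumes g: "sq_int M g" and ne: "\<exists>u\<in>H. ip u g = 0 \<and> \<not> ae_zero u"
  obtains e where "e \<in> H" "ip e g = 0" "ip e e = 1" "\<And>u. u \<in> H \<Longrightarrow> ip u g = 0 \<Longrightarrow> form e e * ip u u \<le> form u u"
proof -
  define S where "S = {form u u | u. u \<in> H \<and> ip u g = 0 \<and> ip u u = 1}"
  have normal: "form u u / ip u u \<in> S" if u: "u \<in> H" "ip u g = 0" "\<not> ae_zero u" for u
  proof -
    have i: "ip u u > 0" using norm_pos[OF u(1,3)] by (simp add: ip_self)
    define a where "a = 1 / sqrt (ip u u)"
    have a2: "a\<^sup>2 = 1 / ip u u" using i by (simp add: a_def power_divide)
    have "ip (\<lambda>x. a * u x) g = 0"
      using ip_lin_left[OF H_D(3)[OF u(1)] H_D(3)[OF u(1)] g, of a 0] u(2) by simp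
    moreover have "ip (\<lambda>x. a * u x) (\<lambda>x. a * u x) = 1" using i by (simp add: ip_scale a2)
    moreover have "form (\<lambda>x. a * u x) (\<lambda>x. a * u x) = form u u / ip u u"
      by (simp add: form_scale[OF u(1)] a2)
    ultimately show ?thesis unfolding S_def using H_scale[OF u(1), of a] by (auto intro!: exI[of _ "\<lambda>x. a * u x"])
  qed
  have Sne: "S \<noteq> {}" using ne normal by blast
  have S0: "y \<ge> 0" if "y \<in> S" for y using that form_nonneg by (auto simp: S_def)
  then have bdd: "bdd_below S" by (intro bdd_belowI[of S 0])
  define m where "m = Inf S"
  have "\<exists>u. u \<in> H \<and> ip u g = 0 \<and> ip u u = 1 \<and> form u u \<le> m + 1 / real (Suc n)" for n
  proof -
    have "Inf S < m + 1 / real (Suc n)" by (simp add: m_def)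
    then obtain y where "y \<in> S" "y < m + 1 / real (Suc n)" using cInf_lessD[OF Sne] by blast
    then show ?thesis by (auto simp: S_def intro: less_imp_le)
  qed
  then obtain u where u: "\<And>n. u n \<in> H" "\<And>n. ip (u n) g = 0" "\<And>n. ip (u n) (u n) = 1"
    and fu: "\<And>n. form (u n) (u n) \<le> m + 1 / real (Suc n)" by metis
  obtain CV where CV: "CV \<ge> 0" "\<And>u. u \<in> H \<Longrightarrow> inner u u \<le> form u u + CV * ip u u"
    by (rule inner_le_form_plus_L2) blast
  have bd: "inner (u n) (u n) \<le> m + 1 + CV" for n
  proof -
    have "1 / real (Suc n) \<le> 1" by simp
    moreover have "CV * ip (u n) (u n) = CV" using u(3)[of n] by simp
    ultimately show ?thesis using CV(2)[OF u(1), of n] fu[of n] by linarith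
  qed
  obtain r w where r: "strict_mono r" "w \<in> H"
    "AE x in M. (\<lambda>n. u (r n) x) \<longlonglongrightarrow> w x" "(\<lambda>n. \<integral>x. (u (r n) x - w x)\<^sup>2 \<partial>M) \<longlonglongrightarrow> 0"
    by (rule Rellich[of u, OF u(1) bd]) blast
  have one: "AE x in M. \<bar>1::real\<bar> \<le> 1" by simp
  have g0: "(\<lambda>n. \<integral>x. (g x - g x)\<^sup>2 \<partial>M) \<longlonglongrightarrow> 0" by simp
  have "(\<lambda>n. \<integral>x. 1 * u (r n) x * g x \<partial>M) \<longlonglongrightarrow> (\<integral>x. 1 * w x * g x \<partial>M)"
    by (rule L2_weighted_bilinear_tendsto[OF H_D(3)[OF u(1)] H_D(3)[OF r(2)] r(4) g g g0 _ one]) simp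
  then have wg: "ip w g = 0" using u(2) by (simp add: ip_def[symmetric] LIMSEQ_const_iff)
  have "(\<lambda>n. \<integral>x. 1 * u (r n) x * u (r n) x \<partial>M) \<longlonglongrightarrow> (\<integral>x. 1 * w x * w x \<partial>M)"
    by (rule L2_weighted_bilinear_tendsto[OF H_D(3)[OF u(1)] H_D(3)[OF r(2)] r(4) H_D(3)[OF u(1)] H_D(3)[OF r(2)] r(4) _ one]) simp
  then have w1: "ip w w = 1" using u(3) by (simp add: ip_def[symmetric] LIMSEQ_const_iff)
  have "(\<lambda>n. m + 1 / real (Suc n)) \<longlonglongrightarrow> m + 0"
    by (intro tendsto_add tendsto_const LIMSEQ_Suc[OF lim_1_over_n])
  from LIMSEQ_subseq_LIMSEQ[OF this r(1)]
  have mlim: "(\<lambda>n. m + 1 / real (Suc (r n))) \<longlonglongrightarrow> m" by (simp add: o_def)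
  have wm: "form w w \<le> m"
    by (rule form_lower_semicontinuous[of "\<lambda>n. u (r n)", OF u(1) r(2) r(3) r(4) fu mlim])
  show ?thesis
  proof (rule that[OF r(2) wg w1])
    fix v assume v: "v \<in> H" "ip v g = 0"
    show "form w w * ip v v \<le> form v v"
    proof (cases "ae_zero v")
      case True
      then show ?thesis using ae_zero_iff_ip[OF v(1)] form_nonneg[OF v(1)] by simp
    next
      case False
      have i: "ip v v > 0" using norm_pos[OF v(1) False] by (simp add: ip_self)
      have "m \<le> form v v / ip v v" unfolding m_def by (rule cInf_lower[OF normal[OF v False] bdd])
      with wm have "form w w \<le> form v v / ip v v" by linarith
      then show ?thesis using i by (simp add: pos_le_divide_eq)
    qed
  qed
qed

lemma Rayleigh_Euler_Lagrange:
  assumes e: "e \<in> H" "ip e g = 0" "ip e e = 1" and g: "sq_int M g"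
    and min: "\<And>u. u \<in> H \<Longrightarrow> ip u g = 0 \<Longrightarrow> form e e * ip u u \<le> form u u"
    and v: "v \<in> H" "ip v g = 0"
  shows "form e v = form e e * ip e v"
proof -
  have "0 \<le> 2 * t * (form e v - form e e * ip e v) + t\<^sup>2 * (form v v - form e e * ip v v)" for t
  proof -
    have "ip (\<lambda>x. 1 * e x + t * v x) g = 0"
      using ip_lin_left[OF H_D(3)[OF e(1)] H_D(3)[OF v(1)] g, of 1 t] e v by simp
    from min[OF H_lin[OF e(1) v(1)] this]
    show ?thesis unfolding form_quadratic[OF e(1) v(1)] ip_quadratic[OF H_D(3)[OF e(1)] H_D(3)[OF v(1)]]
      using e(3) by (simp add: algebra_simps)
  qed
  then have "form e v - form e e * ip e v = 0" by (rule nonneg_quadratic_linear_term_zero)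
  then show ?thesis by simp
qed

text \<open>
  Replacing \<open>u\<close> by \<open>\<bar>u\<bar>\<close> lowers the form by four times the cross term. A minimizer of the
  Rayleigh quotient therefore has one sign.
\<close>

lemma lowest_state_one_sign:
  assumes u: "u \<in> H" and eq: "form u u = l * ip u u" and low: "\<And>v. v \<in> H \<Longrightarrow> l * ip v v \<le> form v v"
  shows "ae_zero (pos_part u) \<or> ae_zero (neg_part u)"
proof -
  note p = H_pos_part[OF u] and q = H_neg_part[OF u]
  have u': "u = (\<lambda>x. 1 * pos_part u x + 1 * neg_part u x)" by (auto simp: max_def min_def)
  have fu: "form u u = form (pos_part u) (pos_part u) + 2 * form (pos_part u) (neg_part u) + form (neg_part u) (neg_part u)"
    using form_quadratic[OF p q, of 1 1] u' by simp
  have iu: "ip u u = ip (pos_part u) (pos_part u) + ip (neg_part u) (neg_part u)"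
    using ip_quadratic[OF H_D(3)[OF p] H_D(3)[OF q], of 1 1] u' by (simp add: ip_pos_neg)
  have "l * ip (\<lambda>x. 1 * pos_part u x + (-1) * neg_part u x) (\<lambda>x. 1 * pos_part u x + (-1) * neg_part u x)
    \<le> form (\<lambda>x. 1 * pos_part u x + (-1) * neg_part u x) (\<lambda>x. 1 * pos_part u x + (-1) * neg_part u x)"
    by (rule low[OF H_lin[OF p q]])
  then have "l * ip u u \<le> form (pos_part u) (pos_part u) - 2 * form (pos_part u) (neg_part u) + form (neg_part u) (neg_part u)"
    unfolding form_quadratic[OF p q] ip_quadratic[OF H_D(3)[OF p] H_D(3)[OF q]] by (simp add: iu ip_pos_neg)
  then have "form (pos_part u) (neg_part u) \<le> 0" using fu eq by linarith
  then show ?thesis using form_pos_neg[OF u] by linarith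
qed

lemma one_sign_mean_zero:
  assumes u: "u \<in> H" and sgn: "ae_zero (pos_part u) \<or> ae_zero (neg_part u)" and mean: "ip u (\<lambda>x. 1) = 0"
  shows "ae_zero u"
proof -
  interpret finite_measure M by (rule finite_M)
  have "sq_int M (\<lambda>x. 1)" by (simp add: sq_int_def)
  from sq_int_mult_integrable[OF H_D(3)[OF u] this] have i: "integrable M u" by simp
  have "AE x in M. u x = 0"
    using sgn
  proof
    assume "ae_zero (pos_part u)"
    then have "AE x in M. max (u x) 0 = 0" using ae_zero_iff_M[OF H_pos_part[OF u]] by blast
    then have "AE x in M. 0 \<le> - u x" by eventually_elim (auto simp: max_def split: if_splits)
    moreover have "(\<integral>x. - u x \<partial>M) = 0" using mean by (simp add: ip_def)
    ultimately have "AE x in M. - u x = 0" using i by (subst (asm) integral_nonneg_eq_0_iff_AE) auto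
    then show ?thesis by simp
  next
    assume "ae_zero (neg_part u)"
    then have "AE x in M. min (u x) 0 = 0" using ae_zero_iff_M[OF H_neg_part[OF u]] by blast
    then have "AE x in M. 0 \<le> u x" by eventually_elim (auto simp: min_def split: if_splits)
    moreover have "(\<integral>x. u x \<partial>M) = 0" using mean by (simp add: ip_def)
    ultimately show ?thesis using i by (subst (asm) integral_nonneg_eq_0_iff_AE) auto
  qed
  then show ?thesis using ae_zero_iff_M[OF u] by simp
qed

lemma first_eigenfunction:
  obtains e l where "e \<in> H" "ip e e = 1" "AE x in lebesgue. 0 \<le> e x" "0 < l"
    "\<And>v. v \<in> H \<Longrightarrow> form e v = l * ip e v" "\<And>v. v \<in> H \<Longrightarrow> l * ip v v \<le> form v v"
proof -
  obtain u0 where u0: "u0 \<in> H" "sign_changing u0" using nontrivial by blast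
  have g: "sq_int M (\<lambda>x. 0)" by (simp add: sq_int_def)
  have ip0: "ip u (\<lambda>x. 0) = 0" for u by (simp add: ip_def)
  have "\<exists>u\<in>H. ip u (\<lambda>x. 0) = 0 \<and> \<not> ae_zero u"
    using u0 H_pos_part[OF u0(1)] ip0 by (auto simp: sign_changing_def intro!: bexI[of _ "pos_part u0"])
  then obtain e where e: "e \<in> H" "ip e (\<lambda>x. 0) = 0" "ip e e = 1"
    and min: "\<And>u. u \<in> H \<Longrightarrow> ip u (\<lambda>x. 0) = 0 \<Longrightarrow> form e e * ip u u \<le> form u u"
    by (rule Rayleigh_minimizer_exists[OF g]) blast
  define l where "l = form e e"
  have min': "l * ip u u \<le> form u u" if "u \<in> H" for u using min[OF that ip0] by (simp add: l_def)
  have EL: "form e v = l * ip e v" if "v \<in> H" for v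
    unfolding l_def by (rule Rayleigh_Euler_Lagrange[OF e g min that ip0])
  have "\<not> ae_zero e" using ae_zero_iff_ip[OF e(1)] e(3) by simp
  then have l: "l > 0" unfolding l_def by (rule form_pos[OF e(1)])
  have "ae_zero (pos_part e) \<or> ae_zero (neg_part e)"
    by (rule lowest_state_one_sign[OF e(1) _ min']) (use e(3) in \<open>auto simp: l_def\<close>)
  then show ?thesis
  proof
    assume "ae_zero (neg_part e)"
    then have "AE x in lebesgue. 0 \<le> e x"
      unfolding ae_zero_def by eventually_elim (auto simp: min_def split: if_splits)
    with that[OF e(1,3) _ l EL min'] show ?thesis by blast
  next
    assume "ae_zero (pos_part e)"
    then have n: "AE x in lebesgue. 0 \<le> (-1) * e x"
      unfolding ae_zero_def by eventually_elim (auto simp: max_def split: if_splits)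
    have "ip (\<lambda>x. (-1) * e x) (\<lambda>x. (-1) * e x) = 1" unfolding ip_scale using e(3) by simp
    moreover have "form (\<lambda>x. (-1) * e x) v = l * ip (\<lambda>x. (-1) * e x) v" if "v \<in> H" for v
      using form_scale_left[OF e(1) that, of "-1"] EL[OF that] by (simp add: ip_def)
    ultimately show ?thesis using that[OF H_scale[OF e(1)] _ n l _ min'] by blast
  qed
qed

text \<open>
  Every state at the lowest level has one sign, so the combination of two of them with mean zero
  vanishes.
\<close>

lemma lowest_eigenvalue_simple:
  assumes e: "e \<in> H" "ip e e = 1" "\<And>v. v \<in> H \<Longrightarrow> form e v = l * ip e v"
    and low: "\<And>v. v \<in> H \<Longrightarrow> l * ip v v \<le> form v v"
    and f: "f \<in> H" "\<And>v. v \<in> H \<Longrightarrow> form f v = l * ip f v" "ip f e = 0"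
  shows "ae_zero f"
proof -
  interpret finite_measure M by (rule finite_M)
  have one: "sq_int M (\<lambda>x. 1)" by (simp add: sq_int_def)
  define a b where "a = ip e (\<lambda>x. 1)" and "b = ip f (\<lambda>x. 1)"
  define h where "h x = b * e x + (- a) * f x" for x
  have h: "h \<in> H" unfolding h_def[abs_def] by (rule H_lin[OF e(1) f(1)])
  have "form h h = b * form e h + (- a) * form f h"
    using form_lin_left[OF e(1) f(1) h, of b "- a"] by (simp add: h_def[abs_def])
  also have "\<dots> = l * (b * ip e h + (- a) * ip f h)" using e(3)[OF h] f(2)[OF h] by (simp add: algebra_simps)
  also have "b * ip e h + (- a) * ip f h = ip h h"
    using ip_lin_left[OF H_D(3)[OF e(1)] H_D(3)[OF f(1)] H_D(3)[OF h], of b "- a"] by (simp add: h_def[abs_def])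
  finally have fh: "form h h = l * ip h h" .
  have "ip h (\<lambda>x. 1) = 0"
    using ip_lin_left[OF H_D(3)[OF e(1)] H_D(3)[OF f(1)] one, of b "- a"] by (simp add: h_def[abs_def] a_def b_def)
  moreover have "ae_zero (pos_part h) \<or> ae_zero (neg_part h)"
    by (rule lowest_state_one_sign[OF h fh]) (rule low)
  ultimately have "ae_zero h" using one_sign_mean_zero[OF h] by blast
  then have "ip h e = 0" by (rule form_ae_zero(2)[OF h _ e(1)])
  then have "b = 0"
    using ip_lin_left[OF H_D(3)[OF e(1)] H_D(3)[OF f(1)] H_D(3)[OF e(1)], of b "- a"] e(2) f(3) by (simp add: h_def[abs_def])
  then have "ip f (\<lambda>x. 1) = 0" by (simp add: b_def)
  moreover have "ae_zero (pos_part f) \<or> ae_zero (neg_part f)"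
    by (rule lowest_state_one_sign[OF f(1) f(2)[OF f(1)]]) (rule low)
  ultimately show "ae_zero f" using one_sign_mean_zero[OF f(1)] by blast
qed

lemma sign_changing_orthogonal_combination:
  assumes u: "u \<in> H" "sign_changing u" and e: "sq_int M e" "AE x in M. 0 \<le> e x"
  obtains t where "0 \<le> t" "t \<le> 1" "ip (\<lambda>x. t * pos_part u x + (1 - t) * neg_part u x) e = 0"
    "\<not> ae_zero (\<lambda>x. t * pos_part u x + (1 - t) * neg_part u x)"
proof -
  note p = H_pos_part[OF u(1)] and q = H_neg_part[OF u(1)]
  define A B where "A = ip (pos_part u) e" and "B = - ip (neg_part u) e"
  have "A \<ge> 0" unfolding A_def ip_def
    by (rule Bochner_Integration.integral_nonneg_AE) (use e(2) in eventually_elim, simp)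
  have "0 \<le> (\<integral>x. - (neg_part u x * e x) \<partial>M)"
  proof (rule Bochner_Integration.integral_nonneg_AE)
    show "AE x in M. 0 \<le> - (neg_part u x * e x)"
      using e(2) by eventually_elim (simp add: mult_nonpos_nonneg)
  qed
  then have "B \<ge> 0" by (simp add: B_def ip_def)
  define t where "t = (if A + B = 0 then 1 else B / (A + B))"
  have t: "0 \<le> t" "t \<le> 1" using \<open>A \<ge> 0\<close> \<open>B \<ge> 0\<close> by (auto simp: t_def divide_le_eq)
  have "t * A = (1 - t) * B"
    using \<open>A \<ge> 0\<close> \<open>B \<ge> 0\<close> by (auto simp: t_def field_simps add_nonneg_eq_0_iff)
  then have o: "ip (\<lambda>x. t * pos_part u x + (1 - t) * neg_part u x) e = 0"
    unfolding ip_lin_left[OF H_D(3)[OF p] H_D(3)[OF q] e(1)] by (simp add: A_def B_def)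
  have "\<not> ae_zero (\<lambda>x. t * pos_part u x + (1 - t) * neg_part u x)"
  proof
    assume "ae_zero (\<lambda>x. t * pos_part u x + (1 - t) * neg_part u x)"
    then have "0 = ip (\<lambda>x. t * pos_part u x + (1 - t) * neg_part u x) (\<lambda>x. t * pos_part u x + (1 - t) * neg_part u x)"
      using ae_zero_iff_ip[OF H_lin[OF p q]] by simp
    also have "\<dots> = t\<^sup>2 * ip (pos_part u) (pos_part u) + (1 - t)\<^sup>2 * ip (neg_part u) (neg_part u)"
      unfolding ip_quadratic[OF H_D(3)[OF p] H_D(3)[OF q]] by (simp add: ip_pos_neg)
    finally have "t\<^sup>2 * ip (pos_part u) (pos_part u) = 0 \<and> (1 - t)\<^sup>2 * ip (neg_part u) (neg_part u) = 0"
      by (simp add: add_nonneg_eq_0_iff ip_nonneg)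
    moreover have "ip (pos_part u) (pos_part u) \<noteq> 0" "ip (neg_part u) (neg_part u) \<noteq> 0"
      using u(2) ae_zero_iff_ip[OF p] ae_zero_iff_ip[OF q] by (auto simp: sign_changing_def)
    ultimately show False by auto
  qed
  with t o show ?thesis by (rule that)
qed

text \<open>
  Minimizing over the orthogonal complement of the first eigenfunction yields an eigenvalue \<open>m\<close>.
  An eigenfunction for any eigenvalue other than the lowest is orthogonal to the first one, so its
  eigenvalue is at least \<open>m\<close>. Exactly one eigenvalue therefore lies strictly below \<open>m\<close>.
\<close>

theorem second_eigenvalue:
  obtains e l where "e \<in> H" "ip e e = 1" "AE x in lebesgue. 0 \<le> e x"
    "\<And>v. v \<in> H \<Longrightarrow> form e v = l * ip e v" "0 < l" "l < eig \<Omega> K V 2"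
    "\<And>v. v \<in> H \<Longrightarrow> l * ip v v \<le> form v v"
    "\<And>v. v \<in> H \<Longrightarrow> ip v e = 0 \<Longrightarrow> eig \<Omega> K V 2 * ip v v \<le> form v v"
proof -
  obtain e l where e: "e \<in> H" "ip e e = 1" "AE x in lebesgue. 0 \<le> e x" and l: "0 < l"
    and EL: "\<And>v. v \<in> H \<Longrightarrow> form e v = l * ip e v" and low: "\<And>v. v \<in> H \<Longrightarrow> l * ip v v \<le> form v v"
    by (rule first_eigenfunction) blast
  have ne: "\<not> ae_zero e" using ae_zero_iff_ip[OF e(1)] e(2) by simp
  have eM: "AE x in M. 0 \<le> e x" unfolding AE_lebesgue_on_iff[OF Omega_sets] using e(3) by eventually_elim simp
  obtain u0 where u0: "u0 \<in> H" "sign_changing u0" using nontrivial by blast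
  obtain t where t: "ip (\<lambda>x. t * pos_part u0 x + (1 - t) * neg_part u0 x) e = 0"
    "\<not> ae_zero (\<lambda>x. t * pos_part u0 x + (1 - t) * neg_part u0 x)"
    using sign_changing_orthogonal_combination[OF u0 H_D(3)[OF e(1)] eM] by blast
  have "\<exists>u\<in>H. ip u e = 0 \<and> \<not> ae_zero u"
    using t H_lin[OF H_pos_part[OF u0(1)] H_neg_part[OF u0(1)]] by blast
  then obtain f where f: "f \<in> H" "ip f e = 0" "ip f f = 1"
    and min: "\<And>u. u \<in> H \<Longrightarrow> ip u e = 0 \<Longrightarrow> form f f * ip u u \<le> form u u"
    by (rule Rayleigh_minimizer_exists[OF H_D(3)[OF e(1)]]) blast
  define m where "m = form f f"
  have nf: "\<not> ae_zero f" using ae_zero_iff_ip[OF f(1)] f(3) by simp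
  \<comment> \<open>The orthogonality constraint costs no multiplier: on the first eigenfunction both sides vanish.\<close>
  have ELf: "form f v = m * ip f v" if v: "v \<in> H" for v
  proof -
    define a where "a = ip v e"
    define z where "z x = 1 * v x + (- a) * e x" for x
    have z: "z \<in> H" unfolding z_def[abs_def] by (rule H_lin[OF v e(1)])
    have "ip z e = 0"
      using ip_lin_left[OF H_D(3)[OF v] H_D(3)[OF e(1)] H_D(3)[OF e(1)], of 1 "- a"] e(2) by (simp add: z_def[abs_def] a_def)
    then have "form f z = m * ip f z"
      unfolding m_def using Rayleigh_Euler_Lagrange[OF f(1,2,3) H_D(3)[OF e(1)] min z] by blast
    moreover have "form f z = form f v - a * form f e"
      using form_lin_right[OF v e(1) f(1), of 1 "- a"] by (simp add: z_def[abs_def])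
    moreover have "form f e = 0" using EL[OF f(1)] f(2) by (simp add: form_sym[of f e] ip_sym[of e f])
    moreover have "ip f z = ip f v - a * ip f e"
      using ip_lin_left[OF H_D(3)[OF v] H_D(3)[OF e(1)] H_D(3)[OF f(1)], of 1 "- a"]
      by (simp add: z_def[abs_def] ip_sym[of f])
    ultimately show ?thesis using f(2) by simp
  qed
  have ev_e: "eigenvalue \<Omega> K V l"
    unfolding eigenvalue_def weak_eigenfunction_iff using e(1) ne EL by blast
  have ev_f: "eigenvalue \<Omega> K V m"
    unfolding eigenvalue_def weak_eigenfunction_iff using f(1) nf ELf by blast
  have "l \<noteq> m"
  proof
    assume "l = m"
    then have "ae_zero f" using lowest_eigenvalue_simple[OF e(1,2) EL low f(1) _ f(2)] ELf by simp
    then show False using nf by simp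
  qed
  have "l \<le> m" using low[OF f(1)] f(3) by (simp add: m_def)
  with \<open>l \<noteq> m\<close> have lm: "l < m" by simp
  have ge: "\<nu> = l \<or> m \<le> \<nu>" if ev: "eigenvalue \<Omega> K V \<nu>" for \<nu>
  proof (rule disjCI)
    assume nm: "\<not> m \<le> \<nu>"
    obtain g where g: "g \<in> H" "\<not> ae_zero g" "\<forall>v\<in>H. form g v = \<nu> * ip g v"
      using ev unfolding eigenvalue_def weak_eigenfunction_iff by blast
    have i: "ip g g > 0" using norm_pos[OF g(1,2)] by (simp add: ip_self)
    show "\<nu> = l"
    proof (rule ccontr)
      assume "\<nu> \<noteq> l"
      have "\<nu> * ip g e = form g e" using g(3) e(1) by simp
      also have "\<dots> = l * ip g e" by (simp only: form_sym[of g e] EL[OF g(1)] ip_sym[of e g])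
      finally have "\<nu> * ip g e = l * ip g e" .
      then have "ip g e = 0" using \<open>\<nu> \<noteq> l\<close> by simp
      then have "m * ip g g \<le> \<nu> * ip g g" using min[OF g(1)] g(1,3) by (simp add: m_def)
      then show False using i nm by simp
    qed
  qed
  have below_m: "{\<nu>. eigenvalue \<Omega> K V \<nu> \<and> \<nu> < m} = {l}" using ge ev_e lm by force
  have "eig \<Omega> K V 2 = m"
    unfolding eig_def
  proof (rule the_equality)
    show "eigenvalue \<Omega> K V m \<and> finite {\<nu>. eigenvalue \<Omega> K V \<nu> \<and> \<nu> < m} \<and> Suc (card {\<nu>. eigenvalue \<Omega> K V \<nu> \<and> \<nu> < m}) = 2"
      using ev_f by (simp add: below_m)
  next
    fix \<mu> assume \<mu>: "eigenvalue \<Omega> K V \<mu> \<and> finite {\<nu>. eigenvalue \<Omega> K V \<nu> \<and> \<nu> < \<mu>} \<and> Suc (card {\<nu>. eigenvalue \<Omega> K V \<nu> \<and> \<nu> < \<mu>}) = 2"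
    show "\<mu> = m"
    proof (rule ccontr)
      assume "\<mu> \<noteq> m"
      then consider "\<mu> = l" | "m < \<mu>" using ge \<mu> by force
      then show False
      proof cases
        case 1
        then have "{\<nu>. eigenvalue \<Omega> K V \<nu> \<and> \<nu> < \<mu>} = {}" using ge lm by force
        then have "card {\<nu>. eigenvalue \<Omega> K V \<nu> \<and> \<nu> < \<mu>} = 0" by (simp only: card.empty)
        then show False using \<mu> by linarith
      next
        case 2
        then have "{l, m} \<subseteq> {\<nu>. eigenvalue \<Omega> K V \<nu> \<and> \<nu> < \<mu>}" using ev_e ev_f lm by auto
        then have "card {l, m} \<le> card {\<nu>. eigenvalue \<Omega> K V \<nu> \<and> \<nu> < \<mu>}" using \<mu> by (intro card_mono) auto
        moreover have "card {l, m} = 2" using lm by simp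
        ultimately show False using \<mu> by linarith
      qed
    qed
  qed
  then show ?thesis using that[OF e EL l _ low] lm min by (simp add: m_def)
qed

lemma eigenspace_iff:
  "v \<in> eigenspace \<Omega> K V 2 \<longleftrightarrow> v \<in> H \<and> (\<forall>\<phi>\<in>H. form v \<phi> = eig \<Omega> K V 2 * ip v \<phi>)"
  by (simp add: eigenspace_def weak_eigenfunction_iff)

lemma eig2_pos: "eig \<Omega> K V 2 > 0"
  by (rule second_eigenvalue) linarith

text \<open>
  A nonnegative function orthogonal to the nonnegative first eigenfunction has disjoint support from
  it. The eigenvalue equation then makes their interaction vanish.
\<close>

lemma second_eigenfunction_sign_changing:
  assumes v: "v \<in> eigenspace \<Omega> K V 2" "\<not> ae_zero v"
  shows "sign_changing v"
proof -
  obtain e l where e: "e \<in> H" "ip e e = 1" "AE x in lebesgue. 0 \<le> e x"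
    and EL: "\<And>v. v \<in> H \<Longrightarrow> form e v = l * ip e v" and l: "l < eig \<Omega> K V 2"
    by (rule second_eigenvalue) blast
  have ne: "\<not> ae_zero e" using ae_zero_iff_ip[OF e(1)] e(2) by simp
  have eM: "AE x in M. 0 \<le> e x" unfolding AE_lebesgue_on_iff[OF Omega_sets] using e(3) by eventually_elim simp
  have nonneg: False if w: "w \<in> H" "\<not> ae_zero w" "AE x in lebesgue. 0 \<le> w x"
    and W: "\<And>\<phi>. \<phi> \<in> H \<Longrightarrow> form w \<phi> = eig \<Omega> K V 2 * ip w \<phi>" for w
  proof -
    have "eig \<Omega> K V 2 * ip e w = form w e" by (simp only: ip_sym[of e w] W[OF e(1)])
    also have "\<dots> = l * ip e w" by (simp only: form_sym[of w e] EL[OF w(1)])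
    finally have "eig \<Omega> K V 2 * ip e w = l * ip e w" .
    then have "(eig \<Omega> K V 2 - l) * ip e w = 0" by (simp add: left_diff_distrib)
    then have 0: "ip e w = 0" using l by simp
    have nn: "AE x in M. 0 \<le> e x * w x"
      unfolding AE_lebesgue_on_iff[OF Omega_sets] using e(3) w(3) by eventually_elim simp
    have "AE x in M. e x * w x = 0"
      using 0 nn sq_int_mult_integrable[OF H_D(3)[OF e(1)] H_D(3)[OF w(1)]]
      unfolding ip_def by (subst (asm) integral_nonneg_eq_0_iff_AE) auto
    then have dM: "AE x in M. V x * e x * w x = 0" by eventually_elim auto
    have d: "AE x in lebesgue. e x * w x = 0"
      using \<open>AE x in M. e x * w x = 0\<close> H_D(2)[OF w(1)] unfolding AE_lebesgue_on_iff[OF Omega_sets]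
      by eventually_elim auto
    have "(\<integral>x. V x * e x * w x \<partial>M) = 0" by (rule integral_eq_zero_AE[OF dM])
    then have "inner e w = 0" using EL[OF w(1)] 0 by (simp add: form_def)
    then show False using inner_disjoint_nonneg(2)[OF e(1) w(1) e(3) w(3) d] ne w(2) by blast
  qed
  have vH: "v \<in> H" and vE: "\<And>\<phi>. \<phi> \<in> H \<Longrightarrow> form v \<phi> = eig \<Omega> K V 2 * ip v \<phi>" using v(1) by (auto simp: eigenspace_iff)
  have "\<not> ae_zero (neg_part v)"
  proof
    assume "ae_zero (neg_part v)"
    then have "AE x in lebesgue. 0 \<le> v x"
      unfolding ae_zero_def by eventually_elim (auto simp: min_def split: if_splits)
    then show False using nonneg[OF vH v(2) _ vE] by blast
  qed
  moreover have "\<not> ae_zero (pos_part v)"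
  proof
    assume "ae_zero (pos_part v)"
    then have n: "AE x in lebesgue. 0 \<le> (-1) * v x"
      unfolding ae_zero_def by eventually_elim (auto simp: max_def split: if_splits)
    have "\<not> ae_zero (\<lambda>x. (-1) * v x)" using v(2) by (simp add: ae_zero_def)
    moreover have "form (\<lambda>x. (-1) * v x) \<phi> = eig \<Omega> K V 2 * ip (\<lambda>x. (-1) * v x) \<phi>" if "\<phi> \<in> H" for \<phi>
      using form_scale_left[OF vH that, of "-1"] vE[OF that] by (simp add: ip_def)
    ultimately show False using nonneg[OF H_scale[OF vH] _ n] by blast
  qed
  ultimately show ?thesis by (simp add: sign_changing_def)
qed

lemma coercive:
  obtains C where "0 < C" "\<And>u. u \<in> H \<Longrightarrow> inner u u \<le> C * form u u"
proof -
  obtain l where l: "0 < l" and low: "\<And>v. v \<in> H \<Longrightarrow> l * ip v v \<le> form v v"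
    by (rule second_eigenvalue) blast
  obtain CV where CV: "CV \<ge> 0" "\<And>u. u \<in> H \<Longrightarrow> inner u u \<le> form u u + CV * ip u u"
    by (rule inner_le_form_plus_L2) blast
  have "inner u u \<le> (1 + CV / l) * form u u" if u: "u \<in> H" for u
  proof -
    have "CV * ip u u \<le> CV * (form u u / l)" using low[OF u] l CV(1) by (intro mult_left_mono) (auto simp: field_simps)
    then have "inner u u \<le> form u u + CV * (form u u / l)" using CV(2)[OF u] by linarith
    then show ?thesis by (simp add: distrib_right)
  qed
  moreover have "0 < 1 + CV / l" using CV(1) l by (simp add: add_pos_nonneg)
  ultimately show ?thesis using that by blast
qed

end

section \<open>Elementary inequalities and a fixed point lemma\<close>

lemma powr_product_le:
  fixes x y :: real
  assumes "0 \<le> x" "0 \<le> y" "0 \<le> a" "0 \<le> b" "a + b \<le> c"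
  shows "x powr a * y powr b \<le> 1 + x powr c + y powr c"
proof -
  define m where "m = max 1 (max x y)"
  have m: "1 \<le> m" "x \<le> m" "y \<le> m" by (auto simp: m_def)
  have "x powr a * y powr b \<le> m powr a * m powr b"
    using assms m by (intro mult_mono powr_mono2) auto
  also have "\<dots> = m powr (a + b)" by (simp add: powr_add)
  also have "\<dots> \<le> m powr c" using m assms by (intro powr_mono) auto
  also have "\<dots> \<le> 1 + x powr c + y powr c" by (auto simp: m_def max_def)
  finally show ?thesis .
qed

lemma fibering_map_le:
  fixes s p :: real
  assumes "0 \<le> s" "2 < p"
  shows "s\<^sup>2 / 2 - s powr p / p \<le> 1 / 2 - 1 / p"
proof (cases "s = 0")
  case True
  then show ?thesis using assms by (simp add: field_simps)
next
  case False
  have "s\<^sup>2 * 1 \<le> (s\<^sup>2) powr (p / 2) / (p / 2) + 1 powr (p / (p - 2)) / (p / (p - 2))"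
    using assms by (intro Youngs_inequality) (auto simp: field_simps)
  moreover have "(s\<^sup>2) powr (p / 2) = s powr p"
    using False assms powr_powr[of s 2 "p / 2"] by simp
  ultimately show ?thesis using assms by (simp add: field_simps)
qed

lemma powr_tangent_le:
  fixes a b p :: real
  assumes p: "2 < p"
  shows "\<bar>a\<bar> powr p + p * (\<bar>a\<bar> powr (p - 2) * a * (b - a)) \<le> \<bar>b\<bar> powr p"
proof (cases "a = 0")
  case False
  have aa: "\<bar>a\<bar> powr (p - 2) * a * a = \<bar>a\<bar> powr p"
    using False by (simp add: powr_diff power2_eq_square)
  have a1: "\<bar>a\<bar> powr (p - 2) * \<bar>a\<bar> = \<bar>a\<bar> powr (p - 1)"
    using False powr_add[of "\<bar>a\<bar>" "p - 2" 1] by simp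
  have "\<bar>b\<bar> * \<bar>a\<bar> powr (p - 1) \<le> \<bar>b\<bar> powr p / p + (\<bar>a\<bar> powr (p - 1)) powr (p / (p - 1)) / (p / (p - 1))"
    using p by (intro Youngs_inequality) (auto simp: field_simps)
  also have "(\<bar>a\<bar> powr (p - 1)) powr (p / (p - 1)) = \<bar>a\<bar> powr p" using p by (simp add: powr_powr)
  finally have y: "p * (\<bar>b\<bar> * \<bar>a\<bar> powr (p - 1)) \<le> \<bar>b\<bar> powr p + (p - 1) * \<bar>a\<bar> powr p"
    using p by (simp add: field_simps)
  have "\<bar>a\<bar> powr (p - 2) * a * b \<le> \<bar>\<bar>a\<bar> powr (p - 2) * a * b\<bar>" by simp
  also have "\<dots> = \<bar>b\<bar> * \<bar>a\<bar> powr (p - 1)" by (simp add: abs_mult a1[symmetric] mult_ac)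
  finally have "p * (\<bar>a\<bar> powr (p - 2) * a * b) \<le> p * (\<bar>b\<bar> * \<bar>a\<bar> powr (p - 1))" using p by (intro mult_left_mono) auto
  then have "p * (\<bar>a\<bar> powr (p - 2) * a * b) \<le> \<bar>b\<bar> powr p + (p - 1) * \<bar>a\<bar> powr p" using y by linarith
  moreover have "\<bar>a\<bar> powr (p - 2) * a * (b - a) = \<bar>a\<bar> powr (p - 2) * a * b - \<bar>a\<bar> powr p"
    by (simp add: right_diff_distrib aa)
  ultimately show ?thesis by (simp add: algebra_simps)
qed simp

text \<open>
  Brouwer's theorem for the displacement \<open>(f, g)\<close> truncated to a square. If \<open>f\<close> and \<open>g\<close> point
  inwards on the respective sides, the point obtained is a common zero.
\<close>

lemma truncated_displacement_fixed_point:
  fixes f g :: "real \<Rightarrow> real \<Rightarrow> real"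
  assumes ab: "a < b"
    and f: "continuous_on ({a..b} \<times> {a..b}) (\<lambda>z. f (fst z) (snd z))"
    and g: "continuous_on ({a..b} \<times> {a..b}) (\<lambda>z. g (fst z) (snd z))"
  obtains s t where "s \<in> {a..b}" "t \<in> {a..b}"
    "s = max a (min b (s + f s t))" "t = max a (min b (t + g s t))"
proof -
  let ?F = "\<lambda>z. (max a (min b (fst z + f (fst z) (snd z))), max a (min b (snd z + g (fst z) (snd z))))"
  have "compact ({a..b} \<times> {a..b})" "convex ({a..b} \<times> {a..b})" "{a..b} \<times> {a..b} \<noteq> {}"
    using ab by (auto intro: compact_Times convex_Times)
  moreover have "continuous_on ({a..b} \<times> {a..b}) ?F"
    by (intro continuous_intros f g)
  moreover have "?F \<in> ({a..b} \<times> {a..b}) \<rightarrow> ({a..b} \<times> {a..b})" using ab by auto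
  ultimately obtain z where z: "z \<in> {a..b} \<times> {a..b}" "?F z = z" by (rule brouwer)
  show ?thesis
  proof (rule that[of "fst z" "snd z"])
    show "fst z \<in> {a..b}" "snd z \<in> {a..b}" using z(1) by auto
    show "fst z = max a (min b (fst z + f (fst z) (snd z)))" using arg_cong[OF z(2), of fst] by simp
    show "snd z = max a (min b (snd z + g (fst z) (snd z)))" using arg_cong[OF z(2), of snd] by simp
  qed
qed

lemma truncated_fixed_pointD:
  fixes s d a b :: real
  assumes "s = max a (min b (s + d))" "a < b"
  shows "a < s \<Longrightarrow> 0 \<le> d" "s < b \<Longrightarrow> d \<le> 0"
  using assms by (auto simp: max_def min_def split: if_splits)

text \<open>
  The two components are the derivatives, multiplied by \<open>s\<close> and \<open>t\<close>, of the energy on the cone of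
  a sign changing function. On a square with a small and a large corner they point inwards because
  \<open>p > 2\<close> and the cross term \<open>c\<close> is nonnegative.
\<close>

lemma two_dimensional_Nehari_point:
  fixes A B a b c l p :: real
  assumes pos: "0 < A" "0 < B" "0 < a" "0 < b" "0 \<le> c" "0 < l" "2 < p"
  obtains s t where "0 < s" "0 < t" "s\<^sup>2 * A + s * t * c = l * (s powr p * a)" "t\<^sup>2 * B + s * t * c = l * (t powr p * b)"
proof -
  define mn mx where "mn = min (A / (l * a)) (B / (l * b))" and "mx = max ((A + c) / (l * a)) ((B + c) / (l * b))"
  have m0: "0 < mn" using pos by (simp add: mn_def)
  have mA: "mn \<le> A / (l * a)" "(A + c) / (l * a) \<le> mx" and mB: "mn \<le> B / (l * b)" "(B + c) / (l * b) \<le> mx"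
    by (auto simp: mn_def mx_def)
  have "A / (l * a) \<le> (A + c) / (l * a)" using pos by (simp add: divide_right_mono)
  then have mM: "mn \<le> mx" using mA by linarith
  have mx0: "0 < mx" using m0 mM by linarith
  define lo hi where "lo = (mn / 2) powr (1 / (p - 2))" and "hi = (2 * mx) powr (1 / (p - 2))"
  have lo: "0 < lo" using m0 by (simp add: lo_def)
  have lohi: "lo < hi" unfolding lo_def hi_def using m0 mM pos by (intro powr_less_mono2) auto
  have root: "(y powr (1 / (p - 2))) powr (p - 2) = y" if "0 < y" for y using that pos by (simp add: powr_powr)
  have plo: "lo powr p = lo\<^sup>2 * (mn / 2)"
  proof -
    have "lo powr (p - 2) = mn / 2" unfolding lo_def by (rule root) (use m0 in simp)
    moreover have "lo powr p = lo powr 2 * lo powr (p - 2)" by (simp flip: powr_add)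
    ultimately show ?thesis using lo by simp
  qed
  have phi: "hi powr p = hi\<^sup>2 * (2 * mx)"
  proof -
    have "hi powr (p - 2) = 2 * mx" unfolding hi_def by (rule root) (use mx0 in simp)
    moreover have "hi powr p = hi powr 2 * hi powr (p - 2)" by (simp flip: powr_add)
    ultimately show ?thesis using lo lohi by simp
  qed
  define f g where "f s t = s\<^sup>2 * A + s * t * c - l * (s powr p * a)" and "g s t = t\<^sup>2 * B + s * t * c - l * (t powr p * b)" for s t
  have "continuous_on ({lo..hi} \<times> {lo..hi}) (\<lambda>z. f (fst z) (snd z))"
    unfolding f_def using lo by (intro continuous_intros) auto
  moreover have "continuous_on ({lo..hi} \<times> {lo..hi}) (\<lambda>z. g (fst z) (snd z))"
    unfolding g_def using lo by (intro continuous_intros) auto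
  ultimately obtain s t where st: "s \<in> {lo..hi}" "t \<in> {lo..hi}"
    and fx: "s = max lo (min hi (s + f s t))" "t = max lo (min hi (t + g s t))"
    by (rule truncated_displacement_fixed_point[OF lohi])
  have low: "0 < lo\<^sup>2 * X + lo * t * c - l * (lo powr p * x)"
    if "0 < X" "0 < x" "mn \<le> X / (l * x)" "lo \<le> t" for X x t
  proof -
    have q: "mn * (l * x) \<le> X" using that pos by (simp add: pos_le_divide_eq)
    have "l * (lo powr p * x) = lo\<^sup>2 * (mn * (l * x)) / 2" unfolding plo by (simp add: mult_ac)
    also have "\<dots> \<le> lo\<^sup>2 * X / 2" using q by (intro divide_right_mono mult_left_mono) auto
    also have "\<dots> < lo\<^sup>2 * X" using lo that by simp
    also have "\<dots> \<le> lo\<^sup>2 * X + lo * t * c" using lo that pos by simp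
    finally show ?thesis by simp
  qed
  have high: "hi\<^sup>2 * X + hi * t * c - l * (hi powr p * x) < 0"
    if "0 < X" "0 < x" "(X + c) / (l * x) \<le> mx" "t \<le> hi" for X x t
  proof -
    have h0: "0 < hi" using lo lohi by simp
    have "hi\<^sup>2 * X + hi * t * c \<le> hi\<^sup>2 * X + hi * hi * c"
      using that pos h0 by (intro add_left_mono mult_right_mono mult_left_mono) auto
    also have "\<dots> = hi\<^sup>2 * (X + c)" by (simp add: power2_eq_square algebra_simps)
    also have "\<dots> < hi\<^sup>2 * (2 * (X + c))" using h0 that pos by simp
    also have "\<dots> = hi\<^sup>2 * (l * x * (2 * ((X + c) / (l * x))))" using that pos by simp
    also have "\<dots> \<le> hi\<^sup>2 * (l * x * (2 * mx))"
      using that pos by (intro mult_left_mono) auto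
    also have "\<dots> = l * (hi powr p * x)" unfolding phi by (simp add: mult_ac)
    finally show ?thesis by simp
  qed
  have "f s t = 0"
  proof (rule antisym)
    show "f s t \<le> 0"
    proof (cases "s < hi")
      case False
      then have "s = hi" using st by simp
      then show ?thesis using high[of A a t] pos st mA by (simp add: f_def)
    qed (rule truncated_fixed_pointD(2)[OF fx(1) lohi])
    show "0 \<le> f s t"
    proof (cases "lo < s")
      case False
      then have "s = lo" using st by simp
      then show ?thesis using low[of A a t] pos st mA by (simp add: f_def)
    qed (rule truncated_fixed_pointD(1)[OF fx(1) lohi])
  qed
  moreover have "g s t = 0"
  proof (rule antisym)
    show "g s t \<le> 0"
    proof (cases "t < hi")
      case False
      then have "t = hi" using st by simp
      then show ?thesis using high[of B b s] pos st mB by (simp add: g_def mult_ac)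
    qed (rule truncated_fixed_pointD(2)[OF fx(2) lohi])
    show "0 \<le> g s t"
    proof (cases "lo < t")
      case False
      then have "t = lo" using st by simp
      then show ?thesis using low[of B b s] pos st mB by (simp add: g_def mult_ac)
    qed (rule truncated_fixed_pointD(1)[OF fx(2) lohi])
  qed
  ultimately show ?thesis using that[of s t] st lo by (simp add: f_def g_def)
qed

text \<open>
  The larger of the two parameters cannot exceed \<open>1\<close> and the smaller one cannot be below it, by the
  sign of the corresponding component.
\<close>

lemma two_dimensional_Nehari_point_unique:
  fixes A B a b c l p s t :: real
  assumes pos: "0 < l * a" "0 < l * b" "0 \<le> c" "2 < p"
    and N: "A + c = l * a" "B + c = l * b"
    and st: "s \<in> {1/2..3/2}" "t \<in> {1/2..3/2}"
    and fx: "s = max (1/2) (min (3/2) (s + (s\<^sup>2 * A + s * t * c - l * (s powr p * a))))"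
      "t = max (1/2) (min (3/2) (t + (t\<^sup>2 * B + s * t * c - l * (t powr p * b))))"
  shows "s = 1" "t = 1"
proof -
  have up: "x \<le> 1" if x: "x \<in> {1/2..3/2}" "y \<le> x" "X + c = l * k" "0 < l * k"
      and f: "x = max (1/2) (min (3/2) (x + (x\<^sup>2 * X + x * y * c - l * (x powr p * k))))" for x y X k
  proof (rule ccontr)
    assume "\<not> x \<le> 1"
    then have x1: "1 < x" by simp
    have "x\<^sup>2 * X + x * y * c \<le> x\<^sup>2 * X + x * x * c"
      using x x1 pos by (intro add_left_mono mult_right_mono mult_left_mono) auto
    also have "\<dots> = x\<^sup>2 * (l * k)" unfolding x(3)[symmetric] by (simp add: power2_eq_square algebra_simps)
    also have "\<dots> < x powr p * (l * k)"
    proof (rule mult_strict_right_mono[OF _ x(4)])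
      have "x powr 2 < x powr p" using x1 pos by (intro powr_less_mono) auto
      then show "x\<^sup>2 < x powr p" using x1 by simp
    qed
    finally have "x\<^sup>2 * X + x * y * c - l * (x powr p * k) < 0" by (simp add: mult_ac)
    moreover have "0 \<le> x\<^sup>2 * X + x * y * c - l * (x powr p * k)"
      by (rule truncated_fixed_pointD(1)[OF f]) (use x1 in auto)
    ultimately show False by simp
  qed
  have low: "1 \<le> x" if x: "x \<in> {1/2..3/2}" "x \<le> y" "X + c = l * k" "0 < l * k"
      and f: "x = max (1/2) (min (3/2) (x + (x\<^sup>2 * X + x * y * c - l * (x powr p * k))))" for x y X k
  proof (rule ccontr)
    assume "\<not> 1 \<le> x"
    then have x1: "x < 1" "0 < x" using x by auto
    have "x powr p * (l * k) < x\<^sup>2 * (l * k)"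
    proof (rule mult_strict_right_mono[OF _ x(4)])
      have "x powr p < x powr 2" using x1 pos by (intro powr_less_mono') auto
      then show "x powr p < x\<^sup>2" using x1 by simp
    qed
    also have "x\<^sup>2 * (l * k) = x\<^sup>2 * X + x * x * c" unfolding x(3)[symmetric] by (simp add: power2_eq_square algebra_simps)
    also have "\<dots> \<le> x\<^sup>2 * X + x * y * c"
      using x x1 pos by (intro add_left_mono mult_right_mono mult_left_mono) auto
    finally have "0 < x\<^sup>2 * X + x * y * c - l * (x powr p * k)" by (simp add: mult_ac)
    moreover have "x\<^sup>2 * X + x * y * c - l * (x powr p * k) \<le> 0"
      by (rule truncated_fixed_pointD(2)[OF f]) (use x1 in auto)
    ultimately show False by simp
  qed
  have fx2: "t = max (1/2) (min (3/2) (t + (t\<^sup>2 * B + t * s * c - l * (t powr p * b))))"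
    using fx(2) by (simp only: mult.commute[of t s])
  have "s = 1 \<and> t = 1"
  proof (cases "t \<le> s")
    case True
    have "s \<le> 1" by (rule up[OF st(1) True N(1) pos(1) fx(1)])
    moreover have "1 \<le> t" by (rule low[OF st(2) True N(2) pos(2) fx2])
    ultimately show ?thesis using True by simp
  next
    case False
    then have ts: "s \<le> t" by simp
    have "t \<le> 1" by (rule up[OF st(2) ts N(2) pos(2) fx2])
    moreover have "1 \<le> s" by (rule low[OF st(1) ts N(1) pos(1) fx(1)])
    ultimately show ?thesis using ts by simp
  qed
  then show "s = 1" "t = 1" by auto
qed

section \<open>Subcritical powers\<close>

context nonlocal_problem begin

definition pw :: "real \<Rightarrow> (real ^ 'n \<Rightarrow> real) \<Rightarrow> real" where
  "pw p u = (\<integral>x. \<bar>u x\<bar> powr p \<partial>M)"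

lemma pw_nonneg: "0 \<le> pw p u" by (simp add: pw_def)

lemma const_int[simp]: "integrable M (\<lambda>x. c :: real)"
proof -
  interpret finite_measure M by (rule finite_M)
  show ?thesis by simp
qed

lemma Sobolev_int: "u \<in> H \<Longrightarrow> integrable M (\<lambda>x. \<bar>u x\<bar> powr (2 + kap))"
  using fractional_Sobolev by metis

lemma mixed_power_int:
  assumes u: "u \<in> H" and v: "v \<in> H" and ab: "0 \<le> a" "0 \<le> b" "a + b \<le> 2 + kap"
  shows "integrable M (\<lambda>x. \<bar>u x\<bar> powr a * \<bar>v x\<bar> powr b)"
proof (rule Bochner_Integration.integrable_bound)
  have [measurable]: "u \<in> borel_measurable M" "v \<in> borel_measurable M" using H_D(5) u v by auto
  show "integrable M (\<lambda>x. 1 + \<bar>u x\<bar> powr (2 + kap) + \<bar>v x\<bar> powr (2 + kap))"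
    using Sobolev_int[OF u] Sobolev_int[OF v] by simp
  show "(\<lambda>x. \<bar>u x\<bar> powr a * \<bar>v x\<bar> powr b) \<in> borel_measurable M" by measurable
  show "AE x in M. norm (\<bar>u x\<bar> powr a * \<bar>v x\<bar> powr b) \<le> norm (1 + \<bar>u x\<bar> powr (2 + kap) + \<bar>v x\<bar> powr (2 + kap))"
    using powr_product_le[OF abs_ge_zero abs_ge_zero ab] by (intro AE_I2) (simp add: abs_mult)
qed

lemma power_int:
  assumes u: "u \<in> H" and q: "0 \<le> q" "q \<le> 2 + kap"
  shows "integrable M (\<lambda>x. \<bar>u x\<bar> powr q)"
proof (rule Bochner_Integration.integrable_bound)
  have [measurable]: "u \<in> borel_measurable M" using H_D(5) u by auto
  show "integrable M (\<lambda>x. 1 + \<bar>u x\<bar> powr (2 + kap) + \<bar>u x\<bar> powr (2 + kap))"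
    using Sobolev_int[OF u] by simp
  show "(\<lambda>x. \<bar>u x\<bar> powr q) \<in> borel_measurable M" by measurable
  show "AE x in M. norm (\<bar>u x\<bar> powr q) \<le> norm (1 + \<bar>u x\<bar> powr (2 + kap) + \<bar>u x\<bar> powr (2 + kap))"
  proof (rule AE_I2)
    fix x
    show "norm (\<bar>u x\<bar> powr q) \<le> norm (1 + \<bar>u x\<bar> powr (2 + kap) + \<bar>u x\<bar> powr (2 + kap))"
      using powr_product_le[of "\<bar>u x\<bar>" "\<bar>u x\<bar>" q 0 "2 + kap"] q by (cases "u x = 0") simp_all
  qed
qed

lemma nonlinear_int:
  assumes u: "u \<in> H" and v: "v \<in> H" and p: "2 < p" "p \<le> 2 + kap"
  shows "integrable M (\<lambda>x. \<bar>u x\<bar> powr (p - 2) * u x * v x)"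
proof (rule Bochner_Integration.integrable_bound)
  have [measurable]: "u \<in> borel_measurable M" "v \<in> borel_measurable M" using H_D(5) u v by auto
  show "integrable M (\<lambda>x. \<bar>u x\<bar> powr (p - 1) * \<bar>v x\<bar> powr 1)"
    by (rule mixed_power_int[OF u v]) (use p in auto)
  show "(\<lambda>x. \<bar>u x\<bar> powr (p - 2) * u x * v x) \<in> borel_measurable M" by measurable
  have "\<bar>y\<bar> powr (p - 2) * \<bar>y\<bar> = \<bar>y\<bar> powr (p - 1)" for y :: real
    using powr_add[of "\<bar>y\<bar>" "p - 2" 1] by (cases "y = 0") simp_all
  then show "AE x in M. norm (\<bar>u x\<bar> powr (p - 2) * u x * v x) \<le> norm (\<bar>u x\<bar> powr (p - 1) * \<bar>v x\<bar> powr 1)"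
    by (intro AE_I2) (auto simp: abs_mult)
qed

lemma pw_scale: "pw p (\<lambda>x. a * u x) = \<bar>a\<bar> powr p * pw p u"
  unfolding pw_def by (simp add: abs_mult powr_mult)

lemma pw_pos:
  assumes u: "u \<in> H" "\<not> ae_zero u" and p: "0 < p" "p \<le> 2 + kap"
  shows "0 < pw p u"
proof (rule ccontr)
  assume "\<not> 0 < pw p u"
  then have "pw p u = 0" using pw_nonneg[of p u] by simp
  then have "AE x in M. \<bar>u x\<bar> powr p = 0"
    using power_int[OF u(1), of p] p unfolding pw_def by (subst (asm) integral_nonneg_eq_0_iff_AE) auto
  then have "AE x in M. u x = 0" by eventually_elim simp
  then show False using u ae_zero_iff_M by blast
qed

lemma pw_ae_zero:
  assumes "u \<in> H" "ae_zero u"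
  shows "pw p u = 0"
proof -
  have "AE x in M. u x = 0" using assms ae_zero_iff_M by blast
  then have "AE x in M. \<bar>u x\<bar> powr p = 0" by eventually_elim simp
  then show ?thesis unfolding pw_def by (rule integral_eq_zero_AE)
qed

lemma powr_interpolation:
  fixes t k L :: real
  assumes "0 \<le> t" "2 \<le> q" "q \<le> 2 + k" "0 < L"
  shows "t powr q \<le> L powr (q - 2) * t\<^sup>2 + L powr (q - 2 - k) * t powr (2 + k)"
proof (cases "t = 0")
  case False
  then have t: "t > 0" using assms by simp
  have "t powr q \<le> L powr (q - 2) * t\<^sup>2 \<or> t powr q \<le> L powr (q - 2 - k) * t powr (2 + k)"
  proof (cases "t \<le> L")
    case True
    have "t powr q = t powr (q - 2) * t powr 2" by (simp flip: powr_add)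
    also have "\<dots> \<le> L powr (q - 2) * t powr 2" using True t assms by (intro mult_right_mono powr_mono2) auto
    finally show ?thesis using t by simp
  next
    case False
    have "t powr q = t powr (q - 2 - k) * t powr (2 + k)" by (simp flip: powr_add)
    also have "\<dots> \<le> L powr (q - 2 - k) * t powr (2 + k)"
      using False t assms by (intro mult_right_mono powr_mono2') auto
    finally show ?thesis by simp
  qed
  moreover have "0 \<le> L powr (q - 2) * t\<^sup>2" "0 \<le> L powr (q - 2 - k) * t powr (2 + k)" by auto
  ultimately show ?thesis by linarith
qed simp

text \<open>
  Interpolation: below a level \<open>L\<close> the power is controlled by the square, above it by the power
  \<open>2 + \<kappa>\<close> with a constant that is small for large \<open>L\<close>.
\<close>

lemma subcritical_convergence:
  fixes v :: "nat \<Rightarrow> real ^ 'n \<Rightarrow> real"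
  assumes v: "\<And>n. v n \<in> H" and R: "\<And>n. inner (v n) (v n) \<le> R" and q: "2 \<le> q" "q < 2 + kap"
    and lim: "(\<lambda>n. \<integral>x. (v n x)\<^sup>2 \<partial>M) \<longlonglongrightarrow> 0"
  shows "(\<lambda>n. pw q (v n)) \<longlonglongrightarrow> 0"
proof (rule LIMSEQ_I)
  fix e :: real assume e: "e > 0"
  obtain C where C: "0 \<le> C" "\<And>u. u \<in> H \<Longrightarrow> integrable M (\<lambda>x. \<bar>u x\<bar> powr (2 + kap)) \<and>
     (\<integral>x. \<bar>u x\<bar> powr (2 + kap) \<partial>M) \<le> C * inner u u powr ((2 + kap) / 2)" by (rule fractional_Sobolev) blast
  define B where "B = C * R powr ((2 + kap) / 2) + 1"
  have B: "B > 0" using C(1) by (simp add: B_def add_nonneg_pos)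
  have vB: "(\<integral>x. \<bar>v n x\<bar> powr (2 + kap) \<partial>M) \<le> B" for n
  proof -
    have "C * inner (v n) (v n) powr ((2 + kap) / 2) \<le> C * R powr ((2 + kap) / 2)"
      using C(1) R kap_pos inner_nonneg by (intro mult_left_mono powr_mono2) auto
    then show ?thesis using C(2)[OF v[of n]] by (simp add: B_def)
  qed
  define g where "g = 2 + kap - q"
  have g: "g > 0" using q by (simp add: g_def)
  define L where "L = (e / (2 * B)) powr (- 1 / g)"
  have L: "L > 0" using e B by (simp add: L_def)
  have LB: "L powr (q - 2 - kap) = e / (2 * B)"
  proof -
    have "q - 2 - kap = - g" by (simp add: g_def)
    then show ?thesis using e B g by (simp add: L_def powr_powr)
  qed
  have "0 < e / (2 * L powr (q - 2))" using e L by simp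
  with lim have "eventually (\<lambda>n. (\<integral>x. (v n x)\<^sup>2 \<partial>M) < e / (2 * L powr (q - 2))) sequentially"
    by (rule order_tendstoD)
  then obtain N where N: "\<And>n. n \<ge> N \<Longrightarrow> (\<integral>x. (v n x)\<^sup>2 \<partial>M) < e / (2 * L powr (q - 2))"
    by (auto simp: eventually_sequentially)
  have "norm (pw q (v n) - 0) < e" if n: "n \<ge> N" for n
  proof -
    have "pw q (v n) \<le> (\<integral>x. L powr (q - 2) * (v n x)\<^sup>2 + L powr (q - 2 - kap) * \<bar>v n x\<bar> powr (2 + kap) \<partial>M)"
      unfolding pw_def
    proof (rule integral_mono)
      show "integrable M (\<lambda>x. \<bar>v n x\<bar> powr q)" using q by (intro power_int v) auto
      show "integrable M (\<lambda>x. L powr (q - 2) * (v n x)\<^sup>2 + L powr (q - 2 - kap) * \<bar>v n x\<bar> powr (2 + kap))"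
        using H_D(6)[OF v] Sobolev_int[OF v] by simp
      show "\<bar>v n x\<bar> powr q \<le> L powr (q - 2) * (v n x)\<^sup>2 + L powr (q - 2 - kap) * \<bar>v n x\<bar> powr (2 + kap)" for x
        using powr_interpolation[of "\<bar>v n x\<bar>" q kap L] q L by simp
    qed
    also have "\<dots> = L powr (q - 2) * (\<integral>x. (v n x)\<^sup>2 \<partial>M) + L powr (q - 2 - kap) * (\<integral>x. \<bar>v n x\<bar> powr (2 + kap) \<partial>M)"
      using H_D(6)[OF v] Sobolev_int[OF v] by simp
    also have "\<dots> \<le> L powr (q - 2) * (\<integral>x. (v n x)\<^sup>2 \<partial>M) + e / (2 * B) * B"
      unfolding LB using vB e B by (intro add_left_mono mult_left_mono) auto
    also have "\<dots> < e / 2 + e / (2 * B) * B" using N[OF n] L by (simp add: field_simps)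
    also have "\<dots> = e" using B by simp
    finally show ?thesis using pw_nonneg[of q "v n"] by simp
  qed
  then show "\<exists>N. \<forall>n\<ge>N. norm (pw q (v n) - 0) < e" by blast
qed

lemma dominated_subsequence:
  fixes v :: "nat \<Rightarrow> real ^ 'n \<Rightarrow> real"
  assumes v: "\<And>n. v n \<in> H" and w: "w \<in> H" and q: "0 \<le> q" "q \<le> 2 + kap"
    and lim: "(\<lambda>n. pw q (\<lambda>x. v n x - w x)) \<longlonglongrightarrow> 0" and q0: "0 < q"
  obtains r g where "strict_mono r" "g \<in> borel_measurable M" "integrable M (\<lambda>x. g x powr q)" "\<And>x. 1 \<le> g x"
    "AE x in M. (\<forall>k. \<bar>v (r k) x\<bar> \<le> g x) \<and> (\<lambda>k. v (r k) x) \<longlonglongrightarrow> w x"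
proof -
  have "integrable M (\<lambda>x. \<bar>v n x - w x\<bar> powr q)" for n using q by (intro power_int H_diff v w) auto
  then obtain r G where r: "strict_mono r" "integrable M G" "\<And>x. 0 \<le> G x"
    "AE x in M. (\<forall>k. \<bar>v (r k) x - w x\<bar> powr q \<le> G x) \<and> (\<lambda>k. \<bar>v (r k) x - w x\<bar> powr q) \<longlonglongrightarrow> 0"
    using L1_dominated_subsequence[of M "\<lambda>n x. \<bar>v n x - w x\<bar> powr q"] lim unfolding pw_def by auto
  define g where "g x = 1 + \<bar>w x\<bar> + G x powr (1 / q)" for x
  have [measurable]: "w \<in> borel_measurable M" "G \<in> borel_measurable M" using H_D(5)[OF w] r(2) by auto
  have gm: "g \<in> borel_measurable M" unfolding g_def by measurable
  have "integrable M (\<lambda>x. g x powr q)"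
  proof (rule Bochner_Integration.integrable_bound)
    show "integrable M (\<lambda>x. 3 powr q * (1 + \<bar>w x\<bar> powr q + G x))"
      using power_int[OF w q] r(2) by simp
    show "(\<lambda>x. g x powr q) \<in> borel_measurable M" using gm by simp
    show "AE x in M. norm (g x powr q) \<le> norm (3 powr q * (1 + \<bar>w x\<bar> powr q + G x))"
    proof (rule AE_I2)
      fix x
      define m where "m = max 1 (max \<bar>w x\<bar> (G x powr (1 / q)))"
      have m: "0 \<le> m" by (auto simp: m_def)
      have "g x \<le> 3 * m" by (simp add: g_def m_def)
      moreover have "0 \<le> g x" by (simp add: g_def)
      ultimately have "g x powr q \<le> (3 * m) powr q" using q by (intro powr_mono2) auto
      also have "\<dots> = 3 powr q * m powr q" using m by (simp add: powr_mult)
      also have "m powr q \<le> 1 + \<bar>w x\<bar> powr q + G x"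
      proof -
        have "(G x powr (1 / q)) powr q = G x" using r(3)[of x] q0 by (simp add: powr_powr)
        then show ?thesis using r(3)[of x] by (auto simp: m_def max_def)
      qed
      finally show "norm (g x powr q) \<le> norm (3 powr q * (1 + \<bar>w x\<bar> powr q + G x))"
        using r(3)[of x] by (simp add: abs_mult)
    qed
  qed
  moreover have "AE x in M. (\<forall>k. \<bar>v (r k) x\<bar> \<le> g x) \<and> (\<lambda>k. v (r k) x) \<longlonglongrightarrow> w x"
    using r(4)
  proof eventually_elim
    case (elim x)
    have root: "(\<bar>y\<bar> powr q) powr (1 / q) = \<bar>y\<bar>" for y :: real using q0 by (simp add: powr_powr)
    have "\<bar>v (r k) x\<bar> \<le> g x" for k
    proof -
      have "(\<bar>v (r k) x - w x\<bar> powr q) powr (1 / q) \<le> G x powr (1 / q)" using elim q0 by (intro powr_mono2) auto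
      then show ?thesis unfolding root g_def by linarith
    qed
    moreover have "(\<lambda>k. v (r k) x) \<longlonglongrightarrow> w x"
    proof -
      have "(\<lambda>k. (\<bar>v (r k) x - w x\<bar> powr q) powr (1 / q)) \<longlonglongrightarrow> 0 powr (1 / q)"
        using elim q0 by (intro tendsto_powr') auto
      then have "(\<lambda>k. \<bar>v (r k) x - w x\<bar>) \<longlonglongrightarrow> 0" unfolding root by simp
      then have "(\<lambda>k. v (r k) x - w x) \<longlonglongrightarrow> 0" by (rule tendsto_rabs_zero_cancel)
      then show ?thesis by (simp add: Lim_null[symmetric])
    qed
    ultimately show ?case by blast
  qed
  moreover have "1 \<le> g x" for x by (simp add: g_def)
  ultimately show ?thesis using that[OF r(1) gm] by blast
qed

end

section \<open>Existence of nodal solutions of low energy\<close>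

context positive_problem begin

abbreviation lam :: real where "lam \<equiv> eig \<Omega> K V 2"

definition J :: "real \<Rightarrow> (real ^ 'n \<Rightarrow> real) \<Rightarrow> real" where
  "J p u = form u u / 2 - lam / p * pw p u"

lemma energy_eq_J: "energy \<Omega> K V p u = J p u"
  by (simp add: energy_eq J_def pw_def)

definition nodal_Nehari :: "real \<Rightarrow> (real ^ 'n \<Rightarrow> real) set" where
  "nodal_Nehari p = {u \<in> H. sign_changing u \<and> form u (pos_part u) = lam * pw p (pos_part u)
     \<and> form u (neg_part u) = lam * pw p (neg_part u)}"

text \<open>
  The cone spanned by the positive and the negative part.
\<close>

definition comb :: "(real ^ 'n \<Rightarrow> real) \<Rightarrow> real \<Rightarrow> real \<Rightarrow> real ^ 'n \<Rightarrow> real" where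
  "comb u \<sigma> t x = \<sigma> * pos_part u x + t * neg_part u x"

lemma comb_H: "u \<in> H \<Longrightarrow> comb u \<sigma> t \<in> H"
  unfolding comb_def[abs_def] by (rule H_lin[OF H_pos_part H_neg_part])

lemma comb_1: "comb u 1 1 = u"
  by (auto simp: comb_def fun_eq_iff max_def min_def)

lemma pos_part_comb: "0 \<le> \<sigma> \<Longrightarrow> 0 \<le> t \<Longrightarrow> pos_part (comb u \<sigma> t) = (\<lambda>x. \<sigma> * pos_part u x)"
  by (auto simp: comb_def fun_eq_iff max_def min_def mult_le_0_iff zero_le_mult_iff intro: antisym)

lemma neg_part_comb: "0 \<le> \<sigma> \<Longrightarrow> 0 \<le> t \<Longrightarrow> neg_part (comb u \<sigma> t) = (\<lambda>x. t * neg_part u x)"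
  by (auto simp: comb_def fun_eq_iff max_def min_def mult_le_0_iff zero_le_mult_iff intro: antisym)

lemma ae_zero_scale: "c \<noteq> 0 \<Longrightarrow> ae_zero (\<lambda>x. c * u x) \<longleftrightarrow> ae_zero u" for c :: real
  by (simp add: ae_zero_def)

lemma sign_changing_comb: "sign_changing u \<Longrightarrow> 0 < \<sigma> \<Longrightarrow> 0 < t \<Longrightarrow> sign_changing (comb u \<sigma> t)"
  using pos_part_comb[of \<sigma> t u] neg_part_comb[of \<sigma> t u]
    ae_zero_scale[of \<sigma> "pos_part u"] ae_zero_scale[of t "neg_part u"]
  by (simp add: sign_changing_def)

lemma form_comb_pos:
  assumes u: "u \<in> H"
  shows "form (comb u \<sigma> t) (pos_part u) = \<sigma> * form (pos_part u) (pos_part u) + t * form (pos_part u) (neg_part u)"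
    and "form (comb u \<sigma> t) (neg_part u) = \<sigma> * form (pos_part u) (neg_part u) + t * form (neg_part u) (neg_part u)"
  using form_lin_left[OF H_pos_part[OF u] H_neg_part[OF u] H_pos_part[OF u], of \<sigma> t]
    form_lin_left[OF H_pos_part[OF u] H_neg_part[OF u] H_neg_part[OF u], of \<sigma> t]
  by (simp_all add: comb_def[abs_def] form_sym[of "neg_part u" "pos_part u"])

lemma form_pos_part_split:
  assumes u: "u \<in> H"
  shows "form u (pos_part u) = form (pos_part u) (pos_part u) + form (pos_part u) (neg_part u)"
    and "form u (neg_part u) = form (pos_part u) (neg_part u) + form (neg_part u) (neg_part u)"
  using form_comb_pos[OF u, of 1 1] by (simp_all add: comb_1)

lemma form_comb:
  assumes u: "u \<in> H"
  shows "form (comb u \<sigma> t) (comb u \<sigma> t) = \<sigma>\<^sup>2 * form (pos_part u) (pos_part u)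
    + 2 * \<sigma> * t * form (pos_part u) (neg_part u) + t\<^sup>2 * form (neg_part u) (neg_part u)"
  using form_quadratic[OF H_pos_part[OF u] H_neg_part[OF u], of \<sigma> t] by (simp add: comb_def[abs_def])

lemma pw_comb:
  assumes u: "u \<in> H" and st: "0 \<le> \<sigma>" "0 \<le> t" and p: "0 < p" "p \<le> 2 + kap"
  shows "pw p (comb u \<sigma> t) = \<sigma> powr p * pw p (pos_part u) + t powr p * pw p (neg_part u)"
proof -
  have "\<bar>comb u \<sigma> t x\<bar> powr p = \<sigma> powr p * \<bar>pos_part u x\<bar> powr p + t powr p * \<bar>neg_part u x\<bar> powr p" for x
  proof (cases "0 \<le> u x")
    case True
    then show ?thesis using st p by (simp add: comb_def abs_mult powr_mult)
  next
    case False
    then show ?thesis using st p powr_mult[of t "- u x" p] by (simp add: comb_def abs_mult)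
  qed
  then show ?thesis
    using power_int[OF H_pos_part[OF u], of p] power_int[OF H_neg_part[OF u], of p] p
    by (simp add: pw_def)
qed

lemma J_comb:
  assumes u: "u \<in> H" and st: "0 \<le> \<sigma>" "0 \<le> t" and p: "0 < p" "p \<le> 2 + kap"
  shows "J p (comb u \<sigma> t) = (\<sigma>\<^sup>2 * form (pos_part u) (pos_part u)
    + 2 * \<sigma> * t * form (pos_part u) (neg_part u) + t\<^sup>2 * form (neg_part u) (neg_part u)) / 2
    - lam / p * (\<sigma> powr p * pw p (pos_part u) + t powr p * pw p (neg_part u))"
  by (simp add: J_def form_comb[OF u] pw_comb[OF assms])

lemma form_parts_pos:
  assumes "u \<in> H" "sign_changing u"
  shows "0 < form (pos_part u) (pos_part u)" "0 < form (neg_part u) (neg_part u)"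
    "0 < form (pos_part u) (neg_part u)"
  using form_pos[OF H_pos_part[OF assms(1)]] form_pos[OF H_neg_part[OF assms(1)]] form_pos_neg[OF assms(1)] assms(2)
  by (auto simp: sign_changing_def order_less_le)

lemma pw_parts_pos:
  assumes "u \<in> H" "sign_changing u" "0 < p" "p \<le> 2 + kap"
  shows "0 < pw p (pos_part u)" "0 < pw p (neg_part u)"
  using pw_pos[OF H_pos_part[OF assms(1)] _ assms(3,4)] pw_pos[OF H_neg_part[OF assms(1)] _ assms(3,4)] assms(2)
  by (auto simp: sign_changing_def)

lemma nodal_Nehari_comb_exists:
  assumes u: "u \<in> H" "sign_changing u" and p: "2 < p" "p \<le> 2 + kap"
  obtains \<sigma> t where "0 < \<sigma>" "0 < t" "comb u \<sigma> t \<in> nodal_Nehari p"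
proof -
  have p0: "0 < p" using p by simp
  obtain \<sigma> t where st: "0 < \<sigma>" "0 < t"
    "\<sigma>\<^sup>2 * form (pos_part u) (pos_part u) + \<sigma> * t * form (pos_part u) (neg_part u) = lam * (\<sigma> powr p * pw p (pos_part u))"
    "t\<^sup>2 * form (neg_part u) (neg_part u) + \<sigma> * t * form (pos_part u) (neg_part u) = lam * (t powr p * pw p (neg_part u))"
    by (rule two_dimensional_Nehari_point[OF form_parts_pos(1,2)[OF u] pw_parts_pos[OF u p0 p(2)] less_imp_le[OF form_parts_pos(3)[OF u]] eig2_pos p(1)])
  have c: "comb u \<sigma> t \<in> H" by (rule comb_H[OF u(1)])
  have "form (comb u \<sigma> t) (pos_part (comb u \<sigma> t)) = \<sigma> * form (comb u \<sigma> t) (pos_part u)"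
    unfolding pos_part_comb[OF less_imp_le[OF st(1)] less_imp_le[OF st(2)]]
    using form_scale_left[OF H_pos_part[OF u(1)] c, of \<sigma>] by (simp add: form_sym[of "comb u \<sigma> t"])
  also have "\<dots> = lam * pw p (pos_part (comb u \<sigma> t))"
    using st by (simp add: form_comb_pos[OF u(1)] pos_part_comb pw_scale power2_eq_square algebra_simps)
  finally have 1: "form (comb u \<sigma> t) (pos_part (comb u \<sigma> t)) = lam * pw p (pos_part (comb u \<sigma> t))" .
  have "form (comb u \<sigma> t) (neg_part (comb u \<sigma> t)) = t * form (comb u \<sigma> t) (neg_part u)"
    unfolding neg_part_comb[OF less_imp_le[OF st(1)] less_imp_le[OF st(2)]]
    using form_scale_left[OF H_neg_part[OF u(1)] c, of t] by (simp add: form_sym[of "comb u \<sigma> t"])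
  also have "\<dots> = lam * pw p (neg_part (comb u \<sigma> t))"
    using st by (simp add: form_comb_pos[OF u(1)] neg_part_comb pw_scale power2_eq_square algebra_simps)
  finally have 2: "form (comb u \<sigma> t) (neg_part (comb u \<sigma> t)) = lam * pw p (neg_part (comb u \<sigma> t))" .
  show ?thesis
    using that[OF st(1,2)] 1 2 c sign_changing_comb[OF u(2) st(1,2)] by (simp add: nodal_Nehari_def)
qed

lemma nodal_NehariD:
  assumes "u \<in> nodal_Nehari p"
  shows "u \<in> H" "sign_changing u"
    "form (pos_part u) (pos_part u) + form (pos_part u) (neg_part u) = lam * pw p (pos_part u)"
    "form (neg_part u) (neg_part u) + form (pos_part u) (neg_part u) = lam * pw p (neg_part u)"
  using assms form_pos_part_split[of u] by (auto simp: nodal_Nehari_def)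

lemma pw_split:
  assumes u: "u \<in> H" and p: "0 < p" "p \<le> 2 + kap"
  shows "pw p u = pw p (pos_part u) + pw p (neg_part u)"
  using pw_comb[OF u _ _ p, of 1 1] by (simp add: comb_1)

lemma form_split:
  assumes u: "u \<in> H"
  shows "form u u = form (pos_part u) (pos_part u) + 2 * form (pos_part u) (neg_part u) + form (neg_part u) (neg_part u)"
  using form_comb[OF u, of 1 1] by (simp add: comb_1)

lemma nodal_Nehari_form:
  assumes "u \<in> nodal_Nehari p" "0 < p" "p \<le> 2 + kap"
  shows "form u u = lam * pw p u" "J p u = (1/2 - 1/p) * form u u"
proof -
  note D = nodal_NehariD[OF assms(1)]
  show *: "form u u = lam * pw p u"
    using D(3,4) by (simp add: form_split[OF D(1)] pw_split[OF D(1) assms(2,3)] distrib_left)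
  have "lam / p * pw p u = form u u / p" unfolding * by simp
  then show "J p u = (1/2 - 1/p) * form u u" by (simp add: J_def left_diff_distrib)
qed

text \<open>
  The cross term enters the fibering map through \<open>- c (\<sigma> - t)\<^sup>2\<close> only, and the remaining one
  variable problems are maximal at \<open>1\<close>. So a point of the nodal Nehari set maximizes the energy
  on its own cone.
\<close>

lemma nodal_Nehari_comb_le:
  assumes u: "u \<in> nodal_Nehari p" and st: "0 \<le> \<sigma>" "0 \<le> t" and p: "2 < p" "p \<le> 2 + kap"
  shows "J p (comb u \<sigma> t) \<le> J p u"
proof -
  note D = nodal_NehariD[OF u]
  define A B c a b where "A = form (pos_part u) (pos_part u)" and "B = form (neg_part u) (neg_part u)"
    and "c = form (pos_part u) (neg_part u)" and "a = pw p (pos_part u)" and "b = pw p (neg_part u)"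
  have N: "A = lam * a - c" "B = lam * b - c" using D(3,4) by (simp_all add: A_def B_def c_def a_def b_def)
  have c: "0 \<le> c" using form_pos_neg(1)[OF D(1)] by (simp add: c_def)
  have ab: "0 \<le> lam * a" "0 \<le> lam * b" using eig2_pos by (auto simp: a_def b_def pw_nonneg)
  have "J p (comb u \<sigma> t) = (\<sigma>\<^sup>2 * A + 2 * \<sigma> * t * c + t\<^sup>2 * B) / 2 - lam / p * (\<sigma> powr p * a + t powr p * b)"
    unfolding A_def B_def c_def a_def b_def using p by (intro J_comb[OF D(1) st]) auto
  also have "\<dots> = lam * a * (\<sigma>\<^sup>2 / 2 - \<sigma> powr p / p) + lam * b * (t\<^sup>2 / 2 - t powr p / p) - c * (\<sigma> - t)\<^sup>2 / 2"
    using p by (simp add: N power2_eq_square field_simps)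
  also have "\<dots> \<le> lam * a * (1/2 - 1/p) + lam * b * (1/2 - 1/p) - 0"
    by (intro diff_mono add_mono mult_left_mono fibering_map_le st p ab) (use c in auto)
  also have "\<dots> = J p u"
    using nodal_Nehari_form[OF u _ p(2)] p pw_split[OF D(1) _ p(2)] by (simp add: a_def b_def algebra_simps)
  finally show ?thesis .
qed

lemma subcritical_embedding:
  obtains C where "0 < C" "\<And>p u. u \<in> H \<Longrightarrow> 2 \<le> p \<Longrightarrow> p \<le> 2 + kap \<Longrightarrow> pw p u \<le> C * form u u powr (p / 2)"
proof -
  obtain C1 where C1: "0 < C1" "\<And>u. u \<in> H \<Longrightarrow> inner u u \<le> C1 * form u u" by (rule coercive) blast
  obtain C2 where C2: "0 < C2" "\<And>u. u \<in> H \<Longrightarrow> (\<integral>x. (u x)\<^sup>2 \<partial>M) \<le> C2 * inner u u" by (rule Poincare) blast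
  obtain C3 where C3: "0 \<le> C3" "\<And>u. u \<in> H \<Longrightarrow> integrable M (\<lambda>x. \<bar>u x\<bar> powr (2 + kap)) \<and>
     (\<integral>x. \<bar>u x\<bar> powr (2 + kap) \<partial>M) \<le> C3 * inner u u powr ((2 + kap) / 2)" by (rule fractional_Sobolev) blast
  define C where "C = C2 * C1 + C3 * C1 powr ((2 + kap) / 2)"
  have C: "C > 0" using C1(1) C2(1) C3(1) by (simp add: C_def add_pos_nonneg)
  have "pw p u \<le> C * form u u powr (p / 2)" if u: "u \<in> H" and p: "2 \<le> p" "p \<le> 2 + kap" for p u
  proof (cases "ae_zero u")
    case True
    then have "pw p u = 0" by (rule pw_ae_zero[OF u])
    then show ?thesis using C by simp
  next
    case False
    then have f: "form u u > 0" by (rule form_pos[OF u])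
    define a where "a = sqrt (form u u)"
    have a: "a > 0" using f by (simp add: a_def)
    define v where "v x = (1 / a) * u x" for x
    have v: "v \<in> H" unfolding v_def[abs_def] by (rule H_scale[OF u])
    have "form v v = 1" unfolding v_def[abs_def] form_scale[OF u] using f by (simp add: a_def power_divide)
    then have i: "inner v v \<le> C1" using C1(2)[OF v] by simp
    have "pw p v \<le> (\<integral>x. (v x)\<^sup>2 + \<bar>v x\<bar> powr (2 + kap) \<partial>M)"
      unfolding pw_def
    proof (rule integral_mono)
      show "integrable M (\<lambda>x. \<bar>v x\<bar> powr p)" using p by (intro power_int v) auto
      show "integrable M (\<lambda>x. (v x)\<^sup>2 + \<bar>v x\<bar> powr (2 + kap))" using H_D(6)[OF v] Sobolev_int[OF v] by simp
      show "\<bar>v x\<bar> powr p \<le> (v x)\<^sup>2 + \<bar>v x\<bar> powr (2 + kap)" for x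
        using powr_interpolation[of "\<bar>v x\<bar>" p kap 1] p by simp
    qed
    also have "\<dots> = (\<integral>x. (v x)\<^sup>2 \<partial>M) + (\<integral>x. \<bar>v x\<bar> powr (2 + kap) \<partial>M)"
      using H_D(6)[OF v] Sobolev_int[OF v] by simp
    also have "\<dots> \<le> C2 * C1 + C3 * C1 powr ((2 + kap) / 2)"
    proof (rule add_mono)
      have "C2 * inner v v \<le> C2 * C1" using i C2(1) by (intro mult_left_mono) auto
      then show "(\<integral>x. (v x)\<^sup>2 \<partial>M) \<le> C2 * C1" using C2(2)[OF v] by linarith
      have "C3 * inner v v powr ((2 + kap) / 2) \<le> C3 * C1 powr ((2 + kap) / 2)"
        using i C3(1) inner_nonneg kap_pos by (intro mult_left_mono powr_mono2) auto
      then show "(\<integral>x. \<bar>v x\<bar> powr (2 + kap) \<partial>M) \<le> C3 * C1 powr ((2 + kap) / 2)" using C3(2)[OF v] by linarith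
    qed
    finally have pv: "pw p v \<le> C" by (simp add: C_def)
    have "u = (\<lambda>x. a * v x)" using a by (simp add: v_def)
    then have "pw p u = a powr p * pw p v" using a pw_scale[of p a v] by simp
    also have "\<dots> \<le> a powr p * C" using pv by (rule mult_left_mono) simp
    also have "a powr p = form u u powr (p / 2)" using f by (simp add: a_def powr_half_sqrt[symmetric] powr_powr)
    finally show ?thesis by (simp add: mult.commute)
  qed
  with C show ?thesis by (rule that)
qed

text \<open>Since \<open>p > 2\<close>, the parts of a point of the nodal Nehari set cannot be small.\<close>

lemma nodal_Nehari_lower_bound:
  assumes p: "2 < p" "p \<le> 2 + kap"
  obtains \<delta> where "0 < \<delta>" "\<And>u. u \<in> nodal_Nehari p \<Longrightarrow> \<delta> \<le> pw p (pos_part u) \<and> \<delta> \<le> pw p (neg_part u)"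
proof -
  obtain C where C: "0 < C" "\<And>p u. u \<in> H \<Longrightarrow> 2 \<le> p \<Longrightarrow> p \<le> 2 + kap \<Longrightarrow> pw p u \<le> C * form u u powr (p / 2)"
    by (rule subcritical_embedding) blast
  have l: "lam > 0" by (rule eig2_pos)
  define \<alpha> where "\<alpha> = (1 / (lam * C)) powr (2 / (p - 2))"
  have \<alpha>: "\<alpha> > 0" using l C(1) by (simp add: \<alpha>_def)
  have key: "\<alpha> / lam \<le> pw p v" if v: "v \<in> H" "0 < form v v" "form v v \<le> lam * pw p v" for v
  proof -
    have "form v v \<le> lam * (C * form v v powr (p / 2))"
      using v C(2)[OF v(1), of p] p l mult_left_mono[of "pw p v" "C * form v v powr (p / 2)" lam] by linarith
    also have "form v v powr (p / 2) = form v v * form v v powr ((p - 2) / 2)"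
      using v(2) powr_add[of "form v v" 1 "(p - 2) / 2"] by (simp add: field_simps)
    finally have "1 \<le> lam * C * form v v powr ((p - 2) / 2)" using v(2) by (simp add: mult_ac)
    then have "1 / (lam * C) \<le> form v v powr ((p - 2) / 2)" using l C(1) by (simp add: field_simps)
    then have "\<alpha> \<le> (form v v powr ((p - 2) / 2)) powr (2 / (p - 2))"
      unfolding \<alpha>_def using l C(1) p by (intro powr_mono2) auto
    also have "\<dots> = form v v"
    proof -
      have e1: "(p - 2) / 2 * (2 / (p - 2)) = 1" using p by simp
      have "(form v v powr ((p - 2) / 2)) powr (2 / (p - 2)) = form v v powr ((p - 2) / 2 * (2 / (p - 2)))"
        by (rule powr_powr)
      also have "\<dots> = form v v" unfolding e1 using v(2) by simp
      finally show ?thesis .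
    qed
    finally show ?thesis using v(3) l by (simp add: pos_divide_le_eq mult.commute)
  qed
  have "\<alpha> / lam \<le> pw p (pos_part u) \<and> \<alpha> / lam \<le> pw p (neg_part u)" if u: "u \<in> nodal_Nehari p" for u
  proof -
    note D = nodal_NehariD[OF u]
    have c: "0 \<le> form (pos_part u) (neg_part u)" by (rule form_pos_neg(1)[OF D(1)])
    show ?thesis
      using key[OF H_pos_part[OF D(1)] form_parts_pos(1)[OF D(1,2)]] key[OF H_neg_part[OF D(1)] form_parts_pos(2)[OF D(1,2)]]
        D(3,4) c by linarith
  qed
  moreover have "0 < \<alpha> / lam" using \<alpha> l by simp
  ultimately show ?thesis by (rule that[rotated])
qed

text \<open>
  Transfers \<open>L\<^sup>2\<close> convergence to images under Lipschitz maps such as the positive part.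
\<close>

lemma L2_contraction_tendsto:
  fixes v :: "nat \<Rightarrow> real ^ 'n \<Rightarrow> real"
  assumes v: "\<And>n. v n \<in> H" and w: "w \<in> H" and lim: "(\<lambda>n. \<integral>x. (v n x - w x)\<^sup>2 \<partial>M) \<longlonglongrightarrow> 0"
    and f: "\<And>n. f n \<in> H" "g \<in> H" and le: "\<And>n x. \<bar>f n x - g x\<bar> \<le> c * \<bar>v n x - w x\<bar>"
  shows "(\<lambda>n. \<integral>x. (f n x - g x)\<^sup>2 \<partial>M) \<longlonglongrightarrow> 0"
proof (rule tendsto_sandwich[OF _ _ tendsto_const])
  show "\<forall>\<^sub>F n in sequentially. 0 \<le> (\<integral>x. (f n x - g x)\<^sup>2 \<partial>M)" by simp
  show "\<forall>\<^sub>F n in sequentially. (\<integral>x. (f n x - g x)\<^sup>2 \<partial>M) \<le> c\<^sup>2 * (\<integral>x. (v n x - w x)\<^sup>2 \<partial>M)"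
  proof (intro always_eventually allI)
    fix n
    have "(\<integral>x. (f n x - g x)\<^sup>2 \<partial>M) \<le> (\<integral>x. c\<^sup>2 * (v n x - w x)\<^sup>2 \<partial>M)"
    proof (rule integral_mono)
      show "integrable M (\<lambda>x. (f n x - g x)\<^sup>2)" by (rule H_D(6)[OF H_diff[OF f]])
      show "integrable M (\<lambda>x. c\<^sup>2 * (v n x - w x)\<^sup>2)" using H_D(6)[OF H_diff[OF v w]] by simp
      fix x
      have "\<bar>f n x - g x\<bar>\<^sup>2 \<le> (c * \<bar>v n x - w x\<bar>)\<^sup>2" by (rule power_mono[OF le]) simp
      then show "(f n x - g x)\<^sup>2 \<le> c\<^sup>2 * (v n x - w x)\<^sup>2" by (simp add: power_mult_distrib)
    qed
    then show "(\<integral>x. (f n x - g x)\<^sup>2 \<partial>M) \<le> c\<^sup>2 * (\<integral>x. (v n x - w x)\<^sup>2 \<partial>M)" by simp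
  qed
  show "(\<lambda>n. c\<^sup>2 * (\<integral>x. (v n x - w x)\<^sup>2 \<partial>M)) \<longlonglongrightarrow> 0"
    using tendsto_mult_left[OF lim, of "c\<^sup>2"] by simp
qed

lemma pw_parts_tendsto:
  fixes v :: "nat \<Rightarrow> real ^ 'n \<Rightarrow> real"
  assumes v: "\<And>n. v n \<in> H" and w: "w \<in> H" and p: "0 < p" "p \<le> 2 + kap"
    and g: "g \<in> borel_measurable M" "integrable M (\<lambda>x. g x powr p)"
    and ae: "AE x in M. (\<forall>k. \<bar>v k x\<bar> \<le> g x) \<and> (\<lambda>k. v k x) \<longlonglongrightarrow> w x"
  shows "(\<lambda>n. pw p (pos_part (v n))) \<longlonglongrightarrow> pw p (pos_part w)"
    and "(\<lambda>n. pw p (neg_part (v n))) \<longlonglongrightarrow> pw p (neg_part w)"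
    and "(\<lambda>n. pw p (v n)) \<longlonglongrightarrow> pw p w"
proof -
  have *: "(\<lambda>n. pw p (\<lambda>x. f (v n x))) \<longlonglongrightarrow> pw p (\<lambda>x. f (w x))"
    if f: "continuous_on UNIV f" "\<And>y. \<bar>f y\<bar> \<le> \<bar>y\<bar>" for f
    unfolding pw_def
  proof (rule integral_dominated_convergence[OF _ _ g(2)])
    have [measurable]: "f \<in> borel_measurable borel" by (rule borel_measurable_continuous_onI[OF f(1)])
    have [measurable]: "v n \<in> borel_measurable M" "w \<in> borel_measurable M" for n using H_D(5) v w by auto
    show "(\<lambda>x. \<bar>f (w x)\<bar> powr p) \<in> borel_measurable M" "\<And>n. (\<lambda>x. \<bar>f (v n x)\<bar> powr p) \<in> borel_measurable M"
      by measurable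
    show "AE x in M. (\<lambda>n. \<bar>f (v n x)\<bar> powr p) \<longlonglongrightarrow> \<bar>f (w x)\<bar> powr p"
      using ae
    proof eventually_elim
      case (elim x)
      have "(\<lambda>n. f (v n x)) \<longlonglongrightarrow> f (w x)"
        using continuous_on_tendsto_compose[OF f(1), of "\<lambda>n. v n x" "w x"] elim by simp
      then show ?case using p by (intro tendsto_powr' tendsto_rabs tendsto_const) auto
    qed
    show "AE x in M. norm (\<bar>f (v n x)\<bar> powr p) \<le> g x powr p" for n
      using ae
    proof eventually_elim
      case (elim x)
      have "\<bar>f (v n x)\<bar> \<le> g x" using f(2)[of "v n x"] elim order_trans by blast
      then show ?case using p by (simp add: powr_mono2)
    qed
  qed
  show "(\<lambda>n. pw p (pos_part (v n))) \<longlonglongrightarrow> pw p (pos_part w)"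
    by (rule *[of "\<lambda>y. max y 0"]) (auto intro: continuous_intros)
  show "(\<lambda>n. pw p (neg_part (v n))) \<longlonglongrightarrow> pw p (neg_part w)"
    by (rule *[of "\<lambda>y. min y 0"]) (auto intro: continuous_intros)
  show "(\<lambda>n. pw p (v n)) \<longlonglongrightarrow> pw p w"
    by (rule *[of "\<lambda>y. y"]) auto
qed

text \<open>
  A minimizing sequence converges in the subcritical Lebesgue spaces; its limit need not lie in
  the nodal Nehari set, but the point of the set on the cone of the limit has no larger energy,
  because the form is lower semicontinuous along the corresponding combinations.
\<close>

lemma nodal_Nehari_minimizer_exists:
  assumes p: "2 < p" "p < 2 + kap"
  obtains z where "z \<in> nodal_Nehari p" "\<And>w. w \<in> nodal_Nehari p \<Longrightarrow> J p z \<le> J p w"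
proof -
  have p': "p \<le> 2 + kap" "0 < p" "2 \<le> p" using p by auto
  have k: "0 < 1/2 - 1/p" using p by (simp add: field_simps)
  define S where "S = J p ` nodal_Nehari p"
  obtain u0 where u0: "u0 \<in> H" "sign_changing u0" using nontrivial by blast
  obtain s0 t0 where "comb u0 s0 t0 \<in> nodal_Nehari p" using nodal_Nehari_comb_exists[OF u0 p(1) p'(1)] by blast
  then have Sne: "S \<noteq> {}" by (auto simp: S_def)
  have "0 \<le> J p u" if u: "u \<in> nodal_Nehari p" for u
    using nodal_Nehari_form(2)[OF u p'(2,1)] k form_nonneg[OF nodal_NehariD(1)[OF u]] by simp
  then have bdd: "bdd_below S" by (intro bdd_belowI[of S 0]) (auto simp: S_def)
  define m where "m = Inf S"
  have "\<exists>u. u \<in> nodal_Nehari p \<and> J p u \<le> m + 1 / real (Suc n)" for n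
  proof -
    have "Inf S < m + 1 / real (Suc n)" by (simp add: m_def)
    then obtain y where "y \<in> S" "y < m + 1 / real (Suc n)" using cInf_lessD[OF Sne] by blast
    then show ?thesis by (auto simp: S_def intro: less_imp_le)
  qed
  then obtain u where u: "\<And>n. u n \<in> nodal_Nehari p" and Ju: "\<And>n. J p (u n) \<le> m + 1 / real (Suc n)" by metis
  have uH: "u n \<in> H" for n by (rule nodal_NehariD(1)[OF u])
  obtain C1 where C1: "0 < C1" "\<And>u. u \<in> H \<Longrightarrow> inner u u \<le> C1 * form u u" by (rule coercive) blast
  define R where "R = C1 * ((m + 1) / (1/2 - 1/p))"
  have bd: "inner (u n) (u n) \<le> R" for n
  proof -
    have "1 / real (Suc n) \<le> 1" by simp
    then have "J p (u n) \<le> m + 1" using Ju[of n] by linarith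
    then have "form (u n) (u n) \<le> (m + 1) / (1/2 - 1/p)"
      using k by (simp only: nodal_Nehari_form(2)[OF u p'(2,1)] pos_le_divide_eq[OF k] mult.commute)
    then have "C1 * form (u n) (u n) \<le> R" unfolding R_def using C1(1) by (intro mult_left_mono) auto
    then show ?thesis using C1(2)[OF uH[of n]] by linarith
  qed
  obtain r w where r: "strict_mono r" "w \<in> H" "inner w w \<le> R"
    "(\<lambda>n. \<integral>x. (u (r n) x - w x)\<^sup>2 \<partial>M) \<longlonglongrightarrow> 0"
    by (rule Rellich[of u, OF uH bd]) blast
  have "(\<lambda>n. pw p (\<lambda>x. u (r n) x - w x)) \<longlonglongrightarrow> 0"
    by (rule subcritical_convergence[OF H_diff[OF uH r(2)] inner_diff_le[OF uH r(2) bd r(3)] p'(3) p(2) r(4)])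
  then obtain r' g where r': "strict_mono r'" "g \<in> borel_measurable M" "integrable M (\<lambda>x. g x powr p)"
    "AE x in M. (\<forall>k. \<bar>u (r (r' k)) x\<bar> \<le> g x) \<and> (\<lambda>k. u (r (r' k)) x) \<longlonglongrightarrow> w x"
    using dominated_subsequence[of "\<lambda>n. u (r n)", OF uH r(2) less_imp_le[OF p'(2)] p'(1) _ p'(2)] by blast
  define v where "v n = u (r (r' n))" for n
  have v: "v n \<in> nodal_Nehari p" "v n \<in> H" for n using u uH by (auto simp: v_def)
  have Jv: "J p (v n) \<le> m + 1 / real (Suc n)" for n
  proof -
    have "n \<le> r (r' n)" using seq_suble[OF r(1), of "r' n"] seq_suble[OF r'(1), of n] by linarith
    then have "1 / real (Suc (r (r' n))) \<le> 1 / real (Suc n)" by (simp add: frac_le)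
    then show ?thesis using Ju[of "r (r' n)"] by (simp add: v_def)
  qed
  have l2: "(\<lambda>n. \<integral>x. (v n x - w x)\<^sup>2 \<partial>M) \<longlonglongrightarrow> 0"
    using LIMSEQ_subseq_LIMSEQ[OF r(4) r'(1)] by (simp add: v_def o_def)
  have ae: "AE x in M. (\<forall>k. \<bar>v k x\<bar> \<le> g x) \<and> (\<lambda>k. v k x) \<longlonglongrightarrow> w x"
    using r'(4) by (simp add: v_def)
  note pwl = pw_parts_tendsto[OF v(2) r(2) p'(2,1) r'(2,3) ae]
  obtain \<delta> where \<delta>: "0 < \<delta>" "\<And>u. u \<in> nodal_Nehari p \<Longrightarrow> \<delta> \<le> pw p (pos_part u) \<and> \<delta> \<le> pw p (neg_part u)"
    by (rule nodal_Nehari_lower_bound[OF p(1) p'(1)]) blast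
  have "\<delta> \<le> pw p (pos_part w)" by (rule LIMSEQ_le_const[OF pwl(1)]) (use \<delta>(2)[OF v(1)] in auto)
  moreover have "\<delta> \<le> pw p (neg_part w)" by (rule LIMSEQ_le_const[OF pwl(2)]) (use \<delta>(2)[OF v(1)] in auto)
  moreover note pw_ae_zero[of _ p]
  ultimately have sc: "sign_changing w"
    using \<delta>(1) H_pos_part[OF r(2)] H_neg_part[OF r(2)] by (fastforce simp: sign_changing_def)
  obtain \<sigma> t where st: "0 < \<sigma>" "0 < t" "comb w \<sigma> t \<in> nodal_Nehari p"
    by (rule nodal_Nehari_comb_exists[OF r(2) sc p(1) p'(1)])
  have st0: "0 \<le> \<sigma>" "0 \<le> t" using st by auto
  have "J p (comb w \<sigma> t) \<le> m"
  proof -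
    define q where "q n = lam / p * pw p (comb (v n) \<sigma> t)" for n
    have ql: "q \<longlonglongrightarrow> lam / p * pw p (comb w \<sigma> t)"
      unfolding q_def pw_comb[OF v(2) st0 p'(2,1)] pw_comb[OF r(2) st0 p'(2,1)]
      by (intro tendsto_intros pwl)
    have fle: "form (comb (v n) \<sigma> t) (comb (v n) \<sigma> t) \<le> 2 * (m + 1 / real (Suc n) + q n)" for n
      using nodal_Nehari_comb_le[OF v(1) st0 p(1) p'(1), of n] Jv[of n] by (simp add: J_def q_def)
    have lim: "(\<lambda>n. 2 * (m + 1 / real (Suc n) + q n)) \<longlonglongrightarrow> 2 * (m + 0 + lam / p * pw p (comb w \<sigma> t))"
      by (intro tendsto_intros ql LIMSEQ_Suc[OF lim_1_over_n])
    have aec: "AE x in M. (\<lambda>n. comb (v n) \<sigma> t x) \<longlonglongrightarrow> comb w \<sigma> t x"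
      using ae by eventually_elim (auto simp: comb_def intro!: tendsto_intros)
    have l2c: "(\<lambda>n. \<integral>x. (comb (v n) \<sigma> t x - comb w \<sigma> t x)\<^sup>2 \<partial>M) \<longlonglongrightarrow> 0"
    proof (rule L2_contraction_tendsto[OF v(2) r(2) l2 comb_H[OF v(2)] comb_H[OF r(2)]])
      fix n x
      have a: "\<bar>\<sigma> * (max a 0 - max b 0) + t * (min a 0 - min b 0)\<bar> \<le> (\<sigma> + t) * \<bar>a - b\<bar>" for a b :: real
      proof -
        have "\<bar>\<sigma> * (max a 0 - max b 0) + t * (min a 0 - min b 0)\<bar> \<le> \<sigma> * \<bar>max a 0 - max b 0\<bar> + t * \<bar>min a 0 - min b 0\<bar>"
          using st0 abs_triangle_ineq[of "\<sigma> * (max a 0 - max b 0)" "t * (min a 0 - min b 0)"] by (simp add: abs_mult)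
        also have "\<dots> \<le> \<sigma> * \<bar>a - b\<bar> + t * \<bar>a - b\<bar>" using st0 by (intro add_mono mult_left_mono) auto
        finally show ?thesis by (simp add: distrib_right)
      qed
      show "\<bar>comb (v n) \<sigma> t x - comb w \<sigma> t x\<bar> \<le> (\<sigma> + t) * \<bar>v n x - w x\<bar>"
        using a[of "v n x" "w x"] by (simp add: comb_def algebra_simps)
    qed
    have "form (comb w \<sigma> t) (comb w \<sigma> t) \<le> 2 * (m + 0 + lam / p * pw p (comb w \<sigma> t))"
      by (rule form_lower_semicontinuous[OF comb_H[OF v(2)] comb_H[OF r(2)] aec l2c fle lim])
    then show ?thesis by (simp add: J_def)
  qed
  then have "J p (comb w \<sigma> t) \<le> J p y" if "y \<in> nodal_Nehari p" for y
    using cInf_lower[OF _ bdd, of "J p y"] that by (force simp: S_def m_def)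
  then show ?thesis by (rule that[OF st(3)])
qed

text \<open>
  A perturbation of a point of a cone by a multiple of an arbitrary direction. All quantities
  entering the nodal constraints are continuous in the three parameters, by dominated convergence.
\<close>

definition pert :: "(real ^ 'n \<Rightarrow> real) \<Rightarrow> (real ^ 'n \<Rightarrow> real) \<Rightarrow> real \<Rightarrow> real \<Rightarrow> real \<Rightarrow> real ^ 'n \<Rightarrow> real" where
  "pert z \<phi> a b e x = comb z a b x + e * \<phi> x"

lemma pert_H: "z \<in> H \<Longrightarrow> \<phi> \<in> H \<Longrightarrow> pert z \<phi> a b e \<in> H"
  unfolding pert_def[abs_def] using H_lin[of "comb z a b" \<phi> 1 e] comb_H[of z a b] by simp

lemma pert_0: "pert z \<phi> a b 0 = comb z a b"
  by (simp add: pert_def fun_eq_iff)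

lemma pert_tendsto:
  fixes a b e :: "nat \<Rightarrow> real"
  assumes z: "z \<in> H" and \<phi>: "\<phi> \<in> H" and p: "2 < p" "p \<le> 2 + kap"
    and lim: "a \<longlonglongrightarrow> a'" "b \<longlonglongrightarrow> b'" "e \<longlonglongrightarrow> e'"
    and bd: "\<And>k. \<bar>a k\<bar> \<le> 2" "\<And>k. \<bar>b k\<bar> \<le> 2" "\<And>k. \<bar>e k\<bar> \<le> 1"
  defines "h \<equiv> \<lambda>k. pert z \<phi> (a k) (b k) (e k)" and "h' \<equiv> pert z \<phi> a' b' e'"
  shows "(\<lambda>k. form (h k) (pos_part (h k))) \<longlonglongrightarrow> form h' (pos_part h')"
    "(\<lambda>k. form (h k) (neg_part (h k))) \<longlonglongrightarrow> form h' (neg_part h')"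
    "(\<lambda>k. pw p (pos_part (h k))) \<longlonglongrightarrow> pw p (pos_part h')"
    "(\<lambda>k. pw p (neg_part (h k))) \<longlonglongrightarrow> pw p (neg_part h')"
    "(\<lambda>k. form (h k) \<phi>) \<longlonglongrightarrow> form h' \<phi>"
    "(\<lambda>k. \<integral>x. \<bar>h k x\<bar> powr (p - 2) * h k x * \<phi> x \<partial>M) \<longlonglongrightarrow> (\<integral>x. \<bar>h' x\<bar> powr (p - 2) * h' x * \<phi> x \<partial>M)"
proof -
  have hH: "h k \<in> H" "h' \<in> H" for k unfolding h_def h'_def by (intro pert_H z \<phi>)+
  define g where "g x = 4 * \<bar>z x\<bar> + 1 * \<bar>\<phi> x\<bar>" for x
  have absH: "(\<lambda>x. \<bar>v x\<bar>) \<in> H" if "v \<in> H" for v by (rule H_contraction(1)[OF that, of abs]) auto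
  have gH: "g \<in> H" unfolding g_def[abs_def] by (intro H_lin absH z \<phi>)
  have g0: "0 \<le> g x" for x by (simp add: g_def)
  have ptl: "(\<lambda>k. h k x) \<longlonglongrightarrow> h' x" for x
    unfolding h_def h'_def pert_def comb_def by (intro tendsto_intros lim)
  have le: "\<bar>h k x\<bar> \<le> g x" for k x
  proof -
    have "\<bar>h k x\<bar> \<le> \<bar>a k\<bar> * \<bar>pos_part z x\<bar> + \<bar>b k\<bar> * \<bar>neg_part z x\<bar> + \<bar>e k\<bar> * \<bar>\<phi> x\<bar>"
      unfolding h_def pert_def comb_def abs_mult[symmetric] by linarith
    also have "\<dots> \<le> 2 * \<bar>z x\<bar> + 2 * \<bar>z x\<bar> + 1 * \<bar>\<phi> x\<bar>"
      by (intro add_mono mult_mono bd) auto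
    finally show ?thesis by (simp add: g_def)
  qed
  define G where "G y = 2 * \<bar>D (pos_part z) y\<bar> + 2 * \<bar>D (neg_part z) y\<bar> + 1 * \<bar>D \<phi> y\<bar>" for y
  have Gs: "sq_int P (\<lambda>y. G y + \<bar>D \<phi> y\<bar>)" unfolding G_def
    by (intro sq_int_add sq_int_scale sq_int_abs H_D(4) H_pos_part H_neg_part z \<phi>)
  have Dle: "\<bar>D (h k) y\<bar> \<le> G y" for k y
  proof -
    have "D (h k) y = a k * D (pos_part z) y + b k * D (neg_part z) y + e k * D \<phi> y"
      by (simp add: D_def h_def pert_def comb_def algebra_simps)
    then have "\<bar>D (h k) y\<bar> \<le> \<bar>a k\<bar> * \<bar>D (pos_part z) y\<bar> + \<bar>b k\<bar> * \<bar>D (neg_part z) y\<bar> + \<bar>e k\<bar> * \<bar>D \<phi> y\<bar>"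
      unfolding abs_mult[symmetric] by linarith
    also have "\<dots> \<le> G y" unfolding G_def by (intro add_mono mult_mono bd) auto
    finally show ?thesis .
  qed
  have Dle': "\<bar>D (h k) y\<bar> \<le> G y + \<bar>D \<phi> y\<bar>" for k y using Dle[of k y] by linarith
  have D\<phi>: "\<bar>D \<phi> y\<bar> \<le> G y + \<bar>D \<phi> y\<bar>" for y by (simp add: G_def)
  have le2: "\<bar>pos_part (h k) x\<bar> \<le> g x" "\<bar>neg_part (h k) x\<bar> \<le> g x" for k x
    using le[of k x] g0[of x] by (auto simp: max_def min_def)
  have D2: "\<bar>D (pos_part (h k)) y\<bar> \<le> G y + \<bar>D \<phi> y\<bar>" "\<bar>D (neg_part (h k)) y\<bar> \<le> G y + \<bar>D \<phi> y\<bar>" for k y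
    using D_pos_part_le[OF hH(1), of k y] D_neg_part_le[OF hH(1), of k y] Dle'[of k y] by linarith+
  have pt2: "(\<lambda>k. pos_part (h k) x) \<longlonglongrightarrow> pos_part h' x" "(\<lambda>k. neg_part (h k) x) \<longlonglongrightarrow> neg_part h' x" for x
    by (intro tendsto_max tendsto_min ptl tendsto_const)+
  show "(\<lambda>k. form (h k) (pos_part (h k))) \<longlonglongrightarrow> form h' (pos_part h')"
    by (rule form_dominated_convergence[OF hH(1) H_pos_part[OF hH(1)] hH(2) H_pos_part[OF hH(2)] ptl pt2(1) H_D(3)[OF gH] le le2(1) Gs Dle' D2(1)])
  show "(\<lambda>k. form (h k) (neg_part (h k))) \<longlonglongrightarrow> form h' (neg_part h')"
    by (rule form_dominated_convergence[OF hH(1) H_neg_part[OF hH(1)] hH(2) H_neg_part[OF hH(2)] ptl pt2(2) H_D(3)[OF gH] le le2(2) Gs Dle' D2(2)])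
  have gp: "integrable M (\<lambda>x. g x powr p)"
    using power_int[OF gH, of p] p g0 by simp
  have ae: "AE x in M. (\<forall>k. \<bar>h k x\<bar> \<le> g x) \<and> (\<lambda>k. h k x) \<longlonglongrightarrow> h' x" using le ptl by simp
  note pwl = pw_parts_tendsto[OF hH(1) hH(2) _ p(2) H_D(5)[OF gH] gp ae]
  show "(\<lambda>k. pw p (pos_part (h k))) \<longlonglongrightarrow> pw p (pos_part h')" by (rule pwl(1)) (use p in simp)
  show "(\<lambda>k. pw p (neg_part (h k))) \<longlonglongrightarrow> pw p (neg_part h')" by (rule pwl(2)) (use p in simp)
  show "(\<lambda>k. form (h k) \<phi>) \<longlonglongrightarrow> form h' \<phi>"
    by (rule form_dominated_convergence[OF hH(1) \<phi> hH(2) \<phi> ptl _ H_D(3)[OF gH] le _ Gs Dle' D\<phi>])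
       (auto simp: g_def)
  show "(\<lambda>k. \<integral>x. \<bar>h k x\<bar> powr (p - 2) * h k x * \<phi> x \<partial>M) \<longlonglongrightarrow> (\<integral>x. \<bar>h' x\<bar> powr (p - 2) * h' x * \<phi> x \<partial>M)"
  proof (rule integral_dominated_convergence)
    have [measurable]: "h k \<in> borel_measurable M" "h' \<in> borel_measurable M" "\<phi> \<in> borel_measurable M" for k
      using H_D(5) hH \<phi> by auto
    show "(\<lambda>x. \<bar>h' x\<bar> powr (p - 2) * h' x * \<phi> x) \<in> borel_measurable M"
      "\<And>k. (\<lambda>x. \<bar>h k x\<bar> powr (p - 2) * h k x * \<phi> x) \<in> borel_measurable M" by measurable
    show "integrable M (\<lambda>x. g x powr (p - 1) * \<bar>\<phi> x\<bar>)"
      using mixed_power_int[OF gH \<phi>, of "p - 1" 1] p g0 by simp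
    show "AE x in M. (\<lambda>k. \<bar>h k x\<bar> powr (p - 2) * h k x * \<phi> x) \<longlonglongrightarrow> \<bar>h' x\<bar> powr (p - 2) * h' x * \<phi> x"
      using p by (intro AE_I2 tendsto_mult tendsto_powr' tendsto_rabs ptl tendsto_const) auto
    have "\<bar>y\<bar> powr (p - 2) * \<bar>y\<bar> = \<bar>y\<bar> powr (p - 1)" for y :: real
      using powr_add[of "\<bar>y\<bar>" "p - 2" 1] by (cases "y = 0") simp_all
    then show "AE x in M. norm (\<bar>h k x\<bar> powr (p - 2) * h k x * \<phi> x) \<le> g x powr (p - 1) * \<bar>\<phi> x\<bar>" for k
      using p le by (intro AE_I2) (auto simp: abs_mult intro!: mult_right_mono powr_mono2)
  qed
qed

text \<open>
  At the parameter value \<open>e = 0\<close> the constraints hold on the cone of \<open>z\<close> at \<open>(1, 1)\<close> only. By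
  Brouwer's theorem the truncated constraints have fixed points for small \<open>e\<close>, which converge to
  \<open>(1, 1)\<close> and therefore become genuine points of the nodal Nehari set.
\<close>

lemma nodal_Nehari_perturbation:
  assumes z: "z \<in> nodal_Nehari p" and \<phi>: "\<phi> \<in> H" and p: "2 < p" "p \<le> 2 + kap"
  obtains a b e where "a \<longlonglongrightarrow> 1" "b \<longlonglongrightarrow> 1" "e \<longlonglongrightarrow> 0"
    "\<And>k :: nat. 0 < e k \<and> e k \<le> 1 \<and> \<bar>a k\<bar> \<le> 2 \<and> \<bar>b k\<bar> \<le> 2 \<and> 0 \<le> a k \<and> 0 \<le> b k \<and> pert z \<phi> (a k) (b k) (e k) \<in> nodal_Nehari p"
proof -
  note Dz = nodal_NehariD[OF z]
  have p0: "0 < p" using p by simp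
  define E where "E n = 1 / real (Suc n)" for n
  have E: "0 < E n" "\<bar>E n\<bar> \<le> 1" for n by (auto simp: E_def)
  have E0: "E \<longlonglongrightarrow> 0" unfolding E_def by (rule LIMSEQ_Suc[OF lim_1_over_n])
  define F G where "F e a b = form (pert z \<phi> a b e) (pos_part (pert z \<phi> a b e)) - lam * pw p (pos_part (pert z \<phi> a b e))"
    and "G e a b = form (pert z \<phi> a b e) (neg_part (pert z \<phi> a b e)) - lam * pw p (neg_part (pert z \<phi> a b e))" for e a b
  have lims: "(\<lambda>k. F (e k) (a k) (b k)) \<longlonglongrightarrow> F e' a' b'" "(\<lambda>k. G (e k) (a k) (b k)) \<longlonglongrightarrow> G e' a' b'"
    if "a \<longlonglongrightarrow> a'" "b \<longlonglongrightarrow> b'" "e \<longlonglongrightarrow> e'" "\<And>k. \<bar>a k\<bar> \<le> 2" "\<And>k. \<bar>b k\<bar> \<le> 2" "\<And>k. \<bar>e k\<bar> \<le> 1"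
    for a b e :: "nat \<Rightarrow> real" and a' b' e'
    unfolding F_def G_def
    by (intro tendsto_diff tendsto_mult tendsto_const pert_tendsto[OF Dz(1) \<phi> p that])+
  have cont: "continuous_on ({1/2..3/2} \<times> {1/2..3/2}) (\<lambda>y. F (E n) (fst y) (snd y))"
    "continuous_on ({1/2..3/2} \<times> {1/2..3/2}) (\<lambda>y. G (E n) (fst y) (snd y))" for n
  proof -
    have seq: "(\<lambda>k. F (E n) (fst (x k)) (snd (x k))) \<longlonglongrightarrow> F (E n) (fst y) (snd y) \<and>
        (\<lambda>k. G (E n) (fst (x k)) (snd (x k))) \<longlonglongrightarrow> G (E n) (fst y) (snd y)"
      if x: "\<forall>k. x k \<in> {1/2..3/2} \<times> {1/2..3/2}" "x \<longlonglongrightarrow> y" for x :: "nat \<Rightarrow> real \<times> real" and y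
    proof -
      have "\<bar>fst (x k)\<bar> \<le> 2" "\<bar>snd (x k)\<bar> \<le> 2" for k
      proof -
        have "fst (x k) \<in> {1/2..3/2}" "snd (x k) \<in> {1/2..3/2}" using x(1) by (auto simp: mem_Times_iff)
        then show "\<bar>fst (x k)\<bar> \<le> 2" "\<bar>snd (x k)\<bar> \<le> 2" by auto
      qed
      from lims[OF tendsto_fst[OF x(2)] tendsto_snd[OF x(2)] tendsto_const this E(2)[of n]] show ?thesis by simp
    qed
    show "continuous_on ({1/2..3/2} \<times> {1/2..3/2}) (\<lambda>y. F (E n) (fst y) (snd y))"
      "continuous_on ({1/2..3/2} \<times> {1/2..3/2}) (\<lambda>y. G (E n) (fst y) (snd y))"
      unfolding continuous_on_sequentially o_def using seq by blast+
  qed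
  have "\<exists>a b. a \<in> {1/2..3/2} \<and> b \<in> {1/2..3/2} \<and> a = max (1/2) (min (3/2) (a + F (E n) a b))
      \<and> b = max (1/2) (min (3/2) (b + G (E n) a b))" for n
    by (rule truncated_displacement_fixed_point[OF _ cont(1)[of n] cont(2)[of n]]) auto
  then obtain a b where ab: "\<And>n. a n \<in> {1/2..3/2::real}" "\<And>n. b n \<in> {1/2..3/2::real}"
    and fa: "\<And>n. a n = max (1/2) (min (3/2) (a n + F (E n) (a n) (b n)))"
    and fb: "\<And>n. b n = max (1/2) (min (3/2) (b n + G (E n) (a n) (b n)))" by metis
  have "compact ({1/2..3/2::real} \<times> {1/2..3/2::real})" by (intro compact_Times) auto
  then obtain y r where y: "y \<in> {1/2..3/2} \<times> {1/2..3/2}" "strict_mono r" "((\<lambda>n. (a n, b n)) \<circ> r) \<longlonglongrightarrow> y"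
    using ab unfolding compact_def by (metis (no_types, lifting) mem_Sigma_iff)
  define a' b' where "a' = fst y" and "b' = snd y"
  have la: "(\<lambda>n. a (r n)) \<longlonglongrightarrow> a'" using tendsto_fst[OF y(3)] by (simp add: o_def a'_def)
  have lb: "(\<lambda>n. b (r n)) \<longlonglongrightarrow> b'" using tendsto_snd[OF y(3)] by (simp add: o_def b'_def)
  have lE: "(\<lambda>n. E (r n)) \<longlonglongrightarrow> 0" using LIMSEQ_subseq_LIMSEQ[OF E0 y(2)] by (simp add: o_def)
  have abs2: "\<bar>a n\<bar> \<le> 2" "\<bar>b n\<bar> \<le> 2" for n using ab[of n] by auto
  note FG = lims[OF la lb lE abs2 E(2)]
  have "(\<lambda>n. max (1/2) (min (3/2) (a (r n) + F (E (r n)) (a (r n)) (b (r n))))) \<longlonglongrightarrow> max (1/2) (min (3/2) (a' + F 0 a' b'))"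
    by (intro tendsto_max tendsto_min tendsto_const tendsto_add la FG)
  then have fa': "a' = max (1/2) (min (3/2) (a' + F 0 a' b'))"
    unfolding fa[symmetric] using la LIMSEQ_unique by blast
  have "(\<lambda>n. max (1/2) (min (3/2) (b (r n) + G (E (r n)) (a (r n)) (b (r n))))) \<longlonglongrightarrow> max (1/2) (min (3/2) (b' + G 0 a' b'))"
    by (intro tendsto_max tendsto_min tendsto_const tendsto_add lb FG)
  then have fb': "b' = max (1/2) (min (3/2) (b' + G 0 a' b'))"
    unfolding fb[symmetric] using lb LIMSEQ_unique by blast
  have ab': "a' \<in> {1/2..3/2}" "b' \<in> {1/2..3/2}" using y(1) by (auto simp: a'_def b'_def)
  have ab0: "0 \<le> a'" "0 \<le> b'" using ab' by auto
  have F0: "F 0 a' b' = a'\<^sup>2 * form (pos_part z) (pos_part z) + a' * b' * form (pos_part z) (neg_part z) - lam * (a' powr p * pw p (pos_part z))"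
    unfolding F_def pert_0 pos_part_comb[OF ab0]
    using form_scale_left[OF H_pos_part[OF Dz(1)] comb_H[OF Dz(1)], of a' a' b'] ab0 form_comb_pos(1)[OF Dz(1), of a' b']
    by (simp add: form_sym[of "comb z a' b'"] pw_scale power2_eq_square algebra_simps)
  have G0: "G 0 a' b' = b'\<^sup>2 * form (neg_part z) (neg_part z) + a' * b' * form (pos_part z) (neg_part z) - lam * (b' powr p * pw p (neg_part z))"
    unfolding G_def pert_0 neg_part_comb[OF ab0]
    using form_scale_left[OF H_neg_part[OF Dz(1)] comb_H[OF Dz(1)], of b' a' b'] ab0 form_comb_pos(2)[OF Dz(1), of a' b']
    by (simp add: form_sym[of "comb z a' b'"] pw_scale power2_eq_square algebra_simps)
  have lz: "0 < lam * pw p (pos_part z)" "0 < lam * pw p (neg_part z)"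
    using pw_parts_pos[OF Dz(1,2) p0 p(2)] eig2_pos by auto
  note one = two_dimensional_Nehari_point_unique[OF lz form_pos_neg(1)[OF Dz(1)] p(1) Dz(3,4) ab' fa'[unfolded F0] fb'[unfolded G0]]
  have h0: "pert z \<phi> a' b' 0 = z" by (simp add: one pert_0 comb_1)
  note pl = pert_tendsto[OF Dz(1) \<phi> p la lb lE abs2 E(2), unfolded h0]
  have ev: "eventually (\<lambda>n. 1/2 < a (r n) \<and> a (r n) < 3/2 \<and> 1/2 < b (r n) \<and> b (r n) < 3/2
     \<and> 0 < pw p (pos_part (pert z \<phi> (a (r n)) (b (r n)) (E (r n)))) \<and> 0 < pw p (neg_part (pert z \<phi> (a (r n)) (b (r n)) (E (r n))))) sequentially"
  proof -
    have h: "(1/2::real) < 1" "1 < (3/2::real)" by simp_all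
    note la1 = la[unfolded one] and lb1 = lb[unfolded one] and pp = pw_parts_pos[OF Dz(1,2) p0 p(2)]
    show ?thesis
      by (intro eventually_conj order_tendstoD(1)[OF la1 h(1)] order_tendstoD(2)[OF la1 h(2)]
          order_tendstoD(1)[OF lb1 h(1)] order_tendstoD(2)[OF lb1 h(2)]
          order_tendstoD(1)[OF pl(3) pp(1)] order_tendstoD(1)[OF pl(4) pp(2)])
  qed
  then obtain N where N: "\<And>n. n \<ge> N \<Longrightarrow> 1/2 < a (r n) \<and> a (r n) < 3/2 \<and> 1/2 < b (r n) \<and> b (r n) < 3/2
     \<and> 0 < pw p (pos_part (pert z \<phi> (a (r n)) (b (r n)) (E (r n)))) \<and> 0 < pw p (neg_part (pert z \<phi> (a (r n)) (b (r n)) (E (r n))))"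
    by (auto simp: eventually_sequentially)
  have mem: "pert z \<phi> (a (r n)) (b (r n)) (E (r n)) \<in> nodal_Nehari p" if n: "n \<ge> N" for n
  proof -
    let ?h = "pert z \<phi> (a (r n)) (b (r n)) (E (r n))"
    have hH: "?h \<in> H" by (rule pert_H[OF Dz(1) \<phi>])
    have "F (E (r n)) (a (r n)) (b (r n)) = 0"
      using truncated_fixed_pointD[OF fa[of "r n"]] N[OF n] by (simp add: antisym)
    moreover have "G (E (r n)) (a (r n)) (b (r n)) = 0"
      using truncated_fixed_pointD[OF fb[of "r n"]] N[OF n] by (simp add: antisym)
    moreover
    have "sign_changing ?h"
      using N[OF n] pw_ae_zero[OF H_pos_part[OF hH]] pw_ae_zero[OF H_neg_part[OF hH]] unfolding sign_changing_def by (metis less_irrefl)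
    ultimately show ?thesis using hH by (simp add: nodal_Nehari_def F_def G_def)
  qed
  show ?thesis
  proof (rule that[of "\<lambda>k. a (r (k + N))" "\<lambda>k. b (r (k + N))" "\<lambda>k. E (r (k + N))"])
    show "(\<lambda>k. a (r (k + N))) \<longlonglongrightarrow> 1" using LIMSEQ_ignore_initial_segment[OF la, of N] by (simp add: one)
    show "(\<lambda>k. b (r (k + N))) \<longlonglongrightarrow> 1" using LIMSEQ_ignore_initial_segment[OF lb, of N] by (simp add: one)
    show "(\<lambda>k. E (r (k + N))) \<longlonglongrightarrow> 0" by (rule LIMSEQ_ignore_initial_segment[OF lE])
    show "0 < E (r (k + N)) \<and> E (r (k + N)) \<le> 1 \<and> \<bar>a (r (k + N))\<bar> \<le> 2 \<and> \<bar>b (r (k + N))\<bar> \<le> 2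
      \<and> 0 \<le> a (r (k + N)) \<and> 0 \<le> b (r (k + N)) \<and> pert z \<phi> (a (r (k + N))) (b (r (k + N))) (E (r (k + N))) \<in> nodal_Nehari p" for k
      using E[of "r (k + N)"] abs2[of "r (k + N)"] ab[of "r (k + N)"] mem[of "k + N"] by auto
  qed
qed

text \<open>
  Along the perturbation the quadratic part of the energy expands exactly and the power is bounded
  below by its tangent. The comparison of energies, divided by the size of the perturbation, thus
  becomes a sign of the first variation in the limit.
\<close>

lemma nodal_Nehari_minimizer_one_sided:
  assumes z: "z \<in> nodal_Nehari p" and min: "\<And>w. w \<in> nodal_Nehari p \<Longrightarrow> J p z \<le> J p w"
    and \<phi>: "\<phi> \<in> H" and p: "2 < p" "p \<le> 2 + kap"
  shows "0 \<le> form z \<phi> - lam * (\<integral>x. \<bar>z x\<bar> powr (p - 2) * z x * \<phi> x \<partial>M)"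
proof -
  have zH: "z \<in> H" by (rule nodal_NehariD(1)[OF z])
  obtain a b e where lim: "a \<longlonglongrightarrow> 1" "b \<longlonglongrightarrow> 1" "e \<longlonglongrightarrow> 0"
    and abe: "\<And>k :: nat. 0 < e k \<and> e k \<le> 1 \<and> \<bar>a k\<bar> \<le> 2 \<and> \<bar>b k\<bar> \<le> 2 \<and> 0 \<le> a k \<and> 0 \<le> b k \<and> pert z \<phi> (a k) (b k) (e k) \<in> nodal_Nehari p"
    by (rule nodal_Nehari_perturbation[OF z \<phi> p]) blast
  define g where "g k = comb z (a k) (b k)" for k
  have gH: "g k \<in> H" for k unfolding g_def by (rule comb_H[OF zH])
  define I where "I k = (\<integral>x. \<bar>g k x\<bar> powr (p - 2) * g k x * \<phi> x \<partial>M)" for k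
  have ge: "0 \<le> form (g k) \<phi> + e k / 2 * form \<phi> \<phi> - lam * I k" for k
  proof -
    define h where "h = pert z \<phi> (a k) (b k) (e k)"
    have h: "h = (\<lambda>x. 1 * g k x + e k * \<phi> x)" by (simp add: h_def pert_def g_def fun_eq_iff)
    have hH: "h \<in> H" unfolding h_def by (rule pert_H[OF zH \<phi>])
    have "J p (g k) \<le> J p z" unfolding g_def using abe[of k] by (intro nodal_Nehari_comb_le[OF z] p) auto
    also have "\<dots> \<le> J p h" using abe[of k] by (intro min) (simp add: h_def)
    finally have Jle: "J p (g k) \<le> J p h" .
    have fh: "form h h = form (g k) (g k) + 2 * e k * form (g k) \<phi> + (e k)\<^sup>2 * form \<phi> \<phi>"
      unfolding h using form_quadratic[OF gH \<phi>, of 1 k "e k"] by simp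
    have pwh: "pw p (g k) + p * e k * I k \<le> pw p h"
    proof -
      have "pw p (g k) + p * e k * I k = (\<integral>x. \<bar>g k x\<bar> powr p + p * e k * (\<bar>g k x\<bar> powr (p - 2) * g k x * \<phi> x) \<partial>M)"
        unfolding pw_def I_def using power_int[OF gH, of p] nonlinear_int[OF gH \<phi> p] p by simp
      also have "\<dots> \<le> pw p h"
        unfolding pw_def
      proof (rule integral_mono)
        show "integrable M (\<lambda>x. \<bar>g k x\<bar> powr p + p * e k * (\<bar>g k x\<bar> powr (p - 2) * g k x * \<phi> x))"
          using power_int[OF gH, of p] nonlinear_int[OF gH \<phi> p] p by simp
        show "integrable M (\<lambda>x. \<bar>h x\<bar> powr p)" using p by (intro power_int hH) auto
        show "\<bar>g k x\<bar> powr p + p * e k * (\<bar>g k x\<bar> powr (p - 2) * g k x * \<phi> x) \<le> \<bar>h x\<bar> powr p" for x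
          using powr_tangent_le[OF p(1), of "g k x" "h x"] by (simp add: h mult_ac)
      qed
      finally show ?thesis .
    qed
    have "lam / p * (pw p (g k) + p * e k * I k) \<le> lam / p * pw p h"
      using pwh eig2_pos p by (intro mult_left_mono) auto
    then have "lam / p * pw p (g k) + lam * e k * I k \<le> lam / p * pw p h"
      using p by (simp add: distrib_left)
    then have "0 \<le> (2 * e k * form (g k) \<phi> + (e k)\<^sup>2 * form \<phi> \<phi>) / 2 - lam * e k * I k"
      using Jle unfolding J_def fh by (simp add: add_divide_distrib)
    also have "\<dots> = e k * (form (g k) \<phi> + e k / 2 * form \<phi> \<phi> - lam * I k)"
      by (simp add: power2_eq_square algebra_simps)
    finally show ?thesis using abe[of k] by (simp add: zero_le_mult_iff)
  qed
  have z0: "pert z \<phi> 1 1 0 = z" by (simp add: pert_0 comb_1)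
  have bd: "\<bar>a k\<bar> \<le> 2" "\<bar>b k\<bar> \<le> 2" for k using abe[of k] by auto
  note pl = pert_tendsto[OF zH \<phi> p lim(1,2) tendsto_const[of 0] bd, unfolded z0]
  have "(\<lambda>k. form (g k) \<phi> + e k / 2 * form \<phi> \<phi> - lam * I k) \<longlonglongrightarrow>
      form z \<phi> + 0 / 2 * form \<phi> \<phi> - lam * (\<integral>x. \<bar>z x\<bar> powr (p - 2) * z x * \<phi> x \<partial>M)"
    unfolding g_def I_def pert_0[of z \<phi>, symmetric] by (intro tendsto_intros pl lim) auto
  then have "0 \<le> form z \<phi> + 0 / 2 * form \<phi> \<phi> - lam * (\<integral>x. \<bar>z x\<bar> powr (p - 2) * z x * \<phi> x \<partial>M)"
    by (rule LIMSEQ_le_const) (use ge in auto)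
  then show ?thesis by simp
qed

theorem nodal_solution_exists:
  assumes p: "2 < p" "p < 2 + kap"
  obtains z where "nodal_solution \<Omega> K V p z"
    "\<And>w. w \<in> nodal_Nehari p \<Longrightarrow> energy \<Omega> K V p z \<le> energy \<Omega> K V p w"
proof -
  have p': "p \<le> 2 + kap" using p by simp
  obtain z where z: "z \<in> nodal_Nehari p" "\<And>w. w \<in> nodal_Nehari p \<Longrightarrow> J p z \<le> J p w"
    by (rule nodal_Nehari_minimizer_exists[OF p]) blast
  note Dz = nodal_NehariD[OF z(1)]
  have eq: "form z \<phi> = lam * (\<integral>x. \<bar>z x\<bar> powr (p - 2) * z x * \<phi> x \<partial>M)" if \<phi>: "\<phi> \<in> H" for \<phi>
  proof -
    have "0 \<le> form z \<phi> - lam * (\<integral>x. \<bar>z x\<bar> powr (p - 2) * z x * \<phi> x \<partial>M)"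
      by (rule nodal_Nehari_minimizer_one_sided[OF z \<phi> p(1) p'])
    moreover have "0 \<le> form z (\<lambda>x. (-1) * \<phi> x) - lam * (\<integral>x. \<bar>z x\<bar> powr (p - 2) * z x * ((-1) * \<phi> x) \<partial>M)"
      by (rule nodal_Nehari_minimizer_one_sided[OF z H_scale[OF \<phi>] p(1) p'])
    moreover have "form z (\<lambda>x. (-1) * \<phi> x) = - form z \<phi>"
      using form_scale_left[OF \<phi> Dz(1), of "-1"] by (simp add: form_sym[of z])
    ultimately show ?thesis by simp
  qed
  have "nodal_solution \<Omega> K V p z"
    unfolding nodal_solution_def weak_solution_iff using Dz(1,2) eq by (auto simp: mult.assoc)
  then show ?thesis using that z(2) by (simp add: energy_eq_J)
qed

end

section \<open>The logarithm as a limit of difference quotients\<close>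

text \<open>
  The difference quotient at exponent zero of the nonlinearity \<open>\<bar>t\<bar>\<^sup>e t\<close>, whose derivative there is
  \<open>t ln \<bar>t\<bar>\<close>.
\<close>

definition log_quotient :: "real \<Rightarrow> real \<Rightarrow> real" where
  "log_quotient e t = t * ((\<bar>t\<bar> powr e - 1) / e)"

text \<open>
  Convexity of \<open>a\<^sup>e\<close> in \<open>e\<close>, between the exponents \<open>0\<close> and \<open>d\<close>.
\<close>

lemma powr_le_affine:
  fixes a e d :: real
  assumes "0 < a" "0 < e" "e \<le> d"
  shows "a powr e \<le> (1 - e / d) + e / d * a powr d"
proof -
  have "(a powr d) powr (e / d) * 1 powr (1 - e / d) \<le> (e / d) * a powr d + (1 - e / d) * 1"
    using assms by (intro Youngs_inequality_0) (auto simp: divide_le_eq)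
  moreover have "(a powr d) powr (e / d) = a powr e" using assms by (simp add: powr_powr)
  ultimately show ?thesis by simp
qed

lemma log_quotient_bounds:
  fixes a e :: real
  assumes a: "0 < a" and e: "0 < e"
  shows "ln a \<le> (a powr e - 1) / e" "(a powr e - 1) / e \<le> a powr e * ln a"
proof -
  have "1 + e * ln a \<le> exp (e * ln a)" by (rule exp_ge_add_one_self)
  also have "\<dots> = a powr e" using a by (simp add: powr_def)
  finally show "ln a \<le> (a powr e - 1) / e" using e by (simp add: pos_le_divide_eq mult.commute)
  have "1 + - (e * ln a) \<le> exp (- (e * ln a))" by (rule exp_ge_add_one_self)
  also have "\<dots> = inverse (a powr e)" using a by (simp add: powr_def exp_minus)
  finally have "a powr e * (1 - e * ln a) \<le> a powr e * inverse (a powr e)" by (intro mult_left_mono) auto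
  then have "a powr e - a powr e * (e * ln a) \<le> 1" using a by (simp add: right_diff_distrib)
  then show "(a powr e - 1) / e \<le> a powr e * ln a" using e by (simp add: pos_divide_le_eq mult_ac)
qed

lemma neg_x_ln_x_le:
  fixes a :: real
  assumes "0 < a" "a \<le> 1"
  shows "0 \<le> - (a * ln a)" "- (a * ln a) \<le> 2 * sqrt a"
proof -
  show "0 \<le> - (a * ln a)" using assms by (simp add: mult_le_0_iff)
  have "ln (1 / sqrt a) \<le> 1 / sqrt a - 1" using assms by (intro ln_le_minus_one) auto
  moreover have "ln (1 / sqrt a) = - ln a / 2" using assms by (simp add: ln_div ln_sqrt)
  ultimately have "- ln a \<le> 2 / sqrt a" by simp
  then have "a * (- ln a) \<le> a * (2 / sqrt a)" using assms by (intro mult_left_mono) auto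
  also have "a * (2 / sqrt a) = 2 * (a / sqrt a)" by simp
  also have "a / sqrt a = sqrt a" using assms by (intro real_div_sqrt) simp
  finally show "- (a * ln a) \<le> 2 * sqrt a" by simp
qed

lemma log_quotient_small:
  assumes "\<bar>t\<bar> \<le> 1" "0 < e"
  shows "\<bar>log_quotient e t\<bar> \<le> 2 * sqrt \<bar>t\<bar>"
proof (cases "t = 0")
  case False
  then have a: "0 < \<bar>t\<bar>" by simp
  have "\<bar>t\<bar> powr e \<le> 1" using powr_mono2[of e "\<bar>t\<bar>" 1] assms by simp
  then have "(\<bar>t\<bar> powr e - 1) / e \<le> 0" using assms by (simp add: divide_le_0_iff)
  then have "\<bar>(\<bar>t\<bar> powr e - 1) / e\<bar> = - ((\<bar>t\<bar> powr e - 1) / e)" by (rule abs_of_nonpos)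
  then have "\<bar>log_quotient e t\<bar> = \<bar>t\<bar> * - ((\<bar>t\<bar> powr e - 1) / e)" by (simp only: log_quotient_def abs_mult abs_idempotent)
  also have "\<dots> \<le> \<bar>t\<bar> * - ln \<bar>t\<bar>" using log_quotient_bounds(1)[OF a assms(2)] by (intro mult_left_mono) auto
  also have "\<dots> \<le> 2 * sqrt \<bar>t\<bar>" using neg_x_ln_x_le(2)[OF a assms(1)] by simp
  finally show ?thesis .
qed (simp add: log_quotient_def)

lemma log_quotient_dominated:
  assumes e: "0 < e" "e \<le> d" and g: "1 \<le> g" "\<bar>t\<bar> \<le> g"
  shows "\<bar>log_quotient e t\<bar> \<le> (2 + 1 / d) * g powr (1 + d)"
proof -
  have g1: "1 \<le> g powr (1 + d)" using g e by (intro ge_one_powr_ge_zero) auto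
  show ?thesis
  proof (cases "\<bar>t\<bar> \<le> 1")
    case True
    have "sqrt \<bar>t\<bar> \<le> 1" using True by simp
    then have "\<bar>log_quotient e t\<bar> \<le> 2" using log_quotient_small[OF True e(1)] by linarith
    also have "2 \<le> (2 + 1 / d) * 1" using e by simp
    also have "\<dots> \<le> (2 + 1 / d) * g powr (1 + d)" using g1 e by (intro mult_left_mono) auto
    finally show ?thesis .
  next
    case False
    then have a: "1 < \<bar>t\<bar>" by simp
    have "\<bar>t\<bar> powr e \<le> (1 - e / d) + e / d * \<bar>t\<bar> powr d" using a e by (intro powr_le_affine) auto
    moreover have "0 \<le> e / d" using e by simp
    ultimately have "\<bar>t\<bar> powr e - 1 \<le> e / d * \<bar>t\<bar> powr d" by linarith
    then have "(\<bar>t\<bar> powr e - 1) / e \<le> (e / d * \<bar>t\<bar> powr d) / e"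
      using e by (intro divide_right_mono) auto
    also have "\<dots> = \<bar>t\<bar> powr d / d" using e by simp
    finally have u: "(\<bar>t\<bar> powr e - 1) / e \<le> \<bar>t\<bar> powr d / d" .
    have "1 \<le> \<bar>t\<bar> powr e" using a e by (intro ge_one_powr_ge_zero) auto
    then have l: "0 \<le> (\<bar>t\<bar> powr e - 1) / e" using e by simp
    have "\<bar>log_quotient e t\<bar> = \<bar>t\<bar> * ((\<bar>t\<bar> powr e - 1) / e)"
      using abs_of_nonneg[OF l] by (simp only: log_quotient_def abs_mult)
    also have "\<dots> \<le> g * (g powr d / d)"
      using u l g e by (intro mult_mono) (auto intro!: order_trans[OF u] divide_right_mono powr_mono2)
    also have "\<dots> = 1 / d * g powr (1 + d)" using g by (simp add: powr_add)
    also have "\<dots> \<le> (2 + 1 / d) * g powr (1 + d)" by (intro mult_right_mono) auto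
    finally show ?thesis .
  qed
qed

lemma log_quotient_tendsto:
  fixes e t :: "nat \<Rightarrow> real"
  assumes e: "\<And>k. 0 < e k" "e \<longlonglongrightarrow> 0" and t: "t \<longlonglongrightarrow> l"
  shows "(\<lambda>k. log_quotient (e k) (t k)) \<longlonglongrightarrow> l * ln \<bar>l\<bar>"
proof (cases "l = 0")
  case True
  have s: "(\<lambda>k. 2 * sqrt \<bar>t k\<bar>) \<longlonglongrightarrow> 0"
    using tendsto_mult_left[OF tendsto_real_sqrt[OF tendsto_rabs[OF t]], of 2] True by simp
  have "eventually (\<lambda>k. \<bar>t k\<bar> < 1) sequentially"
    using tendsto_rabs[OF t] True by (intro order_tendstoD) auto
  then have "eventually (\<lambda>k. \<bar>log_quotient (e k) (t k)\<bar> \<le> 2 * sqrt \<bar>t k\<bar>) sequentially"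
    by eventually_elim (use log_quotient_small e(1) in auto)
  then have "(\<lambda>k. \<bar>log_quotient (e k) (t k)\<bar>) \<longlonglongrightarrow> 0"
    by (intro tendsto_sandwich[OF _ _ tendsto_const s]) auto
  then show ?thesis using True by (simp add: tendsto_rabs_zero_cancel)
next
  case False
  have a: "(\<lambda>k. \<bar>t k\<bar>) \<longlonglongrightarrow> \<bar>l\<bar>" by (rule tendsto_rabs[OF t])
  have l: "(\<lambda>k. ln \<bar>t k\<bar>) \<longlonglongrightarrow> ln \<bar>l\<bar>" using a False by (intro tendsto_ln) auto
  have u: "(\<lambda>k. \<bar>t k\<bar> powr e k * ln \<bar>t k\<bar>) \<longlonglongrightarrow> \<bar>l\<bar> powr 0 * ln \<bar>l\<bar>"
    using False by (intro tendsto_mult l tendsto_powr a e) auto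
  have ev: "eventually (\<lambda>k. 0 < \<bar>t k\<bar>) sequentially" using a False by (intro order_tendstoD) auto
  have "(\<lambda>k. (\<bar>t k\<bar> powr e k - 1) / e k) \<longlonglongrightarrow> ln \<bar>l\<bar>"
  proof (rule tendsto_sandwich[OF _ _ l])
    show "(\<lambda>k. \<bar>t k\<bar> powr e k * ln \<bar>t k\<bar>) \<longlonglongrightarrow> ln \<bar>l\<bar>" using u False by simp
    show "\<forall>\<^sub>F k in sequentially. ln \<bar>t k\<bar> \<le> (\<bar>t k\<bar> powr e k - 1) / e k"
      using ev by eventually_elim (rule log_quotient_bounds(1)[OF _ e(1)])
    show "\<forall>\<^sub>F k in sequentially. (\<bar>t k\<bar> powr e k - 1) / e k \<le> \<bar>t k\<bar> powr e k * ln \<bar>t k\<bar>"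
      using ev by eventually_elim (rule log_quotient_bounds(2)[OF _ e(1)])
  qed
  then show ?thesis unfolding log_quotient_def by (intro tendsto_mult t)
qed

lemma powr_times_square_eq:
  fixes t e :: real
  shows "\<bar>t\<bar> powr (2 + e) = t\<^sup>2 * \<bar>t\<bar> powr e"
proof (cases "t = 0")
  case False
  then have "\<bar>t\<bar> powr 2 = t\<^sup>2" by simp
  then show ?thesis by (simp add: powr_add)
qed simp

context nonlocal_problem begin

text \<open>
  The majorant \<open>g\<close> dominates the quotient up to the power \<open>1 + \<kappa> / 4\<close>, uniformly in the exponent,
  which together with one further factor from the space stays below the power \<open>2 + \<kappa>\<close>.
\<close>

lemma log_quotient_integral_tendsto:
  fixes h :: "nat \<Rightarrow> real ^ 'n \<Rightarrow> real"
  assumes e: "\<And>k. 0 < e k" "\<And>k. e k \<le> kap / 4" "e \<longlonglongrightarrow> 0"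
    and h: "\<And>k. h k \<in> H" "h' \<in> H" and \<phi>: "\<phi> \<in> H"
    and g: "g \<in> borel_measurable M" "integrable M (\<lambda>x. g x powr (2 + kap))" "\<And>x. 1 \<le> g x"
    and ae: "AE x in M. (\<forall>k. \<bar>h k x\<bar> \<le> g x) \<and> (\<lambda>k. h k x) \<longlonglongrightarrow> h' x"
  shows "(\<lambda>k. \<integral>x. log_quotient (e k) (h k x) * \<phi> x \<partial>M) \<longlonglongrightarrow> (\<integral>x. h' x * ln \<bar>h' x\<bar> * \<phi> x \<partial>M)"
    and "integrable M (\<lambda>x. h' x * ln \<bar>h' x\<bar> * \<phi> x)"
    and "\<And>k. integrable M (\<lambda>x. log_quotient (e k) (h k x) * \<phi> x)"
proof -
  define d where "d = kap / 4"
  have d: "0 < d" "\<And>k. e k \<le> d" using kap_pos e(2) by (auto simp: d_def)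
  have [measurable]: "h k \<in> borel_measurable M" "h' \<in> borel_measurable M" "\<phi> \<in> borel_measurable M" for k
    using H_D(5) h \<phi> by auto
  note [measurable] = g(1)
  have lm: "(\<lambda>x. h' x * ln \<bar>h' x\<bar> * \<phi> x) \<in> borel_measurable M"
    "(\<lambda>x. log_quotient (e k) (h k x) * \<phi> x) \<in> borel_measurable M" for k
    unfolding log_quotient_def by measurable
  have G: "integrable M (\<lambda>x. (2 + 1 / d) * (1 + g x powr (2 + kap) + \<bar>\<phi> x\<bar> powr (2 + kap)))"
    using g(2) Sobolev_int[OF \<phi>] by simp
  have lim: "AE x in M. (\<lambda>k. log_quotient (e k) (h k x) * \<phi> x) \<longlonglongrightarrow> h' x * ln \<bar>h' x\<bar> * \<phi> x"
    using ae by eventually_elim (auto intro!: tendsto_mult log_quotient_tendsto e)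
  have bd: "AE x in M. norm (log_quotient (e k) (h k x) * \<phi> x) \<le> (2 + 1 / d) * (1 + g x powr (2 + kap) + \<bar>\<phi> x\<bar> powr (2 + kap))" for k
    using ae
  proof eventually_elim
    case (elim x)
    have g0: "0 \<le> g x" using g(3)[of x] by simp
    have "norm (log_quotient (e k) (h k x) * \<phi> x) = \<bar>log_quotient (e k) (h k x)\<bar> * \<bar>\<phi> x\<bar>" by (simp add: abs_mult)
    also have "\<dots> \<le> (2 + 1 / d) * g x powr (1 + d) * \<bar>\<phi> x\<bar>"
      using elim by (intro mult_right_mono log_quotient_dominated e d g) auto
    also have "\<dots> = (2 + 1 / d) * (g x powr (1 + d) * \<bar>\<phi> x\<bar> powr 1)" by simp
    also have "\<dots> \<le> (2 + 1 / d) * (1 + g x powr (2 + kap) + \<bar>\<phi> x\<bar> powr (2 + kap))"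
      using d kap_pos g0 by (intro mult_left_mono powr_product_le) (auto simp: d_def)
    finally show ?case .
  qed
  show "(\<lambda>k. \<integral>x. log_quotient (e k) (h k x) * \<phi> x \<partial>M) \<longlonglongrightarrow> (\<integral>x. h' x * ln \<bar>h' x\<bar> * \<phi> x \<partial>M)"
    by (rule integral_dominated_convergence[OF lm G lim bd])
  show "integrable M (\<lambda>x. h' x * ln \<bar>h' x\<bar> * \<phi> x)"
    by (rule integrable_dominated_convergence[OF lm G lim bd])
  show "integrable M (\<lambda>x. log_quotient (e k) (h k x) * \<phi> x)" for k
    by (rule integrable_dominated_convergence2[OF lm G lim bd])
qed

text \<open>An admissible majorant for the constant sequence at \<open>u\<close>.\<close>

lemma majorant:
  assumes u: "u \<in> H"
  shows "(\<lambda>x. 1 + \<bar>u x\<bar>) \<in> borel_measurable M" "integrable M (\<lambda>x. (1 + \<bar>u x\<bar>) powr (2 + kap))"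
proof -
  have [measurable]: "u \<in> borel_measurable M" by (rule H_D(5)[OF u])
  show "(\<lambda>x. 1 + \<bar>u x\<bar>) \<in> borel_measurable M" by measurable
  show "integrable M (\<lambda>x. (1 + \<bar>u x\<bar>) powr (2 + kap))"
  proof (rule Bochner_Integration.integrable_bound)
    show "integrable M (\<lambda>x. 2 powr (2 + kap) * (1 + \<bar>u x\<bar> powr (2 + kap)))" using Sobolev_int[OF u] by simp
    show "(\<lambda>x. (1 + \<bar>u x\<bar>) powr (2 + kap)) \<in> borel_measurable M" by measurable
    show "AE x in M. norm ((1 + \<bar>u x\<bar>) powr (2 + kap)) \<le> norm (2 powr (2 + kap) * (1 + \<bar>u x\<bar> powr (2 + kap)))"
    proof (rule AE_I2)
      fix x
      define m where "m = max 1 \<bar>u x\<bar>"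
      have "(1 + \<bar>u x\<bar>) powr (2 + kap) \<le> (2 * m) powr (2 + kap)"
        using kap_pos by (intro powr_mono2) (auto simp: m_def)
      also have "\<dots> = 2 powr (2 + kap) * m powr (2 + kap)" by (simp add: powr_mult m_def)
      also have "\<dots> \<le> 2 powr (2 + kap) * (1 + \<bar>u x\<bar> powr (2 + kap))"
        by (intro mult_left_mono) (auto simp: m_def max_def)
      finally show "norm ((1 + \<bar>u x\<bar>) powr (2 + kap)) \<le> norm (2 powr (2 + kap) * (1 + \<bar>u x\<bar> powr (2 + kap)))"
        by (simp add: abs_mult)
    qed
  qed
qed

definition loglin :: "(real ^ 'n \<Rightarrow> real) \<Rightarrow> (real ^ 'n \<Rightarrow> real) \<Rightarrow> real" where
  "loglin u v = (\<integral>x. u x * ln \<bar>u x\<bar> * v x \<partial>M)"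

lemma loglin_integrable:
  assumes u: "u \<in> H" and v: "v \<in> H"
  shows "integrable M (\<lambda>x. u x * ln \<bar>u x\<bar> * v x)"
proof -
  define e where "e k = kap / 4 / real (Suc k)" for k
  have e: "0 < e k" "e k \<le> kap / 4" for k
    using kap_pos frac_le[of "kap / 4" "kap / 4" 1 "real (Suc k)"] by (auto simp: e_def)
  have "(\<lambda>k. kap / 4 * (1 / real (Suc k))) \<longlonglongrightarrow> kap / 4 * 0"
    by (intro tendsto_mult tendsto_const LIMSEQ_Suc[OF lim_1_over_n])
  moreover have "e = (\<lambda>k. kap / 4 * (1 / real (Suc k)))" by (simp add: e_def fun_eq_iff)
  ultimately have "e \<longlonglongrightarrow> 0" by simp
  then show ?thesis
    by (rule log_quotient_integral_tendsto(2)[where h = "\<lambda>k. u", OF e _ u u v majorant[OF u]]) auto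
qed

lemma power_difference_quotient:
  assumes e: "\<And>k :: nat. 0 < e k" "\<And>k. e k \<le> kap / 4" "e \<longlonglongrightarrow> 0" and u: "u \<in> H"
  shows "(\<lambda>k. (pw (2 + e k) u - ip u u) / e k) \<longlonglongrightarrow> loglin u u"
proof -
  have "(pw (2 + e k) u - ip u u) / e k = (\<integral>x. log_quotient (e k) (u x) * u x \<partial>M)" for k
  proof -
    have "pw (2 + e k) u - ip u u = (\<integral>x. \<bar>u x\<bar> powr (2 + e k) - u x * u x \<partial>M)"
      unfolding pw_def ip_def
      using power_int[OF u, of "2 + e k"] sq_int_mult_integrable[OF H_D(3)[OF u] H_D(3)[OF u]] e(1)[of k] e(2)[of k] kap_pos by simp
    also have "\<dots> = (\<integral>x. e k * (log_quotient (e k) (u x) * u x) \<partial>M)"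
    proof (rule Bochner_Integration.integral_cong)
      fix x
      show "\<bar>u x\<bar> powr (2 + e k) - u x * u x = e k * (log_quotient (e k) (u x) * u x)"
        unfolding powr_times_square_eq using e(1)[of k] by (simp add: log_quotient_def power2_eq_square field_simps)
    qed simp
    finally show ?thesis using e(1)[of k] by (simp add: less_imp_neq[symmetric])
  qed
  then show ?thesis
    using log_quotient_integral_tendsto(1)[where h = "\<lambda>k. u", OF e u u u majorant[OF u]]
    by (simp add: loglin_def)
qed

section \<open>The reduced functional\<close>

text \<open>
  Along a ray the reduced functional is explicit, which gives its radial derivative and identifies the
  reduced Nehari manifold.
\<close>

lemma reduced_energy_scaled:
  assumes u: "u \<in> H" and c: "0 < c"
  shows "reduced_energy \<Omega> (\<lambda>x. c * u x) = c\<^sup>2 / 2 * (ip u u - 2 * loglin u u - 2 * ln c * ip u u)"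
proof -
  have i: "integrable M (\<lambda>x. u x * u x)" by (rule sq_int_mult_integrable[OF H_D(3)[OF u] H_D(3)[OF u]])
  have l: "integrable M (\<lambda>x. u x * ln \<bar>u x\<bar> * u x)" by (rule loglin_integrable[OF u u])
  have pt: "(c * u x)\<^sup>2 - (c * u x)\<^sup>2 * ln ((c * u x)\<^sup>2)
     = c\<^sup>2 * (u x * u x - 2 * (u x * ln \<bar>u x\<bar> * u x) - 2 * ln c * (u x * u x))" for x
  proof (cases "u x = 0")
    case False
    have "ln ((c * u x)\<^sup>2) = 2 * ln c + 2 * ln \<bar>u x\<bar>"
    proof -
      have "(c * u x)\<^sup>2 = (c * \<bar>u x\<bar>)\<^sup>2" by (simp add: power_mult_distrib)
      then have "ln ((c * u x)\<^sup>2) = 2 * ln (c * \<bar>u x\<bar>)" using False c by (simp add: ln_realpow)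
      then show ?thesis using False c by (simp add: ln_mult)
    qed
    then show ?thesis by (simp add: power2_eq_square algebra_simps)
  qed simp
  have "reduced_energy \<Omega> (\<lambda>x. c * u x) = (\<integral>x. c\<^sup>2 * (u x * u x - 2 * (u x * ln \<bar>u x\<bar> * u x) - 2 * ln c * (u x * u x)) \<partial>M) / 2"
    unfolding reduced_energy_def set_integral_Omega pt ..
  also have "\<dots> = c\<^sup>2 * (ip u u - 2 * loglin u u - 2 * ln c * ip u u) / 2"
    unfolding ip_def loglin_def using i l by simp
  finally show ?thesis by simp
qed

lemma reduced_energy_eq: "u \<in> H \<Longrightarrow> reduced_energy \<Omega> u = ip u u / 2 - loglin u u"
  using reduced_energy_scaled[of u 1] by (simp add: diff_divide_distrib)

lemma reduced_energy_radial_derivative: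
  assumes u: "u \<in> H"
  shows "has_directional_derivative (reduced_energy \<Omega>) u u d \<longleftrightarrow> d = - 2 * loglin u u"
proof -
  define F where "F t = (1 + t)\<^sup>2 / 2 * (ip u u - 2 * loglin u u - 2 * ln (1 + t) * ip u u)" for t
  have der: "(F has_real_derivative - 2 * loglin u u) (at 0)"
    unfolding F_def by (auto intro!: derivative_eq_intros)
  have ev: "eventually (\<lambda>t. reduced_energy \<Omega> (\<lambda>x. u x + t * u x) = F t) (nhds 0)"
  proof -
    have "eventually (\<lambda>t::real. t \<in> {-1<..}) (nhds 0)" by (rule eventually_nhds_in_open) auto
    then show ?thesis
    proof eventually_elim
      case (elim t)
      have "(\<lambda>x. u x + t * u x) = (\<lambda>x. (1 + t) * u x)" by (simp add: distrib_right)
      then show ?case using reduced_energy_scaled[OF u, of "1 + t"] elim by (simp add: F_def)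
    qed
  qed
  have "has_directional_derivative (reduced_energy \<Omega>) u u d \<longleftrightarrow> (F has_real_derivative d) (at 0)"
    unfolding has_directional_derivative_def by (rule DERIV_cong_ev[OF refl ev refl])
  also have "\<dots> \<longleftrightarrow> d = - 2 * loglin u u" using der DERIV_unique by blast
  finally show ?thesis .
qed

lemma loglin_parts:
  assumes u: "u \<in> H"
  shows "loglin u u = loglin (pos_part u) (pos_part u) + loglin (neg_part u) (neg_part u)"
proof -
  have "u x * ln \<bar>u x\<bar> * u x = pos_part u x * ln \<bar>pos_part u x\<bar> * pos_part u x + neg_part u x * ln \<bar>neg_part u x\<bar> * neg_part u x" for x
    by (auto simp: max_def min_def)
  then show ?thesis
    unfolding loglin_def using loglin_integrable[OF H_pos_part[OF u] H_pos_part[OF u]] loglin_integrable[OF H_neg_part[OF u] H_neg_part[OF u]] by simp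
qed

lemma ip_parts:
  assumes u: "u \<in> H"
  shows "ip u (pos_part u) = ip (pos_part u) (pos_part u)" "ip u (neg_part u) = ip (neg_part u) (neg_part u)"
    "ip u u = ip (pos_part u) (pos_part u) + ip (neg_part u) (neg_part u)"
proof -
  have e: "(\<lambda>x. u x * pos_part u x) = (\<lambda>x. pos_part u x * pos_part u x)"
    "(\<lambda>x. u x * neg_part u x) = (\<lambda>x. neg_part u x * neg_part u x)"
    "(\<lambda>x. u x * u x) = (\<lambda>x. pos_part u x * pos_part u x + neg_part u x * neg_part u x)"
    by (auto simp: fun_eq_iff max_def min_def)
  show "ip u (pos_part u) = ip (pos_part u) (pos_part u)" unfolding ip_def e(1) ..
  show "ip u (neg_part u) = ip (neg_part u) (neg_part u)" unfolding ip_def e(2) ..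
  show "ip u u = ip (pos_part u) (pos_part u) + ip (neg_part u) (neg_part u)"
    unfolding ip_def e(3) by (intro Bochner_Integration.integral_add sq_int_mult_integrable H_D(3) H_pos_part H_neg_part u)
qed

end

context positive_problem begin

lemma reduced_Nehari_iff:
  "u \<in> reduced_Nehari \<Omega> K V \<longleftrightarrow> u \<in> eigenspace \<Omega> K V 2 \<and> \<not> ae_zero u \<and> loglin u u = 0"
proof -
  have "u \<in> eigenspace \<Omega> K V 2 \<Longrightarrow> u \<in> H" by (simp add: eigenspace_iff)
  then show ?thesis unfolding reduced_Nehari_def using reduced_energy_radial_derivative[of u 0] by auto
qed

lemma nodal_solution_in_nodal_Nehari:
  assumes u: "nodal_solution \<Omega> K V p u" and p: "2 < p"
  shows "u \<in> nodal_Nehari p" "\<And>\<phi>. \<phi> \<in> H \<Longrightarrow> form u \<phi> = lam * (\<integral>x. \<bar>u x\<bar> powr (p - 2) * u x * \<phi> x \<partial>M)"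
proof -
  have uH: "u \<in> H" and sc: "sign_changing u"
    and eq0: "\<And>\<phi>. \<phi> \<in> H \<Longrightarrow> form u \<phi> = (\<integral>x. lam * \<bar>u x\<bar> powr (p - 2) * u x * \<phi> x \<partial>M)"
    using u by (auto simp: nodal_solution_def weak_solution_iff)
  show eq: "form u \<phi> = lam * (\<integral>x. \<bar>u x\<bar> powr (p - 2) * u x * \<phi> x \<partial>M)" if "\<phi> \<in> H" for \<phi>
    using eq0[OF that] by (simp add: mult.assoc)
  have pow: "\<bar>t\<bar> powr (p - 2) * t * t = \<bar>t\<bar> powr p" for t :: real
    using powr_times_square_eq[of t "p - 2"] by (simp add: power2_eq_square mult_ac)
  have "\<bar>u x\<bar> powr (p - 2) * u x * pos_part u x = \<bar>pos_part u x\<bar> powr p" for x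
    using pow[of "u x"] p by (auto simp: max_def)
  moreover have "\<bar>u x\<bar> powr (p - 2) * u x * neg_part u x = \<bar>neg_part u x\<bar> powr p" for x
    using pow[of "u x"] p by (auto simp: min_def)
  ultimately show "u \<in> nodal_Nehari p"
    using uH sc eq[OF H_pos_part[OF uH]] eq[OF H_neg_part[OF uH]] by (simp add: nodal_Nehari_def pw_def)
qed

end

section \<open>The limit of least energy nodal solutions\<close>

text \<open>
  A subsequence of the solutions with exponents so close to \<open>2\<close> that all powers in use are
  integrable, together with a common majorant \<open>g\<close>.
\<close>

locale nodal_limit = positive_problem \<Omega> K V s for \<Omega> :: "(real ^ 'n) set" and K V :: "real ^ 'n \<Rightarrow> real" and s :: real +
  fixes v :: "nat \<Rightarrow> real ^ 'n \<Rightarrow> real" and q :: "nat \<Rightarrow> real" and w g :: "real ^ 'n \<Rightarrow> real"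
  assumes sol: "\<And>k. nodal_solution \<Omega> K V (q k) (v k)"
    and least: "\<And>k z. nodal_solution \<Omega> K V (q k) z \<Longrightarrow> energy \<Omega> K V (q k) (v k) \<le> energy \<Omega> K V (q k) z"
    and q2: "\<And>k. 2 < q k" and q_le: "\<And>k. q k \<le> 2 + kap / 4" and q_lim: "q \<longlonglongrightarrow> 2"
    and wH: "w \<in> H" and inner_lim: "(\<lambda>k. inner (\<lambda>x. v k x - w x) (\<lambda>x. v k x - w x)) \<longlonglongrightarrow> 0"
    and g: "g \<in> borel_measurable M" "integrable M (\<lambda>x. g x powr (2 + kap))" "\<And>x. 1 \<le> g x"
    and ae: "AE x in M. (\<forall>k. \<bar>v k x\<bar> \<le> g x) \<and> (\<lambda>k. v k x) \<longlonglongrightarrow> w x"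
begin

definition \<epsilon> :: "nat \<Rightarrow> real" where "\<epsilon> k = q k - 2"

lemma eps: "0 < \<epsilon> k" "\<epsilon> k \<le> kap / 4" "\<epsilon> \<longlonglongrightarrow> 0"
proof -
  show "0 < \<epsilon> k" "\<epsilon> k \<le> kap / 4" using q2[of k] q_le[of k] by (auto simp: \<epsilon>_def)
  have "(\<lambda>k. q k - 2) \<longlonglongrightarrow> 2 - 2" by (intro tendsto_diff q_lim tendsto_const)
  then show "\<epsilon> \<longlonglongrightarrow> 0" by (simp add: \<epsilon>_def[abs_def])
qed

lemma q_eq: "q k = 2 + \<epsilon> k" by (simp add: \<epsilon>_def)

lemma q_bounds: "0 < q k" "2 < q k" "q k < 2 + kap" "q k \<le> 2 + kap"
  using q2[of k] q_le[of k] kap_pos by auto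

lemma vN: "v k \<in> nodal_Nehari (q k)"
  by (rule nodal_solution_in_nodal_Nehari(1)[OF sol q2])

lemma v_eq: "\<phi> \<in> H \<Longrightarrow> form (v k) \<phi> = lam * (\<integral>x. \<bar>v k x\<bar> powr \<epsilon> k * v k x * \<phi> x \<partial>M)"
  unfolding \<epsilon>_def by (rule nodal_solution_in_nodal_Nehari(2)[OF sol q2])

lemma vH: "v k \<in> H" by (rule nodal_NehariD(1)[OF vN])

lemma v_sign_changing: "sign_changing (v k)" by (rule nodal_NehariD(2)[OF vN])

lemma L2_lim: "(\<lambda>k. \<integral>x. (v k x - w x)\<^sup>2 \<partial>M) \<longlonglongrightarrow> 0"
proof -
  obtain C where C: "0 < C" "\<And>u. u \<in> H \<Longrightarrow> (\<integral>x. (u x)\<^sup>2 \<partial>M) \<le> C * inner u u" by (rule Poincare) blast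
  show ?thesis
  proof (rule tendsto_sandwich[OF _ _ tendsto_const])
    show "\<forall>\<^sub>F k in sequentially. 0 \<le> (\<integral>x. (v k x - w x)\<^sup>2 \<partial>M)" by simp
    show "\<forall>\<^sub>F k in sequentially. (\<integral>x. (v k x - w x)\<^sup>2 \<partial>M) \<le> C * inner (\<lambda>x. v k x - w x) (\<lambda>x. v k x - w x)"
      using C(2)[OF H_diff[OF vH wH]] by simp
    show "(\<lambda>k. C * inner (\<lambda>x. v k x - w x) (\<lambda>x. v k x - w x)) \<longlonglongrightarrow> 0"
      using tendsto_mult_left[OF inner_lim, of C] by simp
  qed
qed

lemma ip_lim:
  assumes \<phi>: "\<phi> \<in> H" shows "(\<lambda>k. ip (v k) \<phi>) \<longlonglongrightarrow> ip w \<phi>"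
proof -
  have one: "AE x in M. \<bar>1::real\<bar> \<le> 1" by simp
  have c: "(\<lambda>n. \<integral>x. (\<phi> x - \<phi> x)\<^sup>2 \<partial>M) \<longlonglongrightarrow> 0" by simp
  have "(\<lambda>k. \<integral>x. 1 * v k x * \<phi> x \<partial>M) \<longlonglongrightarrow> (\<integral>x. 1 * w x * \<phi> x \<partial>M)"
    by (rule L2_weighted_bilinear_tendsto[OF H_D(3)[OF vH] H_D(3)[OF wH] L2_lim H_D(3)[OF \<phi>] H_D(3)[OF \<phi>] c _ one]) simp
  then show ?thesis by (simp add: ip_def)
qed

lemma form_lim:
  assumes \<phi>: "\<phi> \<in> H" shows "(\<lambda>k. form (v k) \<phi>) \<longlonglongrightarrow> form w \<phi>"
proof -
  obtain CV where CV: "CV \<ge> 0" "AE x in M. \<bar>V x\<bar> \<le> CV" by (rule V_bound)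
  have c: "(\<lambda>n. \<integral>x. (\<phi> x - \<phi> x)\<^sup>2 \<partial>M) \<longlonglongrightarrow> 0" by simp
  have 2: "(\<lambda>k. \<integral>x. V x * v k x * \<phi> x \<partial>M) \<longlonglongrightarrow> (\<integral>x. V x * w x * \<phi> x \<partial>M)"
    by (rule L2_weighted_bilinear_tendsto[OF H_D(3)[OF vH] H_D(3)[OF wH] L2_lim H_D(3)[OF \<phi>] H_D(3)[OF \<phi>] c V_meas CV(2)])
  have lim0: "(\<lambda>k. sqrt (inner (\<lambda>x. v k x - w x) (\<lambda>x. v k x - w x)) * sqrt (inner \<phi> \<phi>)) \<longlonglongrightarrow> 0"
    using tendsto_mult_right[OF tendsto_real_sqrt[OF inner_lim], of "sqrt (inner \<phi> \<phi>)"] by simp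
  have "(\<lambda>k. \<bar>inner (\<lambda>x. v k x - w x) \<phi>\<bar>) \<longlonglongrightarrow> 0"
    by (rule tendsto_sandwich[OF _ _ tendsto_const lim0])
       (use inner_Cauchy_Schwarz[OF H_diff[OF vH wH] \<phi>] in auto)
  then have "(\<lambda>k. inner (\<lambda>x. v k x - w x) \<phi>) \<longlonglongrightarrow> 0" by (rule tendsto_rabs_zero_cancel)
  moreover have "inner (\<lambda>x. v k x - w x) \<phi> = inner (v k) \<phi> - inner w \<phi>" for k
    using inner_lin_left[OF vH wH \<phi>, of 1 k "-1"] by simp
  ultimately have 1: "(\<lambda>k. inner (v k) \<phi>) \<longlonglongrightarrow> inner w \<phi>" by (simp add: Lim_null[symmetric])
  show ?thesis unfolding form_def by (intro tendsto_add 1 2)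
qed

lemma log_lim:
  assumes \<phi>: "\<phi> \<in> H"
  shows "(\<lambda>k. \<integral>x. log_quotient (\<epsilon> k) (v k x) * \<phi> x \<partial>M) \<longlonglongrightarrow> loglin w \<phi>"
    and "integrable M (\<lambda>x. log_quotient (\<epsilon> k) (v k x) * \<phi> x)"
  unfolding loglin_def
  by (rule log_quotient_integral_tendsto(1)[OF eps vH wH \<phi> g ae])
     (rule log_quotient_integral_tendsto(3)[OF eps vH wH \<phi> g ae])

lemma equation_expanded:
  assumes \<phi>: "\<phi> \<in> H"
  shows "form (v k) \<phi> = lam * (ip (v k) \<phi> + \<epsilon> k * (\<integral>x. log_quotient (\<epsilon> k) (v k x) * \<phi> x \<partial>M))"
proof -
  have "\<bar>v k x\<bar> powr \<epsilon> k * v k x * \<phi> x = v k x * \<phi> x + \<epsilon> k * (log_quotient (\<epsilon> k) (v k x) * \<phi> x)" for x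
    using eps(1)[of k] by (simp add: log_quotient_def field_simps)
  then show ?thesis
    unfolding v_eq[OF \<phi>] ip_def
    using sq_int_mult_integrable[OF H_D(3)[OF vH] H_D(3)[OF \<phi>]] log_lim(2)[OF \<phi>] by simp
qed

lemma limit_in_eigenspace: "w \<in> eigenspace \<Omega> K V 2"
proof -
  have "form w \<phi> = lam * ip w \<phi>" if \<phi>: "\<phi> \<in> H" for \<phi>
  proof (rule LIMSEQ_unique[OF form_lim[OF \<phi>]])
    have "(\<lambda>k. lam * (ip (v k) \<phi> + \<epsilon> k * (\<integral>x. log_quotient (\<epsilon> k) (v k x) * \<phi> x \<partial>M))) \<longlonglongrightarrow> lam * (ip w \<phi> + 0 * loglin w \<phi>)"
      by (intro tendsto_intros ip_lim log_lim eps \<phi>)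
    then show "(\<lambda>k. form (v k) \<phi>) \<longlonglongrightarrow> lam * ip w \<phi>" using equation_expanded[OF \<phi>] by simp
  qed
  then show ?thesis using wH by (simp add: eigenspace_iff)
qed

text \<open>
  Testing the equation with a second eigenfunction cancels the linear terms exactly, so only the
  difference quotient of the power is left.
\<close>

lemma limit_orthogonality:
  assumes \<phi>: "\<phi> \<in> eigenspace \<Omega> K V 2"
  shows "loglin w \<phi> = 0"
proof -
  have \<phi>H: "\<phi> \<in> H" and E: "\<And>\<psi>. \<psi> \<in> H \<Longrightarrow> form \<phi> \<psi> = lam * ip \<phi> \<psi>" using \<phi> by (auto simp: eigenspace_iff)
  have "(\<integral>x. log_quotient (\<epsilon> k) (v k x) * \<phi> x \<partial>M) = 0" for k
  proof -
    have "form (v k) \<phi> = lam * ip (v k) \<phi>" using E[OF vH, of k] by (simp only: form_sym[of "v k"] ip_sym[of "v k"])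
    then have "lam * (\<epsilon> k * (\<integral>x. log_quotient (\<epsilon> k) (v k x) * \<phi> x \<partial>M)) = 0"
      using equation_expanded[OF \<phi>H, of k] by (simp add: distrib_left)
    then show ?thesis using eig2_pos eps(1)[of k] by simp
  qed
  then show ?thesis using log_lim(1)[OF \<phi>H] by (simp add: LIMSEQ_const_iff)
qed

text \<open>
  A convex combination of \<open>v\<^sup>+\<close> and \<open>v\<^sup>-\<close> orthogonal to the first eigenfunction has Rayleigh
  quotient at least the second eigenvalue. The equation bounds it by the same eigenvalue with
  weight \<open>\<bar>v\<bar>\<close> to the power \<open>p - 2\<close>, and convexity in the exponent transfers this to the weight
  with a fixed positive exponent, independent of \<open>p\<close>.
\<close>

lemma orthogonal_part_estimate:
  fixes d :: real
  assumes d: "kap / 4 \<le> d" "d \<le> kap"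
  obtains z where "z \<in> H" "0 < form z z" "integrable M (\<lambda>x. \<bar>v k x\<bar> powr d * (z x)\<^sup>2)"
    "form z z \<le> lam * (\<integral>x. \<bar>v k x\<bar> powr d * (z x)\<^sup>2 \<partial>M)"
proof -
  obtain e l where e: "e \<in> H" "AE x in lebesgue. 0 \<le> e x"
    and low: "\<And>u. u \<in> H \<Longrightarrow> ip u e = 0 \<Longrightarrow> lam * ip u u \<le> form u u"
    by (rule second_eigenvalue) blast
  have eM: "AE x in M. 0 \<le> e x" unfolding AE_lebesgue_on_iff[OF Omega_sets] using e(2) by eventually_elim simp
  have d0: "0 < d" "\<epsilon> k \<le> d" using d kap_pos eps(2)[of k] by auto
  obtain t where t: "0 \<le> t" "t \<le> 1" "ip (comb (v k) t (1 - t)) e = 0" "\<not> ae_zero (comb (v k) t (1 - t))"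
    using sign_changing_orthogonal_combination[OF vH v_sign_changing H_D(3)[OF e(1)] eM, of k] unfolding comb_def[abs_def] by blast
  define z where "z = comb (v k) t (1 - t)"
  have zH: "z \<in> H" unfolding z_def by (rule comb_H[OF vH])
  have fpos: "0 < form z z" by (rule form_pos[OF zH]) (use t z_def in simp)
  define c where "c = form (pos_part (v k)) (neg_part (v k))"
  have c0: "0 \<le> c" unfolding c_def by (rule form_pos_neg(1)[OF vH])
  note Nv = nodal_NehariD(3,4)[OF vN, of k]
  have zz: "\<bar>v k x\<bar> powr \<epsilon> k * (z x)\<^sup>2 = t\<^sup>2 * \<bar>pos_part (v k) x\<bar> powr q k + (1 - t)\<^sup>2 * \<bar>neg_part (v k) x\<bar> powr q k" for x
  proof (cases "0 \<le> v k x")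
    case True
    then show ?thesis using powr_times_square_eq[of "v k x" "\<epsilon> k"] q_bounds(1)[of k]
      by (simp add: z_def comb_def q_eq[of k] power_mult_distrib)
  next
    case False
    then show ?thesis using powr_times_square_eq[of "v k x" "\<epsilon> k"] q_bounds(1)[of k]
      by (simp add: z_def comb_def q_eq[of k] power_mult_distrib)
  qed
  have izz: "integrable M (\<lambda>x. \<bar>v k x\<bar> powr \<epsilon> k * (z x)\<^sup>2)"
    unfolding zz using power_int[OF H_pos_part[OF vH], of "q k" k] power_int[OF H_neg_part[OF vH], of "q k" k] q_bounds(1,4)[of k] by simp
  have Izz: "(\<integral>x. \<bar>v k x\<bar> powr \<epsilon> k * (z x)\<^sup>2 \<partial>M) = t\<^sup>2 * pw (q k) (pos_part (v k)) + (1 - t)\<^sup>2 * pw (q k) (neg_part (v k))"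
    unfolding zz pw_def using power_int[OF H_pos_part[OF vH], of "q k" k] power_int[OF H_neg_part[OF vH], of "q k" k] q_bounds(1,4)[of k] by simp
  have "form z z = t\<^sup>2 * (lam * pw (q k) (pos_part (v k)) - c) + 2 * t * (1 - t) * c + (1 - t)\<^sup>2 * (lam * pw (q k) (neg_part (v k)) - c)"
  proof -
    have "form (pos_part (v k)) (pos_part (v k)) = lam * pw (q k) (pos_part (v k)) - c"
      "form (neg_part (v k)) (neg_part (v k)) = lam * pw (q k) (neg_part (v k)) - c"
      using Nv by (simp_all add: c_def)
    then show ?thesis unfolding z_def form_comb[OF vH] by (simp only: c_def[symmetric])
  qed
  also have "\<dots> = lam * (\<integral>x. \<bar>v k x\<bar> powr \<epsilon> k * (z x)\<^sup>2 \<partial>M) - c * (2 * t - 1)\<^sup>2"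
    unfolding Izz by (simp add: power2_eq_square algebra_simps)
  also have "\<dots> \<le> lam * (\<integral>x. \<bar>v k x\<bar> powr \<epsilon> k * (z x)\<^sup>2 \<partial>M)" using c0 by simp
  finally have up: "form z z \<le> lam * (\<integral>x. \<bar>v k x\<bar> powr \<epsilon> k * (z x)\<^sup>2 \<partial>M)" .
  have iX: "integrable M (\<lambda>x. \<bar>v k x\<bar> powr d * (z x)\<^sup>2)"
  proof -
    have "\<bar>y\<bar> powr 2 = y\<^sup>2" for y :: real by (cases "y = 0") simp_all
    then show ?thesis using mixed_power_int[OF vH zH, of d 2 k] d d0 by simp
  qed
  have iz: "integrable M (\<lambda>x. (z x)\<^sup>2)" by (rule H_D(6)[OF zH])
  define th where "th = \<epsilon> k / d"
  have th: "0 < th" "th \<le> 1" using eps(1)[of k] d0 by (auto simp: th_def)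
  have "(\<integral>x. \<bar>v k x\<bar> powr \<epsilon> k * (z x)\<^sup>2 \<partial>M) \<le> (\<integral>x. (1 - th) * (z x)\<^sup>2 + th * (\<bar>v k x\<bar> powr d * (z x)\<^sup>2) \<partial>M)"
  proof (rule integral_mono[OF izz])
    show "integrable M (\<lambda>x. (1 - th) * (z x)\<^sup>2 + th * (\<bar>v k x\<bar> powr d * (z x)\<^sup>2))" using iX iz by simp
    fix x
    show "\<bar>v k x\<bar> powr \<epsilon> k * (z x)\<^sup>2 \<le> (1 - th) * (z x)\<^sup>2 + th * (\<bar>v k x\<bar> powr d * (z x)\<^sup>2)"
    proof (cases "v k x = 0")
      case True
      then show ?thesis by (simp add: z_def comb_def)
    next
      case False
      then have "\<bar>v k x\<bar> powr \<epsilon> k \<le> (1 - th) + th * \<bar>v k x\<bar> powr d"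
        unfolding th_def using eps(1)[of k] d0 by (intro powr_le_affine) auto
      from mult_right_mono[OF this, of "(z x)\<^sup>2"] show ?thesis by (simp add: distrib_right mult.assoc)
    qed
  qed
  also have "\<dots> = (1 - th) * ip z z + th * (\<integral>x. \<bar>v k x\<bar> powr d * (z x)\<^sup>2 \<partial>M)"
    using iX iz by (simp add: ip_self)
  finally have mid: "(\<integral>x. \<bar>v k x\<bar> powr \<epsilon> k * (z x)\<^sup>2 \<partial>M) \<le> (1 - th) * ip z z + th * (\<integral>x. \<bar>v k x\<bar> powr d * (z x)\<^sup>2 \<partial>M)" .
  define X where "X = (\<integral>x. \<bar>v k x\<bar> powr d * (z x)\<^sup>2 \<partial>M)"
  have lo: "lam * ip z z \<le> form z z" by (rule low[OF zH]) (use t z_def in simp)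
  have l0: "0 < lam" by (rule eig2_pos)
  have up2: "form z z \<le> lam * ((1 - th) * ip z z + th * X)"
    unfolding X_def by (rule order_trans[OF up mult_left_mono[OF mid less_imp_le[OF l0]]])
  have "lam * ip z z \<le> lam * ((1 - th) * ip z z + th * X)" using lo up2 by linarith
  then have "ip z z \<le> (1 - th) * ip z z + th * X" using l0 by simp
  then have "th * ip z z \<le> th * X" by (simp add: left_diff_distrib)
  then have ipX: "ip z z \<le> X" using th by simp
  have "(1 - th) * ip z z + th * X \<le> (1 - th) * X + th * X" using ipX th by (intro add_right_mono mult_left_mono) auto
  also have "\<dots> = X" by (simp add: left_diff_distrib)
  finally have "lam * ((1 - th) * ip z z + th * X) \<le> lam * X" using l0 by (intro mult_left_mono) auto
  with up2 have "form z z \<le> lam * X" by linarith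
  then show ?thesis using that[OF zH fpos iX] by (simp add: X_def)
qed

text \<open>
  Young's inequality with the exponent \<open>d\<close> chosen so that \<open>x\<close> enters only through its square.
\<close>

lemma Young_split:
  fixes x y \<eta> k :: real
  assumes "0 < \<eta>" "0 < k"
  defines "d \<equiv> 2 * k / (k + 2)"
  shows "\<bar>x\<bar> powr d * y\<^sup>2 \<le> \<eta> * \<bar>y\<bar> powr (2 + k) + \<eta> powr (- 2 / k) * x\<^sup>2"
proof (cases "x = 0 \<or> y = 0")
  case False
  then have x: "0 < \<bar>x\<bar>" and y: "0 < \<bar>y\<bar>" by auto
  have "d + d * (2 / k) = d * ((k + 2) / k)" using assms(2) by (simp add: field_simps)
  also have "\<dots> = 2" unfolding d_def using assms(2) by simp
  finally have d: "d + d * (2 / k) = 2" .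
  have nn: "0 \<le> \<eta> * \<bar>y\<bar> powr (2 + k)" "0 \<le> \<eta> powr (- 2 / k) * x\<^sup>2" using assms by auto
  show ?thesis
  proof (cases "\<bar>x\<bar> powr d \<le> \<eta> * \<bar>y\<bar> powr k")
    case True
    have "\<bar>x\<bar> powr d * y\<^sup>2 \<le> \<eta> * \<bar>y\<bar> powr k * y\<^sup>2" using True by (rule mult_right_mono) simp
    also have "\<dots> = \<eta> * \<bar>y\<bar> powr (2 + k)" unfolding powr_times_square_eq by (simp add: mult_ac)
    finally show ?thesis using nn by linarith
  next
    case False
    then have "\<bar>y\<bar> powr k \<le> \<bar>x\<bar> powr d / \<eta>" using assms by (simp add: field_simps)
    then have "(\<bar>y\<bar> powr k) powr (2 / k) \<le> (\<bar>x\<bar> powr d / \<eta>) powr (2 / k)" using assms by (intro powr_mono2) auto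
    also have "(\<bar>y\<bar> powr k) powr (2 / k) = y\<^sup>2" using assms y by (simp add: powr_powr)
    also have "(\<bar>x\<bar> powr d / \<eta>) powr (2 / k) = \<eta> powr (- 2 / k) * \<bar>x\<bar> powr (d * (2 / k))"
      using assms by (simp add: powr_divide powr_powr powr_minus divide_simps)
    finally have "\<bar>x\<bar> powr d * y\<^sup>2 \<le> \<bar>x\<bar> powr d * (\<eta> powr (- 2 / k) * \<bar>x\<bar> powr (d * (2 / k)))"
      by (rule mult_left_mono) simp
    also have "\<dots> = \<eta> powr (- 2 / k) * \<bar>x\<bar> powr (d + d * (2 / k))" by (simp add: powr_add)
    also have "\<dots> = \<eta> powr (- 2 / k) * x\<^sup>2" unfolding d using x by simp
    finally show ?thesis using nn by linarith
  qed
qed (use assms in \<open>auto simp: d_def\<close>)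

text \<open>
  If the limit were zero, the weighted integral in the preceding estimate would be at most half of
  what the estimate requires, for some \<open>k\<close>.
\<close>

lemma limit_nonzero: "\<not> ae_zero w"
proof
  assume w0: "ae_zero w"
  have k1: "0 < kap" "kap < 1"
    using kap_pos dim s1 by (auto simp: integrability_gain_def divide_simps)
  define d where "d = 2 * kap / (kap + 2)"
  have "kap * kap \<le> kap" using mult_left_mono[of kap 1 kap] k1 by simp
  then have d: "kap / 4 \<le> d" "d \<le> kap" using k1 by (auto simp: d_def field_simps)
  obtain C1 where C1: "0 < C1" "\<And>p u. u \<in> H \<Longrightarrow> 2 \<le> p \<Longrightarrow> p \<le> 2 + kap \<Longrightarrow> pw p u \<le> C1 * form u u powr (p / 2)"
    by (rule subcritical_embedding) blast
  have l0: "0 < lam" by (rule eig2_pos)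
  define \<eta> where "\<eta> = 1 / (4 * lam * C1)"
  have \<eta>: "0 < \<eta>" using l0 C1 by (simp add: \<eta>_def)
  define Y where "Y k = \<eta> powr (- 2 / kap) * (\<integral>x. (v k x)\<^sup>2 \<partial>M)" for k
  have "(\<lambda>k. \<integral>x. (v k x)\<^sup>2 \<partial>M) \<longlonglongrightarrow> 0"
  proof -
    have "(\<integral>x. (v k x - w x)\<^sup>2 \<partial>M) = (\<integral>x. (v k x)\<^sup>2 \<partial>M)" for k
    proof (rule integral_cong_AE)
      show "(\<lambda>x. (v k x - w x)\<^sup>2) \<in> borel_measurable M" "(\<lambda>x. (v k x)\<^sup>2) \<in> borel_measurable M"
        using H_D(5)[OF vH] H_D(5)[OF wH] by auto
      have "AE x in M. w x = 0" using w0 ae_zero_iff_M[OF wH] by blast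
      then show "AE x in M. (v k x - w x)\<^sup>2 = (v k x)\<^sup>2" by eventually_elim simp
    qed
    then show ?thesis using L2_lim by simp
  qed
  then have "Y \<longlonglongrightarrow> \<eta> powr (- 2 / kap) * 0" unfolding Y_def by (intro tendsto_mult tendsto_const)
  then have "eventually (\<lambda>k. Y k < 1 / (4 * lam)) sequentially" using l0 by (intro order_tendstoD) auto
  then obtain k where Yk: "Y k < 1 / (4 * lam)" by (auto simp: eventually_sequentially)
  obtain z where z: "z \<in> H" "0 < form z z" "integrable M (\<lambda>x. \<bar>v k x\<bar> powr d * (z x)\<^sup>2)"
    "form z z \<le> lam * (\<integral>x. \<bar>v k x\<bar> powr d * (z x)\<^sup>2 \<partial>M)"
    by (rule orthogonal_part_estimate[OF d])
  define a where "a = 1 / sqrt (form z z)"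
  have a2: "a\<^sup>2 = 1 / form z z" using z(2) by (simp add: a_def power_divide)
  define y where "y x = a * z x" for x
  have yH: "y \<in> H" unfolding y_def[abs_def] by (rule H_scale[OF z(1)])
  have fy: "form y y = 1" unfolding y_def[abs_def] form_scale[OF z(1)] using z(2) by (simp add: a2)
  have iy: "integrable M (\<lambda>x. \<bar>v k x\<bar> powr d * (y x)\<^sup>2)"
    using integrable_mult_right[OF z(3), of "a\<^sup>2"] by (simp add: y_def power_mult_distrib mult_ac)
  have "(\<integral>x. \<bar>v k x\<bar> powr d * (y x)\<^sup>2 \<partial>M) = a\<^sup>2 * (\<integral>x. \<bar>v k x\<bar> powr d * (z x)\<^sup>2 \<partial>M)"
    by (simp add: y_def power_mult_distrib mult.left_commute)
  moreover have "1 \<le> (lam * (\<integral>x. \<bar>v k x\<bar> powr d * (z x)\<^sup>2 \<partial>M)) / form z z"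
    using z(2,4) by (simp add: pos_le_divide_eq)
  ultimately have "1 \<le> lam * (\<integral>x. \<bar>v k x\<bar> powr d * (y x)\<^sup>2 \<partial>M)" by (simp add: a2)
  also have "(\<integral>x. \<bar>v k x\<bar> powr d * (y x)\<^sup>2 \<partial>M) \<le> (\<integral>x. \<eta> * \<bar>y x\<bar> powr (2 + kap) + \<eta> powr (- 2 / kap) * (v k x)\<^sup>2 \<partial>M)"
  proof (rule integral_mono[OF iy])
    show "integrable M (\<lambda>x. \<eta> * \<bar>y x\<bar> powr (2 + kap) + \<eta> powr (- 2 / kap) * (v k x)\<^sup>2)"
      using Sobolev_int[OF yH] H_D(6)[OF vH] by simp
    show "\<bar>v k x\<bar> powr d * (y x)\<^sup>2 \<le> \<eta> * \<bar>y x\<bar> powr (2 + kap) + \<eta> powr (- 2 / kap) * (v k x)\<^sup>2" for x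
      unfolding d_def by (rule Young_split[OF \<eta> k1(1)])
  qed
  also have "\<dots> = \<eta> * pw (2 + kap) y + Y k"
    using Sobolev_int[OF yH] H_D(6)[OF vH] by (simp add: pw_def Y_def)
  also have "\<dots> \<le> \<eta> * C1 + 1 / (4 * lam)"
  proof -
    have "pw (2 + kap) y \<le> C1" using C1(2)[OF yH, of "2 + kap"] k1 fy by simp
    then have "\<eta> * pw (2 + kap) y \<le> \<eta> * C1" using \<eta> by (intro mult_left_mono) auto
    then show ?thesis using Yk by linarith
  qed
  also have "\<dots> = 1 / (2 * lam)" using l0 C1(1) by (simp add: \<eta>_def field_simps)
  finally have "1 \<le> lam * (1 / (2 * lam))" using l0 by simp
  then show False using l0 by simp
qed

lemma pw_lim: "(\<lambda>k. pw (q k) (v k)) \<longlonglongrightarrow> ip w w"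
  unfolding pw_def ip_def
proof (rule integral_dominated_convergence[OF _ _ g(2)])
  have [measurable]: "v k \<in> borel_measurable M" "w \<in> borel_measurable M" for k using H_D(5) vH wH by auto
  show "(\<lambda>x. w x * w x) \<in> borel_measurable M" "\<And>k. (\<lambda>x. \<bar>v k x\<bar> powr q k) \<in> borel_measurable M" by measurable
  show "AE x in M. (\<lambda>k. \<bar>v k x\<bar> powr q k) \<longlonglongrightarrow> w x * w x"
    using ae
  proof eventually_elim
    case (elim x)
    have "(\<lambda>k. \<bar>v k x\<bar> powr q k) \<longlonglongrightarrow> \<bar>w x\<bar> powr 2"
      using elim by (intro tendsto_powr' tendsto_rabs q_lim) auto
    moreover have "\<bar>w x\<bar> powr 2 = w x * w x" by (cases "w x = 0") (auto simp: power2_eq_square)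
    ultimately show ?case by simp
  qed
  show "AE x in M. norm (\<bar>v k x\<bar> powr q k) \<le> g x powr (2 + kap)" for k
    using ae
  proof eventually_elim
    case (elim x)
    have "\<bar>v k x\<bar> powr q k \<le> g x powr q k" using elim q_bounds[of k] by (intro powr_mono2) auto
    also have "\<dots> \<le> g x powr (2 + kap)" using g(3)[of x] q_bounds[of k] by (intro powr_mono) auto
    finally show ?case by simp
  qed
qed

text \<open>
  The larger parameter \<open>x\<close> satisfies \<open>x\<^sup>e \<le> a / a'\<close>. Here \<open>a'\<close> differs from \<open>a\<close> by a multiple of
  \<open>e\<close>, so the bound for \<open>x\<close> is independent of \<open>e\<close>.
\<close>

lemma cone_parameter_bound:
  fixes A a a' B c t x m :: real
  assumes pos: "0 < a" "0 < a'" "0 < x" "0 \<le> c" "0 \<le> t" "t \<le> x" "0 < l" "0 < e"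
    and N: "A + c = l * a" and eq: "x\<^sup>2 * A + x * t * c = l * (x powr (2 + e) * a')"
    and m: "\<bar>(a' - a) / e\<bar> \<le> m" and half: "a / 2 \<le> a'"
  shows "x \<le> exp (2 * m / a)" 
proof -
  have "l * (x powr (2 + e) * a') \<le> x\<^sup>2 * A + x * x * c"
    unfolding eq[symmetric] using pos by (intro add_left_mono mult_right_mono mult_left_mono) auto
  also have "\<dots> = x\<^sup>2 * (A + c)" by (simp add: power2_eq_square algebra_simps)
  also have "\<dots> = l * (x\<^sup>2 * a)" unfolding N by simp
  finally have "x powr (2 + e) * a' \<le> x\<^sup>2 * a" using pos by simp
  then have "x\<^sup>2 * (x powr e * a') \<le> x\<^sup>2 * a" using powr_times_square_eq[of x e] pos by (simp add: mult_ac)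
  then have "x powr e * a' \<le> a" using pos by simp
  then have r: "x powr e \<le> a / a'" using pos by (simp add: field_simps)
  have "e * ln x = ln (x powr e)" using pos by (simp add: ln_powr)
  also have "\<dots> \<le> ln (a / a')" by (subst ln_le_cancel_iff) (use r pos in auto)
  also have "\<dots> \<le> a / a' - 1" using pos by (intro ln_le_minus_one) simp
  also have "\<dots> = e * (- ((a' - a) / e) / a')" using pos by (simp add: field_simps)
  finally have "e * ln x \<le> e * (- ((a' - a) / e) / a')" .
  then have "ln x \<le> - ((a' - a) / e) / a'" by (rule mult_left_le_imp_le[OF _ pos(8)])
  also have "\<dots> \<le> m / a'"
  proof (rule divide_right_mono)
    show "- ((a' - a) / e) \<le> m" using m abs_ge_minus_self[of "(a' - a) / e"] by (rule order_trans[rotated])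
  qed (use pos in simp)
  also have "\<dots> \<le> m / (a / 2)"
  proof (rule divide_left_mono[OF half])
    show "0 \<le> m" using m abs_ge_zero[of "(a' - a) / e"] by (rule order_trans[rotated])
  qed (use pos in simp)
  also have "m / (a / 2) = 2 * m / a" by simp
  finally have "ln x \<le> 2 * m / a" .
  then show ?thesis using pos by (metis exp_le_cancel_iff exp_ln)
qed

text \<open>
  For an element \<open>y\<close> of the reduced Nehari manifold, the point of the nodal Nehari set on the cone
  of \<open>y\<close> competes with \<open>v\<close>. The cross term of \<open>y\<close> is strictly positive, so the two cone parameters
  have the same limit; the first order terms then combine to the integral of \<open>y\<^sup>2 ln \<bar>y\<bar>\<close>, which
  vanishes.
\<close>

lemma limit_minimizes_norm:
  assumes y: "y \<in> reduced_Nehari \<Omega> K V"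
  shows "ip w w \<le> ip y y"
proof -
  have yE: "y \<in> eigenspace \<Omega> K V 2" "\<not> ae_zero y" "loglin y y = 0" using y by (auto simp: reduced_Nehari_iff)
  have yH: "y \<in> H" and E: "\<And>\<phi>. \<phi> \<in> H \<Longrightarrow> form y \<phi> = lam * ip y \<phi>" using yE(1) by (auto simp: eigenspace_iff)
  have sc: "sign_changing y" by (rule second_eigenfunction_sign_changing[OF yE(1,2)])
  note pH = H_pos_part[OF yH] and nH = H_neg_part[OF yH]
  define A B c where "A = form (pos_part y) (pos_part y)" and "B = form (neg_part y) (neg_part y)"
    and "c = form (pos_part y) (neg_part y)"
  define a b where "a = ip (pos_part y) (pos_part y)" and "b = ip (neg_part y) (neg_part y)"
  define ak bk where "ak k = pw (q k) (pos_part y)" and "bk k = pw (q k) (neg_part y)" for k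
  define \<alpha> \<beta> where "\<alpha> k = (ak k - a) / \<epsilon> k" and "\<beta> k = (bk k - b) / \<epsilon> k" for k
  have l0: "0 < lam" by (rule eig2_pos)
  have AB: "0 < A" "0 < B" "0 < c" using form_parts_pos[OF yH sc] by (simp_all add: A_def B_def c_def)
  have NA: "A + c = lam * a" and NB: "B + c = lam * b"
    using form_pos_part_split[OF yH] E[OF pH] E[OF nH] ip_parts[OF yH] by (simp_all add: A_def B_def c_def a_def b_def)
  have ab: "0 < a" "0 < b"
    using sc ae_zero_iff_ip[OF pH] ae_zero_iff_ip[OF nH] ip_nonneg[of "pos_part y"] ip_nonneg[of "neg_part y"]
    by (auto simp: a_def b_def sign_changing_def order_less_le)
  have akbk: "0 < ak k" "0 < bk k" for k
    using pw_parts_pos[OF yH sc q_bounds(1,4)] by (simp_all add: ak_def bk_def)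
  have \<alpha>l: "\<alpha> \<longlonglongrightarrow> loglin (pos_part y) (pos_part y)"
  proof -
    have "\<alpha> k = (pw (2 + \<epsilon> k) (pos_part y) - ip (pos_part y) (pos_part y)) / \<epsilon> k" for k
      by (simp only: \<alpha>_def ak_def a_def q_eq[of k])
    then have "\<alpha> = (\<lambda>k. (pw (2 + \<epsilon> k) (pos_part y) - ip (pos_part y) (pos_part y)) / \<epsilon> k)" by (rule ext)
    then show ?thesis using power_difference_quotient[OF eps pH] by (simp only:)
  qed
  have \<beta>l: "\<beta> \<longlonglongrightarrow> loglin (neg_part y) (neg_part y)"
  proof -
    have "\<beta> k = (pw (2 + \<epsilon> k) (neg_part y) - ip (neg_part y) (neg_part y)) / \<epsilon> k" for k
      by (simp only: \<beta>_def bk_def b_def q_eq[of k])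
    then have "\<beta> = (\<lambda>k. (pw (2 + \<epsilon> k) (neg_part y) - ip (neg_part y) (neg_part y)) / \<epsilon> k)" by (rule ext)
    then show ?thesis using power_difference_quotient[OF eps nH] by (simp only:)
  qed
  have \<alpha>\<beta>: "loglin (pos_part y) (pos_part y) + loglin (neg_part y) (neg_part y) = 0"
    using loglin_parts[OF yH] yE(3) by simp
  obtain m1 where m1: "\<And>k. \<bar>\<alpha> k\<bar> \<le> m1" using convergent_imp_Bseq[OF convergentI[OF \<alpha>l]] by (auto simp: Bseq_def)
  obtain m2 where m2: "\<And>k. \<bar>\<beta> k\<bar> \<le> m2" using convergent_imp_Bseq[OF convergentI[OF \<beta>l]] by (auto simp: Bseq_def)
  have ak_eq: "ak k = a + \<epsilon> k * \<alpha> k" and bk_eq: "bk k = b + \<epsilon> k * \<beta> k" for k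
    using eps(1)[of k] by (simp_all add: \<alpha>_def \<beta>_def)
  have "(\<lambda>k. a + \<epsilon> k * \<alpha> k) \<longlonglongrightarrow> a + 0 * loglin (pos_part y) (pos_part y)" by (intro tendsto_intros eps \<alpha>l)
  moreover have "ak = (\<lambda>k. a + \<epsilon> k * \<alpha> k)" using ak_eq by (rule ext)
  moreover have "(\<lambda>k. b + \<epsilon> k * \<beta> k) \<longlonglongrightarrow> b + 0 * loglin (neg_part y) (neg_part y)" by (intro tendsto_intros eps \<beta>l)
  moreover have "bk = (\<lambda>k. b + \<epsilon> k * \<beta> k)" using bk_eq by (rule ext)
  ultimately have "ak \<longlonglongrightarrow> a" "bk \<longlonglongrightarrow> b" by simp_all
  then have "eventually (\<lambda>k. a / 2 < ak k \<and> b / 2 < bk k) sequentially"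
    using ab by (intro eventually_conj order_tendstoD) auto
  then obtain N where N: "\<And>k. k \<ge> N \<Longrightarrow> a / 2 < ak k \<and> b / 2 < bk k" by (auto simp: eventually_sequentially)
  have "\<exists>\<sigma> t. 0 < \<sigma> \<and> 0 < t \<and> comb y \<sigma> t \<in> nodal_Nehari (q k)" for k
    using nodal_Nehari_comb_exists[OF yH sc q_bounds(2,4)] by metis
  then obtain \<sigma> t where st: "\<And>k. 0 < \<sigma> k" "\<And>k. 0 < t k" and mem: "\<And>k. comb y (\<sigma> k) (t k) \<in> nodal_Nehari (q k)" by metis
  have eqs: "(\<sigma> k)\<^sup>2 * A + \<sigma> k * t k * c = lam * (\<sigma> k powr (2 + \<epsilon> k) * ak k)"
    "(t k)\<^sup>2 * B + t k * \<sigma> k * c = lam * (t k powr (2 + \<epsilon> k) * bk k)" for k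
  proof -
    have s0: "0 \<le> \<sigma> k" "0 \<le> t k" using st[of k] by auto
    note NN = nodal_NehariD(3,4)[OF mem[of k], unfolded pos_part_comb[OF s0] neg_part_comb[OF s0]]
    have "form (\<lambda>x. \<sigma> k * pos_part y x) (\<lambda>x. t k * neg_part y x) = \<sigma> k * t k * c"
      using form_scale_left[OF pH H_scale[OF nH], of "\<sigma> k" "t k"] form_scale_left[OF nH pH, of "t k"]
      by (simp add: c_def form_sym[of "pos_part y"])
    then show "(\<sigma> k)\<^sup>2 * A + \<sigma> k * t k * c = lam * (\<sigma> k powr (2 + \<epsilon> k) * ak k)"
      "(t k)\<^sup>2 * B + t k * \<sigma> k * c = lam * (t k powr (2 + \<epsilon> k) * bk k)"
      using NN s0 unfolding form_scale[OF pH] form_scale[OF nH] pw_scale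
      by (simp_all add: A_def B_def ak_def bk_def q_eq[of k] mult_ac)
  qed
  define R where "R = max (exp (2 * m1 / a)) (exp (2 * m2 / b))"
  have bound: "\<sigma> k \<le> R \<and> t k \<le> R" if k: "k \<ge> N" for k
  proof (cases "t k \<le> \<sigma> k")
    case True
    have "\<sigma> k \<le> exp (2 * m1 / a)"
      by (rule cone_parameter_bound[OF ab(1) akbk(1) st(1) less_imp_le[OF AB(3)] less_imp_le[OF st(2)] True l0 eps(1) NA eqs(1)])
         (use m1[of k] N[OF k] in \<open>auto simp: \<alpha>_def\<close>)
    then show ?thesis using True by (auto simp: R_def)
  next
    case False
    then have le: "\<sigma> k \<le> t k" by simp
    have "t k \<le> exp (2 * m2 / b)"
      by (rule cone_parameter_bound[OF ab(2) akbk(2) st(2) less_imp_le[OF AB(3)] less_imp_le[OF st(1)] le l0 eps(1) NB eqs(2)])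
         (use m2[of k] N[OF k] in \<open>auto simp: \<beta>_def\<close>)
    then show ?thesis using le by (auto simp: R_def)
  qed
  have J_le: "J (q k) (comb y (\<sigma> k) (t k)) \<le> lam * \<epsilon> k / q k * ((a + b) / 2 - \<sigma> k powr q k * \<alpha> k - t k powr q k * \<beta> k) - c * (\<sigma> k - t k)\<^sup>2 / 2" for k
  proof -
    have s0: "0 \<le> \<sigma> k" "0 \<le> t k" using st[of k] by auto
    have N': "A = lam * a - c" "B = lam * b - c" using NA NB by auto
    have "J (q k) (comb y (\<sigma> k) (t k)) = ((\<sigma> k)\<^sup>2 * A + 2 * \<sigma> k * t k * c + (t k)\<^sup>2 * B) / 2
        - lam / q k * (\<sigma> k powr q k * ak k + t k powr q k * bk k)"
      unfolding A_def B_def c_def ak_def bk_def by (rule J_comb[OF yH s0 q_bounds(1,4)])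
    also have "\<dots> = lam * a * ((\<sigma> k)\<^sup>2 / 2 - \<sigma> k powr q k / q k) + lam * b * ((t k)\<^sup>2 / 2 - t k powr q k / q k)
        - lam * \<epsilon> k / q k * (\<sigma> k powr q k * \<alpha> k + t k powr q k * \<beta> k) - c * (\<sigma> k - t k)\<^sup>2 / 2"
      unfolding N' ak_eq bk_eq using q_bounds(1)[of k] by (simp add: power2_eq_square field_simps)
    also have "\<dots> \<le> lam * a * (1 / 2 - 1 / q k) + lam * b * (1 / 2 - 1 / q k)
        - lam * \<epsilon> k / q k * (\<sigma> k powr q k * \<alpha> k + t k powr q k * \<beta> k) - c * (\<sigma> k - t k)\<^sup>2 / 2"
      using l0 ab by (intro diff_right_mono add_mono mult_left_mono fibering_map_le s0 q_bounds) auto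
    also have "1 / 2 - 1 / q k = \<epsilon> k / (2 * q k)" using q_bounds(1)[of k] by (simp add: q_eq[of k] field_simps)
    also have "lam * a * (\<epsilon> k / (2 * q k)) = lam * \<epsilon> k / q k * (a / 2)" by (simp add: mult_ac)
    also have "lam * b * (\<epsilon> k / (2 * q k)) = lam * \<epsilon> k / q k * (b / 2)" by (simp add: mult_ac)
    finally have le: "J (q k) (comb y (\<sigma> k) (t k)) \<le> lam * \<epsilon> k / q k * (a / 2) + lam * \<epsilon> k / q k * (b / 2)
        - lam * \<epsilon> k / q k * (\<sigma> k powr q k * \<alpha> k + t k powr q k * \<beta> k) - c * (\<sigma> k - t k)\<^sup>2 / 2" .
    have alg: "x * (a / 2) + x * (b / 2) - x * (X + Y) - Z = x * ((a + b) / 2 - X - Y) - Z" for x X Y Z :: real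
      by (simp add: algebra_simps add_divide_distrib)
    show ?thesis using le unfolding alg .
  qed
  have J_ge: "lam * \<epsilon> k / q k * (pw (q k) (v k) / 2) \<le> J (q k) (comb y (\<sigma> k) (t k))" for k
  proof -
    obtain z where z: "nodal_solution \<Omega> K V (q k) z" "\<And>w. w \<in> nodal_Nehari (q k) \<Longrightarrow> energy \<Omega> K V (q k) z \<le> energy \<Omega> K V (q k) w"
      by (rule nodal_solution_exists[OF q_bounds(2,3)]) blast
    have "J (q k) (v k) \<le> J (q k) (comb y (\<sigma> k) (t k))"
      using least[OF z(1)] z(2)[OF mem] by (simp add: energy_eq_J)
    moreover have "J (q k) (v k) = (1 / 2 - 1 / q k) * (lam * pw (q k) (v k))"
      using nodal_Nehari_form[OF vN q_bounds(1,4)] by simp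
    moreover have "1 / 2 - 1 / q k = \<epsilon> k / (2 * q k)" using q_bounds(1)[of k] by (simp add: q_eq[of k] field_simps)
    ultimately show ?thesis by (simp add: field_simps)
  qed
  \<comment> \<open>Along a subsequence the cone parameters converge, to a common limit because \<open>c > 0\<close>.\<close>
  have "compact ({0..R} \<times> {0..R})" by (intro compact_Times) auto
  moreover have "\<forall>k. (\<sigma> (k + N), t (k + N)) \<in> {0..R} \<times> {0..R}" using st bound by (auto intro: less_imp_le)
  ultimately obtain l r where r: "l \<in> {0..R} \<times> {0..R}" "strict_mono r" "((\<lambda>k. (\<sigma> (k + N), t (k + N))) \<circ> r) \<longlonglongrightarrow> l"
    unfolding compact_def by (metis (no_types, lifting))
  define f where "f k = r k + N" for k
  have fm: "strict_mono f" using r(2) by (auto simp: f_def strict_mono_def)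
  define \<sigma>' t' where "\<sigma>' = fst l" and "t' = snd l"
  have l\<sigma>: "(\<lambda>k. \<sigma> (f k)) \<longlonglongrightarrow> \<sigma>'" using tendsto_fst[OF r(3)] by (simp add: o_def \<sigma>'_def f_def)
  have lt: "(\<lambda>k. t (f k)) \<longlonglongrightarrow> t'" using tendsto_snd[OF r(3)] by (simp add: o_def t'_def f_def)
  have sub: "X \<longlonglongrightarrow> L \<Longrightarrow> (\<lambda>k. X (f k)) \<longlonglongrightarrow> L" for X :: "nat \<Rightarrow> real" and L
    using LIMSEQ_subseq_LIMSEQ[OF _ fm] by (simp add: o_def)
  note lims = l\<sigma> lt sub[OF \<alpha>l] sub[OF \<beta>l] sub[OF q_lim] sub[OF eps(3)] sub[OF pw_lim]
  define T where "T k = (a + b) / 2 - \<sigma> (f k) powr q (f k) * \<alpha> (f k) - t (f k) powr q (f k) * \<beta> (f k)" for k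
  have T: "T \<longlonglongrightarrow> (a + b) / 2 - \<sigma>' powr 2 * loglin (pos_part y) (pos_part y) - t' powr 2 * loglin (neg_part y) (neg_part y)"
    unfolding T_def
    by (intro tendsto_diff tendsto_mult tendsto_const tendsto_powr' lims)
       (use less_imp_le[OF st(1)] less_imp_le[OF st(2)] in auto)
  have main: "lam * \<epsilon> (f k) / q (f k) * (pw (q (f k)) (v (f k)) / 2) \<le> lam * \<epsilon> (f k) / q (f k) * T k - c * (\<sigma> (f k) - t (f k))\<^sup>2 / 2" for k
    using J_ge[of "f k"] J_le[of "f k"] unfolding T_def by linarith
  have "c * (\<sigma>' - t')\<^sup>2 / 2 \<le> 0"
  proof (rule LIMSEQ_le)
    show "(\<lambda>k. c * (\<sigma> (f k) - t (f k))\<^sup>2 / 2) \<longlonglongrightarrow> c * (\<sigma>' - t')\<^sup>2 / 2"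
      by (intro tendsto_intros lims) simp
    have "(\<lambda>k. lam * \<epsilon> (f k) / q (f k) * T k) \<longlonglongrightarrow> lam * 0 / 2 * ((a + b) / 2 - \<sigma>' powr 2 * loglin (pos_part y) (pos_part y) - t' powr 2 * loglin (neg_part y) (neg_part y))"
      by (intro tendsto_mult tendsto_divide tendsto_const lims T) simp
    then show "(\<lambda>k. lam * \<epsilon> (f k) / q (f k) * T k) \<longlonglongrightarrow> 0" by simp
    have "0 \<le> lam * \<epsilon> (f k) / q (f k) * (pw (q (f k)) (v (f k)) / 2)" for k
      using l0 eps(1)[of "f k"] q_bounds(1)[of "f k"] pw_nonneg by simp
    then have "c * (\<sigma> (f k) - t (f k))\<^sup>2 / 2 \<le> lam * \<epsilon> (f k) / q (f k) * T k" for k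
      using main[of k] order_trans by fastforce
    then show "\<exists>N. \<forall>k\<ge>N. c * (\<sigma> (f k) - t (f k))\<^sup>2 / 2 \<le> lam * \<epsilon> (f k) / q (f k) * T k" by blast
  qed
  then have "(\<sigma>' - t')\<^sup>2 \<le> 0" using AB(3) by (simp add: mult_le_0_iff)
  then have eq: "\<sigma>' = t'" by simp
  have "ip w w / 2 \<le> (a + b) / 2 - \<sigma>' powr 2 * loglin (pos_part y) (pos_part y) - t' powr 2 * loglin (neg_part y) (neg_part y)"
  proof (rule LIMSEQ_le[OF _ T])
    show "(\<lambda>k. pw (q (f k)) (v (f k)) / 2) \<longlonglongrightarrow> ip w w / 2" by (intro tendsto_divide lims tendsto_const) simp
    have "pw (q (f k)) (v (f k)) / 2 \<le> T k" for k
    proof -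
      have pos: "0 < lam * \<epsilon> (f k) / q (f k)" using l0 eps(1)[of "f k"] q_bounds(1)[of "f k"] by simp
      have "0 \<le> c * (\<sigma> (f k) - t (f k))\<^sup>2 / 2" using AB(3) by simp
      then have "lam * \<epsilon> (f k) / q (f k) * (pw (q (f k)) (v (f k)) / 2) \<le> lam * \<epsilon> (f k) / q (f k) * T k"
        using main[of k] by linarith
      then show ?thesis by (rule mult_left_le_imp_le[OF _ pos])
    qed
    then show "\<exists>N. \<forall>k\<ge>N. pw (q (f k)) (v (f k)) / 2 \<le> T k" by blast
  qed
  also have "\<dots> = (a + b) / 2 - t' powr 2 * (loglin (pos_part y) (pos_part y) + loglin (neg_part y) (neg_part y))"
    by (simp add: eq algebra_simps)
  also have "\<dots> = ip y y / 2" unfolding \<alpha>\<beta> using ip_parts(3)[OF yH] by (simp add: a_def b_def)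
  finally show ?thesis by simp
qed

lemma limit_characterization:
  "w \<in> eigenspace \<Omega> K V 2" "\<not> ae_zero w" "w \<in> reduced_Nehari \<Omega> K V"
  "\<And>y. y \<in> reduced_Nehari \<Omega> K V \<Longrightarrow> reduced_energy \<Omega> w \<le> reduced_energy \<Omega> y"
  "\<And>y. y \<in> eigenspace \<Omega> K V 2 \<Longrightarrow> loglin w y = 0"
proof -
  show E: "w \<in> eigenspace \<Omega> K V 2" by (rule limit_in_eigenspace)
  show nz: "\<not> ae_zero w" by (rule limit_nonzero)
  show orth: "loglin w y = 0" if "y \<in> eigenspace \<Omega> K V 2" for y by (rule limit_orthogonality[OF that])
  show "w \<in> reduced_Nehari \<Omega> K V" using E nz orth[OF E] by (simp add: reduced_Nehari_iff)
  show "reduced_energy \<Omega> w \<le> reduced_energy \<Omega> y" if y: "y \<in> reduced_Nehari \<Omega> K V" for y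
  proof -
    have "y \<in> H" "loglin y y = 0" using y by (auto simp: reduced_Nehari_iff eigenspace_iff)
    then show ?thesis using limit_minimizes_norm[OF y] orth[OF E] by (simp add: reduced_energy_eq wH)
  qed
qed

end

theorem theorem5p5:
  fixes \<Omega> :: "(real ^ 'n) set"
    and K V :: "real ^ 'n \<Rightarrow> real"
    and s :: real
    and u :: "real \<Rightarrow> real ^ 'n \<Rightarrow> real"
    and p :: "nat \<Rightarrow> real"
    and u_star :: "real ^ 'n \<Rightarrow> real"
  assumes "CARD('n) \<ge> 2"
    and "0 < s" "s < 1"
    and "open \<Omega>" "connected \<Omega>" "\<Omega> \<noteq> {}" "bounded \<Omega>" "lipschitz_boundary \<Omega>"
    and "Linf_on \<Omega> V"
    and "admissible_kernel s K"
    and "positive_definite \<Omega> K V"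
    and "\<And>q. 2 < q \<Longrightarrow> q < crit_exponent TYPE('n) s \<Longrightarrow> least_energy_nodal_solution \<Omega> K V q (u q)"
    and "\<And>n. 2 < p n" "\<And>n. p n < crit_exponent TYPE('n) s"
    and "p \<longlonglongrightarrow> 2"
    and "u_star \<in> H_space \<Omega> K"
    and "(\<lambda>n. norm_H \<Omega> K (\<lambda>x. u (p n) x - u_star x)) \<longlonglongrightarrow> 0"
  shows "u_star \<in> eigenspace \<Omega> K V 2 \<and> \<not> ae_zero u_star
    \<and> u_star \<in> reduced_Nehari \<Omega> K V
    \<and> (\<forall>v \<in> reduced_Nehari \<Omega> K V. reduced_energy \<Omega> u_star \<le> reduced_energy \<Omega> v)
    \<and> weak_solution \<Omega> K V (\<lambda>x. eig \<Omega> K V 2 * u_star x) u_star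
    \<and> (\<forall>v \<in> eigenspace \<Omega> K V 2. (LINT x:\<Omega>|lebesgue. u_star x * ln \<bar>u_star x\<bar> * v x) = 0)"
proof -
  interpret nonlocal_problem \<Omega> K V s
    using assms(1-4,6,7,9,10) by unfold_locales
  have ls: "least_energy_nodal_solution \<Omega> K V (p n) (u (p n))" for n
    by (rule assms(12)[OF assms(13,14)])
  have ns: "nodal_solution \<Omega> K V (p n) (u (p n))" for n
    using ls by (simp add: least_energy_nodal_solution_def)
  have uH: "u (p n) \<in> H" for n using ns by (simp add: nodal_solution_def weak_solution_def)
  interpret positive_problem \<Omega> K V s
    using assms(11) uH[of 0] ns[of 0] by unfold_locales (auto simp: nodal_solution_def)
  have il: "(\<lambda>n. inner (\<lambda>x. u (p n) x - u_star x) (\<lambda>x. u (p n) x - u_star x)) \<longlonglongrightarrow> 0"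
    using tendsto_power[OF assms(17), of 2] by (simp add: norm_H_sq)
  have "eventually (\<lambda>n. p n < 2 + kap / 4) sequentially"
    using assms(15) kap_pos by (intro order_tendstoD) auto
  then obtain N where N: "\<And>n. n \<ge> N \<Longrightarrow> p n < 2 + kap / 4" by (auto simp: eventually_sequentially)
  define P where "P n = p (n + N)" for n
  have Pl: "P \<longlonglongrightarrow> 2" unfolding P_def by (rule LIMSEQ_ignore_initial_segment[OF assms(15)])
  have il': "(\<lambda>n. inner (\<lambda>x. u (P n) x - u_star x) (\<lambda>x. u (P n) x - u_star x)) \<longlonglongrightarrow> 0"
    unfolding P_def by (rule LIMSEQ_ignore_initial_segment[OF il])
  have PH: "u (P n) \<in> H" for n by (simp add: P_def uH)
  have k0: "0 \<le> 2 + kap" "0 < 2 + kap" using kap_pos by auto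
  have "(\<lambda>n. pw (2 + kap) (\<lambda>x. u (P n) x - u_star x)) \<longlonglongrightarrow> 0"
  proof -
    obtain C where C: "0 \<le> C" "\<And>u. u \<in> H \<Longrightarrow> integrable M (\<lambda>x. \<bar>u x\<bar> powr (2 + kap)) \<and>
      (\<integral>x. \<bar>u x\<bar> powr (2 + kap) \<partial>M) \<le> C * inner u u powr ((2 + kap) / 2)" by (rule fractional_Sobolev) blast
    have "(\<lambda>n. C * inner (\<lambda>x. u (P n) x - u_star x) (\<lambda>x. u (P n) x - u_star x) powr ((2 + kap) / 2)) \<longlonglongrightarrow> C * 0 powr ((2 + kap) / 2)"
      using k0 by (intro tendsto_mult tendsto_const tendsto_powr' il') (auto simp: inner_nonneg)
    then have lim: "(\<lambda>n. C * inner (\<lambda>x. u (P n) x - u_star x) (\<lambda>x. u (P n) x - u_star x) powr ((2 + kap) / 2)) \<longlonglongrightarrow> 0" by simp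
    show ?thesis
      by (rule tendsto_sandwich[OF _ _ tendsto_const lim])
         (use C(2)[OF H_diff[OF PH assms(16)]] pw_nonneg in \<open>auto simp: pw_def\<close>)
  qed
  then obtain r g where r: "strict_mono r" "g \<in> borel_measurable M" "integrable M (\<lambda>x. g x powr (2 + kap))" "\<And>x. 1 \<le> g x"
    "AE x in M. (\<forall>k. \<bar>u (P (r k)) x\<bar> \<le> g x) \<and> (\<lambda>k. u (P (r k)) x) \<longlonglongrightarrow> u_star x"
    using dominated_subsequence[of "\<lambda>n. u (P n)", OF PH assms(16) k0(1) order_refl _ k0(2)] by blast
  interpret nodal_limit \<Omega> K V s "\<lambda>k. u (P (r k))" "\<lambda>k. P (r k)" u_star g
  proof unfold_locales
    fix k
    show "nodal_solution \<Omega> K V (P (r k)) (u (P (r k)))" unfolding P_def by (rule ns)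
    show "energy \<Omega> K V (P (r k)) (u (P (r k))) \<le> energy \<Omega> K V (P (r k)) z" if "nodal_solution \<Omega> K V (P (r k)) z" for z
      using ls[of "r k + N"] that by (simp add: least_energy_nodal_solution_def P_def)
    show "2 < P (r k)" unfolding P_def by (rule assms(13))
    show "P (r k) \<le> 2 + kap / 4" unfolding P_def by (rule less_imp_le[OF N]) simp
  next
    show "(\<lambda>k. P (r k)) \<longlonglongrightarrow> 2" using LIMSEQ_subseq_LIMSEQ[OF Pl r(1)] by (simp add: o_def)
    show "(\<lambda>k. inner (\<lambda>x. u (P (r k)) x - u_star x) (\<lambda>x. u (P (r k)) x - u_star x)) \<longlonglongrightarrow> 0"
      using LIMSEQ_subseq_LIMSEQ[OF il' r(1)] by (simp add: o_def)
  qed (use r assms(16) in auto)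
  have "weak_solution \<Omega> K V (\<lambda>x. eig \<Omega> K V 2 * u_star x) u_star"
    using limit_characterization(1) by (simp add: eigenspace_def)
  then show ?thesis
    using limit_characterization by (auto simp: loglin_def set_integral_Omega)
qed

end
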